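(* Let $m\ge0$ and let $\boldsymbol\pi=(\pi_1,\dots,\pi_m)\in\overline{\mathbf K}^m$ with $\pi_m\ne0$ (if $m=0$, $\boldsymbol\pi$ is the empty tuple). Then the $\mathbf U_q$-module $W_q(\boldsymbol\pi)$ has a unique irreducible quotient $\mathbf U_q$-module $V_q(\boldsymbol\pi)$. Conversely, any irreducible finite-dimensional (over $\mathbf K$) $\mathbf U_q$-module of type 1 is isomorphic to $V_q(\boldsymbol\pi)$ for a suitable choice of $m\ge 0$ and $\boldsymbol\pi=(\pi_1,\dots,\pi_m)\in\overline{\mathbf K}^m$ with $\pi_m\ne0$ (the empty tuple if $m=0$).
   Context: **The algebra.** Let $q$ be an indeterminate, $\mathbf K=\mathbb C(q)$, $\overline{\mathbf K}$ an algebraic closure of $\mathbf K$, $[k]=\frac{q^k-q^{-k}}{q-q^{-1}}$. $\mathbf U_q$ is the $\mathbf K$-algebra (quantum loop algebra of $sl_2$) with generators $\mathbf x_r^\pm$ ($r\in\mathbb Z$), $\mathbf h_r$ ($r\in\mathbb Z\setminus\{0\}$), $K^{\pm1}$ and relations: $KK^{-1}=K^{-1}K=1$; $K\mathbf h_r=\mathbf h_rK$; $K\mathbf x_r^\pm K^{-1}=q^{\pm2}\mathbf x_r^\pm$; $[\mathbf h_r,\mathbf h_s]=0$; $[\mathbf h_r,\mathbf x_s^\pm]=\pm\frac1r[2r]\mathbf x_{r+s}^\pm$; $\mathbf x_{r+1}^\pm\mathbf x_s^\pm-q^{\pm2}\mathbf x_s^\pm\mathbf x_{r+1}^\pm=q^{\pm2}\mathbf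 x_r^\pm\mathbf x_{s+1}^\pm-\mathbf x_{s+1}^\pm\mathbf x_r^\pm$; $[\mathbf x_r^+,\mathbf x_s^-]=\frac{\psi^+_{r+s}-\psi^-_{r+s}}{q-q^{-1}}$, where $\sum_{r\ge0}\psi^\pm_{\pm r}u^{\pm r}=K^{\pm1}\exp\big(\pm(q-q^{-1})\sum_{s\ge1}\mathbf h_{\pm s}u^{\pm s}\big)$ and $\psi^+_r=0$ for $r<0$, $\psi^-_r=0$ for $r>0$. $\mathbf U_q(0)$ is the subalgebra generated by the $\mathbf h_r$. Define $\mathbf\Lambda_{\pm r}\in\mathbf U_q(0)$ ($r\ge0$) by $\mathbf\Lambda^\pm(u)=\sum_{r\ge0}\mathbf\Lambda_{\pm r}u^r=\exp\big(-\sum_{k\ge1}\frac{q^{\pm k}\mathbf h_{\pm k}}{[k]}u^k\big)$. A $\mathbf U_q$-module is of type 1 if it is the direct sum of its weight spaces $\{v: Kv=q^nv\}$, $n\in\mathbb Z$. **The module $W_q(m)$** ($m\ge0$). Put $\tilde{\mathbf X}^-(u)=\sum_{k\in\mathbb Z}\mathbf x_k^-u^{k+1}$ and $\mathbf X_0^-(u)=\sum_{k\ge0}\mathbf x_k^-u^{k+1}$; $f_s$ denotes the coefficient of $u^s$ in a series $f$. $I_q(m)$ is the left ideal of $\mathbf U_q$ generated by: $\mathbf x_k^+$ ($k\in\mathbb Z$); $K-q^m$; $\mathbf\Lambda_r$ ($|r|>m$); $\mathbf\Lambda_m\mathbf\Lambda_{-r}-\mathbf\Lambda_{m-r}$ ($1\le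 r\le m$); all elements of $(\tilde{\mathbf X}^-(u)\mathbf\Lambda^+(u))_r\,\mathbf U_q(0)$ ($r\in\mathbb Z$); all elements of $(\mathbf X_0^-(u)^r\mathbf\Lambda^+(u))_s\,\mathbf U_q(0)$ ($r\ge1$, $|s|>m$). Set $W_q(m)=\mathbf U_q/I_q(m)$ and let $w_m$ be the image of $1$. $W_q(m)$ is a left $\mathbf U_q$-module and a right $\mathbf U_q(0)$-module via $(xw_m)\cdot y=xy\,w_m$ ($x\in\mathbf U_q$, $y\in\mathbf U_q(0)$), and these actions commute. The right action factors through $\mathbf U_q(0)/I_q(m,0)\cong\mathbf K[\mathbf\Lambda_1,\dots,\mathbf\Lambda_m,\mathbf\Lambda_m^{-1}]$, where $I_q(m,0)$ is the ideal of $\mathbf U_q(0)$ generated by $\mathbf\Lambda_r$ ($|r|>m$) and $\mathbf\Lambda_m\mathbf\Lambda_{-r}-\mathbf\Lambda_{m-r}$ ($1\le r\le m$). **The module $W_q(\boldsymbol\pi)$.** For $m\ge0$ and $\boldsymbol\pi=(\pi_1,\dots,\pi_m)\in\overline{\mathbf K}^m$ with $\pi_m\ne0$ (the empty tuple if $m=0$), let $\mathbf F_{\boldsymbol\pi}$ be the smallest subfield of $\overline{\mathbf K}$ containing $\mathbf K$ and $\pi_1,\dots,\pi_m$, regarded as a $\mathbf U_q(0)$-module via the homomorphism $\mathbf U_q(0)\to\mathbf K[\mathbf\Lambda_1,\dots,\mathbf\Lambda_m,\mathbf\Lambda_m^{-1}]\to\mathbf F_{\boldsymbol\pi}$, $\mathbf\Lambda_i\mapsto\pi_i$.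 Set $W_q(\boldsymbol\pi)=W_q(m)\otimes_{\mathbf U_q(0)}\mathbf F_{\boldsymbol\pi}$, a left $\mathbf U_q$-module. *)

theory Defs
  imports
    "HOL-Algebra.Algebraic_Closure_Type"
    "HOL-Algebra.Free_Abelian_Groups"
    "HOL-Algebra.Generated_Groups"
begin

text \<open>The library locale \<open>module\<close> requires a commutative ring of scalars; its record and the
  locale \<open>submodule\<close> do not. The fields \<open>mult\<close> and \<open>one\<close> of a module record play no role.\<close>

locale left_module = R?: ring R + M?: abelian_group M
    for R :: "('a, 'b) ring_scheme" (structure) and M :: "('a, 'v, 'z) module_scheme" (structure) +
  assumes smult_closed:
      "\<lbrakk>a \<in> carrier R; x \<in> carrier M\<rbrakk> \<Longrightarrow> a \<odot>\<^bsub>M\<^esub> x \<in> carrier M"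
    and smult_l_distr:
      "\<lbrakk>a \<in> carrier R; b \<in> carrier R; x \<in> carrier M\<rbrakk> \<Longrightarrow>
        (a \<oplus>\<^bsub>R\<^esub> b) \<odot>\<^bsub>M\<^esub> x = a \<odot>\<^bsub>M\<^esub> x \<oplus>\<^bsub>M\<^esub> b \<odot>\<^bsub>M\<^esub> x"
    and smult_r_distr:
      "\<lbrakk>a \<in> carrier R; x \<in> carrier M; y \<in> carrier M\<rbrakk> \<Longrightarrow>
        a \<odot>\<^bsub>M\<^esub> (x \<oplus>\<^bsub>M\<^esub> y) = a \<odot>\<^bsub>M\<^esub> x \<oplus>\<^bsub>M\<^esub> a \<odot>\<^bsub>M\<^esub> y"
    and smult_assoc:
      "\<lbrakk>a \<in> carrier R; b \<in> carrier R; x \<in> carrier M\<rbrakk> \<Longrightarrow>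
        (a \<otimes>\<^bsub>R\<^esub> b) \<odot>\<^bsub>M\<^esub> x = a \<odot>\<^bsub>M\<^esub> (b \<odot>\<^bsub>M\<^esub> x)"
    and smult_one: "x \<in> carrier M \<Longrightarrow> \<one>\<^bsub>R\<^esub> \<odot>\<^bsub>M\<^esub> x = x"

definition irreducible_module :: "('r, 'a) ring_scheme \<Rightarrow> ('r, 'v) module \<Rightarrow> bool" where
  "irreducible_module R M \<longleftrightarrow> left_module R M \<and> carrier M \<noteq> {\<zero>\<^bsub>M\<^esub>} \<and>
     (\<forall>N. submodule N R M \<longrightarrow> N = {\<zero>\<^bsub>M\<^esub>} \<or> N = carrier M)"

definition isomorphic_modules ::
  "('r, 'a) ring_scheme \<Rightarrow> ('r, 'v) module \<Rightarrow> ('r, 'w) module \<Rightarrow> bool" where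
  "isomorphic_modules R M N \<longleftrightarrow>
     (\<exists>f \<in> iso (add_monoid M) (add_monoid N).
        \<forall>a \<in> carrier R. \<forall>v \<in> carrier M. f (a \<odot>\<^bsub>M\<^esub> v) = a \<odot>\<^bsub>N\<^esub> f v)"

definition quotient_module :: "('r, 'v) module \<Rightarrow> 'v set \<Rightarrow> ('r, 'v set) module" where
  "quotient_module M N =
     \<lparr>carrier = a_rcosets\<^bsub>M\<^esub> N, monoid.mult = undefined, one = undefined,
      ring.zero = N, add = set_add M,
      module.smult = (\<lambda>a C. \<Union>v\<in>C. N +>\<^bsub>M\<^esub> (a \<odot>\<^bsub>M\<^esub> v))\<rparr>"

definition left_regular :: "'r ring \<Rightarrow> ('r, 'r) module" where
  "left_regular R =
     \<lparr>carrier = carrier R, monoid.mult = monoid.mult R, one = monoid.one R, ring.zero = ring.zero R,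
      add = add R, module.smult = monoid.mult R\<rparr>"

definition genlideal :: "'r ring \<Rightarrow> 'r set \<Rightarrow> 'r set" where
  "genlideal R S = (\<lambda>I. submodule I R (left_regular R)) hull S"

text \<open>The tensor product over \<open>S\<close> of a left \<open>R\<close>-module \<open>W\<close>, which is also a right \<open>S\<close>-module via
  \<open>ract\<close>, with a left \<open>S\<close>-module \<open>F\<close>: the free abelian group on the pairs modulo the balancing
  relations. The operators of \<open>R\<close> on the free abelian group do not make it a module; they
  preserve the subgroup of relations, and the module axioms hold for the quotient.\<close>

definition tensor_free :: "('r, 'w) module \<Rightarrow> ('s, 'f) module \<Rightarrow> ('r, 'w \<times> 'f \<Rightarrow>\<^sub>0 int) module" where
  "tensor_free W F =
     \<lparr>carrier = carrier (free_Abelian_group (carrier W \<times> carrier F)),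
      monoid.mult = undefined, one = undefined, ring.zero = 0, add = (+),
      module.smult = (\<lambda>a. frag_extend (\<lambda>(w, f). frag_of (a \<odot>\<^bsub>W\<^esub> w, f)))\<rparr>"

inductive_set tensor_relators ::
    "('r, 'w) module \<Rightarrow> ('w \<Rightarrow> 's \<Rightarrow> 'w) \<Rightarrow> ('s, 'b) ring_scheme \<Rightarrow> ('s, 'f) module \<Rightarrow>
     ('w \<times> 'f \<Rightarrow>\<^sub>0 int) set"
  for W ract S F where
  add_left: "\<lbrakk>w \<in> carrier W; w' \<in> carrier W; f \<in> carrier F\<rbrakk> \<Longrightarrow>
    frag_of (w \<oplus>\<^bsub>W\<^esub> w', f) - frag_of (w, f) - frag_of (w', f) \<in> tensor_relators W ract S F"
| add_right: "\<lbrakk>w \<in> carrier W; f \<in> carrier F; f' \<in> carrier F\<rbrakk> \<Longrightarrow>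
    frag_of (w, f \<oplus>\<^bsub>F\<^esub> f') - frag_of (w, f) - frag_of (w, f') \<in> tensor_relators W ract S F"
| balanced: "\<lbrakk>w \<in> carrier W; s \<in> carrier S; f \<in> carrier F\<rbrakk> \<Longrightarrow>
    frag_of (ract w s, f) - frag_of (w, s \<odot>\<^bsub>F\<^esub> f) \<in> tensor_relators W ract S F"

definition tensor_module ::
    "('r, 'w) module \<Rightarrow> ('w \<Rightarrow> 's \<Rightarrow> 'w) \<Rightarrow> ('s, 'b) ring_scheme \<Rightarrow> ('s, 'f) module \<Rightarrow>
     ('r, ('w \<times> 'f \<Rightarrow>\<^sub>0 int) set) module" where
  "tensor_module W ract S F =
     quotient_module (tensor_free W F)
       (generate (add_monoid (tensor_free W F)) (tensor_relators W ract S F))"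

type_synonym Kq = "complex poly fract"

type_synonym Kbar = "Kq alg_closure"

definition q :: Kq where "q = Fract [:0, 1:] 1"

definition qint :: "int \<Rightarrow> Kq" where
  "qint k = (q powi k - q powi (- k)) / (q - inverse q)"

text \<open>The free monoid, written additively so that \<open>'a fmon \<Rightarrow>\<^sub>0 'k\<close> is the free algebra.\<close>

datatype 'a fmon = FMon "'a list"

primrec letters :: "'a fmon \<Rightarrow> 'a list" where
  "letters (FMon xs) = xs"

instantiation fmon :: (type) monoid_add
begin

definition zero_fmon :: "'a fmon" where "zero_fmon = FMon []"

definition plus_fmon :: "'a fmon \<Rightarrow> 'a fmon \<Rightarrow> 'a fmon" where
  "plus_fmon a b = FMon (letters a @ letters b)"

instance
proof
  fix a b c :: "'a fmon"
  show "a + b + c = a + (b + c)" by (simp add: plus_fmon_def)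
  show "0 + a = a" by (cases a) (simp add: plus_fmon_def zero_fmon_def)
  show "a + 0 = a" by (cases a) (simp add: plus_fmon_def zero_fmon_def)
qed

end

datatype gen = GXplus int | GXminus int | GH int | GK | GKinv

type_synonym falg = "gen fmon \<Rightarrow>\<^sub>0 Kq"

definition fscal :: "Kq \<Rightarrow> falg" where
  "fscal c = Poly_Mapping.single 0 c"

definition fgen :: "gen \<Rightarrow> falg" where
  "fgen g = Poly_Mapping.single (FMon [g]) 1"

text \<open>The signs \<open>\<plusminus>\<close> are represented by \<open>\<epsilon> = 1\<close> and \<open>\<epsilon> = - 1\<close>.\<close>

definition fX :: "int \<Rightarrow> int \<Rightarrow> falg" where
  "fX \<epsilon> r = fgen (if \<epsilon> = 1 then GXplus r else GXminus r)"

definition fKpow :: "int \<Rightarrow> falg" where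
  "fKpow \<epsilon> = fgen (if \<epsilon> = 1 then GK else GKinv)"

text \<open>The exponential of a power series \<open>f\<close> with zero constant term over a \<open>Kq\<close>-algebra with
  structure map \<open>scal\<close>. The powers \<open>f ^ k\<close> with \<open>k > n\<close> do not contribute to the coefficient
  of degree \<open>n\<close>.\<close>

definition alg_exp :: "(Kq \<Rightarrow> 'a::ring_1) \<Rightarrow> 'a fps \<Rightarrow> 'a fps" where
  "alg_exp scal f = Abs_fps (\<lambda>n. \<Sum>k\<le>n. scal (inverse (of_nat (fact k))) * fps_nth (f ^ k) n)"

text \<open>\<open>fpsi \<epsilon> r\<close> is \<open>\<psi>\<^sup>\<epsilon>\<^sub>r\<close>; the series is in the variable \<open>u\<close> for \<open>\<epsilon> = 1\<close> and in \<open>1/u\<close> for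
  \<open>\<epsilon> = - 1\<close>.\<close>

definition fpsi :: "int \<Rightarrow> int \<Rightarrow> falg" where
  "fpsi \<epsilon> r = (if \<epsilon> * r \<ge> 0
     then fKpow \<epsilon> * fps_nth (alg_exp fscal
            (Abs_fps (\<lambda>s. if s = 0 then 0
               else fscal (of_int \<epsilon> * (q - inverse q)) * fgen (GH (\<epsilon> * int s))))) (nat (\<epsilon> * r))
     else 0)"

text \<open>The index \<open>0\<close> in \<open>GH\<close> is superfluous: this generator is killed by the relator \<open>h_zero\<close>.\<close>

inductive_set uq_relators :: "falg set" where
  h_zero: "fgen (GH 0) \<in> uq_relators"
| K_Kinv: "fgen GK * fgen GKinv - 1 \<in> uq_relators"
| Kinv_K: "fgen GKinv * fgen GK - 1 \<in> uq_relators"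
| K_h: "r \<noteq> 0 \<Longrightarrow> fgen GK * fgen (GH r) - fgen (GH r) * fgen GK \<in> uq_relators"
| K_x: "\<epsilon> \<in> {1, -1} \<Longrightarrow>
    fgen GK * fX \<epsilon> r * fgen GKinv - fscal (q powi (2 * \<epsilon>)) * fX \<epsilon> r \<in> uq_relators"
| h_h: "\<lbrakk>r \<noteq> 0; s \<noteq> 0\<rbrakk> \<Longrightarrow>
    fgen (GH r) * fgen (GH s) - fgen (GH s) * fgen (GH r) \<in> uq_relators"
| h_x: "\<lbrakk>\<epsilon> \<in> {1, -1}; r \<noteq> 0\<rbrakk> \<Longrightarrow>
    fgen (GH r) * fX \<epsilon> s - fX \<epsilon> s * fgen (GH r)
      - fscal (of_int \<epsilon> * (1 / of_int r) * qint (2 * r)) * fX \<epsilon> (r + s) \<in> uq_relators"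
| x_x: "\<epsilon> \<in> {1, -1} \<Longrightarrow>
    (fX \<epsilon> (r + 1) * fX \<epsilon> s - fscal (q powi (2 * \<epsilon>)) * fX \<epsilon> s * fX \<epsilon> (r + 1))
      - (fscal (q powi (2 * \<epsilon>)) * fX \<epsilon> r * fX \<epsilon> (s + 1) - fX \<epsilon> (s + 1) * fX \<epsilon> r) \<in> uq_relators"
| xp_xm:
    "fX 1 r * fX (-1) s - fX (-1) s * fX 1 r
      - fscal (1 / (q - inverse q)) * (fpsi 1 (r + s) - fpsi (-1) (r + s)) \<in> uq_relators"

definition uq_ideal :: "falg set" where
  "uq_ideal = genideal ring_of_type_algebra uq_relators"

lemma ring_type_algebra: "ring (ring_of_type_algebra :: 'a::ring_1 ring)"
proof -
  have "\<exists>y. x + y = 0" for x :: 'a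
    using add.right_inverse by blast
  thus ?thesis
    unfolding ring_of_type_algebra_def using add.right_inverse
    by unfold_locales (auto simp: algebra_simps Units_def)
qed

lemma ideal_uq_ideal: "ideal uq_ideal (ring_of_type_algebra :: falg ring)"
  unfolding uq_ideal_def
  by (rule ring.genideal_ideal[OF ring_type_algebra]) (simp add: ring_of_type_algebra_def)

lemma uq_ideal_add: "a \<in> uq_ideal \<Longrightarrow> b \<in> uq_ideal \<Longrightarrow> a + b \<in> uq_ideal"
  using additive_subgroup.a_closed[OF ideal.axioms(1)[OF ideal_uq_ideal]]
  by (simp add: ring_of_type_algebra_def)

lemma uq_ideal_zero: "0 \<in> uq_ideal"
  using additive_subgroup.zero_closed[OF ideal.axioms(1)[OF ideal_uq_ideal]]
  by (simp add: ring_of_type_algebra_def)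

lemma uq_ideal_mult_left: "a \<in> uq_ideal \<Longrightarrow> b * a \<in> uq_ideal"
  using ideal.I_l_closed[OF ideal_uq_ideal] by (simp add: ring_of_type_algebra_def)

lemma uq_ideal_mult_right: "a \<in> uq_ideal \<Longrightarrow> a * b \<in> uq_ideal"
  using ideal.I_r_closed[OF ideal_uq_ideal] by (simp add: ring_of_type_algebra_def)

lemma uq_ideal_uminus: "a \<in> uq_ideal \<Longrightarrow> - a \<in> uq_ideal"
  using uq_ideal_mult_left[of a "- 1"] by simp

text \<open>The ideal is proper: it lies in the kernel of the homomorphism to \<open>Kq\<close> sending
  \<open>GK\<close> and \<open>GKinv\<close> to \<open>1\<close> and all other generators to \<open>0\<close>.\<close>

definition word_counit :: "gen fmon \<Rightarrow> Kq" where
  "word_counit w = (if set (letters w) \<subseteq> {GK, GKinv} then 1 else 0)"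

definition counit :: "falg \<Rightarrow> Kq" where
  "counit a = (\<Sum>w\<in>Poly_Mapping.keys a. Poly_Mapping.lookup a w * word_counit w)"

lemma word_counit_add: "word_counit (v + w) = word_counit v * word_counit w"
  by (auto simp: word_counit_def plus_fmon_def)

lemma word_counit_zero: "word_counit 0 = 1"
  by (simp add: word_counit_def zero_fmon_def)

lemma counit_superset:
  "finite S \<Longrightarrow> Poly_Mapping.keys a \<subseteq> S \<Longrightarrow>
    counit a = (\<Sum>w\<in>S. Poly_Mapping.lookup a w * word_counit w)"
  unfolding counit_def
  by (rule sum.mono_neutral_left) (auto simp: in_keys_iff)

lemma counit_zero [simp]: "counit 0 = 0"
  by (simp add: counit_def)

lemma counit_single [simp]: "counit (Poly_Mapping.single w c) = c * word_counit w"
  by (simp add: counit_superset[of "{w}"])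

lemma counit_add [simp]: "counit (a + b) = counit a + counit b"
proof -
  let ?S = "Poly_Mapping.keys a \<union> Poly_Mapping.keys b"
  have "counit (a + b) = (\<Sum>w\<in>?S. Poly_Mapping.lookup (a + b) w * word_counit w)"
    by (rule counit_superset) (simp_all add: Poly_Mapping.keys_add)
  also have "\<dots> = counit a + counit b"
    by (simp add: counit_superset[of ?S a] counit_superset[of ?S b] lookup_add
        distrib_right sum.distrib)
  finally show ?thesis .
qed

lemma counit_sum: "counit (\<Sum>i\<in>I. f i) = (\<Sum>i\<in>I. counit (f i))"
  by (induction I rule: infinite_finite_induct) auto

lemma falg_eq_sum_single:
  "(a :: falg) = (\<Sum>w\<in>Poly_Mapping.keys a. Poly_Mapping.single w (Poly_Mapping.lookup a w))"
  by (rule poly_mapping_eqI) (auto simp: lookup_sum lookup_single when_def in_keys_iff)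

lemma counit_mult [simp]: "counit (a * b) = counit a * counit b"
proof -
  let ?s = "\<lambda>a w. Poly_Mapping.single w (Poly_Mapping.lookup a w) :: falg"
  have "counit (a * b) =
      counit ((\<Sum>v\<in>Poly_Mapping.keys a. ?s a v) * (\<Sum>w\<in>Poly_Mapping.keys b. ?s b w))"
    using falg_eq_sum_single[of a] falg_eq_sum_single[of b]
    by (intro arg_cong[where f = counit] arg_cong2[where f = "(*)"])
  also have "\<dots> = counit a * counit b"
    unfolding counit_def[of a] counit_def[of b]
    by (simp add: sum_product counit_sum mult_single word_counit_add ac_simps)
  finally show ?thesis .
qed

lemma counit_one [simp]: "counit 1 = 1"
  by (metis counit_single mult_1 single_one word_counit_zero)

lemma counit_uminus [simp]: "counit (- a) = - counit a"
  using counit_add[of a "- a"] by (simp add: eq_neg_iff_add_eq_0 add.commute)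

lemma counit_diff [simp]: "counit (a - b) = counit a - counit b"
  using counit_add[of a "- b"] by simp

lemma counit_fscal [simp]: "counit (fscal c) = c"
  by (simp add: fscal_def word_counit_zero)

lemma counit_fgen: "counit (fgen g) = (if g \<in> {GK, GKinv} then 1 else 0)"
  by (simp add: fgen_def word_counit_def)

lemma counit_fX [simp]: "counit (fX \<epsilon> r) = 0"
  by (simp add: fX_def counit_fgen)

lemma counit_alg_exp:
  assumes "\<And>n. counit (fps_nth f n) = 0"
  shows "counit (fps_nth (alg_exp fscal f) n) = (if n = 0 then 1 else 0)"
proof -
  have *: "counit (fps_nth (f ^ k) n) = (if k = 0 \<and> n = 0 then 1 else 0)" for k n
    by (cases k) (auto simp: fps_mult_nth counit_sum assms)
  have "counit (fps_nth (alg_exp fscal f) n) =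
      (\<Sum>k\<le>n. inverse (of_nat (fact k)) * (if k = 0 \<and> n = 0 then 1 else 0))"
    by (simp add: alg_exp_def counit_sum *)
  also have "\<dots> = (if n = 0 then 1 else 0)"
    by simp
  finally show ?thesis .
qed

lemma counit_fpsi: "\<epsilon> \<in> {1, -1} \<Longrightarrow> counit (fpsi \<epsilon> r) = (if r = 0 then 1 else 0)"
  unfolding fpsi_def by (auto simp: counit_alg_exp counit_fgen fKpow_def)

lemma counit_uq_relators: "a \<in> uq_relators \<Longrightarrow> counit a = 0"
  by (induction rule: uq_relators.induct) (auto simp: counit_fgen counit_fpsi)

lemma counit_uq_ideal: "a \<in> uq_ideal \<Longrightarrow> counit a = 0"
proof -
  let ?R = "ring_of_type_algebra :: falg ring"
  have "ideal {a. counit a = 0} ?R"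
  proof (rule idealI[OF ring_type_algebra])
    show "subgroup {a. counit a = 0} (add_monoid ?R)"
    proof (rule group.subgroupI)
      show "group (add_monoid ?R)"
        using abelian_group.a_group[OF ring.is_abelian_group[OF ring_type_algebra]] .
    next
      fix a assume a: "a \<in> {a. counit a = 0}"
      have "inv\<^bsub>add_monoid ?R\<^esub> a = - a"
        using abelian_group.minus_equality[OF ring.is_abelian_group[OF ring_type_algebra], of "- a" a]
        by (simp add: ring_of_type_algebra_def a_inv_def)
      with a show "inv\<^bsub>add_monoid ?R\<^esub> a \<in> {a. counit a = 0}" by simp
    qed (auto simp: ring_of_type_algebra_def intro: exI[of _ 0])
  qed (auto simp: ring_of_type_algebra_def)
  moreover assume "a \<in> uq_ideal"
  ultimately show "counit a = 0"
    unfolding uq_ideal_def genideal_def using counit_uq_relators by blast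
qed

quotient_type uq = falg / "\<lambda>a b. a - b \<in> uq_ideal"
proof (rule equivpI)
  show "reflp (\<lambda>a b. a - b \<in> uq_ideal)"
    by (rule reflpI) (simp add: uq_ideal_zero)
  show "symp (\<lambda>a b. a - b \<in> uq_ideal)"
    by (rule sympI) (use uq_ideal_uminus in fastforce)
  show "transp (\<lambda>a b. a - b \<in> uq_ideal)"
    by (rule transpI) (use uq_ideal_add in fastforce)
qed

instantiation uq :: ring_1
begin

lift_definition zero_uq :: uq is 0 .

lift_definition one_uq :: uq is 1 .

lift_definition plus_uq :: "uq \<Rightarrow> uq \<Rightarrow> uq" is "(+)"
  by (simp only: add_diff_add uq_ideal_add)

lift_definition minus_uq :: "uq \<Rightarrow> uq \<Rightarrow> uq" is "(-)"
proof -
  fix a a' b b' :: falg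
  assume "a - a' \<in> uq_ideal" "b - b' \<in> uq_ideal"
  hence "(a - a') + - (b - b') \<in> uq_ideal"
    by (intro uq_ideal_add uq_ideal_uminus)
  thus "a - b - (a' - b') \<in> uq_ideal"
    by (simp add: algebra_simps)
qed

lift_definition uminus_uq :: "uq \<Rightarrow> uq" is uminus
proof -
  fix a a' :: falg
  assume "a - a' \<in> uq_ideal"
  from uq_ideal_uminus[OF this] show "- a - - a' \<in> uq_ideal"
    by (simp add: algebra_simps)
qed

lift_definition times_uq :: "uq \<Rightarrow> uq \<Rightarrow> uq" is "(*)"
proof -
  fix a a' b b' :: falg
  assume "a - a' \<in> uq_ideal" "b - b' \<in> uq_ideal"
  hence "(a - a') * b + a' * (b - b') \<in> uq_ideal"
    by (intro uq_ideal_add uq_ideal_mult_left uq_ideal_mult_right)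
  thus "a * b - a' * b' \<in> uq_ideal"
    by (simp add: algebra_simps)
qed

instance
proof
  fix a b c :: uq
  show "a * b * c = a * (b * c)" by transfer (simp add: mult.assoc uq_ideal_zero)
  show "1 * a = a" by transfer (simp add: uq_ideal_zero)
  show "a * 1 = a" by transfer (simp add: uq_ideal_zero)
  show "a + b + c = a + (b + c)" by transfer (simp add: add.assoc uq_ideal_zero)
  show "a + b = b + a" by transfer (simp add: add.commute uq_ideal_zero)
  show "0 + a = a" by transfer (simp add: uq_ideal_zero)
  show "- a + a = 0" by transfer (simp add: uq_ideal_zero)
  show "a - b = a + - b" by transfer (simp add: uq_ideal_zero)
  show "(a + b) * c = a * c + b * c" by transfer (simp add: distrib_right uq_ideal_zero)
  show "a * (b + c) = a * b + a * c" by transfer (simp add: distrib_left uq_ideal_zero)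
  show "(0::uq) \<noteq> 1" by transfer (use counit_uq_ideal[of "0 - 1"] in auto)
qed

end

abbreviation UQ :: "uq ring" where "UQ \<equiv> ring_of_type_algebra"

lift_definition scal :: "Kq \<Rightarrow> uq" is fscal .

lift_definition xp :: "int \<Rightarrow> uq" is "\<lambda>r. fgen (GXplus r)" .

lift_definition xm :: "int \<Rightarrow> uq" is "\<lambda>r. fgen (GXminus r)" .

lift_definition h :: "int \<Rightarrow> uq" is "\<lambda>r. fgen (GH r)" .

lift_definition KK :: uq is "fgen GK" .

definition UQ0 :: "uq set" where
  "UQ0 = (\<lambda>A. subring A UQ \<and> range scal \<subseteq> A) hull (h ` (- {0}))"

definition Lam_series :: "int \<Rightarrow> uq fps" where
  "Lam_series \<epsilon> = alg_exp scal
     (Abs_fps (\<lambda>k. if k = 0 then 0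
        else - (scal (q powi (\<epsilon> * int k) / qint (int k)) * h (\<epsilon> * int k))))"

definition Lam :: "int \<Rightarrow> uq" where
  "Lam r = (if r \<ge> 0 then fps_nth (Lam_series 1) (nat r) else fps_nth (Lam_series (-1)) (nat (- r)))"

text \<open>The coefficient of \<open>u\<^sup>r\<close> in the product of the doubly infinite series for \<open>x\<^sup>-\<close> with
  \<open>\<Lambda>\<^sup>+(u)\<close> is the infinite sum of all \<open>xm (r - 1 - j) * Lam j\<close> with \<open>j \<ge> 0\<close>. It is truncated at
  \<open>j = m\<close>: as \<open>UQ0\<close> is commutative, for \<open>j > m\<close> the elements \<open>xm k * Lam j * y\<close> (\<open>y \<in> UQ0\<close>)
  lie in the left ideal generated by \<open>Lam j\<close>.\<close>

definition Xtilde_Lam :: "nat \<Rightarrow> int \<Rightarrow> uq" where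
  "Xtilde_Lam m r = (\<Sum>j\<le>m. xm (r - 1 - int j) * Lam (int j))"

definition X0 :: "uq fps" where
  "X0 = Abs_fps (\<lambda>n. if n = 0 then 0 else xm (int n - 1))"

text \<open>In \<open>X0_pow\<close> only coefficients of non-negative degree occur, since those of negative degree
  vanish.\<close>

inductive_set Iq_gens :: "nat \<Rightarrow> uq set" for m where
  xp: "xp k \<in> Iq_gens m"
| KK: "KK - scal (q ^ m) \<in> Iq_gens m"
| Lam: "\<bar>r\<bar> > int m \<Longrightarrow> Lam r \<in> Iq_gens m"
| Lam_Lam: "\<lbrakk>1 \<le> r; r \<le> m\<rbrakk> \<Longrightarrow>
    Lam (int m) * Lam (- int r) - Lam (int m - int r) \<in> Iq_gens m"
| Xtilde: "y \<in> UQ0 \<Longrightarrow> Xtilde_Lam m r * y \<in> Iq_gens m"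
| X0_pow: "\<lbrakk>r \<ge> 1; s > m; y \<in> UQ0\<rbrakk> \<Longrightarrow>
    fps_nth (X0 ^ r * Lam_series 1) s * y \<in> Iq_gens m"

definition Iq :: "nat \<Rightarrow> uq set" where
  "Iq m = genlideal UQ (Iq_gens m)"

definition Wq :: "nat \<Rightarrow> (uq, uq set) module" where
  "Wq m = quotient_module (left_regular UQ) (Iq m)"

definition Wq_ract :: "nat \<Rightarrow> uq set \<Rightarrow> uq \<Rightarrow> uq set" where
  "Wq_ract m C y = (\<Union>x\<in>C. Iq m +>\<^bsub>UQ\<^esub> (x * y))"

text \<open>The entry \<open>\<pi>\<^sub>i\<close> is \<open>\<pi> ! (i - 1)\<close>.\<close>

definition parameters :: "nat \<Rightarrow> Kbar list set" where
  "parameters m = {\<pi>. length \<pi> = m \<and> (m > 0 \<longrightarrow> \<pi> ! (m - 1) \<noteq> 0)}"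

definition Fpi :: "Kbar list \<Rightarrow> Kbar set" where
  "Fpi \<pi> = (\<lambda>L. subfield L (ring_of_type_algebra :: Kbar ring)) hull (range to_ac \<union> set \<pi>)"

definition Iq0 :: "nat \<Rightarrow> uq set" where
  "Iq0 m = genideal (UQ\<lparr>carrier := UQ0\<rparr>)
     ({Lam r | r. \<bar>r\<bar> > int m} \<union>
      {Lam (int m) * Lam (- int r) - Lam (int m - int r) | r. 1 \<le> r \<and> r \<le> m})"

text \<open>At most one \<open>\<phi>\<close> satisfies this for \<open>\<pi> \<in> parameters m\<close>, as the \<open>Lam r\<close> generate \<open>UQ0\<close>.\<close>

definition is_eval_hom :: "nat \<Rightarrow> Kbar list \<Rightarrow> (uq \<Rightarrow> Kbar) \<Rightarrow> bool" where
  "is_eval_hom m \<pi> \<phi> \<longleftrightarrow>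
     \<phi> \<in> extensional UQ0 \<and>
     \<phi> \<in> ring_hom (UQ\<lparr>carrier := UQ0\<rparr>) (ring_of_type_algebra\<lparr>carrier := Fpi \<pi>\<rparr>) \<and>
     (\<forall>c. \<phi> (scal c) = to_ac c) \<and>
     (\<forall>y\<in>Iq0 m. \<phi> y = 0) \<and>
     (\<forall>i\<in>{1..m}. \<phi> (Lam (int i)) = \<pi> ! (i - 1))"

definition eval_hom :: "nat \<Rightarrow> Kbar list \<Rightarrow> uq \<Rightarrow> Kbar" where
  "eval_hom m \<pi> = (THE \<phi>. is_eval_hom m \<pi> \<phi>)"

definition Fpi_module :: "nat \<Rightarrow> Kbar list \<Rightarrow> (uq, Kbar) module" where
  "Fpi_module m \<pi> =
     \<lparr>carrier = Fpi \<pi>, monoid.mult = (*), one = 1, ring.zero = 0, add = (+),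
      module.smult = (\<lambda>y f. eval_hom m \<pi> y * f)\<rparr>"

type_synonym wpi = "(uq set \<times> Kbar \<Rightarrow>\<^sub>0 int) set"

definition Wq_pi :: "nat \<Rightarrow> Kbar list \<Rightarrow> (uq, wpi) module" where
  "Wq_pi m \<pi> = tensor_module (Wq m) (Wq_ract m) (UQ\<lparr>carrier := UQ0\<rparr>) (Fpi_module m \<pi>)"

definition Vq_pi :: "nat \<Rightarrow> Kbar list \<Rightarrow> (uq, wpi set) module" where
  "Vq_pi m \<pi> = quotient_module (Wq_pi m \<pi>)
     (THE N. submodule N UQ (Wq_pi m \<pi>) \<and>
             irreducible_module UQ (quotient_module (Wq_pi m \<pi>) N))"

definition finite_dimensional :: "(uq, 'v) module \<Rightarrow> bool" where
  "finite_dimensional M \<longleftrightarrow>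
     (\<exists>B. finite B \<and> B \<subseteq> carrier M \<and>
        (\<forall>v\<in>carrier M. \<exists>c. v = (\<Oplus>\<^bsub>M\<^esub>b\<in>B. scal (c b) \<odot>\<^bsub>M\<^esub> b)))"

definition weight_space :: "(uq, 'v) module \<Rightarrow> int \<Rightarrow> 'v set" where
  "weight_space M n = {v \<in> carrier M. KK \<odot>\<^bsub>M\<^esub> v = scal (q powi n) \<odot>\<^bsub>M\<^esub> v}"

definition type_1 :: "(uq, 'v) module \<Rightarrow> bool" where
  "type_1 M \<longleftrightarrow>
     (\<forall>v\<in>carrier M. \<exists>!f. (\<forall>n. f n \<in> weight_space M n) \<and> finite {n. f n \<noteq> \<zero>\<^bsub>M\<^esub>} \<and>
        v = (\<Oplus>\<^bsub>M\<^esub>n\<in>{n. f n \<noteq> \<zero>\<^bsub>M\<^esub>}. f n))"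

end

theory Submission
  imports Defs "HOL-Computational_Algebra.Formal_Laurent_Series"
begin

text \<open>Modulo the left ideal generated by the \<open>xp k\<close> and \<open>KK - scal (q powi m)\<close>, every element of the
  algebra is a sum of products \<open>xm k\<^sub>1 * \<dots> * xm k\<^sub>r * y\<close> with \<open>y \<in> UQ0\<close>, and polynomials in \<open>KK\<close>
  project onto the terms with \<open>r = 0\<close>. Hence a highest weight module whose top space is a field has a
  largest proper submodule, and an irreducible highest weight module is determined by the annihilator
  in \<open>UQ0\<close> of its highest weight vector. The top space of \<open>W\<^sub>q(\<pi>)\<close> is the field \<open>F\<^sub>\<pi>\<close>, and not zero,
  because the tensor product of two-dimensional evaluation modules, whose parameters are the
  inverse roots of \<open>1 + \<Sum>i. \<pi>\<^sub>i u\<^sup>i\<close>, satisfies the relations of \<open>W\<^sub>q(\<pi>)\<close>.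

  Conversely, let \<open>v\<close> be a highest weight vector of a finite-dimensional irreducible module. Its
  annihilator in \<open>UQ0\<close> is a maximal ideal whose residue field is algebraic over \<open>Kq\<close> and so embeds into
  \<open>Kbar\<close>. The representation theory of \<open>sl\<^sub>2\<close> gives \<open>xm 1 ^ (m + 1) v = 0\<close>. By the identity of Garland
  the sum of the \<open>xm (s - j) Lam j v\<close> over \<open>j \<le> m\<close> vanishes, first for one \<open>s\<close> and then, commuting with
  the \<open>h k\<close>, for all \<open>s\<close>. Applying \<open>xp 0\<close> gives recursions which imply the relations between the
  values of the \<open>Lam r\<close> that define the parameter \<open>\<pi>\<close>.\<close>

section \<open>Exponential series and partial fractions\<close>

text \<open>From the triangular decomposition only spanning is used; no basis theorem enters.
  Whatever must be nonzero is detected in an explicit module, because \<open>Wq_pi\<close> is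
  presented by generators and relations and could a priori collapse. The explicit module is written
  in a basis where the \<open>h r\<close> are diagonal, so that no coproduct is required: the
  coefficients of the \<open>xp k\<close> and \<open>xm k\<close> are rational functions of the
  \<open>z i\<close>, and the relation between \<open>xp\<close> and \<open>xm\<close> says that the
  two series psi expand one rational function at 0 and at infinity. The price is the denominators
  \<open>z i - z j\<close>; coinciding roots can only be reached by specialisation. In the converse
  nothing is known in advance about the values of the \<open>Lam r\<close> on the highest weight
  vector. The bridge is the functional equation between psi(u) Lam(u) and Lam(q^-2 u): a sum that
  lacks the last term isolates one \<open>Lam r\<close> with the factor q^(-2r) - 1, nonzero because
  q is not a root of unity. It drives the induction for the identity of Garland, the vanishing of
  \<open>Lam r\<close> for large r and the reflection law between positive and negative
  indices.\<close>

lemma of_nat_fract: "of_nat n = (Fract (of_nat n) 1 :: 'a::idom fract)"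
  by (induction n) (simp_all add: Zero_fract_def One_fract_def)

text \<open>Provides characteristic zero for \<open>Kq\<close>, so that factorials and positive
  integers are invertible in every \<open>Kq\<close>-algebra.\<close>

instance fract :: ("{idom,ring_char_0}") field_char_0
proof
  show "inj (of_nat :: nat \<Rightarrow> 'a fract)"
    by (rule injI) (simp add: of_nat_fract eq_fract)
qed

locale Kq_scalars =
  fixes s :: "Kq \<Rightarrow> 'a::comm_ring_1"
  assumes s_add: "s (a + b) = s a + s b"
    and s_mult: "s (a * b) = s a * s b"
    and s_one: "s 1 = 1"
begin

lemma s_of_nat: "s (of_nat n) = of_nat n"
proof (induction n)
  case 0
  show ?case using s_add[of 0 0] by simp
qed (simp add: s_add s_one)

lemma of_nat_cancel:
  fixes x y :: 'a
  assumes "of_nat (Suc n) * x = of_nat (Suc n) * y"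
  shows "x = y"
proof -
  have inv: "s (inverse (of_nat (Suc n))) * of_nat (Suc n) = 1"
    using s_mult[of "inverse (of_nat (Suc n))" "of_nat (Suc n)"]
    by (simp add: s_of_nat s_one del: of_nat_Suc)
  have "s (inverse (of_nat (Suc n))) * (of_nat (Suc n) * x)
      = s (inverse (of_nat (Suc n))) * (of_nat (Suc n) * y)"
    using assms by simp
  thus ?thesis unfolding mult.assoc[symmetric] inv by simp
qed

lemma alg_exp_nth_0: "fps_nth (alg_exp s f) 0 = 1"
  by (simp add: alg_exp_def s_one)

text \<open>Termwise differentiation: the derivative of the term with index k + 1 is
  \<open>fps_deriv f\<close> times the term with index k. Since \<open>f ^ k\<close> starts in
  degree k, the cut-off of the sum over k may be moved freely.\<close>

lemma alg_exp_deriv: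
  assumes f: "fps_nth f 0 = 0"
  shows "fps_deriv (alg_exp s f) = fps_deriv f * alg_exp s f"
proof (rule fps_ext)
  fix n
  have vanish: "fps_nth (f ^ k) j = 0" if "j < k" for j k
    using startsby_zero_power_prefix[OF f, of k] that by blast
  have step: "of_nat (Suc n) * (s (inverse (of_nat (fact (Suc k)))) * fps_nth (f ^ Suc k) (Suc n))
     = s (inverse (of_nat (fact k))) * fps_nth (fps_deriv f * f ^ k) n" for k
  proof -
    have "of_nat (fact (Suc k)) = of_nat (Suc k) * (of_nat (fact k) :: Kq)"
      by (simp only: fact_Suc of_nat_mult of_nat_id)
    hence "inverse (of_nat (fact (Suc k))) * of_nat (Suc k) = (inverse (of_nat (fact k)) :: Kq)"
      by (simp add: field_simps del: of_nat_Suc of_nat_fact fact_Suc)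
    hence 1: "s (inverse (of_nat (fact (Suc k)))) * of_nat (Suc k) = s (inverse (of_nat (fact k)))"
      by (metis s_mult s_of_nat)
    have "of_nat (Suc n) * fps_nth (f ^ Suc k) (Suc n) = fps_nth (fps_deriv (f ^ Suc k)) n"
      by (simp only: fps_deriv_nth Suc_eq_plus1)
    also have "\<dots> = of_nat (Suc k) * fps_nth (fps_deriv f * f ^ k) n"
      by (subst fps_deriv_power) (simp add: mult.assoc)
    finally have 2: "of_nat (Suc n) * fps_nth (f ^ Suc k) (Suc n)
      = of_nat (Suc k) * fps_nth (fps_deriv f * f ^ k) n" .
    show ?thesis unfolding 1[symmetric] using 2
      by (simp only: mult.left_commute[of "of_nat (Suc n)"] mult.assoc)
  qed
  have "fps_nth (fps_deriv (alg_exp s f)) n =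
     (\<Sum>k\<le>Suc n. of_nat (Suc n) * (s (inverse (of_nat (fact k))) * fps_nth (f ^ k) (Suc n)))"
    by (simp add: alg_exp_def sum_distrib_left del: of_nat_Suc sum.atMost_Suc)
  also have "\<dots> = (\<Sum>k\<le>n. of_nat (Suc n) *
     (s (inverse (of_nat (fact (Suc k)))) * fps_nth (f ^ Suc k) (Suc n)))"
    by (subst sum.atMost_Suc_shift) (simp del: of_nat_Suc fact_Suc power_Suc)
  also have "\<dots> = (\<Sum>k\<le>n. s (inverse (of_nat (fact k))) * fps_nth (fps_deriv f * f ^ k) n)"
    by (simp only: step)
  also have "\<dots> = (\<Sum>k\<le>n. \<Sum>i=0..n. fps_nth (fps_deriv f) i *
      (s (inverse (of_nat (fact k))) * fps_nth (f ^ k) (n - i)))"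
    unfolding fps_mult_nth[of "fps_deriv f"]
    by (simp only: sum_distrib_left mult.left_commute)
  also have "\<dots> = (\<Sum>i=0..n. fps_nth (fps_deriv f) i *
      (\<Sum>k\<le>n. s (inverse (of_nat (fact k))) * fps_nth (f ^ k) (n - i)))"
    by (subst sum.swap) (simp only: sum_distrib_left)
  also have "\<dots> = (\<Sum>i=0..n. fps_nth (fps_deriv f) i * fps_nth (alg_exp s f) (n - i))"
  proof (rule sum.cong[OF refl])
    fix i
    have "(\<Sum>k\<le>n. s (inverse (of_nat (fact k))) * fps_nth (f ^ k) (n - i))
       = (\<Sum>k\<le>n - i. s (inverse (of_nat (fact k))) * fps_nth (f ^ k) (n - i))"
      by (rule sum.mono_neutral_right) (auto simp: vanish)
    thus "fps_nth (fps_deriv f) i * (\<Sum>k\<le>n. s (inverse (of_nat (fact k))) * fps_nth (f ^ k) (n - i))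
      = fps_nth (fps_deriv f) i * fps_nth (alg_exp s f) (n - i)"
      by (simp add: alg_exp_def)
  qed
  also have "\<dots> = fps_nth (fps_deriv f * alg_exp s f) n"
    by (simp add: fps_mult_nth)
  finally show "fps_nth (fps_deriv (alg_exp s f)) n = fps_nth (fps_deriv f * alg_exp s f) n" .
qed

text \<open>The equation Y' = g Y determines (n + 1) times the next coefficient from the earlier
  ones, and n + 1 can be cancelled. All identities between exponentials are reduced to this
  equation.\<close>

lemma log_deriv_unique:
  fixes Y Z g :: "'a fps"
  assumes "fps_nth Y 0 = fps_nth Z 0" and "fps_deriv Y = g * Y" and "fps_deriv Z = g * Z"
  shows "Y = Z"
proof -
  have "fps_nth Y n = fps_nth Z n" for n
  proof (induction n rule: less_induct)
    case (less n)
    show ?case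
    proof (cases n)
      case 0
      thus ?thesis using assms by simp
    next
      case (Suc j)
      have "of_nat (Suc j) * fps_nth Y (Suc j) = fps_nth (g * Y) j"
        using arg_cong[OF assms(2), of "\<lambda>F. fps_nth F j"] by simp
      also have "\<dots> = fps_nth (g * Z) j"
        unfolding fps_mult_nth by (rule sum.cong) (use less Suc in auto)
      also have "\<dots> = of_nat (Suc j) * fps_nth Z (Suc j)"
        using arg_cong[OF assms(3), of "\<lambda>F. fps_nth F j"] by simp
      finally show ?thesis unfolding Suc by (rule of_nat_cancel)
    qed
  qed
  thus ?thesis by (rule fps_ext)
qed

lemma alg_exp_unique:
  assumes "fps_nth f 0 = 0" "fps_nth Y 0 = 1" "fps_deriv Y = fps_deriv f * Y"
  shows "alg_exp s f = Y"
  by (rule log_deriv_unique[of _ _ "fps_deriv f"]) (simp_all add: assms alg_exp_deriv alg_exp_nth_0)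

lemma alg_exp_add:
  assumes "fps_nth f 0 = 0" "fps_nth g 0 = 0"
  shows "alg_exp s (f + g) = alg_exp s f * alg_exp s g"
  by (rule alg_exp_unique) (simp_all add: assms alg_exp_deriv alg_exp_nth_0 algebra_simps)

lemma alg_exp_zero: "alg_exp s 0 = 1"
  by (rule alg_exp_unique) simp_all

lemma alg_exp_sum:
  assumes "\<And>i. i \<in> I \<Longrightarrow> fps_nth (f i) 0 = 0"
  shows "alg_exp s (\<Sum>i\<in>I. f i) = (\<Prod>i\<in>I. alg_exp s (f i))"
  using assms
proof (induction I rule: infinite_finite_induct)
  case (insert i I)
  thus ?case by (simp add: alg_exp_add fps_sum_nth)
qed (simp_all add: alg_exp_zero)

text \<open>The power series of -log(1 - c u).\<close>

definition neg_log :: "'a \<Rightarrow> 'a fps" where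
  "neg_log c = Abs_fps (\<lambda>n. if n = 0 then 0 else s (inverse (of_nat n)) * c ^ n)"

lemma neg_log_nth_0 [simp]: "fps_nth (neg_log c) 0 = 0"
  by (simp add: neg_log_def)

lemma alg_exp_minus_neg_log: "alg_exp s (- neg_log c) = 1 - fps_const c * fps_X"
proof (rule alg_exp_unique)
  have *: "fps_deriv (neg_log c) = Abs_fps (\<lambda>n. c ^ Suc n)"
  proof (rule fps_ext)
    fix n
    have "of_nat (Suc n) * s (inverse (of_nat (Suc n))) = 1"
      using s_mult[of "of_nat (Suc n)" "inverse (of_nat (Suc n))"]
      by (simp add: s_of_nat s_one del: of_nat_Suc)
    thus "fps_nth (fps_deriv (neg_log c)) n = fps_nth (Abs_fps (\<lambda>n. c ^ Suc n)) n"
      unfolding neg_log_def fps_deriv_nth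
      by (simp add: mult.assoc[symmetric] del: of_nat_Suc)
  qed
  have "Abs_fps (\<lambda>n. c ^ Suc n) * (1 - fps_const c * fps_X) = fps_const c"
  proof (rule fps_ext)
    fix n show "fps_nth (Abs_fps (\<lambda>n. c ^ Suc n) * (1 - fps_const c * fps_X)) n
        = fps_nth (fps_const c) n"
      by (cases n) (simp_all add: right_diff_distrib mult.assoc[symmetric]
          mult.commute[of _ "fps_const c"])
  qed
  thus "fps_deriv (1 - fps_const c * fps_X) = fps_deriv (- neg_log c) * (1 - fps_const c * fps_X)"
    by (simp add: *)
qed simp_all

lemma alg_exp_neg_log: "alg_exp s (neg_log c) * (1 - fps_const c * fps_X) = 1"
  using alg_exp_add[of "neg_log c" "- neg_log c"] by (simp add: alg_exp_minus_neg_log alg_exp_zero)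

end

text \<open>The subset \<open>A\<close> allows maps that are multiplicative only on a subring:
  besides the quotient map of the free algebra this serves for functionals on \<open>uq\<close> that
  are homomorphisms on \<open>UQ0\<close> alone, and for eigenvalues.\<close>

lemma alg_exp_map:
  fixes s :: "Kq \<Rightarrow> 'a::ring_1" and s' :: "Kq \<Rightarrow> 'b::ring_1"
  assumes one: "1 \<in> A" and zero: "0 \<in> A"
    and add: "\<And>x y. x \<in> A \<Longrightarrow> y \<in> A \<Longrightarrow> x + y \<in> A \<and> \<phi> (x + y) = \<phi> x + \<phi> y"
    and mult: "\<And>x y. x \<in> A \<Longrightarrow> y \<in> A \<Longrightarrow> x * y \<in> A \<and> \<phi> (x * y) = \<phi> x * \<phi> y"
    and scal: "\<And>c. s c \<in> A \<and> \<phi> (s c) = s' c"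
    and phi1: "\<phi> 1 = 1"
    and f: "\<And>n. fps_nth f n \<in> A"
  shows "fps_nth (alg_exp s f) n \<in> A \<and>
    \<phi> (fps_nth (alg_exp s f) n) = fps_nth (alg_exp s' (Abs_fps (\<lambda>n. \<phi> (fps_nth f n)))) n"
proof -
  have phi0: "\<phi> 0 = 0"
    using add[OF zero zero] by simp
  have sum: "sum g I \<in> A \<and> \<phi> (sum g I) = (\<Sum>i\<in>I. \<phi> (g i))"
    if "\<And>i. i \<in> I \<Longrightarrow> g i \<in> A" for g and I :: "nat set"
    using that by (induction I rule: infinite_finite_induct) (auto simp: zero phi0 add)
  let ?f = "Abs_fps (\<lambda>n. \<phi> (fps_nth f n))"
  have pow: "fps_nth (f ^ k) n \<in> A \<and> \<phi> (fps_nth (f ^ k) n) = fps_nth (?f ^ k) n" for k n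
  proof (induction k arbitrary: n)
    case 0
    show ?case by (simp add: one zero phi0 phi1)
  next
    case (Suc k)
    thus ?case using f mult by (simp add: fps_mult_nth sum)
  qed
  show ?thesis
    using pow scal mult by (simp add: alg_exp_def sum)
qed

text \<open>Gaussian elimination on the coordinates: a vector \<open>p\<close> with nonzero
  coordinate at \<open>b\<close> is used to clear that coordinate from the others, which leaves one
  vector and one coordinate less.\<close>

lemma linear_dependence:
  fixes c :: "nat \<Rightarrow> 'b \<Rightarrow> 'k::field"
  assumes "finite B" "card B < n"
  shows "\<exists>d. (\<exists>i<n. d i \<noteq> 0) \<and> (\<forall>b\<in>B. (\<Sum>i<n. d i * c i b) = 0)"
  using assms
proof (induction B arbitrary: n c rule: finite_induct)
  case empty
  thus ?case by (intro exI[of _ "\<lambda>_. 1"]) auto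
next
  case (insert b B)
  obtain n' where n: "n = Suc n'" "card B < n'"
    using insert.prems insert.hyps by (cases n) simp_all
  show ?case
  proof (cases "\<forall>i<n. c i b = 0")
    case True
    obtain d where "\<exists>i<n. d i \<noteq> 0" "\<forall>b\<in>B. (\<Sum>i<n. d i * c i b) = 0"
      using insert.IH[of n c] n by auto
    thus ?thesis using True by (intro exI[of _ d]) auto
  next
    case False
    then obtain p where p: "p < n" "c p b \<noteq> 0" by auto
    \<comment> \<open>Enumerates the indices below \<open>n\<close> except \<open>p\<close>.\<close>
    define \<sigma> where "\<sigma> = (\<lambda>i. if i < p then i else Suc i)"
    have bij: "bij_betw \<sigma> {..<n'} ({..<n} - {p})"
      unfolding bij_betw_def
    proof
      show "inj_on \<sigma> {..<n'}" by (auto simp: inj_on_def \<sigma>_def split: if_splits)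
      show "\<sigma> ` {..<n'} = {..<n} - {p}"
      proof (intro equalityI subsetI)
        fix j assume "j \<in> {..<n} - {p}"
        hence "j < n" "j \<noteq> p" by auto
        show "j \<in> \<sigma> ` {..<n'}"
        proof (cases "j < p")
          case True
          hence "j = \<sigma> j" "j < n'" using p(1) n(1) by (simp_all add: \<sigma>_def)
          thus ?thesis by blast
        next
          case False
          hence "j = \<sigma> (j - 1)" "j - 1 < n'"
            using \<open>j < n\<close> \<open>j \<noteq> p\<close> n(1) by (simp_all add: \<sigma>_def)
          thus ?thesis by blast
        qed
      qed (use p(1) n(1) in \<open>auto simp: \<sigma>_def split: if_splits\<close>)
    qed
    obtain d where d: "\<exists>i<n'. d i \<noteq> 0"
      "\<forall>b'\<in>B. (\<Sum>i<n'. d i * (c (\<sigma> i) b' - c (\<sigma> i) b / c p b * c p b')) = 0"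
      using insert.IH[of n' "\<lambda>i b'. c (\<sigma> i) b' - c (\<sigma> i) b / c p b * c p b'"] n by auto
    \<comment> \<open>The coefficient at the pivot is forced: it is the one that cancels the
      coordinate at \<open>b\<close>.\<close>
    define e where "e = (\<lambda>j. if j = p then - (\<Sum>i<n'. d i * (c (\<sigma> i) b / c p b))
       else d (the_inv_into {..<n'} \<sigma> j))"
    have e: "e (\<sigma> i) = d i" if "i < n'" for i
    proof -
      have "\<sigma> i \<noteq> p" by (simp add: \<sigma>_def)
      moreover have "the_inv_into {..<n'} \<sigma> (\<sigma> i) = i"
        using that bij by (intro the_inv_into_f_f) (auto simp: bij_betw_def)
      ultimately show ?thesis by (simp add: e_def)
    qed
    have sum: "(\<Sum>j<n. e j * c j b') =
        (\<Sum>i<n'. d i * (c (\<sigma> i) b' - c (\<sigma> i) b / c p b * c p b'))" for b'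
    proof -
      have "(\<Sum>j<n. e j * c j b') = e p * c p b' + (\<Sum>j\<in>{..<n} - {p}. e j * c j b')"
        using p by (intro sum.remove) auto
      also have "(\<Sum>j\<in>{..<n} - {p}. e j * c j b') = (\<Sum>i<n'. d i * c (\<sigma> i) b')"
        by (subst sum.reindex_bij_betw[OF bij, symmetric]) (simp add: e)
      also have "e p = - (\<Sum>i<n'. d i * (c (\<sigma> i) b / c p b))"
        by (simp add: e_def)
      also have "- (\<Sum>i<n'. d i * (c (\<sigma> i) b / c p b)) * c p b' + (\<Sum>i<n'. d i * c (\<sigma> i) b')
         = (\<Sum>i<n'. d i * (c (\<sigma> i) b' - c (\<sigma> i) b / c p b * c p b'))"
        by (simp add: right_diff_distrib sum_subtractf sum_distrib_right mult.assoc)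
      finally show ?thesis .
    qed
    from d(1) obtain i where i: "i < n'" "d i \<noteq> 0" by auto
    have "\<sigma> i < n" using bij_betwE[OF bij] i by auto
    moreover have "e (\<sigma> i) \<noteq> 0" using e i by simp
    moreover have "(\<Sum>j<n. e j * c j b) = 0" unfolding sum using p by simp
    moreover have "\<forall>b'\<in>B. (\<Sum>j<n. e j * c j b') = 0" using d(2) unfolding sum by blast
    ultimately show ?thesis by auto
  qed
qed

text \<open>The residue at \<open>w = z i\<close> of the product over j of (\<alpha> j w - \<beta> j
  z j) / (w - z j), divided by \<open>z i\<close>. This is the coefficient of w / (w - z i) in the
  partial fraction expansion.\<close>

definition pf_residue :: "('i \<Rightarrow> 'a::field) \<Rightarrow> ('i \<Rightarrow> 'a) \<Rightarrow> ('i \<Rightarrow> 'a) \<Rightarrow> 'i set \<Rightarrow> 'i \<Rightarrow> 'a" where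
  "pf_residue z \<alpha> \<beta> N i = (\<alpha> i - \<beta> i) * (\<Prod>j\<in>N - {i}. (\<alpha> j * z i - \<beta> j * z j) / (z i - z j))"

lemma pf_residue_insert:
  assumes "finite N" "k \<notin> N" "i \<in> N"
  shows "pf_residue z \<alpha> \<beta> (insert k N) i
     = pf_residue z \<alpha> \<beta> N i * ((\<alpha> k * z i - \<beta> k * z k) / (z i - z k))"
proof -
  have "insert k N - {i} = insert k (N - {i})" using assms by auto
  thus ?thesis using assms by (simp add: pf_residue_def)
qed

lemma fps_const_sum: "fps_const (\<Sum>i\<in>N. f i) = (\<Sum>i\<in>N. fps_const (f i))"
  by (induction N rule: infinite_finite_induct) (simp_all flip: fps_const_add)

lemma fps_nth_0_prod:
  fixes f :: "'i \<Rightarrow> 'a::comm_ring_1 fps"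
  shows "fps_nth (\<Prod>i\<in>N. f i) 0 = (\<Prod>i\<in>N. fps_nth (f i) 0)"
  by (induction N rule: infinite_finite_induct) simp_all

text \<open>With \<open>e i = w / (w - z i)\<close> this is the partial fraction expansion of
  \<open>\<Prod>j. (\<alpha> j * w - \<beta> j * z j) / (w - z j)\<close>; only the relation between the \<open>e i\<close> enters, so it
  applies equally to constants and to geometric series.\<close>

lemma partial_fractions:
  fixes z :: "'i \<Rightarrow> 'a::field"
  assumes "finite N" "inj_on z N"
    and rel: "\<And>i k. i \<in> N \<Longrightarrow> k \<in> N \<Longrightarrow>
      fps_const (z i - z k) * (e i * e k) = fps_const (z i) * e i - fps_const (z k) * e k"
  shows "(\<Prod>j\<in>N. fps_const (\<beta> j) + fps_const (\<alpha> j - \<beta> j) * e j)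
    = fps_const (\<Prod>j\<in>N. \<beta> j) + (\<Sum>i\<in>N. fps_const (pf_residue z \<alpha> \<beta> N i) * e i)"
  using assms
proof (induction N arbitrary: e rule: finite_induct)
  case empty
  show ?case by simp
next
  case (insert k N)
  have z: "z i \<noteq> z k" if "i \<in> N" for i
    using insert.prems(1) insert.hyps that by (auto simp: inj_on_def)
  have inj: "inj_on z N" using insert.prems(1) by (rule inj_on_subset) auto
  let ?R = "pf_residue z \<alpha> \<beta> N"
  let ?R' = "pf_residue z \<alpha> \<beta> (insert k N)"
  let ?b = "\<Prod>j\<in>N. \<beta> j"
  have IH: "(\<Prod>j\<in>N. fps_const (\<beta> j) + fps_const (\<alpha> j - \<beta> j) * e j)
    = fps_const ?b + (\<Sum>i\<in>N. fps_const (?R i) * e i)"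
    using insert.IH[OF inj] insert.prems(2) by auto
  \<comment> \<open>The induction hypothesis for constants: it evaluates the expansion over
    \<open>N\<close> at \<open>w = z k\<close>. The product on the left is the one that enters the
    new residue at \<open>k\<close>.\<close>
  have "(\<Prod>j\<in>N. fps_const (\<beta> j) + fps_const (\<alpha> j - \<beta> j) * fps_const (z k / (z k - z j)))
    = fps_const ?b + (\<Sum>i\<in>N. fps_const (?R i) * fps_const (z k / (z k - z i)))"
  proof (rule insert.IH[OF inj])
    fix i l assume il: "i \<in> N" "l \<in> N"
    have [simp]: "z k \<noteq> z i" "z k \<noteq> z l" using z il by metis+
    have "(z i - z l) * (z k / (z k - z i) * (z k / (z k - z l)))
      = z i * (z k / (z k - z i)) - z l * (z k / (z k - z l))"
      by (simp add: divide_simps) (simp add: algebra_simps)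
    thus "fps_const (z i - z l) * (fps_const (z k / (z k - z i)) * fps_const (z k / (z k - z l))) =
       fps_const (z i) * fps_const (z k / (z k - z i)) - fps_const (z l) * fps_const (z k / (z k
           - z l))"
      by (simp only: fps_const_mult fps_const_sub)
  qed
  from arg_cong[OF this, of "\<lambda>F. fps_nth F 0"]
  have "(\<Prod>j\<in>N. \<beta> j + (\<alpha> j - \<beta> j) * (z k / (z k - z j)))
     = ?b + (\<Sum>i\<in>N. ?R i * (z k / (z k - z i)))"
    by (simp add: fps_nth_0_prod fps_sum_nth)
  also have "(\<Prod>j\<in>N. \<beta> j + (\<alpha> j - \<beta> j) * (z k / (z k - z j)))
     = (\<Prod>j\<in>N. (\<alpha> j * z k - \<beta> j * z j) / (z k - z j))"
  proof (rule prod.cong[OF refl])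
    fix j assume "j \<in> N"
    hence "z k - z j \<noteq> 0" using z by fastforce
    thus "\<beta> j + (\<alpha> j - \<beta> j) * (z k / (z k - z j)) = (\<alpha> j * z k - \<beta> j * z j) / (z k - z j)"
      by (simp add: divide_simps) (simp add: algebra_simps)
  qed
  finally have *: "(\<Prod>j\<in>N. (\<alpha> j * z k - \<beta> j * z j) / (z k - z j))
     = ?b + (\<Sum>i\<in>N. ?R i * (z k / (z k - z i)))" .
  have "?R' k = (\<alpha> k - \<beta> k) * (\<Prod>j\<in>N. (\<alpha> j * z k - \<beta> j * z j) / (z k - z j))"
    using insert.hyps by (simp add: pf_residue_def)
  hence Rk: "?R' k = (\<alpha> k - \<beta> k) * ?b + (\<Sum>i\<in>N. (\<alpha> k - \<beta> k) * ?R i * (z k / (z k - z i)))"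
    unfolding * by (simp add: distrib_left sum_distrib_left mult.assoc)
  have expand: "(fps_const (\<beta> k) + fps_const (\<alpha> k - \<beta> k) * e k) * (fps_const (?R i) * e i)
     = fps_const (?R' i) * e i + fps_const ((\<alpha> k - \<beta> k) * ?R i * (z k / (z k - z i))) * e k"
    if i: "i \<in> N" for i
  proof -
    have zz: "z i - z k \<noteq> 0" "z k - z i \<noteq> 0" using z[OF i] by auto
    have "fps_const (1 / (z i - z k)) * (fps_const (z i - z k) * (e i * e k))
       = fps_const (1 / (z i - z k)) * (fps_const (z i) * e i - fps_const (z k) * e k)"
      using insert.prems(2)[of i k] i by simp
    hence ee: "e i * e k = fps_const (z i / (z i - z k)) * e i - fps_const (z k / (z i - z k))
        * e k"
      using zz by (simp add: mult.assoc[symmetric] right_diff_distrib fps_const_mult[symmetric]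
            del: fps_const_mult) (simp add: mult.assoc[symmetric])
    have "(fps_const (\<beta> k) + fps_const (\<alpha> k - \<beta> k) * e k) * (fps_const (?R i) * e i)
      = fps_const (\<beta> k * ?R i) * e i + fps_const ((\<alpha> k - \<beta> k) * ?R i) * (e i * e k)"
      by (simp add: algebra_simps fps_const_mult[symmetric] del: fps_const_mult)
    also have "\<dots> = fps_const (\<beta> k * ?R i + (\<alpha> k - \<beta> k) * ?R i * (z i / (z i - z k))) * e i
       + fps_const (- ((\<alpha> k - \<beta> k) * ?R i * (z k / (z i - z k)))) * e k"
      unfolding ee fps_const_add[symmetric] fps_const_mult[symmetric] fps_const_neg[symmetric]
      by (simp add: algebra_simps del: fps_const_mult fps_const_add fps_const_neg)
    also have "\<beta> k * ?R i + (\<alpha> k - \<beta> k) * ?R i * (z i / (z i - z k)) = ?R' i"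
      unfolding pf_residue_insert[OF insert.hyps i] using zz
      by (simp add: divide_simps) (simp add: algebra_simps)
    also have "- ((\<alpha> k - \<beta> k) * ?R i * (z k / (z i - z k)))
       = (\<alpha> k - \<beta> k) * ?R i * (z k / (z k - z i))"
      using zz by (simp add: divide_simps) (simp add: algebra_simps)
    finally show ?thesis .
  qed
  have "(\<Prod>j\<in>insert k N. fps_const (\<beta> j) + fps_const (\<alpha> j - \<beta> j) * e j)
    = (fps_const (\<beta> k) + fps_const (\<alpha> k - \<beta> k) * e k) * fps_const ?b +
      (\<Sum>i\<in>N. (fps_const (\<beta> k) + fps_const (\<alpha> k - \<beta> k) * e k) * (fps_const (?R i) * e i))"
    using insert.hyps by (simp add: IH distrib_left sum_distrib_left)
  also have "\<dots> = fps_const (\<beta> k) * fps_const ?b + (\<Sum>i\<in>N. fps_const (?R' i) * e i)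
      + (fps_const (\<alpha> k - \<beta> k) * fps_const ?b
        + (\<Sum>i\<in>N. fps_const ((\<alpha> k - \<beta> k) * ?R i * (z k / (z k - z i))))) * e k"
    by (subst sum.cong[OF refl expand], assumption)
      (simp only: sum.distrib distrib_left distrib_right sum_distrib_left sum_distrib_right
          ac_simps)
  also have "fps_const (\<alpha> k - \<beta> k) * fps_const ?b
      + (\<Sum>i\<in>N. fps_const ((\<alpha> k - \<beta> k) * ?R i * (z k / (z k - z i)))) = fps_const (?R' k)"
    unfolding Rk fps_const_sum[symmetric] by simp
  finally show ?case using insert.hyps by (simp add: algebra_simps)
qed

section \<open>Triangular decomposition\<close>

lemma q_nonzero [simp]: "q \<noteq> 0"
  by (simp add: q_def Zero_fract_def eq_fract)

lemma q_power: "q ^ n = Fract (monom 1 n) 1"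
  by (induction n) (simp_all add: q_def One_fract_def monom_Suc flip: one_pCons)

lemma q_power_eq_1_iff: "q ^ n = 1 \<longleftrightarrow> n = 0"
proof
  assume "q ^ n = 1"
  hence "monom (1::complex) n = 1"
    by (simp add: q_power One_fract_def eq_fract)
  hence "degree (monom (1::complex) n) = degree (1 :: complex poly)" by simp
  thus "n = 0" by (simp add: degree_monom_eq)
qed simp

lemma q_powi_eq_1_iff: "q powi n = 1 \<longleftrightarrow> n = 0"
  using q_power_eq_1_iff[of "nat n"] q_power_eq_1_iff[of "nat (- n)"]
  by (auto simp: power_int_def power_inverse)

lemma q_powi_eq_iff: "q powi m = q powi n \<longleftrightarrow> m = n"
proof
  assume "q powi m = q powi n"
  hence "q powi (m - n) = 1" by (simp add: power_int_diff)
  thus "m = n" by (simp add: q_powi_eq_1_iff)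
qed simp

lemma q_diff_nonzero [simp]: "q - inverse q \<noteq> 0"
  using q_powi_eq_iff[of 1 "-1"] by (simp add: power_int_minus)

lemma qint_0 [simp]: "qint 0 = 0"
  by (simp add: qint_def)

lemma qint_eq_0_iff [simp]: "qint n = 0 \<longleftrightarrow> n = 0"
  using q_powi_eq_iff[of n "- n"] q_diff_nonzero by (simp add: qint_def del: q_diff_nonzero)

lemma subring_type_algebraD:
  assumes "subring A (ring_of_type_algebra :: 'a::ring_1 ring)"
  shows "0 \<in> A" "1 \<in> A" "x \<in> A \<Longrightarrow> y \<in> A \<Longrightarrow> x + y \<in> A"
    "x \<in> A \<Longrightarrow> y \<in> A \<Longrightarrow> x * y \<in> A" "x \<in> A \<Longrightarrow> - x \<in> A"
proof -
  interpret R: ring "ring_of_type_algebra :: 'a ring" by (rule ring_type_algebra)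
  show "0 \<in> A" "1 \<in> A" "x \<in> A \<Longrightarrow> y \<in> A \<Longrightarrow> x + y \<in> A" "x \<in> A \<Longrightarrow> y \<in> A \<Longrightarrow> x * y \<in> A"
    using subringE[OF assms] by (auto simp: ring_of_type_algebra_def)
  assume x: "x \<in> A"
  have "\<ominus>\<^bsub>ring_of_type_algebra\<^esub> x = - x"
    using R.minus_equality[of "- x" x] by (simp add: ring_of_type_algebra_def)
  thus "- x \<in> A" using subringE(5)[OF assms x] by simp
qed

lemma subring_type_algebraI:
  assumes "0 \<in> A" "1 \<in> A" "\<And>x y. x \<in> A \<Longrightarrow> y \<in> A \<Longrightarrow> x + y \<in> A"
    "\<And>x y. x \<in> A \<Longrightarrow> y \<in> A \<Longrightarrow> x * y \<in> A" "\<And>x. x \<in> A \<Longrightarrow> - x \<in> A"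
  shows "subring A (ring_of_type_algebra :: 'a::ring_1 ring)"
proof -
  interpret R: ring "ring_of_type_algebra :: 'a ring" by (rule ring_type_algebra)
  have inv: "\<ominus>\<^bsub>ring_of_type_algebra\<^esub> x = - x" for x :: 'a
    using R.minus_equality[of "- x" x] by (simp add: ring_of_type_algebra_def)
  show ?thesis
    by (rule R.subringI) (use assms inv in \<open>auto simp: ring_of_type_algebra_def\<close>)
qed

lemma UQ0_zero [simp]: "0 \<in> UQ0"
  unfolding UQ0_def hull_def by (blast intro: subring_type_algebraD)

lemma UQ0_one [simp]: "1 \<in> UQ0"
  unfolding UQ0_def hull_def by (blast intro: subring_type_algebraD)

lemma UQ0_scal [simp]: "scal c \<in> UQ0"
  unfolding UQ0_def hull_def by blast

lemma UQ0_h':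
  assumes "r \<noteq> 0"
  shows "h r \<in> UQ0"
proof -
  have "h ` (- {0}) \<subseteq> UQ0" unfolding UQ0_def by (rule hull_subset)
  thus ?thesis using assms by auto
qed

lemma UQ0_add [intro]: "x \<in> UQ0 \<Longrightarrow> y \<in> UQ0 \<Longrightarrow> x + y \<in> UQ0"
  unfolding UQ0_def hull_def by (blast intro: subring_type_algebraD)

lemma UQ0_mult [intro]: "x \<in> UQ0 \<Longrightarrow> y \<in> UQ0 \<Longrightarrow> x * y \<in> UQ0"
  unfolding UQ0_def hull_def by (blast intro: subring_type_algebraD)

lemma UQ0_uminus [intro]: "x \<in> UQ0 \<Longrightarrow> - x \<in> UQ0"
  unfolding UQ0_def hull_def by (blast intro: subring_type_algebraD)

lemma UQ0_diff [intro]: "x \<in> UQ0 \<Longrightarrow> y \<in> UQ0 \<Longrightarrow> x - y \<in> UQ0"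
  using UQ0_add[of x "- y"] by auto

lemma UQ0_sum: "(\<And>i. i \<in> I \<Longrightarrow> f i \<in> UQ0) \<Longrightarrow> sum f I \<in> UQ0"
  by (induction I rule: infinite_finite_induct) auto

lemma scal_zero [simp]: "scal 0 = 0"
  by transfer (simp add: fscal_def uq_ideal_zero)

lemma scal_one [simp]: "scal 1 = 1"
  by transfer (simp add: fscal_def uq_ideal_zero)

lemma scal_add: "scal (a + b) = scal a + scal b"
  by transfer (simp add: fscal_def single_add uq_ideal_zero)

lemma scal_mult: "scal (a * b) = scal a * scal b"
  by transfer (simp add: fscal_def mult_single uq_ideal_zero)

lemma scal_minus: "scal (- a) = - scal a"
  by transfer (simp add: fscal_def single_uminus uq_ideal_zero)

lemma scal_diff: "scal (a - b) = scal a - scal b"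
  using scal_add[of a "- b"] by (simp add: scal_minus)

lemma fscal_commute: "fscal c * a = a * fscal c"
proof -
  have "fscal c * Poly_Mapping.single w d = Poly_Mapping.single w d * fscal c" for w d
    by (simp add: fscal_def mult_single mult.commute)
  thus ?thesis
    by (subst (1 2) falg_eq_sum_single) (simp add: sum_distrib_left sum_distrib_right)
qed

lemma scal_commute: "x * scal c = scal c * x"
  by transfer (simp add: fscal_commute uq_ideal_zero)

lemma scal_left_commute: "x * (scal c * y) = scal c * (x * y)"
  by (metis mult.assoc scal_commute)

lemma scal_inverse: "c \<noteq> 0 \<Longrightarrow> scal (inverse c) * (scal c * x) = x"
  by (simp add: mult.assoc[symmetric] flip: scal_mult)

section \<open>Generators and relations in the quotient algebra\<close>

lift_definition Kinv :: uq is "fgen GKinv" .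

text \<open>Words are built up by multiplication from the left only, which fits statements modulo a
  left ideal.\<close>

lemma uq_induct [case_names scal add mult]:
  assumes "\<And>c. P (scal c)"
    and "\<And>x y. P x \<Longrightarrow> P y \<Longrightarrow> P (x + y)"
    and "\<And>x g. P x \<Longrightarrow> g \<in> range xp \<union> range xm \<union> range h \<union> {KK, Kinv} \<Longrightarrow> P (g * x)"
  shows "P x"
proof -
  have word: "P (abs_uq (Poly_Mapping.single (FMon xs) c))" for xs c
  proof (induction xs)
    case Nil
    have "abs_uq (Poly_Mapping.single (FMon []) c) = scal c"
      by (simp add: scal.abs_eq fscal_def zero_fmon_def)
    thus ?case using assms(1) by simp
  next
    case (Cons g xs)
    have "Poly_Mapping.single (FMon (g # xs)) c = fgen g * Poly_Mapping.single (FMon xs) c"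
      by (simp add: fgen_def mult_single plus_fmon_def)
    hence "abs_uq (Poly_Mapping.single (FMon (g # xs)) c)
        = abs_uq (fgen g) * abs_uq (Poly_Mapping.single (FMon xs) c)"
      by (simp add: times_uq.abs_eq)
    moreover have "abs_uq (fgen g) \<in> range xp \<union> range xm \<union> range h \<union> {KK, Kinv}"
      by (cases g) (auto simp: xp.abs_eq[symmetric] xm.abs_eq[symmetric] h.abs_eq[symmetric]
          KK.abs_eq[symmetric] Kinv.abs_eq[symmetric])
    ultimately show ?case using assms(3)[OF Cons] by simp
  qed
  have "P (abs_uq (\<Sum>w\<in>W. Poly_Mapping.single w (f w)))" if "finite W" for W f
    using that
  proof (induction W rule: finite_induct)
    case empty
    show ?case using assms(1)[of 0] by (simp add: zero_uq.abs_eq)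
  next
    case (insert w W)
    have "P (abs_uq (Poly_Mapping.single w (f w)))" using word by (cases w) simp
    thus ?case using insert assms(2) by (simp flip: plus_uq.abs_eq)
  qed
  hence "P (abs_uq a)" for a using falg_eq_sum_single[of a] by (metis finite_keys)
  thus ?thesis by (rule uq.abs_induct)
qed

lemma abs_uq_relator: "a \<in> uq_relators \<Longrightarrow> abs_uq a = 0"
proof -
  assume "a \<in> uq_relators"
  hence "a \<in> uq_ideal"
    unfolding uq_ideal_def genideal_def by blast
  thus ?thesis by (simp add: zero_uq.abs_eq uq.abs_eq_iff)
qed

text \<open>The coefficients of psi without their factor \<open>KK\<close> or \<open>Kinv\<close>;
  unlike psi they lie in \<open>UQ0\<close>. The index counts in the direction of the sign.\<close>

definition psi0 :: "int \<Rightarrow> nat \<Rightarrow> uq" where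
  "psi0 \<epsilon> n = fps_nth (alg_exp scal (Abs_fps (\<lambda>s. if s = 0 then 0
               else scal (of_int \<epsilon> * (q - inverse q)) * h (\<epsilon> * int s)))) n"

definition Kpow :: "int \<Rightarrow> uq" where
  "Kpow \<epsilon> = (if \<epsilon> = 1 then KK else Kinv)"

definition psi :: "int \<Rightarrow> int \<Rightarrow> uq" where
  "psi \<epsilon> r = (if \<epsilon> * r \<ge> 0 then Kpow \<epsilon> * psi0 \<epsilon> (nat (\<epsilon> * r)) else 0)"

lemma abs_uq_fgen: "abs_uq (fgen (GXplus r)) = xp r" "abs_uq (fgen (GXminus r)) = xm r"
  "abs_uq (fgen (GH r)) = h r" "abs_uq (fgen GK) = KK" "abs_uq (fgen GKinv) = Kinv"
  "abs_uq (fscal c) = scal c"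
  by (simp_all add: xp.abs_eq xm.abs_eq h.abs_eq KK.abs_eq Kinv.abs_eq scal.abs_eq)

lemmas abs_uq_hom = plus_uq.abs_eq[symmetric] times_uq.abs_eq[symmetric]
  minus_uq.abs_eq[symmetric] uminus_uq.abs_eq[symmetric] zero_uq.abs_eq[symmetric]
  one_uq.abs_eq[symmetric]

lemma abs_uq_fpsi: "abs_uq (fpsi \<epsilon> r) = psi \<epsilon> r"
proof -
  have exp: "abs_uq (fps_nth (alg_exp fscal f) n)
    = fps_nth (alg_exp scal (Abs_fps (\<lambda>n. abs_uq (fps_nth f n)))) n" for f n
    by (rule conjunct2, rule alg_exp_map[where A = UNIV])
      (simp_all add: abs_uq_hom abs_uq_fgen)
  have K: "abs_uq (fKpow \<epsilon>) = Kpow \<epsilon>"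
    by (simp add: fKpow_def Kpow_def abs_uq_fgen)
  show ?thesis
    unfolding fpsi_def psi_def psi0_def
    by (auto simp: abs_uq_hom abs_uq_fgen exp K if_distrib[of abs_uq] cong: if_cong)
qed

lemma h_0 [simp]: "h 0 = 0"
  using abs_uq_relator[OF h_zero] by (simp add: abs_uq_fgen)

lemma UQ0_h [simp]: "h r \<in> UQ0"
  by (cases "r = 0") (auto simp: UQ0_h')

lemma K_Kinv [simp]: "KK * Kinv = 1" and Kinv_K [simp]: "Kinv * KK = 1"
  using abs_uq_relator[OF K_Kinv] abs_uq_relator[OF Kinv_K]
    by (simp_all add: abs_uq_hom abs_uq_fgen)

lemma Kinv_K_assoc [simp]: "Kinv * (KK * x) = x" "KK * (Kinv * x) = x"
  by (simp_all flip: mult.assoc)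

lemma K_h_commute: "KK * h r = h r * KK"
  using abs_uq_relator[OF K_h[of r]] by (cases "r = 0") (simp_all add: abs_uq_hom abs_uq_fgen)

lemma K_x_commute:
  assumes "KK * x * Kinv = scal c * x"
  shows "KK * x = scal c * (x * KK)"
proof -
  have "KK * x = KK * x * Kinv * KK" by (simp add: mult.assoc)
  thus ?thesis unfolding assms by (simp add: mult.assoc)
qed

lemma K_xp: "KK * xp r = scal (q powi 2) * (xp r * KK)"
  using abs_uq_relator[OF K_x[of 1 r]]
    by (intro K_x_commute) (simp add: abs_uq_hom abs_uq_fgen fX_def)

lemma K_xm: "KK * xm r = scal (q powi (- 2)) * (xm r * KK)"
  using abs_uq_relator[OF K_x[of "-1" r]]
    by (intro K_x_commute) (simp add: abs_uq_hom abs_uq_fgen fX_def)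

lemma h_h_commute: "h r * h s = h s * h r"
  using abs_uq_relator[OF h_h[of r s]]
  by (cases "r = 0 \<or> s = 0") (auto simp: abs_uq_hom abs_uq_fgen)

lemma h_xp: "h r * xp s = xp s * h r + scal (qint (2 * r) / of_int r) * xp (r + s)"
  using abs_uq_relator[OF h_x[of 1 r s]]
  by (cases "r = 0") (auto simp: abs_uq_hom abs_uq_fgen fX_def algebra_simps)

lemma h_xm: "h r * xm s = xm s * h r - scal (qint (2 * r) / of_int r) * xm (r + s)"
  using abs_uq_relator[OF h_x[of "-1" r s]]
  by (cases "r = 0") (auto simp: abs_uq_hom abs_uq_fgen fX_def scal_minus algebra_simps)

lemma xp_xp: "xp (r + 1) * xp s - scal (q powi 2) * (xp s * xp (r + 1))
   = scal (q powi 2) * (xp r * xp (s + 1)) - xp (s + 1) * xp r"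
  using abs_uq_relator[OF x_x[of 1 r s]] by (simp add: abs_uq_hom abs_uq_fgen fX_def mult.assoc)

lemma xm_xm: "xm (r + 1) * xm s - scal (q powi (- 2)) * (xm s * xm (r + 1))
   = scal (q powi (- 2)) * (xm r * xm (s + 1)) - xm (s + 1) * xm r"
  using abs_uq_relator[OF x_x[of "-1" r s]] by (simp add: abs_uq_hom abs_uq_fgen fX_def mult.assoc)

lemma xp_xm: "xp r * xm s = xm s * xp r
    + scal (1 / (q - inverse q)) * (psi 1 (r + s) - psi (-1) (r + s))"
  using abs_uq_relator[OF xp_xm[of r s]]
  by (simp add: abs_uq_hom abs_uq_fgen abs_uq_fpsi fX_def algebra_simps)

section \<open>The commutative subalgebra generated by the h r\<close>

lemma UQ0_induct [consumes 1, case_names h scal add mult uminus]: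
  assumes "y \<in> UQ0" and "\<And>r. P (h r)" and "\<And>c. P (scal c)"
    and "\<And>x y. x \<in> UQ0 \<Longrightarrow> y \<in> UQ0 \<Longrightarrow> P x \<Longrightarrow> P y \<Longrightarrow> P (x + y)"
    and "\<And>x y. x \<in> UQ0 \<Longrightarrow> y \<in> UQ0 \<Longrightarrow> P x \<Longrightarrow> P y \<Longrightarrow> P (x * y)"
    and "\<And>x. x \<in> UQ0 \<Longrightarrow> P x \<Longrightarrow> P (- x)"
  shows "P y"
proof -
  have "subring {y \<in> UQ0. P y} UQ"
    by (rule subring_type_algebraI) (use assms(3)[of 0] assms(3)[of 1] in \<open>auto intro: assms\<close>)
  moreover have "range scal \<subseteq> {y \<in> UQ0. P y}" "h ` (- {0}) \<subseteq> {y \<in> UQ0. P y}"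
    by (auto simp: assms)
  ultimately have "UQ0 \<subseteq> {y \<in> UQ0. P y}"
    unfolding UQ0_def[of] by (subst (1) hull_def) blast
  thus ?thesis using assms(1) by blast
qed

lemma UQ0_h_commute: "y \<in> UQ0 \<Longrightarrow> h r * y = y * h r"
proof (induction rule: UQ0_induct)
  case (mult x y)
  thus ?case by (metis mult.assoc)
qed (simp_all add: h_h_commute scal_commute algebra_simps)

lemma UQ0_commute: "x \<in> UQ0 \<Longrightarrow> y \<in> UQ0 \<Longrightarrow> x * y = y * x"
proof (induction rule: UQ0_induct)
  case (mult a b)
  thus ?case by (metis mult.assoc)
qed (simp_all add: UQ0_h_commute scal_commute algebra_simps)

lemma UQ0_K_commute: "y \<in> UQ0 \<Longrightarrow> KK * y = y * KK"
proof (induction rule: UQ0_induct)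
  case (mult a b)
  thus ?case by (metis mult.assoc)
qed (simp_all add: K_h_commute scal_commute algebra_simps)

lemma alg_exp_scal_in_UQ0:
  assumes "\<And>n. fps_nth f n \<in> UQ0"
  shows "fps_nth (alg_exp scal f) n \<in> UQ0"
  by (rule conjunct1, rule alg_exp_map[where A = UQ0 and \<phi> = "\<lambda>x. x" and s' = scal])
    (auto simp: assms)

lemma psi0_in_UQ0 [simp]: "psi0 \<epsilon> n \<in> UQ0"
  unfolding psi0_def by (rule alg_exp_scal_in_UQ0) auto

lemma Lam_series_in_UQ0: "fps_nth (Lam_series \<epsilon>) n \<in> UQ0"
  unfolding Lam_series_def by (rule alg_exp_scal_in_UQ0) (simp add: UQ0_mult UQ0_uminus)

lemma Lam_in_UQ0 [simp]: "Lam r \<in> UQ0"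
  by (simp add: Lam_def Lam_series_in_UQ0)

text \<open>The left ideal of relations of a highest weight vector of weight m. It is spelled out
  inductively because it is used through inductions over its elements, and m is an arbitrary integer
  since weights are not known to be nonnegative at first.\<close>

inductive_set hw_ideal :: "int \<Rightarrow> uq set" for m where
  zero: "0 \<in> hw_ideal m"
| xp: "u * xp k \<in> hw_ideal m"
| KK: "u * (KK - scal (q powi m)) \<in> hw_ideal m"
| add: "x \<in> hw_ideal m \<Longrightarrow> y \<in> hw_ideal m \<Longrightarrow> x + y \<in> hw_ideal m"

lemma hw_ideal_mult: "x \<in> hw_ideal m \<Longrightarrow> u * x \<in> hw_ideal m"
  by (induction rule: hw_ideal.induct)
    (auto simp: distrib_left mult.assoc[symmetric] intro: hw_ideal.intros)

lemma hw_ideal_uminus: "x \<in> hw_ideal m \<Longrightarrow> - x \<in> hw_ideal m"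
  using hw_ideal_mult[of x m "-1"] by simp

lemma hw_ideal_diff: "x \<in> hw_ideal m \<Longrightarrow> y \<in> hw_ideal m \<Longrightarrow> x - y \<in> hw_ideal m"
  using hw_ideal.add[of x m "- y"] hw_ideal_uminus by simp

text \<open>Moving \<open>h r\<close> to the left past \<open>xp k\<close> only produces another
  \<open>xp\<close>, and \<open>KK\<close> commutes with it. So the left ideal admits a right action
  of \<open>UQ0\<close>; this is what makes top components multiplicative.\<close>

lemma hw_ideal_mult_UQ0: "y \<in> UQ0 \<Longrightarrow> j \<in> hw_ideal m \<Longrightarrow> j * y \<in> hw_ideal m"
proof (induction arbitrary: j rule: UQ0_induct)
  case (h r)
  from h show ?case
  proof (induction rule: hw_ideal.induct)
    case (xp u k)
    have "u * xp k * h r = (u * h r) * xp k - (u * scal (qint (2 * r) / of_int r)) * xp (r + k)"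
      by (simp add: mult.assoc h_xp distrib_left)
    thus ?case by (auto intro: hw_ideal_diff hw_ideal.xp)
  next
    case (KK u)
    have "u * (KK - scal (q powi m)) * h r = (u * h r) * (KK - scal (q powi m))"
      by (simp add: mult.assoc algebra_simps K_h_commute scal_commute)
    thus ?case by (auto intro: hw_ideal.KK)
  qed (auto simp: distrib_right intro: hw_ideal.intros)
next
  case (scal c)
  thus ?case by (auto simp: scal_commute intro: hw_ideal_mult)
next
  case (add x y)
  thus ?case by (auto simp: distrib_left intro: hw_ideal.add)
next
  case (mult x y)
  thus ?case by (auto simp: mult.assoc[symmetric])
next
  case (uminus x)
  thus ?case by (auto intro: hw_ideal_uminus)
qed

inductive lowers :: "nat \<Rightarrow> uq \<Rightarrow> bool" where
  "y \<in> UQ0 \<Longrightarrow> lowers 0 y"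
| "lowers r s \<Longrightarrow> lowers (Suc r) (xm k * s)"
| "lowers r s \<Longrightarrow> lowers r s' \<Longrightarrow> lowers r (s + s')"

definition lowering :: "nat \<Rightarrow> uq set" where
  "lowering r = {s. lowers r s}"

lemma lowering_base: "y \<in> UQ0 \<Longrightarrow> y \<in> lowering 0"
  and lowering_step: "s \<in> lowering r \<Longrightarrow> xm k * s \<in> lowering (Suc r)"
  and lowering_add: "s \<in> lowering r \<Longrightarrow> s' \<in> lowering r \<Longrightarrow> s + s' \<in> lowering r"
  by (simp_all add: lowering_def lowers.intros)

lemma lowering_induct [consumes 1, case_names base step add]:
  assumes "s \<in> lowering r"
    and "\<And>y. y \<in> UQ0 \<Longrightarrow> P 0 y"
    and "\<And>s r k. s \<in> lowering r \<Longrightarrow> P r s \<Longrightarrow> P (Suc r) (xm k * s)"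
    and "\<And>s r s'. s \<in> lowering r \<Longrightarrow> P r s \<Longrightarrow> s' \<in> lowering r \<Longrightarrow> P r s' \<Longrightarrow> P r (s + s')"
  shows "P r s"
  using assms(1) unfolding lowering_def mem_Collect_eq
  by (induction rule: lowers.induct) (auto intro: assms(2-4) simp: lowering_def)

lemma lowering_0: "s \<in> lowering 0 \<longleftrightarrow> s \<in> UQ0"
proof
  show "s \<in> lowering 0 \<Longrightarrow> s \<in> UQ0"
    by (induction "0::nat" s rule: lowering_induct) auto
qed (rule lowering_base)

lemma lowering_zero [simp]: "0 \<in> lowering r"
proof (induction r)
  case (Suc r)
  thus ?case using lowering_step[of 0 r 0] by simp
qed (simp add: lowering_0)

lemma lowering_scal: "s \<in> lowering r \<Longrightarrow> scal c * s \<in> lowering r"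
  by (induction rule: lowering_induct)
    (auto simp: distrib_left scal_left_commute[symmetric] lowering_0 UQ0_mult
        intro: lowering_step lowering_add)

lemma lowering_uminus: "s \<in> lowering r \<Longrightarrow> - s \<in> lowering r"
  using lowering_scal[of s r "-1"] by (simp add: scal_minus)

lemma lowering_diff: "s \<in> lowering r \<Longrightarrow> s' \<in> lowering r \<Longrightarrow> s - s' \<in> lowering r"
  using lowering_add[of s r "- s'"] lowering_uminus by simp

lemma lowering_h: "s \<in> lowering r \<Longrightarrow> h k * s \<in> lowering r"
proof (induction rule: lowering_induct)
  case (step s r l)
  have "h k * (xm l * s) = xm l * (h k * s) - scal (qint (2 * k) / of_int k) * (xm (k + l) * s)"
    by (simp add: mult.assoc[symmetric] h_xm left_diff_distrib)
  thus ?case using step by (auto intro!: lowering_diff lowering_scal intro: lowering_step)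
qed (auto simp: distrib_left lowering_0 UQ0_mult intro: lowering_add)

lemma lowering_UQ0: "y \<in> UQ0 \<Longrightarrow> s \<in> lowering r \<Longrightarrow> y * s \<in> lowering r"
  by (induction arbitrary: s rule: UQ0_induct)
    (auto simp: lowering_h lowering_scal distrib_right mult.assoc
        intro: lowering_add lowering_uminus)

text \<open>Each factor \<open>xm\<close> contributes q^-2, and the tail in \<open>UQ0\<close>
  commutes with \<open>KK\<close>. Thus the number of factors can be read off from the
  eigenvalue.\<close>

lemma lowering_K: "s \<in> lowering r \<Longrightarrow> KK * s - scal (q powi (m - 2 * int r)) * s \<in> hw_ideal m"
proof (induction rule: lowering_induct)
  case (base y)
  have "KK * y - scal (q powi m) * y = y * (KK - scal (q powi m))"
    using base by (simp add: UQ0_K_commute scal_commute right_diff_distrib)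
  thus ?case by (simp add: hw_ideal.KK)
next
  case (step s r k)
  have "m - 2 * int (Suc r) = - 2 + (m - 2 * int r)" by simp
  hence "q powi (m - 2 * int (Suc r)) = q powi (- 2) * q powi (m - 2 * int r)"
    by (simp only: power_int_add[of q "- 2"] q_nonzero simp_thms)
  moreover have "KK * (xm k * s) = scal (q powi (- 2)) * (xm k * (KK * s))"
    by (metis K_xm mult.assoc)
  ultimately have "KK * (xm k * s) - scal (q powi (m - 2 * int (Suc r))) * (xm k * s)
    = (scal (q powi (- 2)) * xm k) * (KK * s - scal (q powi (m - 2 * int r)) * s)"
    by (simp only: scal_mult right_diff_distrib mult.assoc scal_left_commute[of "xm k"])
  thus ?case using step by (simp only: hw_ideal_mult)
next
  case (add s r s')
  have "KK * (s + s') - scal (q powi (m - 2 * int r)) * (s + s')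
    = (KK * s - scal (q powi (m - 2 * int r)) * s) + (KK * s' - scal (q powi (m - 2 * int r)) * s')"
    by (simp add: algebra_simps)
  thus ?case using hw_ideal.add[OF add.IH] by simp
qed

lemma lowering_Kinv:
  assumes "s \<in> lowering r"
  shows "Kinv * s - scal (q powi (2 * int r - m)) * s \<in> hw_ideal m"
proof -
  let ?c = "q powi (2 * int r - m)"
  have c: "?c * q powi (m - 2 * int r) = 1"
    by (subst power_int_add[symmetric]) simp_all
  have "Kinv * s - scal ?c * s = - (Kinv * scal ?c) * (KK * s - scal (q powi (m - 2 * int r)) * s)"
  proof -
    have "Kinv * scal ?c * (KK * s) = scal ?c * s"
      by (simp add: scal_commute[of Kinv] mult.assoc)
    moreover have "Kinv * scal ?c * (scal (q powi (m - 2 * int r)) * s) = Kinv * s"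
      unfolding mult.assoc by (simp add: mult.assoc[of "scal ?c", symmetric] c flip: scal_mult)
    ultimately show ?thesis by (simp add: right_diff_distrib)
  qed
  thus ?thesis using lowering_K[OF assms, of m] by (simp only: hw_ideal_mult)
qed

lemma lowering_psi:
  assumes "s \<in> lowering r"
  shows "\<exists>s'\<in>lowering r. psi 1 k * s - psi (-1) k * s - s' \<in> hw_ideal m"
proof -
  have *: "\<exists>s'\<in>lowering r. psi \<epsilon> k * s - s' \<in> hw_ideal m" for \<epsilon>
  proof (cases "\<epsilon> * k \<ge> 0")
    case True
    let ?s = "psi0 \<epsilon> (nat (\<epsilon> * k)) * s"
    have s: "?s \<in> lowering r"
      using assms by (intro lowering_UQ0) auto
    show ?thesis
    proof (cases "\<epsilon> = 1")
      case e: True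
      have "psi \<epsilon> k * s = KK * ?s" using True e by (simp add: psi_def Kpow_def mult.assoc)
      with lowering_K[OF s, of m] lowering_scal[OF s] show ?thesis by metis
    next
      case e: False
      have "psi \<epsilon> k * s = Kinv * ?s" using True e by (simp add: psi_def Kpow_def mult.assoc)
      with lowering_Kinv[OF s, of m] lowering_scal[OF s] show ?thesis by metis
    qed
  qed (auto simp: psi_def intro!: bexI[of _ 0] hw_ideal.zero)
  from *[of 1] *[of "-1"] obtain s1 s2 where s: "s1 \<in> lowering r" "s2 \<in> lowering r"
    "psi 1 k * s - s1 \<in> hw_ideal m" "psi (-1) k * s - s2 \<in> hw_ideal m" by blast
  have "psi 1 k * s - psi (-1) k * s - (s1 - s2) = (psi 1 k * s - s1) - (psi (-1) k * s - s2)"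
    by simp
  hence "psi 1 k * s - psi (-1) k * s - (s1 - s2) \<in> hw_ideal m"
    using hw_ideal_diff[OF s(3,4)] by (simp only:)
  thus ?thesis using lowering_diff[OF s(1,2)] by (rule bexI)
qed

lemma lowering_xp_0: "s \<in> lowering 0 \<Longrightarrow> xp k * s \<in> hw_ideal m"
  using hw_ideal_mult_UQ0[of s "xp k" m] hw_ideal.xp[of 1 k m] by (simp add: lowering_0)

text \<open>Passing \<open>xp k\<close> across the first \<open>xm\<close> leaves a commutator, a
  difference of two psi, which keeps the length of the remaining word, plus a term in which
  \<open>xp\<close> acts on a shorter word.\<close>

lemma lowering_xp_Suc:
  "s \<in> lowering (Suc r) \<Longrightarrow> \<exists>s'\<in>lowering r. xp k * s - s' \<in> hw_ideal m"
proof (induction "Suc r" s arbitrary: r rule: lowering_induct)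
  case (step s r l)
  obtain s1 where s1: "s1 \<in> lowering r"
    "psi 1 (k + l) * s - psi (-1) (k + l) * s - s1 \<in> hw_ideal m"
    using lowering_psi[OF step(1)] by blast
  \<comment> \<open>For an empty remaining word there is no induction hypothesis; there
    \<open>xp\<close> is absorbed by the ideal.\<close>
  obtain s2 where s2: "s2 \<in> lowering r" "xm l * (xp k * s) - s2 \<in> hw_ideal m"
  proof (cases r)
    case 0
    thus ?thesis using that[of 0] step(1) hw_ideal_mult[OF lowering_xp_0] by auto
  next
    case (Suc r')
    obtain s' where "s' \<in> lowering r'" "xp k * s - s' \<in> hw_ideal m"
      using step(2)[OF Suc] by blast
    thus ?thesis using that[of "xm l * s'"] Suc hw_ideal_mult[of "xp k * s - s'" m "xm l"]
      by (auto simp: right_diff_distrib intro: lowering_step)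
  qed
  let ?c = "scal (1 / (q - inverse q))"
  have "xp k * (xm l * s) - (s2 + ?c * s1)
    = (xm l * (xp k * s) - s2) + ?c * (psi 1 (k + l) * s - psi (-1) (k + l) * s - s1)"
    by (simp add: mult.assoc[symmetric] xp_xm) (simp add: algebra_simps)
  moreover have "\<dots> \<in> hw_ideal m"
    using s1(2) s2(2) by (intro hw_ideal.add hw_ideal_mult)
  ultimately have "xp k * (xm l * s) - (s2 + ?c * s1) \<in> hw_ideal m" by (simp only:)
  thus ?case using lowering_add[OF s2(1) lowering_scal[OF s1(1)]] by (rule bexI)
next
  case (add s s')
  then obtain t t' where "t \<in> lowering r" "xp k * s - t \<in> hw_ideal m"
    "t' \<in> lowering r" "xp k * s' - t' \<in> hw_ideal m" by blast
  moreover have "xp k * (s + s') - (t + t') = (xp k * s - t) + (xp k * s' - t')"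
    by (simp add: algebra_simps)
  ultimately show ?case by (metis lowering_add hw_ideal.add)
qed

text \<open>Modulo the ideal, the sums of lowering words contain the scalars and are stable under
  left multiplication by each generator, hence exhaust the algebra. Nothing is claimed about
  uniqueness of the components.\<close>

lemma lowering_decomposition:
  "\<exists>R s. (\<forall>r. s r \<in> lowering r) \<and> x - (\<Sum>r\<le>R. s r) \<in> hw_ideal m"
proof -
  let ?D = "\<lambda>x. \<exists>R s. (\<forall>r. s r \<in> lowering r) \<and> x - (\<Sum>r\<le>R. s r) \<in> hw_ideal m"
  have ideal: "?D x" if "x \<in> hw_ideal m" for x
    using that by (intro exI[of _ 0] exI[of _ "\<lambda>_. 0"]) auto
  have low: "?D s" if "s \<in> lowering r" for r s
    using that by (intro exI[of _ r] exI[of _ "\<lambda>i. if i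
      = r then s else 0"]) (auto intro: hw_ideal.zero)
  have add: "?D (x + y)" if "?D x" "?D y" for x y
  proof -
    from that(1) obtain R s where s1: "\<forall>r. s r \<in> lowering r" "x - (\<Sum>r\<le>R. s r) \<in> hw_ideal m"
      by blast
    from that(2) obtain R' s' where s2: "\<forall>r. s' r \<in> lowering r" "y - (\<Sum>r\<le>R'. s' r) \<in> hw_ideal m"
      by blast
    note s = s1 s2
    let ?s = "\<lambda>r. (if r \<le> R then s r else 0) + (if r \<le> R' then s' r else 0)"
    have "(\<Sum>r\<le>max R R'. ?s r) = (\<Sum>r\<le>max R R'. if r \<le> R then s r else 0)
       + (\<Sum>r\<le>max R R'. if r \<le> R' then s' r else 0)" by (simp add: sum.distrib)
    also have "(\<Sum>r\<le>max R R'. if r \<le> R then s r else 0) = (\<Sum>r\<le>R. s r)"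
      by (rule sum.mono_neutral_cong_right) auto
    also have "(\<Sum>r\<le>max R R'. if r \<le> R' then s' r else 0) = (\<Sum>r\<le>R'. s' r)"
      by (rule sum.mono_neutral_cong_right) auto
    finally have "x + y - (\<Sum>r\<le>max R R'. ?s r)
      = (x - (\<Sum>r\<le>R. s r)) + (y - (\<Sum>r\<le>R'. s' r))" by simp
    hence "x + y - (\<Sum>r\<le>max R R'. ?s r) \<in> hw_ideal m"
      using hw_ideal.add[OF s(2,4)] by (simp only:)
    moreover have "\<forall>r. ?s r \<in> lowering r" using s(1,3) by (auto intro: lowering_add)
    ultimately show ?thesis by (intro exI[of _ "max R R'"] exI[of _ ?s] conjI)
  qed
  have sum: "?D (sum f I)" if "finite I" "\<And>i. i \<in> I \<Longrightarrow> ?D (f i)" for f and I :: "nat set"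
    using that
  proof (induction I rule: finite_induct)
    case empty
    show ?case by (simp only: sum.empty) (rule ideal[OF hw_ideal.zero])
  qed (auto intro!: add)
  show ?thesis
  proof (induction x rule: uq_induct)
    case (scal c)
    show ?case by (rule low[of _ 0]) (simp add: lowering_0)
  next
    case (add x y)
    thus ?case by (rule \<open>\<And>x y. ?D x \<Longrightarrow> ?D y \<Longrightarrow> ?D (x + y)\<close>)
  next
    case (mult x g)
    then obtain R s where s: "\<And>r. s r \<in> lowering r" "x - (\<Sum>r\<le>R. s r) \<in> hw_ideal m" by blast
    have gen: "?D (g * s r)" for r
    proof -
      from mult(2) consider k where "g = xp k" | k where "g = xm k" | k where "g = h k" | "g
          = KK" | "g = Kinv"
        by blast
      thus ?thesis
      proof cases
        case 1
        show ?thesis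
        proof (cases r)
          case 0
          thus ?thesis using s(1)[of 0] 1 by (auto intro: ideal lowering_xp_0)
        next
          case (Suc r')
          obtain s' where "s' \<in> lowering r'" "xp k * s r - s' \<in> hw_ideal m"
            using lowering_xp_Suc[of "s r" r' k m] s(1)[of r] Suc by blast
          from add[OF low[OF this(1)] ideal[OF this(2)]] show ?thesis using 1 by simp
        qed
      next
        case 2
        thus ?thesis using s(1)[of r] low[OF lowering_step] by blast
      next
        case 3
        thus ?thesis using s(1)[of r] low[OF lowering_h] by blast
      next
        case 4
        from add[OF low[OF lowering_scal[OF s(1)[of r], of "q powi (m - 2
            * int r)"]] ideal[OF lowering_K[OF s(1)[of r]]]]
        show ?thesis using 4 by simp
      next
        case 5
        from add[OF low[OF lowering_scal[OF s(1)[of r], of "q powi (2 * int r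
            - m)"]] ideal[OF lowering_Kinv[OF s(1)[of r]]]]
        show ?thesis using 5 by simp
      qed
    qed
    have "?D ((\<Sum>r\<le>R. g * s r) + g * (x - (\<Sum>r\<le>R. s r)))"
      by (rule add, rule sum) (use gen ideal hw_ideal_mult[OF s(2)] in auto)
    thus ?case by (simp add: right_diff_distrib sum_distrib_left)
  qed
qed

text \<open>\<open>KK\<close> has the eigenvalue \<open>q powi (m - 2 * int r)\<close> on \<open>lowering r\<close>.\<close>

definition weight_factor :: "int \<Rightarrow> nat \<Rightarrow> uq" where
  "weight_factor m r = scal (inverse (q powi m - q powi (m - 2 * int r)))
     * (KK - scal (q powi (m - 2 * int r)))"

text \<open>The Lagrange interpolation polynomial in \<open>KK\<close> with value 1 at the top
  weight and 0 at the next \<open>R\<close> weights.\<close>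

primrec top_projector :: "int \<Rightarrow> nat \<Rightarrow> uq" where
  "top_projector m 0 = 1"
| "top_projector m (Suc R) = top_projector m R * weight_factor m (Suc R)"

lemma weight_factor_lowering:
  assumes "s \<in> lowering r'"
  shows "weight_factor m r * s - scal (inverse (q powi m - q powi (m - 2 * int r)) *
      (q powi (m - 2 * int r') - q powi (m - 2 * int r))) * s \<in> hw_ideal m"
proof -
  have "weight_factor m r * s - scal (inverse (q powi m - q powi (m - 2 * int r)) *
      (q powi (m - 2 * int r') - q powi (m - 2 * int r))) * s
    = scal (inverse (q powi m - q powi (m - 2 * int r))) * (KK * s - scal (q powi (m - 2
        * int r')) * s)"
    by (simp add: weight_factor_def scal_mult scal_diff left_diff_distrib right_diff_distrib
      mult.assoc)
  thus ?thesis using hw_ideal_mult[OF lowering_K[OF assms]] by simp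
qed

lemma top_projector_top: "s \<in> lowering 0 \<Longrightarrow> top_projector m R * s - s \<in> hw_ideal m"
proof (induction R)
  case (Suc R)
  have "q powi m - q powi (m - 2 * int (Suc R)) \<noteq> 0"
    by (simp add: q_powi_eq_iff)
  hence "weight_factor m (Suc R) * s - s \<in> hw_ideal m"
    using weight_factor_lowering[OF Suc.prems, of m "Suc R"] by simp
  from hw_ideal.add[OF hw_ideal_mult[OF this, of "top_projector m R"] Suc.IH[OF Suc.prems]]
  show ?case by (simp add: right_diff_distrib mult.assoc)
qed (simp add: hw_ideal.zero)

text \<open>The factors with index above r act by scalars modulo the ideal; the factor with index r
  then annihilates the word.\<close>

lemma top_projector_lower:
  "s \<in> lowering r \<Longrightarrow> 1 \<le> r \<Longrightarrow> r \<le> R \<Longrightarrow> top_projector m R * s \<in> hw_ideal m"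
proof (induction R)
  case (Suc R)
  show ?case
  proof (cases "r = Suc R")
    case True
    have "weight_factor m (Suc R) * s \<in> hw_ideal m"
      using weight_factor_lowering[OF Suc.prems(1), of m "Suc R"] True by simp
    thus ?thesis by (simp add: mult.assoc hw_ideal_mult)
  next
    case False
    let ?c = "inverse (q powi m - q powi (m - 2 * int (Suc R))) *
      (q powi (m - 2 * int r) - q powi (m - 2 * int (Suc R)))"
    have 1: "top_projector m R * (weight_factor m (Suc R) * s - scal ?c * s) \<in> hw_ideal m"
      by (rule hw_ideal_mult[OF weight_factor_lowering[OF Suc.prems(1)]])
    have 2: "scal ?c * (top_projector m R * s) \<in> hw_ideal m"
      using False Suc by (intro hw_ideal_mult Suc.IH) auto
    from hw_ideal.add[OF 1 2] show ?thesis
        by (simp add: right_diff_distrib mult.assoc scal_left_commute)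
  qed
qed simp

text \<open>The right ideal generated by the \<open>xm k\<close>; applied to a highest weight vector
  it yields everything below the top.\<close>

inductive_set xm_span :: "uq set" where
  zero: "0 \<in> xm_span"
| xm: "xm k * u \<in> xm_span"
| add: "x \<in> xm_span \<Longrightarrow> y \<in> xm_span \<Longrightarrow> x + y \<in> xm_span"

lemma lowering_Suc_xm_span: "s \<in> lowering (Suc r) \<Longrightarrow> s \<in> xm_span"
  by (induction "Suc r" s arbitrary: r rule: lowering_induct) (auto intro: xm_span.intros)

text \<open>Here y is the part of x without lowering operators and \<kappa> the projecting
  polynomial in \<open>KK\<close>. On a highest weight vector v, \<kappa> acts as the identity and y
  v = \<kappa> x v, so y v belongs to every submodule that contains x v. All later arguments about
  submodules and annihilators use the decomposition in this form.\<close>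

lemma top_component:
  "\<exists>\<kappa> y p. y \<in> UQ0 \<and> p \<in> xm_span \<and> x - y - p \<in> hw_ideal m \<and> \<kappa> * x - y \<in> hw_ideal m
     \<and> \<kappa> - 1 \<in> hw_ideal m"
proof -
  obtain R s where s: "\<And>r. s r \<in> lowering r" "x - (\<Sum>r\<le>R. s r) \<in> hw_ideal m"
    using lowering_decomposition by blast
  have split: "(\<Sum>r\<le>R. s r) = s 0 + (\<Sum>r\<in>{1..R}. s r)"
  proof -
    have "{..R} = insert 0 {1..R}" by auto
    thus ?thesis by simp
  qed
  let ?p = "\<Sum>r\<in>{1..R}. s r" and ?k = "top_projector m R"
  have "?p \<in> xm_span"
  proof -
    have "sum s I \<in> xm_span" if "finite I" "0 \<notin> I" for I
      using that
    proof (induction I rule: finite_induct)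
      case (insert r I)
      then obtain r' where "r = Suc r'" by (cases r) auto
      with insert s(1)[of r] lowering_Suc_xm_span show ?case by (auto intro: xm_span.add)
    qed (auto intro: xm_span.zero)
    thus ?thesis by simp
  qed
  moreover have "?k * x - s 0 \<in> hw_ideal m"
  proof -
    have "?k * ?p \<in> hw_ideal m"
    proof -
      have "sum (\<lambda>r. ?k * s r) I \<in> hw_ideal m" if "finite I" "I \<subseteq> {1..R}" for I
        using that
        by (induction I rule: finite_induct)
          (auto intro!: hw_ideal.add hw_ideal.zero top_projector_lower[OF s(1)])
      thus ?thesis by (simp add: sum_distrib_left)
    qed
    from hw_ideal.add[OF hw_ideal.add[OF hw_ideal_mult[OF s(2), of ?k]
        top_projector_top[OF s(1), of m R]] this]
    show ?thesis unfolding split by (simp add: algebra_simps)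
  qed
  moreover have "?k - 1 \<in> hw_ideal m"
    using top_projector_top[of 1 m R] by (simp add: lowering_0)
  ultimately show ?thesis
    using s unfolding split
    by (intro exI[of _ ?k] exI[of _ "s 0"] exI[of _ ?p]) (simp
      add: lowering_0[symmetric] diff_diff_eq)
qed

section \<open>Highest weight modules\<close>

lemma UQ_simps [simp]: "carrier UQ = UNIV" "x \<oplus>\<^bsub>UQ\<^esub> y = x + y" "x \<otimes>\<^bsub>UQ\<^esub> y = x * y"
  "\<zero>\<^bsub>UQ\<^esub> = 0" "\<one>\<^bsub>UQ\<^esub> = 1"
  by (simp_all add: ring_of_type_algebra_def)

lemma left_module_UQI:
  assumes "abelian_group M"
    and "\<And>a v. v \<in> carrier M \<Longrightarrow> a \<odot>\<^bsub>M\<^esub> v \<in> carrier M"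
    and "\<And>a b v. v \<in> carrier M \<Longrightarrow> (a + b) \<odot>\<^bsub>M\<^esub> v = a \<odot>\<^bsub>M\<^esub> v \<oplus>\<^bsub>M\<^esub> b \<odot>\<^bsub>M\<^esub> v"
    and "\<And>a v w. v \<in> carrier M \<Longrightarrow> w \<in> carrier M \<Longrightarrow>
      a \<odot>\<^bsub>M\<^esub> (v \<oplus>\<^bsub>M\<^esub> w) = a \<odot>\<^bsub>M\<^esub> v \<oplus>\<^bsub>M\<^esub> a \<odot>\<^bsub>M\<^esub> w"
    and "\<And>a b v. v \<in> carrier M \<Longrightarrow> (a * b) \<odot>\<^bsub>M\<^esub> v = a \<odot>\<^bsub>M\<^esub> (b \<odot>\<^bsub>M\<^esub> v)"
    and "\<And>v. v \<in> carrier M \<Longrightarrow> 1 \<odot>\<^bsub>M\<^esub> v = v"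
  shows "left_module UQ M"
  using assms
  by (auto intro!: left_module.intro left_module_axioms.intro ring_type_algebra)

locale UQ_module = left_module UQ M for M :: "(uq, 'v) module" (structure)
begin

lemma smult_closed' [simp, intro]: "v \<in> carrier M \<Longrightarrow> a \<odot> v \<in> carrier M"
  using smult_closed[of a v] by simp

lemma smult_l_distr': "v \<in> carrier M \<Longrightarrow> (a + b) \<odot> v = a \<odot> v \<oplus> b \<odot> v"
  using smult_l_distr[of a b v] by simp

lemma smult_r_distr': "v \<in> carrier M \<Longrightarrow> w \<in> carrier M \<Longrightarrow> a \<odot> (v \<oplus> w) = a \<odot> v \<oplus> a \<odot> w"
  using smult_r_distr[of a v w] by simp

lemma smult_assoc': "v \<in> carrier M \<Longrightarrow> (a * b) \<odot> v = a \<odot> (b \<odot> v)"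
  using smult_assoc[of a b v] by simp

lemma smult_one' [simp]: "v \<in> carrier M \<Longrightarrow> 1 \<odot> v = v"
  using smult_one[of v] by simp

lemma smult_zero_right [simp]: "a \<odot> \<zero> = \<zero>"
  using smult_r_distr'[of \<zero> \<zero> a] by simp

lemma smult_zero_left [simp]: "v \<in> carrier M \<Longrightarrow> 0 \<odot> v = \<zero>"
  using smult_l_distr'[of v 0 0] by simp

lemma smult_minus: "v \<in> carrier M \<Longrightarrow> (- a) \<odot> v = \<ominus> (a \<odot> v)"
  using smult_l_distr'[of v "- a" a] by (intro M.minus_equality[symmetric]) auto

lemma smult_diff: "v \<in> carrier M \<Longrightarrow> (a - b) \<odot> v = a \<odot> v \<ominus> b \<odot> v"
  using smult_l_distr'[of v a "- b"] by (simp add: smult_minus a_minus_def)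

lemma smult_eq_iff: "v \<in> carrier M \<Longrightarrow> a \<odot> v = b \<odot> v \<longleftrightarrow> (a - b) \<odot> v = \<zero>"
proof
  assume "v \<in> carrier M" "(a - b) \<odot> v = \<zero>"
  thus "a \<odot> v = b \<odot> v" using smult_l_distr'[of v "a - b" b] by simp
qed (simp add: smult_diff M.minus_eq M.r_neg)

lemma submodule_iff: "submodule N UQ M \<longleftrightarrow> N \<subseteq> carrier M \<and> \<zero> \<in> N \<and>
    (\<forall>v\<in>N. \<forall>w\<in>N. v \<oplus> w \<in> N) \<and> (\<forall>a. \<forall>v\<in>N. a \<odot> v \<in> N)"
proof
  assume "submodule N UQ M"
  then interpret submodule N UQ M .
  show "N \<subseteq> carrier M \<and> \<zero> \<in> N \<and> (\<forall>v\<in>N. \<forall>w\<in>N. v \<oplus> w \<in> N) \<and> (\<forall>a. \<forall>v\<in>N. a \<odot> v \<in> N)"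
    using subset one_closed m_closed smult_closed by auto
next
  assume N: "N \<subseteq> carrier M \<and> \<zero> \<in> N \<and> (\<forall>v\<in>N. \<forall>w\<in>N. v \<oplus> w \<in> N) \<and> (\<forall>a. \<forall>v\<in>N. a \<odot> v \<in> N)"
  have "\<ominus> v \<in> N" if "v \<in> N" for v
    using N that smult_minus[of v 1] by (metis smult_one' subsetD)
  thus "submodule N UQ M"
    using N by (intro submodule.intro subgroup.intro submodule_axioms.intro)
      (auto simp: a_inv_def)
qed

lemma submoduleD:
  assumes "submodule N UQ M"
  shows "N \<subseteq> carrier M" "v \<in> N \<Longrightarrow> v \<in> carrier M" "\<zero> \<in> N" "v \<in> N \<Longrightarrow> w \<in> N \<Longrightarrow> v \<oplus> w \<in> N"
    "v \<in> N \<Longrightarrow> a \<odot> v \<in> N"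
  using iffD1[OF submodule_iff assms] by auto

lemma submodule_cyclic: "v \<in> carrier M \<Longrightarrow> submodule (range (\<lambda>a. a \<odot> v)) UQ M"
  unfolding submodule_iff
proof (intro conjI allI ballI)
  assume v: "v \<in> carrier M"
  show "\<zero> \<in> range (\<lambda>a. a \<odot> v)" using v by (auto intro!: image_eqI[of _ _ 0])
  show "x \<oplus> y \<in> range (\<lambda>a. a \<odot> v)" if "x \<in> range (\<lambda>a. a \<odot> v)" "y \<in> range (\<lambda>a. a \<odot> v)" for x y
    using that v by (auto simp flip: smult_l_distr')
  show "a \<odot> x \<in> range (\<lambda>a. a \<odot> v)" if "x \<in> range (\<lambda>a. a \<odot> v)" for a x
    using that v by (auto simp flip: smult_assoc')
qed auto

end

lemma UQ_module_iff: "UQ_module M \<longleftrightarrow> left_module UQ M"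
  by (simp add: UQ_module_def)

text \<open>The module axioms are only demanded modulo \<open>N\<close>. This covers quotients of
  modules as well as the tensor product, where the operators on the free abelian group are not
  additive in the scalar.\<close>

locale operator_quotient =
  fixes M :: "(uq, 'v) module" (structure) and N :: "'v set"
  assumes abelian_group: "abelian_group M"
    and subgroup: "subgroup N (add_monoid M)"
    and closed: "v \<in> carrier M \<Longrightarrow> a \<odot> v \<in> carrier M"
    and add: "v \<in> carrier M \<Longrightarrow> w \<in> carrier M \<Longrightarrow> a \<odot> (v \<oplus> w) = a \<odot> v \<oplus> a \<odot> w"
    and stable: "v \<in> N \<Longrightarrow> a \<odot> v \<in> N"
    and l_distr: "v \<in> carrier M \<Longrightarrow> N +> ((a + b) \<odot> v) = N +> (a \<odot> v \<oplus> b \<odot> v)"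
    and assoc: "v \<in> carrier M \<Longrightarrow> N +> ((a * b) \<odot> v) = N +> (a \<odot> (b \<odot> v))"
    and one: "v \<in> carrier M \<Longrightarrow> N +> (1 \<odot> v) = N +> v"
begin

sublocale N: abelian_subgroup N M
  using abelian_group subgroup by (intro abelian_subgroupI3 additive_subgroupI)

abbreviation Q where "Q \<equiv> quotient_module M N"

lemma coset_eqI: "x \<in> N +> y \<Longrightarrow> y \<in> carrier M \<Longrightarrow> N +> x = N +> y"
  using N.a_repr_independence[OF _ _ subgroup] by simp

lemma coset_self: "x \<in> carrier M \<Longrightarrow> x \<in> N +> x"
  using N.zero_closed by (force simp: a_r_coset_def')

lemma coset_eq_iff: "x \<in> carrier M \<Longrightarrow> y \<in> carrier M \<Longrightarrow> N +> x = N +> y \<longleftrightarrow> x \<ominus> y \<in> N"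
proof
  assume xy: "x \<in> carrier M" "y \<in> carrier M"
  show "x \<ominus> y \<in> N" if "N +> x = N +> y"
  proof -
    have "x \<in> N +> y" using coset_self xy that by auto
    then obtain n where "n \<in> N" "x = n \<oplus> y" by (auto simp: a_r_coset_def')
    moreover have "n \<in> carrier M" using \<open>n \<in> N\<close> N.a_subset by auto
    ultimately show ?thesis using xy by (simp add: N.minus_eq N.a_assoc N.r_neg)
  qed
  show "N +> x = N +> y" if "x \<ominus> y \<in> N"
  proof (rule coset_eqI)
    have "x = (x \<ominus> y) \<oplus> y" using xy by (simp add: N.minus_eq N.a_assoc N.l_neg)
    thus "x \<in> N +> y" using that by (force simp: a_r_coset_def')
  qed (rule xy)
qed

lemma carrier_Q: "carrier Q = (\<lambda>v. N +> v) ` carrier M"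
  by (auto simp: quotient_module_def A_RCOSETS_def')

lemma zero_Q: "\<zero>\<^bsub>Q\<^esub> = N"
  by (simp add: quotient_module_def)

lemma add_Q: "v \<in> carrier M \<Longrightarrow> w \<in> carrier M \<Longrightarrow> (N +> v) \<oplus>\<^bsub>Q\<^esub> (N +> w) = N +> (v \<oplus> w)"
  by (simp add: quotient_module_def N.a_rcos_sum)

lemma smult_Q: "v \<in> carrier M \<Longrightarrow> a \<odot>\<^bsub>Q\<^esub> (N +> v) = N +> (a \<odot> v)"
proof -
  assume v: "v \<in> carrier M"
  have "N +> (a \<odot> x) = N +> (a \<odot> v)" if "x \<in> N +> v" for x
  proof (rule coset_eqI)
    obtain n where n: "n \<in> N" "x = n \<oplus> v" using \<open>x \<in> N +> v\<close> by (auto simp: a_r_coset_def')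
    have "a \<odot> x = a \<odot> n \<oplus> a \<odot> v" using n v N.a_subset add by blast
    thus "a \<odot> x \<in> N +> (a \<odot> v)" using stable[OF n(1), of a] by (auto simp: a_r_coset_def')
  qed (use v closed in blast)
  hence "(\<Union>x\<in>N +> v. N +> (a \<odot> x)) = N +> (a \<odot> v)"
    using coset_self[OF v] by blast
  thus ?thesis by (simp add: quotient_module_def)
qed

lemma coset_zero: "N +> \<zero> = N"
  using N.a_coset_add_zero N.a_subset by blast

lemma coset_eq_zero_iff: "v \<in> carrier M \<Longrightarrow> N +> v = \<zero>\<^bsub>Q\<^esub> \<longleftrightarrow> v \<in> N"
  using coset_eq_iff[of v \<zero>] N.minus_equality[of \<zero> \<zero>]
  by (simp add: zero_Q coset_zero N.minus_eq)

lemma left_module_Q: "left_module UQ Q"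
proof (rule left_module_UQI)
  show "abelian_group Q"
  proof (rule abelian_groupI)
    fix v assume "v \<in> carrier Q"
    then obtain x where x: "x \<in> carrier M" "v = N +> x" by (auto simp: carrier_Q)
    have "\<zero>\<^bsub>Q\<^esub> = N +> \<zero>" by (simp add: zero_Q coset_zero)
    moreover have "(N +> \<ominus> x) \<oplus>\<^bsub>Q\<^esub> v = N +> \<zero>" "N +> \<ominus> x \<in> carrier Q"
      unfolding x(2) using x(1) by (simp add: add_Q N.l_neg, simp add: carrier_Q)
    ultimately show "\<zero>\<^bsub>Q\<^esub> \<oplus>\<^bsub>Q\<^esub> v = v" "\<exists>w\<in>carrier Q. w \<oplus>\<^bsub>Q\<^esub> v = \<zero>\<^bsub>Q\<^esub>"
      using x by (simp add: add_Q, metis)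
    fix w assume "w \<in> carrier Q"
    then obtain y where y: "y \<in> carrier M" "w = N +> y" by (auto simp: carrier_Q)
    show "v \<oplus>\<^bsub>Q\<^esub> w \<in> carrier Q" "v \<oplus>\<^bsub>Q\<^esub> w = w \<oplus>\<^bsub>Q\<^esub> v"
      using x y by (auto simp: add_Q carrier_Q N.a_comm)
    fix u assume "u \<in> carrier Q"
    then obtain z where z: "z \<in> carrier M" "u = N +> z" by (auto simp: carrier_Q)
    show "v \<oplus>\<^bsub>Q\<^esub> w \<oplus>\<^bsub>Q\<^esub> u = v \<oplus>\<^bsub>Q\<^esub> (w \<oplus>\<^bsub>Q\<^esub> u)"
      using x y z by (simp add: add_Q N.a_assoc)
  next
    show "\<zero>\<^bsub>Q\<^esub> \<in> carrier Q" using coset_zero by (auto simp: zero_Q carrier_Q)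
  qed
next
  fix a v assume "v \<in> carrier Q"
  then obtain x where x: "x \<in> carrier M" "v = N +> x" by (auto simp: carrier_Q)
  show "a \<odot>\<^bsub>Q\<^esub> v \<in> carrier Q" using x closed by (auto simp: smult_Q carrier_Q)
  show "1 \<odot>\<^bsub>Q\<^esub> v = v" using x one by (simp add: smult_Q)
  fix b
  show "(a + b) \<odot>\<^bsub>Q\<^esub> v = a \<odot>\<^bsub>Q\<^esub> v \<oplus>\<^bsub>Q\<^esub> b \<odot>\<^bsub>Q\<^esub> v"
    using x l_distr closed by (simp add: smult_Q add_Q)
  show "(a * b) \<odot>\<^bsub>Q\<^esub> v = a \<odot>\<^bsub>Q\<^esub> (b \<odot>\<^bsub>Q\<^esub> v)"
    using x assoc closed by (simp add: smult_Q)
next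
  fix a v w assume "v \<in> carrier Q" "w \<in> carrier Q"
  then obtain x y where "x \<in> carrier M" "v = N +> x" "y \<in> carrier M" "w = N +> y"
    by (auto simp: carrier_Q)
  thus "a \<odot>\<^bsub>Q\<^esub> (v \<oplus>\<^bsub>Q\<^esub> w) = a \<odot>\<^bsub>Q\<^esub> v \<oplus>\<^bsub>Q\<^esub> a \<odot>\<^bsub>Q\<^esub> w"
    using add closed by (simp add: smult_Q add_Q)
qed

end

section \<open>Irreducible quotients and cyclic modules\<close>

context UQ_module
begin

lemma operator_quotient: "submodule N UQ M \<Longrightarrow> operator_quotient M N"
proof -
  assume N: "submodule N UQ M"
  show ?thesis
    by (rule operator_quotient.intro)
      (auto simp: smult_l_distr' smult_r_distr' smult_assoc' M.abelian_group_axioms submoduleD[OF N]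
        intro: submodule.axioms N)
qed

text \<open>The correspondence between submodules of the quotient and submodules that contain
  \<open>N\<close>: irreducibility means that \<open>N\<close> is maximal among proper
  submodules.\<close>

lemma irreducible_quotient_iff:
  assumes N: "submodule N UQ M"
  shows "irreducible_module UQ (quotient_module M N) \<longleftrightarrow>
    N \<noteq> carrier M \<and> (\<forall>N'. submodule N' UQ M \<longrightarrow> N \<subseteq> N' \<longrightarrow> N' = N \<or> N' = carrier M)"
proof -
  interpret Q: operator_quotient M N by (rule operator_quotient[OF N])
  interpret QM: UQ_module Q.Q by (simp add: UQ_module_iff Q.left_module_Q)
  have N': "N \<subseteq> carrier M" by (rule submoduleD(1)[OF N])
  have coset: "N +> v \<in> (\<lambda>v. N +> v) ` S \<longleftrightarrow> v \<in> S"
    if "submodule S UQ M" "N \<subseteq> S" "v \<in> carrier M" for S v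
  proof
    assume "N +> v \<in> (\<lambda>v. N +> v) ` S"
    then obtain s where s: "s \<in> S" "N +> v = N +> s" by blast
    have "s \<in> carrier M" using submoduleD(2)[OF that(1) s(1)] .
    hence "v \<ominus> s \<in> N" using Q.coset_eq_iff that s by blast
    hence "(v \<ominus> s) \<oplus> s \<in> S" using submoduleD(4)[OF that(1)] that(2) s(1) by blast
    moreover have "(v \<ominus> s) \<oplus> s = v"
      using \<open>s \<in> carrier M\<close> that by (simp add: M.minus_eq M.a_assoc M.l_neg)
    ultimately show "v \<in> S" by simp
  qed blast
  have trivial: "carrier Q.Q = {\<zero>\<^bsub>Q.Q\<^esub>} \<longleftrightarrow> N = carrier M"
  proof
    assume "carrier Q.Q = {\<zero>\<^bsub>Q.Q\<^esub>}"
    hence "N +> v = \<zero>\<^bsub>Q.Q\<^esub>" if "v \<in> carrier M" for v using that by (auto simp: Q.carrier_Q)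
    thus "N = carrier M" using Q.coset_eq_zero_iff N' by blast
  next
    assume N_eq: "N = carrier M"
    have "N +> v = \<zero>\<^bsub>Q.Q\<^esub>" if "v \<in> carrier M" for v
      using Q.coset_eq_zero_iff[OF that] N_eq that by blast
    thus "carrier Q.Q = {\<zero>\<^bsub>Q.Q\<^esub>}"
      unfolding Q.carrier_Q by (auto simp del: Q.coset_zero intro!: image_eqI[of _ _ \<zero>])
  qed
  show ?thesis
  proof
    assume irr: "irreducible_module UQ Q.Q"
    show "N \<noteq> carrier M \<and> (\<forall>N'. submodule N' UQ M \<longrightarrow> N \<subseteq> N' \<longrightarrow> N' = N \<or> N' = carrier M)"
    proof (intro conjI allI impI)
      show "N \<noteq> carrier M" using irr trivial by (simp add: irreducible_module_def)
      fix S assume S: "submodule S UQ M" "N \<subseteq> S"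
      have Sc: "S \<subseteq> carrier M" by (rule submoduleD(1)[OF S(1)])
      have "submodule ((\<lambda>v. N +> v) ` S) UQ Q.Q"
        unfolding QM.submodule_iff
      proof (intro conjI allI ballI)
        show "(\<lambda>v. N +> v) ` S \<subseteq> carrier Q.Q" using Sc by (auto simp: Q.carrier_Q)
        show "\<zero>\<^bsub>Q.Q\<^esub> \<in> (\<lambda>v. N +> v) ` S"
          using submoduleD(3)[OF S(1)] Q.coset_zero
            by (auto simp: Q.zero_Q intro!: image_eqI[of _ _ \<zero>])
        show "x \<oplus>\<^bsub>Q.Q\<^esub> y \<in> (\<lambda>v. N +> v) ` S" if "x \<in> (\<lambda>v. N +> v) ` S"
            "y \<in> (\<lambda>v. N +> v) ` S" for x y
          using that submoduleD(2,4)[OF S(1)] by (auto simp: Q.add_Q)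
        show "a \<odot>\<^bsub>Q.Q\<^esub> x \<in> (\<lambda>v. N +> v) ` S" if "x \<in> (\<lambda>v. N +> v) ` S" for a x
          using that submoduleD(2,5)[OF S(1)] by (auto simp: Q.smult_Q)
      qed
      hence "(\<lambda>v. N +> v) ` S = {\<zero>\<^bsub>Q.Q\<^esub>} \<or> (\<lambda>v. N +> v) ` S = carrier Q.Q"
        using irr by (simp add: irreducible_module_def)
      thus "S = N \<or> S = carrier M"
      proof
        assume "(\<lambda>v. N +> v) ` S = {\<zero>\<^bsub>Q.Q\<^esub>}"
        hence "N +> x = \<zero>\<^bsub>Q.Q\<^esub>" if "x \<in> S" for x using that by blast
        hence "S \<subseteq> N" using Q.coset_eq_zero_iff Sc by (meson subsetD subsetI)
        thus ?thesis using S by blast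
      next
        assume "(\<lambda>v. N +> v) ` S = carrier Q.Q"
        hence "carrier M \<subseteq> S" using coset[OF S] by (auto simp: Q.carrier_Q)
        thus ?thesis using Sc by blast
      qed
    qed
  next
    assume max: "N \<noteq> carrier M \<and> (\<forall>N'. submodule N' UQ M \<longrightarrow> N \<subseteq> N' \<longrightarrow> N' = N \<or> N' = carrier M)"
    show "irreducible_module UQ Q.Q"
      unfolding irreducible_module_def
    proof (intro conjI allI impI)
      show "left_module UQ Q.Q" by (rule Q.left_module_Q)
      show "carrier Q.Q \<noteq> {\<zero>\<^bsub>Q.Q\<^esub>}" using max trivial by simp
      fix T assume T: "submodule T UQ Q.Q"
      let ?S = "{v \<in> carrier M. N +> v \<in> T}"
      have T': "T \<subseteq> carrier Q.Q" "\<zero>\<^bsub>Q.Q\<^esub> \<in> T" using QM.submoduleD[OF T] by blast+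
      have "submodule ?S UQ M"
        unfolding submodule_iff
      proof (intro conjI allI ballI)
        show "\<zero> \<in> ?S" using T' by (simp add: Q.coset_zero Q.zero_Q)
        show "x \<oplus> y \<in> ?S" if "x \<in> ?S" "y \<in> ?S" for x y
        proof -
          have "(N +> x) \<oplus>\<^bsub>Q.Q\<^esub> (N +> y) \<in> T" using that QM.submoduleD(4,5)[OF T] by blast
          thus ?thesis using that by (simp add: Q.add_Q)
        qed
        show "a \<odot> x \<in> ?S" if "x \<in> ?S" for a x
        proof -
          have "a \<odot>\<^bsub>Q.Q\<^esub> (N +> x) \<in> T" using that QM.submoduleD(4,5)[OF T] by blast
          thus ?thesis using that by (simp add: Q.smult_Q)
        qed
      qed blast
      moreover have "N \<subseteq> ?S"
      proof
        fix x assume x: "x \<in> N"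
        hence "N +> x = \<zero>\<^bsub>Q.Q\<^esub>" using N' Q.coset_eq_zero_iff by blast
        thus "x \<in> ?S" using T' N' x by auto
      qed
      ultimately consider "?S = N" | "?S = carrier M" using max by blast
      thus "T = {\<zero>\<^bsub>Q.Q\<^esub>} \<or> T = carrier Q.Q"
      proof cases
        case 1
        have "t = \<zero>\<^bsub>Q.Q\<^esub>" if t: "t \<in> T" for t
        proof -
          obtain v where v: "v \<in> carrier M" "t = N +> v" using t T' by (auto simp: Q.carrier_Q)
          hence "v \<in> N" using 1 t by blast
          thus ?thesis using v Q.coset_eq_zero_iff by blast
        qed
        thus ?thesis using T' by blast
      next
        case 2
        hence "carrier Q.Q \<subseteq> T" by (auto simp: Q.carrier_Q)
        thus ?thesis using T' by blast
      qed
    qed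
  qed
qed

lemma irreducible_generated:
  assumes "irreducible_module UQ M" "v \<in> carrier M" "v \<noteq> \<zero>" "w \<in> carrier M"
  shows "\<exists>x. w = x \<odot> v"
proof -
  have "v \<in> range (\<lambda>a. a \<odot> v)" using assms(2) by (auto intro!: image_eqI[of _ _ 1])
  hence "range (\<lambda>a. a \<odot> v) = carrier M"
    using submodule_cyclic[OF assms(2)] assms(1,3) by (auto simp: irreducible_module_def)
  thus ?thesis using assms(4) by auto
qed

end

text \<open>The map sending x v to x v' is well defined and injective because the two generators
  have the same annihilator; the choice of x in its definition is therefore immaterial.\<close>

lemma isomorphic_cyclic_modules:
  assumes "left_module UQ V" "left_module UQ V'" and v: "v \<in> carrier V" "v' \<in> carrier V'"
    and gen: "\<And>w. w \<in> carrier V \<Longrightarrow> \<exists>x. w = x \<odot>\<^bsub>V\<^esub> v"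
    and gen': "\<And>w. w \<in> carrier V' \<Longrightarrow> \<exists>x. w = x \<odot>\<^bsub>V'\<^esub> v'"
    and ann: "\<And>x. x \<odot>\<^bsub>V\<^esub> v = \<zero>\<^bsub>V\<^esub> \<longleftrightarrow> x \<odot>\<^bsub>V'\<^esub> v' = \<zero>\<^bsub>V'\<^esub>"
  shows "isomorphic_modules UQ V V'"
proof -
  interpret V: UQ_module V using assms by (simp add: UQ_module_iff)
  interpret V': UQ_module V' using assms by (simp add: UQ_module_iff)
  define f where "f w = (SOME x. w = x \<odot>\<^bsub>V\<^esub> v) \<odot>\<^bsub>V'\<^esub> v'" for w
  have eq: "a \<odot>\<^bsub>V\<^esub> v = b \<odot>\<^bsub>V\<^esub> v \<longleftrightarrow> a \<odot>\<^bsub>V'\<^esub> v' = b \<odot>\<^bsub>V'\<^esub> v'" for a b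
    using V.smult_eq_iff[OF v(1)] V'.smult_eq_iff[OF v(2)] ann by simp
  have f: "f (x \<odot>\<^bsub>V\<^esub> v) = x \<odot>\<^bsub>V'\<^esub> v'" for x
    unfolding f_def by (rule someI2[of _ x]) (auto simp: eq)
  have "f \<in> iso (add_monoid V) (add_monoid V')"
  proof (rule isoI)
    show "f \<in> hom (add_monoid V) (add_monoid V')"
    proof (rule homI)
      fix x y assume "x \<in> carrier (add_monoid V)" "y \<in> carrier (add_monoid V)"
      then obtain a b where "x = a \<odot>\<^bsub>V\<^esub> v" "y = b \<odot>\<^bsub>V\<^esub> v" using gen by auto blast
      thus "f (x \<otimes>\<^bsub>add_monoid V\<^esub> y) = f x \<otimes>\<^bsub>add_monoid V'\<^esub> f y"
        using v by (simp add: f V'.smult_l_distr' flip: V.smult_l_distr')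
    next
      fix x assume "x \<in> carrier (add_monoid V)"
      then obtain a where "x = a \<odot>\<^bsub>V\<^esub> v" using gen by auto
      thus "f x \<in> carrier (add_monoid V')" using v by (simp add: f)
    qed
    have "inj_on f (carrier V)"
    proof (rule inj_onI)
      fix x y assume "x \<in> carrier V" "y \<in> carrier V" "f x = f y"
      moreover then obtain a b where "x = a \<odot>\<^bsub>V\<^esub> v" "y = b \<odot>\<^bsub>V\<^esub> v" using gen by blast
      ultimately show "x = y" by (simp add: f eq)
    qed
    moreover have "f ` carrier V = carrier V'"
    proof (intro equalityI subsetI)
      fix x assume "x \<in> carrier V'"
      then obtain a where "x = a \<odot>\<^bsub>V'\<^esub> v'" using gen' by blast
      thus "x \<in> f ` carrier V" using v by (auto simp flip: f)
    next
      fix x assume "x \<in> f ` carrier V"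
      then obtain w where w: "w \<in> carrier V" "x = f w" by blast
      then obtain a where "w = a \<odot>\<^bsub>V\<^esub> v" using gen by blast
      thus "x \<in> carrier V'" using w v by (simp add: f)
    qed
    ultimately show "bij_betw f (carrier (add_monoid V)) (carrier (add_monoid V'))"
      by (simp add: bij_betw_def)
  qed
  moreover have "f (a \<odot>\<^bsub>V\<^esub> w) = a \<odot>\<^bsub>V'\<^esub> f w" if w: "w \<in> carrier V" for a w
  proof -
    obtain b where b: "w = b \<odot>\<^bsub>V\<^esub> v" using gen w by blast
    show ?thesis unfolding b using v by (simp add: f flip: V.smult_assoc' V'.smult_assoc')
  qed
  ultimately show ?thesis unfolding isomorphic_modules_def by auto
qed

section \<open>Highest weight vectors and largest proper submodules\<close>

locale hw_vector = UQ_module M for M :: "(uq, 'v) module" (structure) +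
  fixes v :: 'v and m :: int
  assumes v_closed [simp, intro]: "v \<in> carrier M"
    and hw: "j \<in> hw_ideal m \<Longrightarrow> j \<odot> v = \<zero>"
begin

lemma hw_eq: "x - y \<in> hw_ideal m \<Longrightarrow> x \<odot> v = y \<odot> v"
  using hw smult_eq_iff by simp

end

text \<open>\<open>top_field\<close> says that every nonzero vector of the top space
  \<open>UQ0\<close> v leads back to v, and \<open>top_proper\<close> that v itself is not reached
  from below. No direct sum of weight spaces is assumed.\<close>

locale hw_cyclic = hw_vector +
  assumes gen: "w \<in> carrier M \<Longrightarrow> \<exists>x. w = x \<odot> v"
    and top_field: "y \<in> UQ0 \<Longrightarrow> y \<odot> v \<noteq> \<zero> \<Longrightarrow> \<exists>y'\<in>UQ0. (y' * y) \<odot> v = v"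
    and top_proper: "p \<in> xm_span \<Longrightarrow> p \<odot> v \<noteq> v"
begin

text \<open>The vectors whose whole orbit stays below the top; the union of all submodules that
  avoid v.\<close>

definition max_submodule :: "'a set" where
  "max_submodule = {w \<in> carrier M. \<forall>x. \<exists>p\<in>xm_span. x \<odot> w = p \<odot> v}"

lemma submodule_max: "submodule max_submodule UQ M"
  unfolding submodule_iff
proof (intro conjI allI ballI)
  show "max_submodule \<subseteq> carrier M" by (auto simp: max_submodule_def)
  have "\<exists>p\<in>xm_span. x \<odot> \<zero> = p \<odot> v" for x
    by (rule bexI[OF _ xm_span.zero]) simp
  thus "\<zero> \<in> max_submodule" by (simp add: max_submodule_def)
next
  fix w w' assume w: "w \<in> max_submodule" "w' \<in> max_submodule"
  have "\<exists>p\<in>xm_span. x \<odot> (w \<oplus> w') = p \<odot> v" for x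
  proof -
    obtain p p' where "p \<in> xm_span" "p' \<in> xm_span" "x \<odot> w = p \<odot> v" "x \<odot> w' = p' \<odot> v"
      using w unfolding max_submodule_def by blast
    moreover have "w \<in> carrier M" "w' \<in> carrier M" using w by (simp_all add: max_submodule_def)
    ultimately have "p + p' \<in> xm_span" "x \<odot> (w \<oplus> w') = (p + p') \<odot> v"
      by (simp_all add: smult_r_distr' smult_l_distr' xm_span.add)
    thus ?thesis by blast
  qed
  thus "w \<oplus> w' \<in> max_submodule" using w by (auto simp: max_submodule_def)
next
  fix a w assume w: "w \<in> max_submodule"
  hence "\<exists>p\<in>xm_span. (x * a) \<odot> w = p \<odot> v" for x
    unfolding max_submodule_def by blast
  hence "\<exists>p\<in>xm_span. x \<odot> (a \<odot> w) = p \<odot> v" for x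
    using w by (simp add: max_submodule_def smult_assoc')
  thus "a \<odot> w \<in> max_submodule" using w by (auto simp: max_submodule_def)
qed

lemma v_notin_max: "v \<notin> max_submodule"
proof
  assume "v \<in> max_submodule"
  hence "\<exists>p\<in>xm_span. 1 \<odot> v = p \<odot> v" unfolding max_submodule_def by blast
  thus False using top_proper by (metis smult_one' v_closed)
qed

text \<open>Write x w = z v. The top component y of z satisfies y v = \<kappa> x w, which lies in N.
  Were it nonzero, \<open>top_field\<close> would bring v into N; so it vanishes and x w is a lower
  vector.\<close>

lemma subset_max:
  assumes N: "submodule N UQ M" and "v \<notin> N"
  shows "N \<subseteq> max_submodule"
proof
  fix w assume w: "w \<in> N"
  have wc: "w \<in> carrier M" by (rule submoduleD(2)[OF N w])
  have "\<exists>p\<in>xm_span. x \<odot> w = p \<odot> v" for x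
  proof -
    obtain z where z: "x \<odot> w = z \<odot> v" using gen wc by blast
    obtain \<kappa> y p where y: "y \<in> UQ0" "p \<in> xm_span" "z - y - p \<in> hw_ideal m" "\<kappa> * z - y \<in> hw_ideal m"
      using top_component by blast
    have "y \<odot> v = \<kappa> \<odot> (x \<odot> w)" using hw_eq[OF y(4)] by (simp add: z smult_assoc')
    hence yN: "y \<odot> v \<in> N" using submoduleD(5)[OF N] w by simp
    have "y \<odot> v = \<zero>"
    proof (rule ccontr)
      assume "y \<odot> v \<noteq> \<zero>"
      then obtain y' where "(y' * y) \<odot> v = v" using top_field y by blast
      hence "v = y' \<odot> (y \<odot> v)" by (simp add: smult_assoc')
      hence "v \<in> N" using submoduleD(5)[OF N yN, of y'] by simp
      thus False using \<open>v \<notin> N\<close> by simp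
    qed
    moreover have "z \<odot> v = (y + p) \<odot> v" using y by (intro hw_eq) (simp add: diff_diff_eq)
    ultimately show ?thesis using y z by (auto simp: smult_l_distr')
  qed
  thus "w \<in> max_submodule" using wc by (simp add: max_submodule_def)
qed

lemma submodule_v: "submodule N UQ M \<Longrightarrow> v \<in> N \<Longrightarrow> N = carrier M"
  using gen submoduleD(1,5) by (metis subsetI subset_antisym)

lemma unique_irreducible_quotient:
  "submodule N UQ M \<and> irreducible_module UQ (quotient_module M N) \<longleftrightarrow> N = max_submodule"
proof (cases "submodule N UQ M")
  case True
  have "N \<noteq> carrier M \<and> (\<forall>N'. submodule N' UQ M \<longrightarrow> N \<subseteq> N' \<longrightarrow> N' = N \<or> N' = carrier M)
    \<longleftrightarrow> N = max_submodule"
    using subset_max submodule_v submodule_max v_notin_max True v_closed by blast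
  thus ?thesis using irreducible_quotient_iff[OF True] True by simp
next
  case False
  thus ?thesis using submodule_max by blast
qed

text \<open>Passing to the irreducible quotient loses nothing of the top space, so the annihilator
  in \<open>UQ0\<close> is unchanged.\<close>

lemma UQ0_max:
  assumes "y \<in> UQ0"
  shows "y \<odot> v \<in> max_submodule \<longleftrightarrow> y \<odot> v = \<zero>"
proof
  assume y: "y \<odot> v \<in> max_submodule"
  show "y \<odot> v = \<zero>"
  proof (rule ccontr)
    assume "y \<odot> v \<noteq> \<zero>"
    then obtain y' where "(y' * y) \<odot> v = v" using top_field assms by blast
    hence "v = y' \<odot> (y \<odot> v)" by (simp add: smult_assoc')
    thus False using submoduleD(5)[OF submodule_max y, of y'] v_notin_max by simp
  qed
qed (simp add: submoduleD[OF submodule_max])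

end

text \<open>Suppose x kills w but not w', and let z x w' = w'. The top component y of z x kills w,
  hence also w' by the assumption on \<open>UQ0\<close>; but y w' = \<kappa> w' = w'. By symmetry
  the full annihilators agree.\<close>

lemma irreducible_hw_isomorphic:
  assumes V: "hw_vector V v m" "irreducible_module UQ V" "v \<noteq> \<zero>\<^bsub>V\<^esub>"
    and V': "hw_vector V' v' m" "irreducible_module UQ V'" "v' \<noteq> \<zero>\<^bsub>V'\<^esub>"
    and top: "\<And>y. y \<in> UQ0 \<Longrightarrow> y \<odot>\<^bsub>V\<^esub> v = \<zero>\<^bsub>V\<^esub> \<longleftrightarrow> y \<odot>\<^bsub>V'\<^esub> v' = \<zero>\<^bsub>V'\<^esub>"
  shows "isomorphic_modules UQ V V'"
proof -
  have ann: "x \<odot>\<^bsub>W'\<^esub> w' = \<zero>\<^bsub>W'\<^esub>" if W: "hw_vector W w m"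
    and W': "hw_vector W' w' m" "irreducible_module UQ W'" "w' \<noteq> \<zero>\<^bsub>W'\<^esub>"
    and top: "\<And>y. y \<in> UQ0 \<Longrightarrow> y \<odot>\<^bsub>W\<^esub> w = \<zero>\<^bsub>W\<^esub> \<longleftrightarrow> y \<odot>\<^bsub>W'\<^esub> w' = \<zero>\<^bsub>W'\<^esub>"
    and x: "x \<odot>\<^bsub>W\<^esub> w = \<zero>\<^bsub>W\<^esub>"
    for W :: "(uq, 'c) module" and W' :: "(uq, 'd) module" and w w' x
  proof (rule ccontr)
    interpret W: hw_vector W w m by fact
    interpret W': hw_vector W' w' m by fact
    assume "x \<odot>\<^bsub>W'\<^esub> w' \<noteq> \<zero>\<^bsub>W'\<^esub>"
    then obtain z where z: "w' = z \<odot>\<^bsub>W'\<^esub> (x \<odot>\<^bsub>W'\<^esub> w')"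
      using W'.irreducible_generated[OF W'(2)] by blast
    obtain \<kappa> y where y: "y \<in> UQ0" "\<kappa> * (z * x) - y \<in> hw_ideal m" "\<kappa> - 1 \<in> hw_ideal m"
      using top_component by blast
    have "y \<odot>\<^bsub>W\<^esub> w = \<zero>\<^bsub>W\<^esub>"
      using W.hw_eq[OF y(2)] x by (simp add: W.smult_assoc')
    hence "y \<odot>\<^bsub>W'\<^esub> w' = \<zero>\<^bsub>W'\<^esub>" using top y by blast
    moreover have "y \<odot>\<^bsub>W'\<^esub> w' = \<kappa> \<odot>\<^bsub>W'\<^esub> w'"
      using W'.hw_eq[OF y(2)] z by (simp add: W'.smult_assoc')
    moreover have "\<kappa> \<odot>\<^bsub>W'\<^esub> w' = w'" using W'.hw_eq[OF y(3)] by simp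
    ultimately show False using W'(3) by simp
  qed
  interpret V: hw_vector V v m by fact
  interpret V': hw_vector V' v' m by fact
  show ?thesis
  proof (rule isomorphic_cyclic_modules)
    show "left_module UQ V" "left_module UQ V'"
      using assms by (auto simp: irreducible_module_def)
    show "\<exists>x. w = x \<odot>\<^bsub>V\<^esub> v" if "w \<in> carrier V" for w
      using V.irreducible_generated[OF V(2) V.v_closed V(3) that] .
    show "\<exists>x. w = x \<odot>\<^bsub>V'\<^esub> v'" if "w \<in> carrier V'" for w
      using V'.irreducible_generated[OF V'(2) V'.v_closed V'(3) that] .
    show "x \<odot>\<^bsub>V\<^esub> v = \<zero>\<^bsub>V\<^esub> \<longleftrightarrow> x \<odot>\<^bsub>V'\<^esub> v' = \<zero>\<^bsub>V'\<^esub>" for x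
      using ann[OF V(1) V' top] ann[OF V'(1) V top[symmetric]] by blast
  qed auto
qed

section \<open>The module of functions on subsets\<close>

lemma sum_antisym_eq_0:
  fixes G :: "'i \<Rightarrow> 'i \<Rightarrow> 'a::field_char_0"
  assumes "finite A" and anti: "\<And>i k. i \<in> A \<Longrightarrow> k \<in> A \<Longrightarrow> i \<noteq> k \<Longrightarrow> G i k + G k i = 0"
  shows "(\<Sum>i\<in>A. \<Sum>k\<in>A - {i}. G i k) = 0"
proof -
  let ?H = "\<lambda>i k. if i = k then 0 else G i k"
  have "(\<Sum>k\<in>A - {i}. G i k) = (\<Sum>k\<in>A. ?H i k)" if "i \<in> A" for i
    using assms(1) that by (intro sum.mono_neutral_cong_left) auto
  hence eq: "(\<Sum>i\<in>A. \<Sum>k\<in>A - {i}. G i k) = (\<Sum>i\<in>A. \<Sum>k\<in>A. ?H i k)" by simp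
  have "(\<Sum>i\<in>A. \<Sum>k\<in>A. ?H i k) + (\<Sum>i\<in>A. \<Sum>k\<in>A. ?H i k)
      = (\<Sum>i\<in>A. \<Sum>k\<in>A. ?H i k) + (\<Sum>i\<in>A. \<Sum>k\<in>A. ?H k i)"
    by (subst (2) sum.swap) simp
  also have "\<dots> = (\<Sum>i\<in>A. \<Sum>k\<in>A. ?H i k + ?H k i)" by (simp add: sum.distrib)
  also have "\<dots> = 0" by (intro sum.neutral ballI) (auto simp: anti)
  finally show ?thesis unfolding eq by (simp flip: mult_2)
qed

locale Kq_field = Kq_scalars s for s :: "Kq \<Rightarrow> 'a::field_char_0"
begin

abbreviation Q where "Q \<equiv> s q"

lemma s_zero [simp]: "s 0 = 0"
  using s_add[of 0 0] by simp

lemma s_minus: "s (- a) = - s a"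
  using s_add[of "- a" a] by (simp add: eq_neg_iff_add_eq_0)

lemma s_diff: "s (a - b) = s a - s b"
  using s_add[of a "- b"] by (simp add: s_minus)

lemma s_inverse: "s (inverse a) = inverse (s a)"
proof (cases "a = 0")
  case False
  hence "s (inverse a) * s a = 1" by (simp flip: s_mult add: s_one)
  thus ?thesis by (metis inverse_unique mult.commute)
qed simp

lemma s_divide: "s (a / b) = s a / s b"
  by (simp add: divide_inverse s_mult s_inverse)

lemma s_of_int: "s (of_int n) = of_int n"
  by (cases n) (simp_all add: s_of_nat s_minus s_diff s_one)

lemma s_power: "s (a ^ n) = s a ^ n"
  by (induction n) (simp_all add: s_mult s_one)

lemma s_powi: "s (a powi n) = s a powi n"
  by (simp add: power_int_def s_power s_inverse)

lemma s_eq_0_iff [simp]: "s a = 0 \<longleftrightarrow> a = 0"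
proof
  assume "s a = 0"
  show "a = 0"
  proof (rule ccontr)
    assume "a \<noteq> 0"
    hence "s a * s (inverse a) = 1" by (simp flip: s_mult add: s_one)
    thus False using \<open>s a = 0\<close> by simp
  qed
qed simp

lemma Q_diff_nonzero [simp]: "Q - inverse Q \<noteq> 0"
proof
  assume "Q - inverse Q = 0"
  hence "s (q - inverse q) = 0" by (simp only: s_diff s_inverse)
  thus False using s_eq_0_iff q_diff_nonzero by blast
qed

lemma Q_neq_inverse [simp]: "Q \<noteq> inverse Q" "inverse Q \<noteq> Q"
  using Q_diff_nonzero by (metis right_minus_eq)+

lemma s_qint: "s (qint n) = (Q powi n - Q powi (- n)) / (Q - inverse Q)"
  by (simp add: qint_def s_divide s_diff s_inverse s_powi)

definition geom :: "'a \<Rightarrow> 'a fps" where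
  "geom c = Abs_fps (\<lambda>n. c ^ n)"

lemma geom_nth [simp]: "fps_nth (geom c) n = c ^ n"
  by (simp add: geom_def)

lemma geom_mult: "geom c * (1 - fps_const c * fps_X) = 1"
proof (rule fps_ext)
  fix n show "fps_nth (geom c * (1 - fps_const c * fps_X)) n = fps_nth 1 n"
    by (cases n) (simp_all add: right_diff_distrib mult.assoc[symmetric] mult.commute[of _
      "fps_const c"])
qed

lemma alg_exp_neg_log_geom: "alg_exp s (neg_log c) = geom c"
proof -
  have "alg_exp s (neg_log c) = alg_exp s (neg_log c) * (geom c * (1 - fps_const c * fps_X))"
    by (simp add: geom_mult)
  also have "\<dots> = geom c * (alg_exp s (neg_log c) * (1 - fps_const c * fps_X))"
    by (simp only: ac_simps)
  finally show ?thesis by (simp add: alg_exp_neg_log)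
qed

lemma geom_relation:
  "fps_const (a - b) * (geom a * geom b) = fps_const a * geom a - fps_const b * geom b"
proof -
  have "fps_const a * geom a - fps_const b * geom b
    = fps_const a * geom a * (geom b * (1 - fps_const b * fps_X))
      - fps_const b * geom b * (geom a * (1 - fps_const a * fps_X))"
    by (simp only: geom_mult mult_1_right)
  also have "\<dots> = (fps_const a - fps_const b) * (geom a * geom b)"
    by (simp only: algebra_simps mult_1_left mult_1_right)
  finally show ?thesis by (simp only: fps_const_sub)
qed

text \<open>The exponential is the product of (1 - (\<beta> j / \<alpha> j) z j u) / (1 - z j u).
  Multiplied by the product of the \<alpha> j it is expanded by \<open>partial_fractions\<close>
  with \<open>e j = geom (z j)\<close>, that is with w = 1/u; the constant of the expansion only
  affects degree 0.\<close>

lemma exp_partial_fractions: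
  assumes "finite N" "inj_on z N" and \<alpha>: "\<And>j. j \<in> N \<Longrightarrow> \<alpha> j \<noteq> 0"
    and f: "\<And>n. fps_nth f n = (if n = 0 then 0 else
      (\<Sum>j\<in>N. (1 - (\<beta> j / \<alpha> j) ^ n) * z j ^ n / of_nat n))"
  shows "(\<Prod>j\<in>N. \<alpha> j) * fps_nth (alg_exp s f) n =
    (if n = 0 then \<Prod>j\<in>N. \<beta> j else 0) + (\<Sum>i\<in>N. pf_residue z \<alpha> \<beta> N i * z i ^ n)"
proof -
  have "f = (\<Sum>j\<in>N. neg_log (z j) + - neg_log (\<beta> j / \<alpha> j * z j))"
  proof (rule fps_ext)
    fix n
    show "fps_nth f n = fps_nth (\<Sum>j\<in>N. neg_log (z j) + - neg_log (\<beta> j / \<alpha> j * z j)) n"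
      by (auto simp: f fps_sum_nth neg_log_def s_divide s_one s_of_nat field_simps
        power_mult_distrib
          intro!: sum.cong)
  qed
  hence "alg_exp s f = (\<Prod>j\<in>N. geom (z j) * (1 - fps_const (\<beta> j / \<alpha> j * z j) * fps_X))"
    by (simp only: alg_exp_sum alg_exp_add fps_neg_nth fps_add_nth neg_log_nth_0 minus_zero add_0
        alg_exp_minus_neg_log alg_exp_neg_log_geom)
  hence "(\<Prod>j\<in>N. fps_const (\<alpha> j)) * alg_exp s f
    = (\<Prod>j\<in>N. fps_const (\<alpha> j) * (geom (z j) * (1 - fps_const (\<beta> j / \<alpha> j * z j) * fps_X)))"
    by (simp add: prod.distrib)
  also have "\<dots> = (\<Prod>j\<in>N. fps_const (\<beta> j) + fps_const (\<alpha> j - \<beta> j) * geom (z j))"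
  proof (rule prod.cong[OF refl])
    fix j assume "j \<in> N"
    have "fps_const (\<alpha> j) * (geom (z j) * (1 - fps_const (\<beta> j / \<alpha> j * z j) * fps_X))
      = geom (z j) * (fps_const (\<alpha> j) - fps_const (\<alpha> j) * fps_const (\<beta> j / \<alpha> j * z j) * fps_X)"
      by (simp only: algebra_simps mult_1_left mult_1_right)
    also have "fps_const (\<alpha> j) * fps_const (\<beta> j / \<alpha> j * z j) = fps_const (\<beta> j) * fps_const (z j)"
      using \<alpha>[OF \<open>j \<in> N\<close>] by simp
    also have "geom (z j) * (fps_const (\<alpha> j) - fps_const (\<beta> j) * fps_const (z j) * fps_X)
      = fps_const (\<beta> j) * (geom (z j) * (1 - fps_const (z j) * fps_X))
        + (fps_const (\<alpha> j) - fps_const (\<beta> j)) * geom (z j)"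
      by (simp only: algebra_simps mult_1_left mult_1_right)
    finally show "fps_const (\<alpha> j) * (geom (z j) * (1 - fps_const (\<beta> j / \<alpha> j * z j) * fps_X))
      = fps_const (\<beta> j) + fps_const (\<alpha> j - \<beta> j) * geom (z j)"
      by (simp add: geom_mult)
  qed
  also have "\<dots> = fps_const (\<Prod>j\<in>N. \<beta> j) + (\<Sum>i\<in>N. fps_const (pf_residue z \<alpha> \<beta> N i) * geom (z i))"
    by (rule partial_fractions) (use assms geom_relation in auto)
  finally have "(\<Prod>j\<in>N. fps_const (\<alpha> j)) * alg_exp s f
    = fps_const (\<Prod>j\<in>N. \<beta> j) + (\<Sum>i\<in>N. fps_const (pf_residue z \<alpha> \<beta> N i) * geom (z i))" .
  moreover have "(\<Prod>j\<in>N. fps_const (\<alpha> j)) = fps_const (\<Prod>j\<in>N. \<alpha> j)"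
    by (induction N rule: infinite_finite_induct) (simp_all flip: fps_const_mult)
  ultimately have "fps_nth (fps_const (\<Prod>j\<in>N. \<alpha> j) * alg_exp s f) n
    = fps_nth (fps_const (\<Prod>j\<in>N. \<beta> j) + (\<Sum>i\<in>N. fps_const (pf_residue z \<alpha> \<beta> N i) * geom (z i))) n"
    by simp
  thus ?thesis by (simp add: fps_sum_nth)
qed

end

text \<open>The tensor product of the two-dimensional evaluation modules with parameters \<open>z i\<close>, in a basis
  of common eigenvectors of the \<open>h r\<close> indexed by the subsets \<open>J\<close> of \<open>N\<close>; the factors in \<open>J\<close> are in
  their lower state. A vector is given by its coordinate function.\<close>

locale subset_module = Kq_field s for s :: "Kq \<Rightarrow> 'a::field_char_0" +
  fixes N :: "'i set" and z :: "'i \<Rightarrow> 'a"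
  assumes fin [simp]: "finite N" and inj: "inj_on z N" and z_nonzero: "i \<in> N \<Longrightarrow> z i \<noteq> 0"
begin

lemma z_distinct: "i \<in> N \<Longrightarrow> j \<in> N \<Longrightarrow> i \<noteq> j \<Longrightarrow> z i \<noteq> z j"
  using inj by (auto simp: inj_on_def)

definition pair_factor :: "'a \<Rightarrow> 'i \<Rightarrow> 'i \<Rightarrow> 'a" where
  "pair_factor t i j = (t * z i - inverse t * z j) / (z i - z j)"

lemma pair_factor_swap: "pair_factor (inverse t) i j = pair_factor t j i"
proof -
  have "pair_factor (inverse t) i j = - (t * z j - inverse t * z i) / - (z j - z i)"
    by (simp add: pair_factor_def)
  thus ?thesis by (simp only: minus_divide_divide pair_factor_def)
qed

text \<open>Acts on coordinate functions, so the value at J collects the basis vectors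
  \<open>J - {i}\<close> in which the factor i is not yet lowered. The parameter t lets one
  computation serve for raising and lowering. J ranges over arbitrary sets, whence the intersections
  with \<open>N\<close>.\<close>

definition lower_op :: "'a \<Rightarrow> int \<Rightarrow> ('i set \<Rightarrow> 'a) \<Rightarrow> 'i set \<Rightarrow> 'a" where
  "lower_op t r f J = (\<Sum>i\<in>N \<inter> J. z i powi r * (\<Prod>j\<in>N \<inter> J - {i}. pair_factor t i j) * f (J - {i}))"

definition height :: "'i set \<Rightarrow> int" where
  "height J = int (card (N - J)) - int (card (N \<inter> J))"

definition h_eigen :: "int \<Rightarrow> 'i set \<Rightarrow> 'a" where
  "h_eigen r J = s (qint r) / of_int r *
     (Q powi (- r) * (\<Sum>j\<in>N - J. z j powi r) - Q powi r * (\<Sum>j\<in>N \<inter> J. z j powi r))"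

text \<open>Complementation of subsets interchanges the lowering and the raising operators.\<close>

definition xm_op :: "int \<Rightarrow> ('i set \<Rightarrow> 'a) \<Rightarrow> 'i set \<Rightarrow> 'a" where
  "xm_op = lower_op (inverse Q)"

definition xp_op :: "int \<Rightarrow> ('i set \<Rightarrow> 'a) \<Rightarrow> 'i set \<Rightarrow> 'a" where
  "xp_op r f J = lower_op Q r (\<lambda>J. f (- J)) (- J)"

lemma lower_op_add: "lower_op t r (\<lambda>J. f J + g J) J = lower_op t r f J + lower_op t r g J"
  by (simp add: lower_op_def distrib_left sum.distrib)

lemma lower_op_scale: "lower_op t r (\<lambda>J. c * f J) J = c * lower_op t r f J"
  by (simp add: lower_op_def sum_distrib_left algebra_simps)

primrec gen_op :: "gen \<Rightarrow> ('i set \<Rightarrow> 'a) \<Rightarrow> 'i set \<Rightarrow> 'a" where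
  "gen_op (GXplus r) f = xp_op r f"
| "gen_op (GXminus r) f = xm_op r f"
| "gen_op (GH r) f = (\<lambda>J. h_eigen r J * f J)"
| "gen_op GK f = (\<lambda>J. Q powi height J * f J)"
| "gen_op GKinv f = (\<lambda>J. Q powi (- height J) * f J)"

lemma gen_op_add: "gen_op g (\<lambda>J. f J + f' J) = (\<lambda>J. gen_op g f J + gen_op g f' J)"
  by (cases g) (simp_all add: xp_op_def xm_op_def lower_op_add distrib_left fun_eq_iff)

lemma gen_op_scale: "gen_op g (\<lambda>J. c * f J) = (\<lambda>J. c * gen_op g f J)"
  by (cases g) (simp_all add: xp_op_def xm_op_def lower_op_scale fun_eq_iff)

definition word_op :: "gen fmon \<Rightarrow> ('i set \<Rightarrow> 'a) \<Rightarrow> 'i set \<Rightarrow> 'a" where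
  "word_op w = foldr gen_op (letters w)"

lemma word_op_add: "word_op w (\<lambda>J. f J + f' J) = (\<lambda>J. word_op w f J + word_op w f' J)"
proof -
  have "foldr gen_op xs (\<lambda>J. f J + f' J) = (\<lambda>J. foldr gen_op xs f J + foldr gen_op xs f' J)" for xs
    by (induction xs) (simp_all add: gen_op_add)
  thus ?thesis by (simp add: word_op_def)
qed

lemma word_op_scale: "word_op w (\<lambda>J. c * f J) = (\<lambda>J. c * word_op w f J)"
proof -
  have "foldr gen_op xs (\<lambda>J. c * f J) = (\<lambda>J. c * foldr gen_op xs f J)" for xs
    by (induction xs) (simp_all add: gen_op_scale)
  thus ?thesis by (simp add: word_op_def)
qed

lemma word_op_plus: "word_op (v + w) f = word_op v (word_op w f)"
  by (simp add: word_op_def plus_fmon_def)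

definition act :: "falg \<Rightarrow> ('i set \<Rightarrow> 'a) \<Rightarrow> 'i set \<Rightarrow> 'a" where
  "act a f J = (\<Sum>w\<in>Poly_Mapping.keys a. s (Poly_Mapping.lookup a w) * word_op w f J)"

lemma act_superset:
  "finite S \<Longrightarrow> Poly_Mapping.keys a \<subseteq> S \<Longrightarrow>
    act a f J = (\<Sum>w\<in>S. s (Poly_Mapping.lookup a w) * word_op w f J)"
  unfolding act_def by (rule sum.mono_neutral_left) (auto simp: in_keys_iff)

lemma act_zero [simp]: "act 0 f J = 0"
  by (simp add: act_def)

lemma act_single: "act (Poly_Mapping.single w c) f J = s c * word_op w f J"
  by (simp add: act_superset[of "{w}"])

lemma act_add: "act (a + b) f J = act a f J + act b f J"
proof -
  let ?S = "Poly_Mapping.keys a \<union> Poly_Mapping.keys b"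
  have "act (a + b) f J = (\<Sum>w\<in>?S. s (Poly_Mapping.lookup (a + b) w) * word_op w f J)"
    by (rule act_superset) (simp_all add: Poly_Mapping.keys_add)
  also have "\<dots> = act a f J + act b f J"
    by (simp add: act_superset[of ?S a] act_superset[of ?S b] lookup_add s_add
        distrib_right sum.distrib)
  finally show ?thesis .
qed

lemma act_sum: "act (\<Sum>i\<in>I. a i) f J = (\<Sum>i\<in>I. act (a i) f J)"
  by (induction I rule: infinite_finite_induct) (simp_all add: act_add)

lemma act_add_right: "act a (\<lambda>J. f J + f' J) J = act a f J + act a f' J"
  by (simp add: act_def word_op_add distrib_left sum.distrib)

lemma act_scale: "act a (\<lambda>J. c * f J) J = c * act a f J"
  by (simp add: act_def word_op_scale sum_distrib_left algebra_simps)

lemma act_zero_right [simp]: "act a (\<lambda>J. 0) J = 0"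
  using act_scale[of a 0 "\<lambda>J. 0" J] by simp

lemma act_sum_right: "act a (\<lambda>J. \<Sum>i\<in>I. f i J) J = (\<Sum>i\<in>I. act a (f i) J)"
  by (induction I rule: infinite_finite_induct) (simp_all add: act_add_right)

lemma act_mult: "act (a * b) f J = act a (act b f) J"
proof -
  let ?s = "\<lambda>a w. Poly_Mapping.single w (Poly_Mapping.lookup a w) :: falg"
  have "act (a * b) f J =
      act ((\<Sum>v\<in>Poly_Mapping.keys a. ?s a v) * (\<Sum>w\<in>Poly_Mapping.keys b. ?s b w)) f J"
    using falg_eq_sum_single[of a] falg_eq_sum_single[of b]
    by (intro arg_cong[where f = "\<lambda>a. act a f J"] arg_cong2[where f = "(*)"])
  also have "\<dots> = (\<Sum>v\<in>Poly_Mapping.keys a. \<Sum>w\<in>Poly_Mapping.keys b.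
      s (Poly_Mapping.lookup a v) * s (Poly_Mapping.lookup b w) * word_op v (word_op w f) J)"
    by (simp add: sum_product act_sum mult_single act_single s_mult word_op_plus)
  also have "\<dots> = act a (\<lambda>J. \<Sum>w\<in>Poly_Mapping.keys b. s (Poly_Mapping.lookup b w) * word_op w f J) J"
    unfolding act_sum_right act_scale
    by (subst sum.swap) (simp add: act_def sum_distrib_left mult.left_commute mult.assoc)
  also have "(\<lambda>J. \<Sum>w\<in>Poly_Mapping.keys b. s (Poly_Mapping.lookup b w) * word_op w f J) = act b f"
    by (simp add: act_def fun_eq_iff)
  finally show ?thesis .
qed

lemma act_fscal: "act (fscal c) f J = s c * f J"
  by (simp add: fscal_def act_single word_op_def zero_fmon_def)

lemma act_fgen: "act (fgen g) f J = gen_op g f J"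
  by (simp add: fgen_def act_single word_op_def s_one)

lemma act_one [simp]: "act 1 f J = f J"
  using act_fscal[of 1 f J] by (simp add: fscal_def s_one)

lemma act_uminus: "act (- a) f J = - act a f J"
  using act_add[of "- a" a f J] by (simp add: eq_neg_iff_add_eq_0)

lemma act_diff: "act (a - b) f J = act a f J - act b f J"
  using act_add[of a "- b"] by (simp add: act_uminus)

definition null :: "falg set" where
  "null = {a. \<forall>f J. act a f J = 0}"

lemma ideal_null: "ideal null (ring_of_type_algebra :: falg ring)"
proof (rule idealI[OF ring_type_algebra])
  let ?R = "ring_of_type_algebra :: falg ring"
  show "subgroup null (add_monoid ?R)"
  proof (rule group.subgroupI)
    show "group (add_monoid ?R)"
      using abelian_group.a_group[OF ring.is_abelian_group[OF ring_type_algebra]] .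
  next
    fix a assume a: "a \<in> null"
    have "inv\<^bsub>add_monoid ?R\<^esub> a = - a"
      using abelian_group.minus_equality[OF ring.is_abelian_group[OF ring_type_algebra], of "- a" a]
      by (simp add: ring_of_type_algebra_def a_inv_def)
    with a show "inv\<^bsub>add_monoid ?R\<^esub> a \<in> null" by (simp add: null_def act_uminus)
  qed (auto simp: ring_of_type_algebra_def null_def act_add intro: exI[of _ 0])
next
  fix a x :: falg assume "a \<in> null"
  moreover hence "act a f = (\<lambda>J. 0)" for f by (auto simp: null_def)
  ultimately show "x \<otimes>\<^bsub>ring_of_type_algebra\<^esub> a \<in> null" "a \<otimes>\<^bsub>ring_of_type_algebra\<^esub> x \<in> null"
    by (simp_all add: ring_of_type_algebra_def null_def act_mult)
qed

section \<open>The relations between the operators on functions\<close>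

lemma lower_op_lower_op:
  "lower_op t r (lower_op t u f) J = (\<Sum>i\<in>N \<inter> J. \<Sum>k\<in>N \<inter> J - {i}. z i powi r * z k powi u *
      ((\<Prod>j\<in>N \<inter> J - {i} - {k}. pair_factor t i j * pair_factor t k j) * pair_factor t i k) * f (J
          - {i} - {k}))"
proof -
  have "z i powi r * (\<Prod>j\<in>N \<inter> J - {i}. pair_factor t i j) * lower_op t u f (J - {i})
    = (\<Sum>k\<in>N \<inter> J - {i}. z i powi r * z k powi u *
      ((\<Prod>j\<in>N \<inter> J - {i} - {k}. pair_factor t i j * pair_factor t k j) * pair_factor t i k) * f (J
          - {i} - {k}))" for i
  proof -
    have set: "N \<inter> (J - {i}) = N \<inter> J - {i}" by auto
    have "(\<Prod>j\<in>N \<inter> J - {i}. pair_factor t i j)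
        = pair_factor t i k * (\<Prod>j\<in>N \<inter> J - {i} - {k}. pair_factor t i j)"
      if "k \<in> N \<inter> J - {i}" for k
      using that by (intro prod.remove) auto
    thus ?thesis
      unfolding lower_op_def set sum_distrib_left
      by (intro sum.cong refl) (simp add: prod.distrib)
  qed
  thus ?thesis by (simp add: lower_op_def[of t r])
qed

text \<open>In the sum over ordered pairs the terms (i, k) and (k, i) cancel. They share the value
  of f and the factors with the remaining indices; the scalar parts are S (z i - t^2 z k) and S (z k
  - t^2 z i) with a symmetric S, and (z i - t^2 z k) (t z i - z k / t) is symmetric in i and k while
  the denominator of \<open>pair_factor\<close> changes sign.\<close>

lemma lower_op_quadratic:
  assumes "t \<noteq> 0"
  shows "lower_op t (r + 1) (lower_op t u f) J - t\<^sup>2 * lower_op t u (lower_op t (r + 1) f) J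
     - (t\<^sup>2 * lower_op t r (lower_op t (u + 1) f) J - lower_op t (u + 1) (lower_op t r f) J) = 0"
proof -
  let ?C = "\<lambda>i k. (\<Prod>j\<in>N \<inter> J - {i} - {k}. pair_factor t i j * pair_factor t k j)
      * pair_factor t i k * f (J - {i} - {k})"
  let ?P = "\<lambda>i k. z i powi (r + 1) * z k powi u - t\<^sup>2 * (z i powi u * z k powi (r + 1))
     - (t\<^sup>2 * (z i powi r * z k powi (u + 1)) - z i powi (u + 1) * z k powi r)"
  have "lower_op t (r + 1) (lower_op t u f) J - t\<^sup>2 * lower_op t u (lower_op t (r + 1) f) J
     - (t\<^sup>2 * lower_op t r (lower_op t (u + 1) f) J - lower_op t (u + 1) (lower_op t r f) J)
     = (\<Sum>i\<in>N \<inter> J. \<Sum>k\<in>N \<inter> J - {i}. ?P i k * ?C i k)"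
    unfolding lower_op_lower_op sum_distrib_left sum_subtractf[symmetric]
    by (intro sum.cong refl) (simp add: algebra_simps)
  also have "\<dots> = 0"
  proof (rule sum_antisym_eq_0)
    fix i k assume ik: "i \<in> N \<inter> J" "k \<in> N \<inter> J" "i \<noteq> k"
    define D where "D = (\<Prod>j\<in>N \<inter> J - {i} - {k}. pair_factor t i j * pair_factor t k j) * f (J - {i}
        - {k})"
    have sets: "J - {k} - {i} = J - {i} - {k}" "N \<inter> J - {k} - {i} = N \<inter> J - {i} - {k}" by auto
    have C: "?C i k = D * pair_factor t i k" "?C k i = D * pair_factor t k i"
      unfolding sets D_def by (simp_all only: ac_simps)
    define S where "S = z i powi r * z k powi u + z i powi u * z k powi r"
    have z: "z i \<noteq> 0" "z k \<noteq> 0" "z i \<noteq> z k"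
      using ik z_nonzero z_distinct by auto
    have P: "?P i k = S * (z i - t\<^sup>2 * z k)" "?P k i = S * (z k - t\<^sup>2 * z i)"
      using z by (simp_all add: S_def power_int_add algebra_simps)
    have "(z i - t\<^sup>2 * z k) * pair_factor t i k + (z k - t\<^sup>2 * z i) * pair_factor t k i = 0"
    proof -
      have "pair_factor t k i = - ((t * z k - inverse t * z i) / (z i - z k))"
        by (metis pair_factor_def minus_diff_eq minus_divide_right)
      moreover have "(z i - t\<^sup>2 * z k) * (t * z i - inverse t * z k)
         = (z k - t\<^sup>2 * z i) * (t * z k - inverse t * z i)"
        using assms by (simp add: field_simps power2_eq_square)
      ultimately show ?thesis by (simp add: pair_factor_def)
    qed
    moreover have "?P i k * ?C i k + ?P k i * ?C k i
      = S * D * ((z i - t\<^sup>2 * z k) * pair_factor t i k + (z k - t\<^sup>2 * z i) * pair_factor t k i)"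
      unfolding C P by (simp add: algebra_simps)
    ultimately show "?P i k * ?C i k + ?P k i * ?C k i = 0" by simp
  qed simp
  finally show ?thesis .
qed

lemma xp_op_xp_op: "xp_op r (xp_op u f) J = lower_op Q r (lower_op Q u (\<lambda>J. f (- J))) (- J)"
  by (simp add: xp_op_def[abs_def])

lemma height_remove: "i \<in> N \<inter> J \<Longrightarrow> height (J - {i}) = height J + 2"
proof -
  assume i: "i \<in> N \<inter> J"
  have "N - (J - {i}) = insert i (N - J)" "N \<inter> (J - {i}) = (N \<inter> J) - {i}" using i by auto
  moreover have "card (N \<inter> J) = Suc (card (N \<inter> J - {i}))" using i by (intro card.remove) auto
  moreover have "card (insert i (N - J)) = Suc (card (N - J))" using i by simp
  ultimately show ?thesis unfolding height_def by (simp only:)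
qed

lemma height_compl: "height (- J) = - height J"
proof -
  have "N - - J = N \<inter> J" "N \<inter> - J = N - J" by auto
  thus ?thesis by (simp add: height_def)
qed

lemma h_eigen_zero [simp]: "h_eigen 0 J = 0"
  by (simp add: h_eigen_def)

lemma h_eigen_remove:
  assumes i: "i \<in> N \<inter> J"
  shows "h_eigen r J = h_eigen r (J - {i}) - s (qint (2 * r)) / of_int r * z i powi r"
proof -
  have "N - (J - {i}) = insert i (N - J)" "N \<inter> (J - {i}) = (N \<inter> J) - {i}" using i by auto
  moreover have "(\<Sum>j\<in>N \<inter> J. z j powi r) = z i powi r + (\<Sum>j\<in>(N \<inter> J) - {i}. z j powi r)"
    using i by (intro sum.remove) auto
  moreover have "s (qint (2 * r)) = s (qint r) * (Q powi r + Q powi (- r))"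
  proof -
    have "(Q powi r - Q powi (- r)) * (Q powi r + Q powi (- r))
        = Q powi (2 * r) - Q powi (- (2 * r))"
      by (simp add: algebra_simps flip: power_int_add)
    thus ?thesis by (simp add: s_qint)
  qed
  ultimately show ?thesis using i by (simp add: h_eigen_def algebra_simps add_divide_distrib)
qed

lemma h_eigen_compl_remove:
  assumes i: "i \<in> N \<inter> - J"
  shows "h_eigen r J = h_eigen r (- (- J - {i})) + s (qint (2 * r)) / of_int r * z i powi r"
proof -
  have "- (- J - {i}) = insert i J" "insert i J - {i} = J" using i by auto
  thus ?thesis using h_eigen_remove[of i "insert i J" r] i by simp
qed

lemma sum_insert_compl:
  fixes g :: "'i \<Rightarrow> 'a"
  assumes "i \<in> N - J" shows "(\<Sum>k\<in>N \<inter> insert i J. g k) = g i + (\<Sum>k\<in>N \<inter> J. g k)"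
proof -
  have "N \<inter> insert i J = insert i (N \<inter> J)" using assms by auto
  thus ?thesis using assms by simp
qed

lemma sum_remove_compl:
  fixes g :: "'i \<Rightarrow> 'a"
  assumes "k \<in> N \<inter> J" shows "(\<Sum>i\<in>N - (J - {k}). g i) = g k + (\<Sum>i\<in>N - J. g i)"
proof -
  have "N - (J - {k}) = insert k (N - J)" using assms by auto
  thus ?thesis using assms by simp
qed

lemma xp_op_eq: "xp_op r f J =
  (\<Sum>i\<in>N - J. z i powi r * (\<Prod>j\<in>N - J - {i}. pair_factor Q i j) * f (insert i J))"
proof -
  have "- (- J - {i}) = insert i J" for i by auto
  moreover have "N \<inter> - J = N - J" by auto
  ultimately show ?thesis by (simp add: xp_op_def lower_op_def)
qed

lemma xm_op_eq: "xm_op r f J =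
  (\<Sum>i\<in>N \<inter> J. z i powi r * (\<Prod>j\<in>N \<inter> J - {i}. pair_factor (inverse Q) i j) * f (J - {i}))"
  by (simp add: xm_op_def lower_op_def)

text \<open>With \<open>pole_den\<close> these give the eigenvalue of psi at J as the rational
  function with factors (num j - den j z j u) / (1 - z j u).\<close>

definition pole_num :: "'i set \<Rightarrow> 'i \<Rightarrow> 'a" where
  "pole_num J j = (if j \<in> J then inverse Q else Q)"

definition pole_den :: "'i set \<Rightarrow> 'i \<Rightarrow> 'a" where
  "pole_den J j = (if j \<in> J then Q else inverse Q)"

text \<open>If different indices are raised and lowered, both compositions give the same term, as
  \<open>pair_factor_swap\<close> shows. The diagonal terms come from i outside J in one composition
  and from i inside J in the other. They fit into one sum of residues over \<open>N\<close>, since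
  \<open>pole_num - pole_den\<close> changes sign between the two cases.\<close>

lemma commutator_op:
  "xp_op r (xm_op u f) J - xm_op u (xp_op r f) J = 1 / (Q - inverse Q) *
     (\<Sum>i\<in>N. pf_residue z (pole_num J) (pole_den J) N i * z i powi (r + u)) * f J"
proof -
  let ?p = "\<lambda>J i. \<Prod>j\<in>N - J - {i}. pair_factor Q i j"
  let ?m = "\<lambda>J i. \<Prod>j\<in>N \<inter> J - {i}. pair_factor (inverse Q) i j"
  let ?R = "pf_residue z (pole_num J) (pole_den J) N"
  let ?O = "\<lambda>i k. z i powi r * z k powi u * (?p J i * ?m J k * pair_factor Q i k) * f (insert i J
      - {k})"
  have pm: "xp_op r (xm_op u f) J = (\<Sum>i\<in>N - J. z i powi (r + u) * (?p J i * ?m (insert i J) i)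
      * f J)
     + (\<Sum>i\<in>N - J. \<Sum>k\<in>N \<inter> J. ?O i k)"
  proof -
    have "z i powi r * ?p J i * xm_op u f (insert i J) =
       z i powi (r + u) * (?p J i * ?m (insert i J) i) * f J + (\<Sum>k\<in>N \<inter> J. ?O i k)" if i: "i \<in> N
           - J" for i
    proof -
      have "?m (insert i J) k = pair_factor Q i k * ?m J k" if k: "k \<in> N \<inter> J" for k
      proof -
        have "N \<inter> insert i J - {k} = insert i (N \<inter> J - {k})" using i k by auto
        thus ?thesis using i pair_factor_swap[of Q k i] by simp
      qed
      moreover have "insert i J - {i} = J" using i by auto
      moreover have "z i powi (r + u) = z i powi r * z i powi u"
        using i z_nonzero by (simp add: power_int_add)
      ultimately show ?thesis
        unfolding xm_op_eq sum_insert_compl[OF i]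
        by (simp add: distrib_left sum_distrib_left ac_simps)
    qed
    thus ?thesis by (simp add: xp_op_eq[of r] sum.distrib)
  qed
  have mp: "xm_op u (xp_op r f) J = (\<Sum>k\<in>N \<inter> J. z k powi (r + u) * (?m J k * ?p (J - {k}) k) * f J)
     + (\<Sum>k\<in>N \<inter> J. \<Sum>i\<in>N - J. ?O i k)"
  proof -
    have "z k powi u * ?m J k * xp_op r f (J - {k}) =
       z k powi (r + u) * (?m J k * ?p (J - {k}) k) * f J + (\<Sum>i\<in>N - J. ?O i k)" if k: "k \<in> N \<inter> J"
           for k
    proof -
      have "?p (J - {k}) i = pair_factor Q i k * ?p J i" if i: "i \<in> N - J" for i
      proof -
        have "N - (J - {k}) - {i} = insert k (N - J - {i})" using i k by auto
        thus ?thesis using k by simp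
      qed
      moreover have "insert k (J - {k}) = J" using k by auto
      moreover have "insert i (J - {k}) = insert i J - {k}" if "i \<in> N - J" for i
          using that k by auto
      moreover have "z k powi (r + u) = z k powi r * z k powi u"
        using k z_nonzero by (simp add: power_int_add)
      ultimately show ?thesis
        unfolding xp_op_eq sum_remove_compl[OF k]
        by (simp add: distrib_left sum_distrib_left ac_simps)
    qed
    thus ?thesis by (simp add: xm_op_eq[of u] sum.distrib)
  qed
  have prod_split: "(\<Prod>j\<in>N - {i}. (pole_num J j * z i - pole_den J j * z j) / (z i - z j))
     = (\<Prod>j\<in>N - J - {i}. pair_factor Q i j) * (\<Prod>j\<in>N \<inter> J - {i}. pair_factor (inverse Q) i j)" for i
  proof -
    have "N - {i} = (N - J - {i}) \<union> (N \<inter> J - {i})" by auto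
    hence "(\<Prod>j\<in>N - {i}. (pole_num J j * z i - pole_den J j * z j) / (z i - z j))
      = (\<Prod>j\<in>N - J - {i}. (pole_num J j * z i - pole_den J j * z j) / (z i - z j)) *
        (\<Prod>j\<in>N \<inter> J - {i}. (pole_num J j * z i - pole_den J j * z j) / (z i - z j))"
      by (simp only:) (rule prod.union_disjoint, auto)
    thus ?thesis by (simp add: pole_num_def pole_den_def pair_factor_def)
  qed
  have out: "?p J i * ?m (insert i J) i = 1 / (Q - inverse Q) * ?R i" if i: "i \<in> N - J" for i
  proof -
    have "N \<inter> insert i J - {i} = N \<inter> J - {i}" by auto
    thus ?thesis using i unfolding pf_residue_def prod_split
        by (simp add: pole_num_def pole_den_def)
  qed
  have inside: "?m J k * ?p (J - {k}) k = - (1 / (Q - inverse Q) * ?R k)" if k: "k \<in> N \<inter> J" for k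
  proof -
    have "N - (J - {k}) - {k} = N - J - {k}" by auto
    moreover have "?R k = - (Q - inverse Q) * (?m J k * ?p J k)"
      using k unfolding pf_residue_def prod_split by (simp add: pole_num_def pole_den_def)
    moreover have "y = - (1 / d * x)" if "x = - d * y" "d \<noteq> 0" for x d y :: 'a
      using that by simp
    ultimately show ?thesis using Q_diff_nonzero by metis
  qed
  have out': "(\<Sum>i\<in>N - J. z i powi (r + u) * (?p J i * ?m (insert i J) i) * f J)
      = (\<Sum>i\<in>N - J. z i powi (r + u) * (1 / (Q - inverse Q) * ?R i) * f J)"
    by (rule sum.cong[OF refl]) (simp only: out)
  have inside': "(\<Sum>k\<in>N \<inter> J. z k powi (r + u) * (?m J k * ?p (J - {k}) k) * f J)
      = - (\<Sum>k\<in>N \<inter> J. z k powi (r + u) * (1 / (Q - inverse Q) * ?R k) * f J)"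
    by (subst sum_negf[symmetric], rule sum.cong[OF refl])
      (simp only: inside mult_minus_left mult_minus_right)
  have "(\<Sum>i\<in>N - J. \<Sum>k\<in>N \<inter> J. ?O i k) = (\<Sum>k\<in>N \<inter> J. \<Sum>i\<in>N - J. ?O i k)" by (rule sum.swap)
  hence "xp_op r (xm_op u f) J - xm_op u (xp_op r f) J
    = (\<Sum>i\<in>N - J. z i powi (r + u) * (1 / (Q - inverse Q) * ?R i) * f J)
      + (\<Sum>k\<in>N \<inter> J. z k powi (r + u) * (1 / (Q - inverse Q) * ?R k) * f J)"
    unfolding pm mp out' inside' by simp
  also have "\<dots> = (\<Sum>i\<in>(N - J) \<union> (N \<inter> J). z i powi (r + u) * (1 / (Q - inverse Q) * ?R i) * f J)"
    by (rule sum.union_disjoint[symmetric]) auto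
  also have "(N - J) \<union> (N \<inter> J) = N" by auto
  finally show ?thesis by (simp add: sum_distrib_left sum_distrib_right ac_simps)
qed

end

section \<open>Polynomials given by the inverses of their roots\<close>

definition linear_product :: "('i \<Rightarrow> 'a::field) \<Rightarrow> 'i set \<Rightarrow> 'a poly" where
  "linear_product c M = (\<Prod>j\<in>M. [:1, - c j:])"

lemma degree_linear_product_le: "degree (linear_product c M) \<le> card M"
proof (cases "finite M")
  case True
  have "degree (linear_product c M) \<le> (\<Sum>j\<in>M. degree [:1, - c j:])"
    using degree_prod_sum_le[OF True, of "\<lambda>j. [:1, - c j:]"] by (simp add: linear_product_def o_def)
  also have "\<dots> \<le> (\<Sum>j\<in>M. 1)" by (rule sum_mono) simp
  finally show ?thesis by simp
qed (simp add: linear_product_def)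

lemma coeff_linear_product_0: "card M < n \<Longrightarrow> coeff (linear_product c M) n = 0"
  using degree_linear_product_le[of c M] by (simp add: coeff_eq_0)

lemma poly_linear_product: "poly (linear_product c M) w = (\<Prod>j\<in>M. 1 - c j * w)"
  by (simp add: linear_product_def poly_prod mult.commute)

lemma coeff_linear_product_const: "coeff (linear_product c M) 0 = 1"
  using poly_linear_product[of c M 0] by (simp add: poly_0_coeff_0)

text \<open>Reversing the order of the coefficients replaces each factor 1 - c u by -c (1 - u / c).
  This is the source of the relation between \<open>Lam m * Lam (- r)\<close> and
  \<open>Lam (m - r)\<close>.\<close>

lemma linear_product_reflect:
  fixes c :: "'i \<Rightarrow> 'a::field"
  assumes "finite M" "\<And>j. j \<in> M \<Longrightarrow> c j \<noteq> 0" "r \<le> card M"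
  shows "coeff (linear_product c M) (card M) * coeff (linear_product (\<lambda>j. inverse (c j)) M) r
    = coeff (linear_product c M) (card M - r)"
proof -
  have deg: "degree (linear_product c M) = card M"
    using assms(1,2) by (simp add: linear_product_def degree_prod_eq_sum_degree)
  have lead: "lead_coeff (linear_product c M) = (\<Prod>j\<in>M. - c j)"
    unfolding linear_product_def lead_coeff_prod by (rule prod.cong) (use assms in auto)
  have refl: "reflect_poly [:1, - c j:] = smult (- c j) [:1, - inverse (c j):]" if "j \<in> M" for j
    using assms(2)[OF that] by (simp add: reflect_poly_def)
  have "reflect_poly (linear_product c M) = (\<Prod>j\<in>M. smult (- c j) [:1, - inverse (c j):])"
    unfolding linear_product_def reflect_poly_prod by (rule prod.cong) (use refl in auto)
  also have "\<dots> = smult (\<Prod>j\<in>M. - c j) (linear_product (\<lambda>j. inverse (c j)) M)"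
    unfolding linear_product_def by (rule prod_smult)
  finally have "coeff (reflect_poly (linear_product c M)) r
     = (\<Prod>j\<in>M. - c j) * coeff (linear_product (\<lambda>j. inverse (c j)) M) r" by simp
  thus ?thesis using assms(3) lead by (simp add: coeff_reflect_poly deg)
qed

lemma fps_of_linear_product:
  "fps_of_poly (linear_product c M) = (\<Prod>j\<in>M. 1 - fps_const (c j) * fps_X)"
proof -
  have "fps_of_poly [:1, - c j:] = 1 - fps_const (c j) * fps_X" for j
    by (simp add: fps_of_poly_pCons flip: fps_const_neg)
  thus ?thesis unfolding linear_product_def fps_of_poly_prod by (simp only:)
qed

lemma left_module_left_regular: "left_module UQ (left_regular UQ)"
proof (rule left_module_UQI)
  show "abelian_group (left_regular UQ)"
    by (rule abelian_groupI)
      (auto simp: left_regular_def algebra_simps intro!: exI[of _ "- x" for x])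
qed (auto simp: left_regular_def algebra_simps)

lemma submodule_left_regular_iff:
  "submodule I UQ (left_regular UQ) \<longleftrightarrow> 0 \<in> I \<and> (\<forall>x\<in>I. \<forall>y\<in>I. x + y \<in> I) \<and> (\<forall>a. \<forall>x\<in>I. a * x \<in> I)"
proof -
  interpret UQ_module "left_regular UQ" by (simp add: UQ_module_iff left_module_left_regular)
  show ?thesis unfolding submodule_iff by (simp add: left_regular_def)
qed

text \<open>Applied with \<open>x\<close> and \<open>y\<close> equal to \<open>Q ^ n\<close> and
  \<open>inverse Q ^ n\<close> in either order; it turns the q-integers in the eigenvalues of
  \<open>h\<close> into the coefficients of a logarithm.\<close>

lemma hyperbolic_product:
  fixes x y a b n :: "'a::field"
  assumes "x * y = 1"
  shows "(x - y) / n * (y * a - x * b) = (1 - y * y) / n * a + (1 - x * x) / n * b"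
proof -
  have "(x - y) * (y * a - x * b) = (x * y) * a - x * x * b - y * y * a + (x * y) * b"
    by (simp add: algebra_simps)
  hence "(x - y) * (y * a - x * b) = (1 - y * y) * a + (1 - x * x) * b"
    unfolding assms by (simp add: algebra_simps)
  thus ?thesis by (simp add: add_divide_distrib)
qed

lemma submodule_Iq: "submodule (Iq m) UQ (left_regular UQ)"
  and Iq_gens_subset: "Iq_gens m \<subseteq> Iq m"
  and Iq_minimal: "submodule I UQ (left_regular UQ) \<Longrightarrow> Iq_gens m \<subseteq> I \<Longrightarrow> Iq m \<subseteq> I"
proof -
  show sub: "Iq_gens m \<subseteq> Iq m" unfolding Iq_def genlideal_def by (rule hull_subset)
  show min: "submodule I UQ (left_regular UQ) \<Longrightarrow> Iq_gens m \<subseteq> I \<Longrightarrow> Iq m \<subseteq> I"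
    unfolding Iq_def genlideal_def by (rule hull_minimal)
  show "submodule (Iq m) UQ (left_regular UQ)"
    unfolding Iq_def genlideal_def by (rule hull_in) (simp add: submodule_left_regular_iff)
qed

section \<open>Eigenvalues of psi and the defining relations\<close>

context subset_module
begin

definition psi_eigen :: "int \<Rightarrow> int \<Rightarrow> 'i set \<Rightarrow> 'a" where
  "psi_eigen \<epsilon> r J = (if \<epsilon> * r \<ge> 0 then Q powi (\<epsilon> * height J) * fps_nth (alg_exp s
     (Abs_fps (\<lambda>n. if n = 0 then 0 else of_int \<epsilon> * (Q - inverse Q) * h_eigen (\<epsilon> * int n) J)))
       (nat (\<epsilon> * r)) else 0)"

text \<open>The elements that multiply the coordinate at J by a scalar form a subring
  \<open>?A\<close>, and the scalar, read off on the constant function 1, is multiplicative there.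
  So the eigenvalue passes inside the exponential.\<close>

lemma act_fpsi:
  assumes "\<epsilon> \<in> {1, -1}"
  shows "act (fpsi \<epsilon> r) f J = psi_eigen \<epsilon> r J * f J"
proof -
  let ?A = "{a. \<forall>f. act a f J = act a (\<lambda>_. 1) J * f J}"
  let ?F = "Abs_fps (\<lambda>n. if n = 0 then 0 else fscal (of_int \<epsilon> * (q - inverse q)) * fgen (GH (\<epsilon>
      * int n)))"
  have F: "fps_nth ?F n \<in> ?A" for n
    by (simp add: act_mult act_fscal act_fgen)
  have E: "fps_nth (alg_exp fscal ?F) n \<in> ?A \<and> act (fps_nth (alg_exp fscal ?F) n) (\<lambda>_. 1) J
     = fps_nth (alg_exp s (Abs_fps (\<lambda>n. act (fps_nth ?F n) (\<lambda>_. 1) J))) n" for n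
  proof (rule alg_exp_map)
    fix x y assume x: "x \<in> ?A" and y: "y \<in> ?A"
    define a b where "a = act x (\<lambda>_. 1) J" and "b = act y (\<lambda>_. 1) J"
    have "act x f J = a * f J" "act y f J = b * f J" for f
      using x y unfolding a_def b_def by blast+
    hence "act (x * y) f J = act x (\<lambda>_. 1) J * act y (\<lambda>_. 1) J * f J" for f
      by (simp add: act_mult)
    thus "x * y \<in> ?A \<and> act (x * y) (\<lambda>_. 1) J = act x (\<lambda>_. 1) J * act y (\<lambda>_. 1) J" by simp
    show "x + y \<in> ?A \<and> act (x + y) (\<lambda>_. 1) J = act x (\<lambda>_. 1) J + act y (\<lambda>_. 1) J"
      using x y unfolding mem_Collect_eq act_add by (metis distrib_right)
  next
    fix n show "fps_nth ?F n \<in> ?A" by (rule F)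
  qed (simp_all add: act_fscal)
  have f: "act (fps_nth ?F n) (\<lambda>_. 1) J
      = (if n = 0 then 0 else of_int \<epsilon> * (Q - inverse Q) * h_eigen (\<epsilon> * int n) J)" for n
    by (simp add: act_mult act_fscal act_fgen s_mult s_of_int s_diff s_inverse)
  have "act (fps_nth (alg_exp fscal ?F) n) f J = fps_nth (alg_exp s
     (Abs_fps (\<lambda>n. if n = 0 then 0 else of_int \<epsilon> * (Q - inverse Q) * h_eigen (\<epsilon> * int n) J))) n
         * f J" for n
  proof -
    have "fps_nth (alg_exp fscal ?F) n \<in> ?A" using E by blast
    hence "act (fps_nth (alg_exp fscal ?F) n) f J
        = act (fps_nth (alg_exp fscal ?F) n) (\<lambda>_. 1) J * f J"
      by blast
    thus ?thesis using E[of n] unfolding f by argo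
  qed
  thus ?thesis using assms
    by (auto simp: fpsi_def psi_eigen_def act_mult fKpow_def act_fgen)
qed

lemma sum_split_N: "(\<Sum>j\<in>N. g j) = (\<Sum>j\<in>N - J. g j) + (\<Sum>j\<in>N \<inter> J. g j :: 'a)"
  and prod_split_N: "(\<Prod>j\<in>N. g j) = (\<Prod>j\<in>N - J. g j) * (\<Prod>j\<in>N \<inter> J. g j :: 'a)"
proof -
  have N: "N = (N - J) \<union> (N \<inter> J)" by auto
  show "(\<Sum>j\<in>N. g j) = (\<Sum>j\<in>N - J. g j) + (\<Sum>j\<in>N \<inter> J. g j)"
    by (subst N) (rule sum.union_disjoint, auto)
  show "(\<Prod>j\<in>N. g j) = (\<Prod>j\<in>N - J. g j) * (\<Prod>j\<in>N \<inter> J. g j)"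
    by (subst N) (rule prod.union_disjoint, auto)
qed

lemma prod_pole_num: "(\<Prod>j\<in>N. pole_num J j) = Q powi height J"
  and prod_pole_den: "(\<Prod>j\<in>N. pole_den J j) = Q powi (- height J)"
  unfolding prod_split_N[of _ J]
  by (simp_all add: pole_num_def pole_den_def height_def power_int_diff divide_inverse
    power_inverse mult.commute)

text \<open>These are the coefficients of the logarithm of the product of (1 - (den j / num j) z j
  u) / (1 - z j u). For negative indices numerators and denominators change places and the z j are
  inverted.\<close>

lemma log_psi_pos:
  assumes "n > 0"
  shows "(Q - inverse Q) * h_eigen (int n) J
    = (\<Sum>j\<in>N. (1 - (pole_den J j / pole_num J j) ^ n) * z j ^ n / of_nat n)"
proof -
  have "(Q - inverse Q) * h_eigen (int n) J = (Q ^ n - inverse Q ^ n) / of_nat n *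
     (inverse Q ^ n * (\<Sum>j\<in>N - J. z j ^ n) - Q ^ n * (\<Sum>j\<in>N \<inter> J. z j ^ n))"
    by (simp add: h_eigen_def s_qint power_int_minus power_inverse)
  also have "\<dots> = (1 - (inverse Q ^ n) * (inverse Q ^ n)) / of_nat n * (\<Sum>j\<in>N - J. z j ^ n)
     + (1 - Q ^ n * Q ^ n) / of_nat n * (\<Sum>j\<in>N \<inter> J. z j ^ n)"
    by (rule hyperbolic_product) (simp flip: power_mult_distrib)
  also have "\<dots> = (\<Sum>j\<in>N - J. (1 - (inverse Q ^ n) * (inverse Q ^ n)) * z j ^ n / of_nat n)
     + (\<Sum>j\<in>N \<inter> J. (1 - Q ^ n * Q ^ n) * z j ^ n / of_nat n)"
    by (simp add: sum_distrib_left)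
  also have "\<dots> = (\<Sum>j\<in>N - J. (1 - (pole_den J j / pole_num J j) ^ n) * z j ^ n / of_nat n)
     + (\<Sum>j\<in>N \<inter> J. (1 - (pole_den J j / pole_num J j) ^ n) * z j ^ n / of_nat n)"
    by (simp add: pole_num_def pole_den_def power_divide power_inverse divide_inverse
      power_mult_distrib)
  also have "\<dots> = (\<Sum>j\<in>N. (1 - (pole_den J j / pole_num J j) ^ n) * z j ^ n / of_nat n)"
    by (rule sum_split_N[symmetric])
  finally show ?thesis .
qed

lemma log_psi_neg:
  assumes "n > 0"
  shows "- (Q - inverse Q) * h_eigen (- int n) J
    = (\<Sum>j\<in>N. (1 - (pole_num J j / pole_den J j) ^ n) * inverse (z j) ^ n / of_nat n)"
proof -
  have "- (Q - inverse Q) * h_eigen (- int n) J = (inverse Q ^ n - Q ^ n) / of_nat n *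
     (Q ^ n * (\<Sum>j\<in>N - J. inverse (z j) ^ n) - inverse Q ^ n * (\<Sum>j\<in>N \<inter> J. inverse (z j) ^ n))"
  proof -
    have "h_eigen (- int n) J = - ((inverse Q ^ n - Q ^ n) / (Q - inverse Q) / of_nat n) *
      (Q ^ n * (\<Sum>j\<in>N - J. inverse (z j) ^ n) - inverse Q ^ n * (\<Sum>j\<in>N \<inter> J. inverse (z j) ^ n))"
      by (simp add: h_eigen_def s_qint power_int_minus power_inverse)
    moreover have "- d * (- (u / d / k) * w) = u / k * w" if "d \<noteq> 0" for d u w k :: 'a
      using that by simp
    ultimately show ?thesis using Q_diff_nonzero by metis
  qed
  also have "\<dots> = (1 - Q ^ n * Q ^ n) / of_nat n * (\<Sum>j\<in>N - J. inverse (z j) ^ n)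
     + (1 - inverse Q ^ n * inverse Q ^ n) / of_nat n * (\<Sum>j\<in>N \<inter> J. inverse (z j) ^ n)"
    by (rule hyperbolic_product) (simp flip: power_mult_distrib)
  also have "\<dots> = (\<Sum>j\<in>N - J. (1 - Q ^ n * Q ^ n) * inverse (z j) ^ n / of_nat n)
     + (\<Sum>j\<in>N \<inter> J. (1 - inverse Q ^ n * inverse Q ^ n) * inverse (z j) ^ n / of_nat n)"
    by (simp add: sum_distrib_left)
  also have "\<dots> = (\<Sum>j\<in>N - J. (1 - (pole_num J j / pole_den J j) ^ n) * inverse (z j) ^ n / of_nat n)
     + (\<Sum>j\<in>N \<inter> J. (1 - (pole_num J j / pole_den J j) ^ n) * inverse (z j) ^ n / of_nat n)"
    by (simp add: pole_num_def pole_den_def power_divide power_inverse divide_inverse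
      power_mult_distrib)
  also have "\<dots> = (\<Sum>j\<in>N. (1 - (pole_num J j / pole_den J j) ^ n) * inverse (z j) ^ n / of_nat n)"
    by (rule sum_split_N[symmetric])
  finally show ?thesis .
qed

lemma pole_nonzero: "pole_num J j \<noteq> 0" "pole_den J j \<noteq> 0"
  by (simp_all add: pole_num_def pole_den_def)

lemma psi_eigen_pos:
  "psi_eigen 1 (int n) J = (if n = 0 then Q powi (- height J) else 0)
    + (\<Sum>i\<in>N. pf_residue z (pole_num J) (pole_den J) N i * z i powi int n)"
proof -
  have "(\<Prod>j\<in>N. pole_num J j) * fps_nth (alg_exp s (Abs_fps (\<lambda>n. if n = 0 then 0 else
      of_int 1 * (Q - inverse Q) * h_eigen (1 * int n) J))) n
    = (if n = 0 then \<Prod>j\<in>N. pole_den J j else 0)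
      + (\<Sum>i\<in>N. pf_residue z (pole_num J) (pole_den J) N i * z i ^ n)"
    by (rule exp_partial_fractions) (use inj log_psi_pos pole_nonzero in auto)
  thus ?thesis by (simp add: psi_eigen_def prod_pole_num prod_pole_den)
qed

text \<open>The substitution w to 1/w interchanges numerators and denominators in each factor; only
  the leading difference changes sign.\<close>

lemma pf_residue_inverse:
  assumes "i \<in> N"
  shows "pf_residue (\<lambda>i. inverse (z i)) (pole_den J) (pole_num J) N i
    = - pf_residue z (pole_num J) (pole_den J) N i"
proof -
  have swap: "(d * inverse x - n * inverse y) / (inverse x - inverse y) = (n * x - d * y) / (x - y)"
    if "x \<noteq> 0" "y \<noteq> 0" "x \<noteq> y" for d n x y :: 'a
  proof -
    have "d * inverse x - n * inverse y = (n * x - d * y) * - (inverse x * inverse y)"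
      "inverse x - inverse y = (x - y) * - (inverse x * inverse y)"
      using that by (simp_all add: algebra_simps)
    moreover have "- (inverse x * inverse y) \<noteq> 0" using that by simp
    ultimately show ?thesis by (metis mult_divide_mult_cancel_right)
  qed
  have "(\<Prod>j\<in>N - {i}. (pole_den J j * inverse (z i) - pole_num J j
      * inverse (z j)) / (inverse (z i) - inverse (z j)))
      = (\<Prod>j\<in>N - {i}. (pole_num J j * z i - pole_den J j * z j) / (z i - z j))"
  proof (rule prod.cong[OF refl])
    fix j assume "j \<in> N - {i}"
    hence "z i \<noteq> 0" "z j \<noteq> 0" "z i \<noteq> z j" using assms z_nonzero z_distinct by auto
    thus "(pole_den J j * inverse (z i) - pole_num J j * inverse (z j)) / (inverse (z i)
        - inverse (z j))
      = (pole_num J j * z i - pole_den J j * z j) / (z i - z j)"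
      by (rule swap)
  qed
  thus ?thesis unfolding pf_residue_def by (simp only: mult_minus_left[symmetric] minus_diff_eq)
qed

lemma psi_eigen_neg:
  "psi_eigen (-1) (- int n) J = (if n = 0 then Q powi height J else 0)
    - (\<Sum>i\<in>N. pf_residue z (pole_num J) (pole_den J) N i * z i powi (- int n))"
proof -
  have "(\<Prod>j\<in>N. pole_den J j) * fps_nth (alg_exp s (Abs_fps (\<lambda>n. if n = 0 then 0 else
      of_int (-1) * (Q - inverse Q) * h_eigen (-1 * int n) J))) n
    = (if n = 0 then \<Prod>j\<in>N. pole_num J j else 0)
      + (\<Sum>i\<in>N. pf_residue (\<lambda>i. inverse (z i)) (pole_den J) (pole_num J) N i * inverse (z i) ^ n)"
  proof (rule exp_partial_fractions)
    show "inj_on (\<lambda>i. inverse (z i)) N" using inj by (auto simp: inj_on_def)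
  qed (use log_psi_neg pole_nonzero in auto)
  also have "(\<Sum>i\<in>N. pf_residue (\<lambda>i. inverse (z i)) (pole_den J) (pole_num J) N i
      * inverse (z i) ^ n)
    = - (\<Sum>i\<in>N. pf_residue z (pole_num J) (pole_den J) N i * z i powi (- int n))"
    by (simp add: pf_residue_inverse power_int_minus power_inverse flip: sum_negf)
  finally show ?thesis by (simp add: psi_eigen_def prod_pole_num prod_pole_den)
qed

text \<open>The two series are expansions of one rational function at 0 and at infinity, so their
  difference consists of the contributions of the poles, with one formula for all integers r. In
  degree 0 the constants must be balanced separately.\<close>

lemma psi_eigen_diff: "psi_eigen 1 r J - psi_eigen (-1) r J
    = (\<Sum>i\<in>N. pf_residue z (pole_num J) (pole_den J) N i * z i powi r)"
proof -
  consider n where "r = int n" "n > 0" | n where "r = - int n" "n > 0" | "r = 0"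
    by (metis linorder_neqE_linordered_idom nat_0_le nat_le_0 neg_0_less_iff_less nonneg_int_cases
        not_less of_nat_0_less_iff zle_int zero_less_imp_eq_int minus_minus)
  thus ?thesis
  proof cases
    case 1
    thus ?thesis using psi_eigen_pos[of n J] by (simp add: psi_eigen_def[of "-1"])
  next
    case 2
    thus ?thesis using psi_eigen_neg[of n J] by (simp add: psi_eigen_def[of 1])
  next
    case 3
    have "psi_eigen 1 0 J = Q powi height J"
      by (simp add: psi_eigen_def alg_exp_nth_0)
    thus ?thesis using psi_eigen_neg[of 0 J] 3 by simp
  qed
qed

lemma act_fun: "act (a * b) f = act a (act b f)" "act (fgen g) f = gen_op g f"
  "act (fscal c) f = (\<lambda>J. s c * f J)"
  by (simp_all add: fun_eq_iff act_mult act_fgen act_fscal)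

lemma act_fX: "act (fX 1 r) f = xp_op r f" "act (fX (-1) r) f = xm_op r f"
  by (simp_all add: fX_def act_fun)

lemma lower_op_diag:
  assumes "\<And>i. i \<in> N \<inter> J \<Longrightarrow> a (J - {i}) = b"
  shows "lower_op t r (\<lambda>J. a J * f J) J = b * lower_op t r f J"
  unfolding lower_op_def sum_distrib_left by (intro sum.cong refl) (simp add: assms algebra_simps)

lemma Q_powi_shift: "Q powi k * (Q powi (- k + n) * x) = Q powi n * x"
  by (simp flip: mult.assoc power_int_add)

lemma Q_powi_cancel [simp]: "Q powi n * (Q powi (- n) * x) = x" "Q powi (- n) * (Q powi n * x) = x"
  by (simp_all flip: mult.assoc power_int_add)

lemma xm_op_h: "h_eigen r J * xm_op k f J - xm_op k (\<lambda>J. h_eigen r J * f J) J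
    = - (s (qint (2 * r)) / of_int r) * xm_op (r + k) f J"
proof -
  have "h_eigen r J * (z i powi k * c * g) - z i powi k * c * (h_eigen r (J - {i}) * g)
      = - (s (qint (2 * r)) / of_int r) * (z i powi (r + k) * c * g)" if "i \<in> N \<inter> J" for i c g
  proof -
    have e: "h_eigen r (J - {i}) = h_eigen r J + s (qint (2 * r)) / of_int r * z i powi r"
      using h_eigen_remove[OF that, of r] by simp
    show ?thesis unfolding e using z_nonzero that by (simp add: power_int_add algebra_simps)
  qed
  thus ?thesis
    unfolding xm_op_def lower_op_def sum_distrib_left sum_subtractf[symmetric]
    by (intro sum.cong refl) auto
qed

lemma xp_op_h: "h_eigen r J * xp_op k f J - xp_op k (\<lambda>J. h_eigen r J * f J) J
    = s (qint (2 * r)) / of_int r * xp_op (r + k) f J"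
proof -
  have "h_eigen r J * (z i powi k * c * g) - z i powi k * c * (h_eigen r (- (- J - {i})) * g)
      = s (qint (2 * r)) / of_int r * (z i powi (r + k) * c * g)" if "i \<in> N \<inter> - J" for i c g
  proof -
    have e: "h_eigen r (- (- J - {i})) = h_eigen r J - s (qint (2 * r)) / of_int r * z i powi r"
      using h_eigen_compl_remove[OF that, of r] by simp
    show ?thesis unfolding e using z_nonzero that by (simp add: power_int_add algebra_simps)
  qed
  thus ?thesis
    unfolding xp_op_def lower_op_def sum_distrib_left sum_subtractf[symmetric]
    by (intro sum.cong refl) auto
qed

lemma relator_null: "a \<in> uq_relators \<Longrightarrow> a \<in> null"
proof (induction rule: uq_relators.induct)
  case h_zero
  show ?case by (simp add: null_def act_fgen)
next
  case K_Kinv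
  show ?case by (simp add: null_def act_diff act_fun)
next
  case Kinv_K
  show ?case by (simp add: null_def act_diff act_fun)
next
  case (K_h r)
  show ?case by (simp add: null_def act_diff act_fun algebra_simps)
next
  case (K_x \<epsilon> r)
  have "Q powi height J * xm_op r (\<lambda>J. Q powi - height J * f J) J
      = Q powi (- 2) * xm_op r f J" for f J
    unfolding xm_op_def
    by (subst lower_op_diag[where b = "Q powi (- height J + - 2)"])
      (simp_all only: height_remove Q_powi_shift minus_add_distrib)
  moreover have "Q powi height J * xp_op r (\<lambda>J. Q powi - height J * f J) J
      = Q powi 2 * xp_op r f J" for f J
    unfolding xp_op_def
    by (subst lower_op_diag[where b = "Q powi (- height J + 2)"])
      (simp_all only: height_compl height_remove minus_minus Q_powi_shift)
  ultimately show ?case using K_x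
    by (auto simp: null_def act_diff act_fun act_fX s_powi)
next
  case (h_h r s)
  show ?case by (simp add: null_def act_diff act_fun algebra_simps)
next
  case (h_x \<epsilon> r k)
  thus ?case
    using xm_op_h[of r _ k] xp_op_h[of r _ k]
    by (auto simp: null_def act_diff act_fun act_fX s_mult s_minus s_divide s_of_int s_one)
next
  case (x_x \<epsilon> r k)
  have "xm_op (r + 1) (xm_op k f) J - Q powi (- 2) * xm_op k (xm_op (r + 1) f) J
     - (Q powi (- 2) * xm_op r (xm_op (k + 1) f) J - xm_op (k + 1) (xm_op r f) J) = 0" for f J
    using lower_op_quadratic[of "inverse Q" r k f J]
    by (simp add: xm_op_def power_int_minus power_inverse)
  moreover have "xp_op (r + 1) (xp_op k f) J - Q powi 2 * xp_op k (xp_op (r + 1) f) J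
     - (Q powi 2 * xp_op r (xp_op (k + 1) f) J - xp_op (k + 1) (xp_op r f) J) = 0" for f J
    unfolding xp_op_xp_op using lower_op_quadratic[of Q r k "\<lambda>J. f (- J)" "- J"] by simp
  ultimately show ?case using x_x
    by (auto simp: null_def act_diff act_fun act_fX s_powi mult.assoc)
next
  case (xp_xm r k)
  show ?case
    using commutator_op[of r k] psi_eigen_diff[of "r + k"]
    by (simp add: null_def act_diff act_fun act_fX act_fpsi s_divide s_diff s_inverse s_one
       left_diff_distrib[symmetric])
qed

lemma uq_ideal_null: "uq_ideal \<subseteq> null"
  unfolding uq_ideal_def genideal_def using ideal_null relator_null by blast

section \<open>The highest weight vector and the relations of the Weyl modules\<close>

definition uact :: "uq \<Rightarrow> ('i set \<Rightarrow> 'a) \<Rightarrow> 'i set \<Rightarrow> 'a" where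
  "uact x = act (rep_uq x)"

lemma uact_abs: "uact (abs_uq a) f J = act a f J"
proof -
  have "abs_uq (rep_uq (abs_uq a)) = abs_uq a" by (rule Quotient_abs_rep[OF Quotient_uq])
  hence "rep_uq (abs_uq a) - a \<in> null" using uq_ideal_null by (auto simp: uq.abs_eq_iff)
  thus ?thesis by (simp add: null_def act_diff uact_def)
qed

lemma abs_uq_surj: "\<exists>a. x = abs_uq a"
  using Quotient_abs_rep[OF Quotient_uq, of x] by metis

lemma uact_add: "uact (x + y) f J = uact x f J + uact y f J"
proof -
  obtain a b where "x = abs_uq a" "y = abs_uq b" using abs_uq_surj by blast
  thus ?thesis by (simp add: uact_abs act_add plus_uq.abs_eq)
qed

lemma uact_mult: "uact (x * y) f J = uact x (uact y f) J"
proof -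
  obtain a b where ab: "x = abs_uq a" "y = abs_uq b" using abs_uq_surj by blast
  have "uact y f = act b f" by (simp add: fun_eq_iff ab uact_abs)
  thus ?thesis by (simp add: ab uact_abs act_mult times_uq.abs_eq)
qed

lemma uact_gen [simp]: "uact (xp r) f J = xp_op r f J" "uact (xm r) f J = xm_op r f J"
  "uact (h r) f J = h_eigen r J * f J" "uact KK f J = Q powi height J * f J"
  "uact Kinv f J = Q powi (- height J) * f J" "uact (scal c) f J = s c * f J"
  by (simp_all add: abs_uq_fgen[symmetric] uact_abs act_fgen act_fscal)

lemma uact_one [simp]: "uact 1 f J = f J"
  using uact_gen(6)[of 1] by (simp add: s_one)

lemma uact_zero [simp]: "uact 0 f J = 0"
  using uact_gen(6)[of 0] by simp

lemma uact_uminus: "uact (- x) f J = - uact x f J"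
  using uact_add[of "- x" x f J] by (simp add: eq_neg_iff_add_eq_0)

lemma uact_diff: "uact (x - y) f J = uact x f J - uact y f J"
  using uact_add[of x "- y"] by (simp add: uact_uminus)

lemma uact_sum: "uact (\<Sum>i\<in>I. x i) f J = (\<Sum>i\<in>I. uact (x i) f J)"
  by (induction I rule: infinite_finite_induct) (simp_all add: uact_add)

lemma uact_scale: "uact x (\<lambda>J. c * f J) J = c * uact x f J"
  by (simp add: uact_def act_scale)

lemma uact_zero_right [simp]: "uact x (\<lambda>J. 0) J = 0"
  by (simp add: uact_def)

definition vac :: "'i set \<Rightarrow> 'a" where
  "vac J = (if J = {} then 1 else 0)"

text \<open>The coefficient at the highest weight vector. It is linear on the whole algebra and
  multiplicative against right factors from \<open>UQ0\<close>, because these act on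
  \<open>vac\<close> by scalars.\<close>

definition tau :: "uq \<Rightarrow> 'a" where
  "tau x = uact x vac {}"

lemma tau_add: "tau (x + y) = tau x + tau y" and tau_uminus: "tau (- x) = - tau x"
  and tau_diff: "tau (x - y) = tau x - tau y"
  and tau_scal [simp]: "tau (scal c) = s c" and tau_one [simp]: "tau 1
      = 1" and tau_zero [simp]: "tau 0 = 0"
  by (simp_all add: tau_def uact_add uact_uminus uact_diff vac_def)

lemma UQ0_diagonal: "y \<in> UQ0 \<Longrightarrow> \<exists>c. \<forall>f. uact y f J = c * f J"
proof (induction rule: UQ0_induct)
  case (add x y)
  then obtain c d where "\<forall>f. uact x f J = c * f J" "\<forall>f. uact y f J = d * f J" by blast
  thus ?case by (intro exI[of _ "c + d"]) (simp add: uact_add distrib_right)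
next
  case (mult x y)
  then obtain c d where "\<forall>f. uact x f J = c * f J" "\<forall>f. uact y f J = d * f J" by blast
  thus ?case by (intro exI[of _ "c * d"]) (simp add: uact_mult mult.assoc)
next
  case (uminus x)
  then obtain c where "\<forall>f. uact x f J = c * f J" by blast
  thus ?case by (intro exI[of _ "- c"]) (simp add: uact_uminus)
qed auto

lemma uact_UQ0_vac: "y \<in> UQ0 \<Longrightarrow> uact y vac = (\<lambda>J. tau y * vac J)"
proof (rule ext)
  fix J assume y: "y \<in> UQ0"
  show "uact y vac J = tau y * vac J"
  proof -
    obtain c where "\<And>f. uact y f J = c * f J" using UQ0_diagonal[OF y] by blast
    thus ?thesis by (cases "J = {}") (simp_all add: tau_def vac_def)
  qed
qed

lemma uact_mult_vac: "y \<in> UQ0 \<Longrightarrow> uact (x * y) vac J = tau y * uact x vac J"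
proof -
  assume "y \<in> UQ0"
  hence "uact (x * y) vac J = uact x (\<lambda>J. tau y * vac J) J"
    by (simp add: uact_mult uact_UQ0_vac)
  thus ?thesis by (simp only: uact_scale)
qed

lemma tau_mult: "y \<in> UQ0 \<Longrightarrow> tau (x * y) = tau x * tau y"
  using uact_mult_vac[of y x "{}"] by (simp add: tau_def mult.commute)

lemma tau_h: "tau (h r) = s (qint r) / of_int r * Q powi (- r) * (\<Sum>j\<in>N. z j powi r)"
  by (simp add: tau_def vac_def h_eigen_def)

lemma hw_ideal_vac: "x \<in> hw_ideal (int (card N)) \<Longrightarrow> uact x vac J = 0"
proof (induction arbitrary: J rule: hw_ideal.induct)
  case (xp u k)
  have "xp_op k vac = (\<lambda>J. 0)" by (simp add: fun_eq_iff xp_op_eq vac_def)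
  hence "uact (xp k) vac = (\<lambda>J. 0)" by (simp add: fun_eq_iff)
  thus ?case by (simp add: uact_mult)
next
  case (KK u)
  have "uact (KK - scal (q powi int (card N))) vac = (\<lambda>J. 0)"
    by (simp add: fun_eq_iff uact_diff s_power vac_def height_def)
  thus ?case by (simp add: uact_mult)
qed (simp_all add: uact_add)

lemma tau_xm_span: "p \<in> xm_span \<Longrightarrow> tau p = 0"
  by (induction rule: xm_span.induct) (simp_all add: tau_def uact_add uact_mult xm_op_eq)

text \<open>The factors q^(\<epsilon> k) / [k] in the definition of \<open>Lam_series\<close> cancel
  those in the eigenvalue of \<open>h\<close>. The exponent becomes the sum of the logarithms of 1 -
  z j^\<epsilon> u.\<close>

lemma tau_Lam_series:
  assumes "\<epsilon> \<in> {1, -1}"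
  shows "tau (fps_nth (Lam_series \<epsilon>) n) = coeff (linear_product (\<lambda>j. z j powi \<epsilon>) N) n"
proof -
  let ?F = "Abs_fps (\<lambda>k. if k = 0 then 0 else - (scal (q powi (\<epsilon> * int k) / qint (int k)) * h (\<epsilon>
      * int k)))"
  have "tau (fps_nth (Lam_series \<epsilon>) n) = fps_nth (alg_exp s (Abs_fps (\<lambda>n. tau (fps_nth ?F n)))) n"
    unfolding Lam_series_def
    by (rule conjunct2, rule alg_exp_map[where A = UQ0])
      (auto simp: tau_add tau_mult UQ0_mult UQ0_uminus UQ0_add)
  also have "Abs_fps (\<lambda>n. tau (fps_nth ?F n)) = (\<Sum>j\<in>N. - neg_log (z j powi \<epsilon>))"
  proof (rule fps_ext)
    fix n
    have E: "s (qint (\<epsilon> * int n)) / of_int (\<epsilon> * int n) = s (qint (int n)) / of_nat n"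
      using assms by (auto simp: s_qint minus_divide_left)
    have AB: "Q powi (\<epsilon> * int n) * Q powi (- (\<epsilon> * int n)) = 1"
      by (simp flip: power_int_add)
    have zpow: "z j powi (\<epsilon> * int n) = (z j powi \<epsilon>) ^ n" for j
      by (simp add: power_int_mult)
    have gen: "a / d * (e * b * w) = w / k" if "a * b = 1" "e = d / k" "d \<noteq> 0" for a b d e w k :: 'a
      using that by (simp add: field_simps)
    have "s (q powi (\<epsilon> * int n) / qint (int n)) * (s (qint (\<epsilon> * int n)) / of_int (\<epsilon> * int n)
       * Q powi (- (\<epsilon> * int n)) * (\<Sum>j\<in>N. z j powi (\<epsilon> * int n)))
       = (\<Sum>j\<in>N. (z j powi \<epsilon>) ^ n) / of_nat n" if "n \<noteq> 0"
      unfolding s_divide s_powi zpow by (rule gen[OF AB E]) (use that in simp)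
    thus "fps_nth (Abs_fps (\<lambda>n. tau (fps_nth ?F n))) n = fps_nth (\<Sum>j\<in>N. - neg_log (z j powi \<epsilon>)) n"
      by (auto simp: tau_uminus tau_mult tau_h fps_sum_nth neg_log_def s_divide s_of_nat s_one
        sum_negf
          sum_divide_distrib s_inverse divide_inverse mult.commute[of "inverse (of_nat n)"]
              sum_distrib_right)
  qed
  also have "alg_exp s (\<Sum>j\<in>N. - neg_log (z j powi \<epsilon>))
      = fps_of_poly (linear_product (\<lambda>j. z j powi \<epsilon>) N)"
    by (simp add: alg_exp_sum alg_exp_minus_neg_log fps_of_linear_product)
  finally show ?thesis by simp
qed

lemma tau_Lam_pos: "tau (Lam (int n)) = coeff (linear_product z N) n"
  and tau_Lam_neg: "tau (Lam (- int n)) = coeff (linear_product (\<lambda>j. inverse (z j)) N) n"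
proof -
  show "tau (Lam (int n)) = coeff (linear_product z N) n"
    using tau_Lam_series[of 1 n] by (simp add: Lam_def)
  show "tau (Lam (- int n)) = coeff (linear_product (\<lambda>j. inverse (z j)) N) n"
  proof (cases "n = 0")
    case True
    thus ?thesis by (simp add: Lam_def Lam_series_def alg_exp_def coeff_linear_product_const)
  next
    case False
    thus ?thesis using tau_Lam_series[of "-1" n] by (simp add: Lam_def power_int_minus)
  qed
qed

lemma tau_Lam_vanish: "\<bar>r\<bar> > int (card N) \<Longrightarrow> tau (Lam r) = 0"
proof (cases r)
  case (nonneg n)
  assume "\<bar>r\<bar> > int (card N)"
  thus ?thesis using nonneg by (simp add: tau_Lam_pos coeff_linear_product_0)
next
  case (neg n)
  assume "\<bar>r\<bar> > int (card N)"
  thus ?thesis using neg tau_Lam_neg[of "Suc n"]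
      by (simp add: coeff_linear_product_0 del: of_nat_Suc)
qed

lemma tau_Lam_Lam:
  assumes "r \<le> card N"
  shows "tau (Lam (int (card N))) * tau (Lam (- int r)) = tau (Lam (int (card N) - int r))"
proof -
  have "int (card N) - int r = int (card N - r)" using assms by simp
  thus ?thesis using linear_product_reflect[of N z r] assms z_nonzero
    by (simp only: tau_Lam_pos tau_Lam_neg) simp
qed

text \<open>Applying \<open>X0\<close> and adding i to the set multiplies by u / (1 - z i u) and a
  constant. The dependence on u is therefore the same for all orders in which the elements of J are
  added, and only the constants \<open>C J\<close> add up.\<close>

lemma X0_power_vac: "\<exists>C. (\<forall>J. C J \<noteq> 0 \<longrightarrow> J \<subseteq> N \<and> card J = r) \<and>
    (\<forall>J. Abs_fps (\<lambda>k. uact (fps_nth (X0 ^ r) k) vac J)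
      = fps_const (C J) * fps_X ^ r * (\<Prod>i\<in>J. geom (z i)))"
proof (induction r)
  case 0
  have "Abs_fps (\<lambda>k. uact (fps_nth (X0 ^ 0) k) vac J)
      = fps_const (vac J) * fps_X ^ 0 * (\<Prod>i\<in>J. geom (z i))" for J
  proof -
    have "Abs_fps (\<lambda>k. uact (fps_nth (X0 ^ 0) k) vac J) = fps_const (vac J)"
      by (rule fps_ext) simp
    thus ?thesis by (cases "J = {}") (simp_all add: vac_def)
  qed
  moreover have "vac J \<noteq> 0 \<longrightarrow> J \<subseteq> N \<and> card J = 0" for J by (simp add: vac_def)
  ultimately show ?case by blast
next
  case (Suc r)
  then obtain C where C: "\<And>J. C J \<noteq> 0 \<Longrightarrow> J \<subseteq> N \<and> card J = r"
    and F: "\<And>J. Abs_fps (\<lambda>k. uact (fps_nth (X0 ^ r) k) vac J)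
      = fps_const (C J) * fps_X ^ r * (\<Prod>i\<in>J. geom (z i))" by blast
  let ?F = "\<lambda>r J. Abs_fps (\<lambda>k. uact (fps_nth (X0 ^ r) k) vac J)"
  define c where "c i J = (\<Prod>j\<in>N \<inter> J - {i}. pair_factor (inverse Q) i j)" for i J
  define C' where "C' J = (\<Sum>i\<in>N \<inter> J. c i J * C (J - {i}))" for J
  have X0: "uact (fps_nth X0 a) f J = (\<Sum>i\<in>N \<inter> J. c i J * fps_nth (fps_X * geom (z i)) a * f (J
      - {i}))" for a f J
    by (cases a) (simp_all add: X0_def xm_op_eq c_def algebra_simps)
  have "?F (Suc r) J = (\<Sum>i\<in>N \<inter> J. fps_const (c i J) * (fps_X * geom (z i) * ?F r (J - {i})))" for J
  proof (rule fps_ext)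
    fix k
    have "fps_nth (?F (Suc r) J) k
      = (\<Sum>a=0..k. \<Sum>i\<in>N \<inter> J. c i J * (fps_nth (fps_X * geom (z i)) a * fps_nth (?F r (J - {i})) (k
          - a)))"
      by (simp add: fps_mult_nth uact_sum uact_mult X0 mult.assoc)
    also have "\<dots> = (\<Sum>i\<in>N \<inter> J. c i J * fps_nth (fps_X * geom (z i) * ?F r (J - {i})) k)"
      by (subst sum.swap) (simp only: fps_mult_nth[of "fps_X * geom _"] sum_distrib_left)
    finally show "fps_nth (?F (Suc r) J) k
      = fps_nth (\<Sum>i\<in>N \<inter> J. fps_const (c i J) * (fps_X * geom (z i) * ?F r (J - {i}))) k"
      by (simp add: fps_sum_nth)
  qed
  moreover have "(\<Sum>i\<in>N \<inter> J. fps_const (c i J) * (fps_X * geom (z i) * ?F r (J - {i})))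
     = fps_const (C' J) * fps_X ^ Suc r * (\<Prod>i\<in>J. geom (z i))" for J
  proof -
    have "fps_const (c i J) * (fps_X * geom (z i) * ?F r (J - {i}))
      = fps_const (c i J * C (J - {i})) * fps_X ^ Suc r * (\<Prod>i\<in>J. geom (z i))" if i: "i \<in> N \<inter> J"
          for i
    proof (cases "C (J - {i}) = 0")
      case False
      \<comment> \<open>A product over an infinite set would be 1 by convention; the support of
        \<open>C\<close> excludes this, so the factor of i can be split off.\<close>
      hence "finite (J - {i})" using C finite_subset fin by blast
      hence "(\<Prod>j\<in>J. geom (z j)) = geom (z i) * (\<Prod>j\<in>J - {i}. geom (z j))"
        using i by (intro prod.remove) auto
      thus ?thesis by (simp add: F ac_simps flip: fps_const_mult)
    qed (simp add: F)
    thus ?thesis unfolding C'_def fps_const_sum sum_distrib_right by (rule sum.cong[OF refl])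
  qed
  moreover have "J \<subseteq> N \<and> card J = Suc r" if "C' J \<noteq> 0" for J
  proof -
    have "\<exists>i\<in>N \<inter> J. C (J - {i}) \<noteq> 0"
    proof (rule ccontr)
      assume "\<not> ?thesis"
      hence "C' J = 0" unfolding C'_def by (intro sum.neutral) simp
      thus False using that by simp
    qed
    then obtain i where i: "i \<in> N \<inter> J" "C (J - {i}) \<noteq> 0" by blast
    hence "J - {i} \<subseteq> N" "card (J - {i}) = r" using C by auto
    moreover hence "finite (J - {i})" using finite_subset fin by blast
    moreover have "J = insert i (J - {i})" using i by auto
    ultimately show ?thesis using i by (metis IntD1 card_insert_disjoint Diff_iff insertI1
        insert_subset)
  qed
  ultimately show ?case by (intro exI[of _ C']) auto
qed

text \<open>The factors 1 - z i u of the Lam series with i in J cancel the denominators. What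
  remains is u^r times a polynomial of degree at most \<open>card N - r\<close>.\<close>

lemma X0_power_Lam_vac:
  assumes "n > card N"
  shows "uact (fps_nth (X0 ^ r * Lam_series 1) n) vac J = 0"
proof -
  obtain C where C: "\<And>J. C J \<noteq> 0 \<Longrightarrow> J \<subseteq> N \<and> card J = r"
    and F: "\<And>J. Abs_fps (\<lambda>k. uact (fps_nth (X0 ^ r) k) vac J)
      = fps_const (C J) * fps_X ^ r * (\<Prod>i\<in>J. geom (z i))" using X0_power_vac by blast
  let ?L = "fps_of_poly (linear_product z N)"
  have "uact (fps_nth (X0 ^ r * Lam_series 1) n) vac J
    = fps_nth (Abs_fps (\<lambda>k. uact (fps_nth (X0 ^ r) k) vac J) * ?L) n"
    unfolding fps_mult_nth uact_sum
    by (rule sum.cong[OF refl]) (simp add: uact_mult_vac Lam_series_in_UQ0 tau_Lam_series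
      mult.commute)
  also have "\<dots> = fps_nth (fps_const (C J) * fps_X ^ r * (\<Prod>i\<in>J. geom (z i)) * ?L) n"
    by (simp only: F)
  also have "\<dots> = 0"
  proof (cases "C J = 0")
    case False
    hence J: "J \<subseteq> N" "card J = r" using C by auto
    have split: "?L = (\<Prod>j\<in>J. 1 - fps_const (z j) * fps_X) * fps_of_poly (linear_product z (N - J))"
      unfolding fps_of_linear_product using J
          by (subst prod.subset_diff[OF J(1) fin]) (simp add: mult.commute)
    have "fps_const (C J) * fps_X ^ r * (\<Prod>i\<in>J. geom (z i)) * ?L
      = fps_const (C J) * fps_X ^ r * (\<Prod>i\<in>J. geom (z i) * (1 - fps_const (z i) * fps_X))
        * fps_of_poly (linear_product z (N - J))"
      unfolding split by (simp add: prod.distrib ac_simps)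
    also have "\<dots> = fps_const (C J) * (fps_X ^ r * fps_of_poly (linear_product z (N - J)))"
      by (simp add: geom_mult mult.assoc)
    finally have eq: "fps_const (C J) * fps_X ^ r * (\<Prod>i\<in>J. geom (z i)) * ?L
       = fps_const (C J) * (fps_X ^ r * fps_of_poly (linear_product z (N - J)))" .
    have "card (N - J) = card N - r" using J by (simp add: card_Diff_subset finite_subset)
    moreover have "r \<le> card N" using J card_mono fin by blast
    ultimately show ?thesis using assms unfolding eq
      by (simp add: fps_X_power_mult_nth coeff_linear_product_0)
  qed simp
  finally show ?thesis .
qed

text \<open>For each i the sum over j is, up to a power of \<open>z i\<close>, the value of the
  product of the 1 - z j w at w = 1 / z i, where the factor of i vanishes.\<close>

lemma Xtilde_vac: "uact (Xtilde_Lam (card N) r) vac J = 0"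
proof -
  let ?c = "\<lambda>i. \<Prod>j\<in>N \<inter> J - {i}. pair_factor (inverse Q) i j"
  have root: "(\<Sum>j\<le>card N. z i powi (r - 1 - int j) * tau (Lam (int j))) = 0" if i: "i \<in> N" for i
  proof -
    have "(\<Sum>j\<le>card N. coeff (linear_product z N) j * inverse (z i) ^ j)
      = poly (linear_product z N) (inverse (z i))"
      unfolding poly_altdef using degree_linear_product_le[of z N]
      by (intro sum.mono_neutral_right) (auto simp: coeff_eq_0)
    also have "\<dots> = 0" using i z_nonzero fin by (auto simp: poly_linear_product intro!: bexI[of _ i])
    finally have "z i powi (r - 1) * (\<Sum>j\<le>card N. coeff (linear_product z N) j * inverse (z i) ^ j)
        = 0" by simp
    moreover have "z i powi (r - 1 - int j) = z i powi (r - 1) * inverse (z i) ^ j" for j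
      using i z_nonzero by (simp add: power_int_diff power_inverse divide_inverse)
    ultimately show ?thesis by (simp add: tau_Lam_pos sum_distrib_left ac_simps)
  qed
  have "uact (Xtilde_Lam (card N) r) vac J
    = (\<Sum>j\<le>card N. tau (Lam (int j)) * (\<Sum>i\<in>N \<inter> J. z i powi (r - 1 - int j) * ?c i * vac (J - {i})))"
    by (simp add: Xtilde_Lam_def uact_sum uact_mult_vac xm_op_eq)
  also have "\<dots> = (\<Sum>i\<in>N \<inter> J. (\<Sum>j\<le>card N. z i powi (r - 1 - int j) * tau (Lam (int j))) * (?c i
      * vac (J - {i})))"
    unfolding sum_distrib_left sum_distrib_right by (subst sum.swap) (simp only: ac_simps)
  also have "\<dots> = 0" by (simp add: root)
  finally show ?thesis .
qed

lemma Iq_gens_vac: "x \<in> Iq_gens (card N) \<Longrightarrow> uact x vac J = 0"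
proof (induction rule: Iq_gens.induct)
  case (xp k)
  show ?case using hw_ideal_vac[OF hw_ideal.xp, of 1 k J] by simp
next
  case KK
  show ?case using hw_ideal_vac[OF hw_ideal.KK, of 1 J] by simp
next
  case (Lam r)
  thus ?case by (simp add: uact_UQ0_vac tau_Lam_vanish)
next
  case (Lam_Lam r)
  have "tau (Lam (int (card N)) * Lam (- int r) - Lam (int (card N) - int r)) = 0"
    using Lam_Lam tau_Lam_Lam[of r] by (simp add: tau_diff tau_mult)
  moreover have "Lam (int (card N)) * Lam (- int r) - Lam (int (card N) - int r) \<in> UQ0"
    by (intro UQ0_diff UQ0_mult Lam_in_UQ0)
  ultimately show ?case by (simp add: uact_UQ0_vac)
next
  case (Xtilde y r)
  thus ?case by (simp add: uact_mult_vac Xtilde_vac)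
next
  case (X0_pow r n y)
  thus ?case by (simp add: uact_mult_vac X0_power_Lam_vac)
qed

lemma Iq_vac: "x \<in> Iq (card N) \<Longrightarrow> uact x vac J = 0"
proof -
  have "submodule {x. uact x vac = (\<lambda>J. 0)} UQ (left_regular UQ)"
    unfolding submodule_left_regular_iff by (auto simp: uact_add uact_mult intro!: ext)
  moreover have "Iq_gens (card N) \<subseteq> {x. uact x vac = (\<lambda>J. 0)}"
    using Iq_gens_vac by (auto simp: fun_eq_iff)
  ultimately have "Iq (card N) \<subseteq> {x. uact x vac = (\<lambda>J. 0)}" by (rule Iq_minimal)
  thus "x \<in> Iq (card N) \<Longrightarrow> uact x vac J = 0" by (auto simp: fun_eq_iff)
qed

end

section \<open>Homomorphisms from the Cartan part\<close>

lemma inv_type_algebra: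
  fixes x :: "'a::field"
  assumes "x \<noteq> 0"
  shows "inv\<^bsub>ring_of_type_algebra\<^esub> x = inverse x"
proof -
  interpret field "ring_of_type_algebra :: 'a ring" by (rule field_from_type_algebra)
  show ?thesis using assms
    by (intro comm_inv_char) (simp_all add: ring_of_type_algebra_def)
qed

lemma subfield_type_algebra_iff:
  "subfield L (ring_of_type_algebra :: 'a::field ring) \<longleftrightarrow>
    subring L (ring_of_type_algebra :: 'a ring) \<and> (\<forall>x\<in>L. inverse x \<in> L)"
proof -
  interpret field "ring_of_type_algebra :: 'a ring" by (rule field_from_type_algebra)
  have zero: "\<zero>\<^bsub>ring_of_type_algebra\<^esub> = (0::'a)" by (simp add: ring_of_type_algebra_def)
  show ?thesis
  proof
    assume L: "subfield L (ring_of_type_algebra :: 'a ring)"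
    note sub = subfieldE(1)[OF L]
    have "inverse x \<in> L" if "x \<in> L" for x
    proof (cases "x = 0")
      case True
      thus ?thesis using subring_type_algebraD(1)[OF sub] by simp
    next
      case False
      hence "inv\<^bsub>ring_of_type_algebra\<^esub> x \<in> L"
        using subfield_m_inv(1)[OF L, of x] that zero by auto
      thus ?thesis using inv_type_algebra[OF False] by simp
    qed
    thus "subring L (ring_of_type_algebra :: 'a ring) \<and> (\<forall>x\<in>L. inverse x \<in> L)" using sub by blast
  next
    assume L: "subring L (ring_of_type_algebra :: 'a ring) \<and> (\<forall>x\<in>L. inverse x \<in> L)"
    show "subfield L (ring_of_type_algebra :: 'a ring)"
      by (rule subfieldI') (use L zero in \<open>auto simp: inv_type_algebra\<close>)
  qed
qed

lemma subfield_Fpi: "subfield (Fpi \<pi>) (ring_of_type_algebra :: Kbar ring)"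
proof -
  have "subfield (\<Inter>T) (ring_of_type_algebra :: Kbar ring)"
    if "\<forall>L\<in>T. subfield L (ring_of_type_algebra :: Kbar ring)" for T
    unfolding subfield_type_algebra_iff
    by (intro conjI subring_type_algebraI ballI InterI)
      (use that[unfolded subfield_type_algebra_iff] subring_type_algebraD in \<open>meson InterD\<close>)+
  thus ?thesis unfolding Fpi_def by (rule hull_in)
qed

lemma Fpi_contains: "to_ac c \<in> Fpi \<pi>" "set \<pi> \<subseteq> Fpi \<pi>"
  using hull_subset[of "range to_ac \<union> set \<pi>"] unfolding Fpi_def by blast+

lemma Fpi_minimal:
  "subfield L (ring_of_type_algebra :: Kbar ring) \<Longrightarrow> range to_ac \<subseteq> L \<Longrightarrow> set \<pi> \<subseteq> L \<Longrightarrow> Fpi \<pi> \<subseteq> L"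
  unfolding Fpi_def by (rule hull_minimal) auto

lemmas Fpi_closed = subring_type_algebraD[OF subfieldE(1)[OF subfield_Fpi]]

lemma Fpi_inverse: "x \<in> Fpi \<pi> \<Longrightarrow> inverse x \<in> Fpi \<pi>"
  using subfield_Fpi subfield_type_algebra_iff by blast

text \<open>Take a polynomial relation for c and divide by c until its constant coefficient is
  nonzero; the relation then expresses 1/c as a polynomial in c.\<close>

lemma algebraic_subring_inverse:
  fixes L :: "Kbar set"
  assumes L: "subring L (ring_of_type_algebra :: Kbar ring)" "range to_ac \<subseteq> L" and c: "c \<in> L"
  shows "inverse c \<in> L"
proof (cases "c = 0")
  case True
  thus ?thesis using c by simp
next
  case False
  note closed = subring_type_algebraD[OF L(1)]
  have poly_in: "poly (map_poly to_ac p) c \<in> L" for p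
  proof (induction p)
    case (pCons a p)
    have "to_ac a + c * poly (map_poly to_ac p) c \<in> L"
      using pCons.IH c L(2) by (intro closed(3,4)) auto
    thus ?case by (simp add: map_poly_pCons)
  qed (simp add: closed)
  obtain p where "p \<noteq> 0" "poly (map_poly to_ac p) c = 0" by (rule alg_closure_algebraic)
  thus ?thesis
  proof (induction p)
    case (pCons a p)
    hence eq: "to_ac a + c * poly (map_poly to_ac p) c = 0" by (simp add: map_poly_pCons)
    show ?case
    proof (cases "a = 0")
      case True
      thus ?thesis using pCons eq False by auto
    next
      case a: False
      have "c * (- poly (map_poly to_ac p) c * to_ac (inverse a)) = 1"
      proof -
        have "c * poly (map_poly to_ac p) c = - to_ac a" using eq
            by (simp add: eq_neg_iff_add_eq_0 add.commute)
        thus ?thesis using a by (simp add: mult.assoc[symmetric])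
      qed
      hence "inverse c = - poly (map_poly to_ac p) c * to_ac (inverse a)" by (rule inverse_unique)
      moreover have "- poly (map_poly to_ac p) c * to_ac (inverse a) \<in> L"
        using poly_in L(2) by (intro closed(4,5)) (auto simp del: to_ac_inverse)
      ultimately show ?thesis by simp
    qed
  qed simp
qed

interpretation Kbar: Kq_scalars "to_ac :: Kq \<Rightarrow> Kbar"
  by unfold_locales simp_all

text \<open>The values of \<open>\<phi>\<close> outside \<open>UQ0\<close> are arbitrary.\<close>

definition UQ0_hom :: "(uq \<Rightarrow> Kbar) \<Rightarrow> bool" where
  "UQ0_hom \<phi> \<longleftrightarrow> (\<forall>c. \<phi> (scal c) = to_ac c) \<and>
    (\<forall>x\<in>UQ0. \<forall>y\<in>UQ0. \<phi> (x + y) = \<phi> x + \<phi> y \<and> \<phi> (x * y) = \<phi> x * \<phi> y)"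

lemma UQ0_homD:
  assumes "UQ0_hom \<phi>"
  shows "\<phi> (scal c) = to_ac c" "x \<in> UQ0 \<Longrightarrow> y \<in> UQ0 \<Longrightarrow> \<phi> (x + y) = \<phi> x + \<phi> y"
    "x \<in> UQ0 \<Longrightarrow> y \<in> UQ0 \<Longrightarrow> \<phi> (x * y) = \<phi> x * \<phi> y" "\<phi> 0 = 0" "\<phi> 1 = 1"
    "x \<in> UQ0 \<Longrightarrow> \<phi> (- x) = - \<phi> x" "x \<in> UQ0 \<Longrightarrow> y \<in> UQ0 \<Longrightarrow> \<phi> (x - y) = \<phi> x - \<phi> y"
proof -
  show scal: "\<phi> (scal c) = to_ac c" for c using assms by (simp add: UQ0_hom_def)
  show add: "x \<in> UQ0 \<Longrightarrow> y \<in> UQ0 \<Longrightarrow> \<phi> (x + y) = \<phi> x + \<phi> y" for x y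
    using assms by (simp add: UQ0_hom_def)
  show "x \<in> UQ0 \<Longrightarrow> y \<in> UQ0 \<Longrightarrow> \<phi> (x * y) = \<phi> x * \<phi> y" using assms by (simp add: UQ0_hom_def)
  show zero: "\<phi> 0 = 0" "\<phi> 1 = 1" using scal[of 0] scal[of 1] by simp_all
  show neg: "\<phi> (- x) = - \<phi> x" if "x \<in> UQ0" for x
    using add[OF UQ0_uminus[OF that] that] zero by (simp add: eq_neg_iff_add_eq_0)
  show "x \<in> UQ0 \<Longrightarrow> y \<in> UQ0 \<Longrightarrow> \<phi> (x - y) = \<phi> x - \<phi> y"
    using add[of x "- y"] neg by auto
qed

lemma UQ0_hom_alg_exp:
  assumes "UQ0_hom \<phi>" "\<And>n. fps_nth f n \<in> UQ0"
  shows "\<phi> (fps_nth (alg_exp scal f) n) = fps_nth (alg_exp to_ac (Abs_fps (\<lambda>n. \<phi> (fps_nth f n)))) n"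
  by (rule conjunct2, rule alg_exp_map[where A = UQ0])
    (use assms(2) UQ0_homD[OF assms(1)] in auto)

section \<open>Homomorphisms determined by their values on the Lam r\<close>

definition log_Lam :: "(uq \<Rightarrow> Kbar) \<Rightarrow> int \<Rightarrow> Kbar fps" where
  "log_Lam \<phi> \<epsilon> = Abs_fps (\<lambda>n. if n = 0 then 0
     else - (to_ac (q powi (\<epsilon> * int n) / qint (int n)) * \<phi> (h (\<epsilon> * int n))))"

lemma log_Lam_nth_0 [simp]: "fps_nth (log_Lam \<phi> \<epsilon>) 0 = 0"
  by (simp add: log_Lam_def)

lemma UQ0_hom_Lam_series:
  assumes "UQ0_hom \<phi>"
  shows "\<phi> (fps_nth (Lam_series \<epsilon>) n) = fps_nth (alg_exp to_ac (log_Lam \<phi> \<epsilon>)) n"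
proof -
  let ?F = "Abs_fps (\<lambda>k. if k = 0 then 0 else - (scal (q powi (\<epsilon> * int k) / qint (int k)) * h (\<epsilon>
      * int k)))"
  have "fps_nth ?F n \<in> UQ0" for n by (simp add: UQ0_mult UQ0_uminus)
  hence "\<phi> (fps_nth (Lam_series \<epsilon>) n) = fps_nth (alg_exp to_ac (Abs_fps (\<lambda>n. \<phi> (fps_nth ?F n)))) n"
    unfolding Lam_series_def by (rule UQ0_hom_alg_exp[OF assms])
  also have "Abs_fps (\<lambda>n. \<phi> (fps_nth ?F n)) = log_Lam \<phi> \<epsilon>"
    by (rule fps_ext) (simp add: log_Lam_def UQ0_homD[OF assms] UQ0_mult del: to_ac_divide)
  finally show ?thesis .
qed

lemma Lam_series_0: "fps_nth (Lam_series \<epsilon>) 0 = 1"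
  by (simp add: Lam_series_def alg_exp_def)

lemma Lam_0 [simp]: "Lam 0 = 1"
  by (simp add: Lam_def Lam_series_0)

lemma Lam_series_nth: "\<epsilon> \<in> {1, -1} \<Longrightarrow> fps_nth (Lam_series \<epsilon>) n = Lam (\<epsilon> * int n)"
  by (cases "n = 0") (auto simp: Lam_def Lam_series_0)

lemma h_from_log_Lam:
  assumes "n > 0" "\<epsilon> \<in> {1, -1}"
  shows "\<phi> (h (\<epsilon> * int n))
      = - (to_ac (qint (int n) / q powi (\<epsilon> * int n)) * fps_nth (log_Lam \<phi> \<epsilon>) n)"
proof -
  have "(qint (int n) / q powi (\<epsilon> * int n)) * (q powi (\<epsilon> * int n) / qint (int n)) = 1"
    using assms by simp
  hence "to_ac (qint (int n) / q powi (\<epsilon> * int n)) * to_ac (q powi (\<epsilon> * int n) / qint (int n)) = 1"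
    by (metis to_ac_mult to_ac_1)
  thus ?thesis using assms by (simp add: log_Lam_def mult.assoc[symmetric] del: to_ac_divide)
qed

text \<open>The logarithmic derivative recovers the exponent from the series of the
  \<open>Lam r\<close>, and the factors q^(\<epsilon> k) / [k] are invertible; so the values on the
  \<open>h r\<close> agree as well.\<close>

lemma UQ0_hom_eqI:
  assumes \<phi>: "UQ0_hom \<phi>" and \<phi>': "UQ0_hom \<phi>'" and Lam: "\<And>r. \<phi> (Lam r) = \<phi>' (Lam r)"
    and y: "y \<in> UQ0"
  shows "\<phi> y = \<phi>' y"
proof -
  have log: "log_Lam \<phi> \<epsilon> = log_Lam \<phi>' \<epsilon>" if \<epsilon>: "\<epsilon> \<in> {1, -1}" for \<epsilon>
  proof -
    let ?E = "alg_exp to_ac (log_Lam \<phi> \<epsilon>)"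
    have E: "?E = alg_exp to_ac (log_Lam \<phi>' \<epsilon>)"
      by (rule fps_ext)
        (simp add: Lam_series_nth[OF \<epsilon>] Lam flip: UQ0_hom_Lam_series[OF \<phi>] UQ0_hom_Lam_series[OF
            \<phi>'])
    have "fps_nth ?E 0 = 1" by (rule Kbar.alg_exp_nth_0)
    hence nz: "?E \<noteq> 0" by force
    have "fps_deriv (log_Lam \<phi> \<epsilon>) * ?E = fps_deriv (log_Lam \<phi>' \<epsilon>) * ?E"
      using Kbar.alg_exp_deriv[OF log_Lam_nth_0, of \<phi> \<epsilon>] Kbar.alg_exp_deriv[OF log_Lam_nth_0, of
        \<phi>' \<epsilon>] E
      by metis
    hence "fps_deriv (log_Lam \<phi> \<epsilon>) = fps_deriv (log_Lam \<phi>' \<epsilon>)" using nz mult_right_cancel by blast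
    thus ?thesis by (simp add: fps_deriv_eq_iff)
  qed
  have h: "\<phi> (h r) = \<phi>' (h r)" for r
  proof (cases r)
    case (nonneg n)
    thus ?thesis
      using h_from_log_Lam[of n 1 \<phi>] h_from_log_Lam[of n 1 \<phi>'] log[of 1] UQ0_homD(4)[OF \<phi>]
        UQ0_homD(4)[OF \<phi>']
      by (cases "n = 0") auto
  next
    case (neg n)
    thus ?thesis
      using h_from_log_Lam[of "Suc n" "-1" \<phi>] h_from_log_Lam[of "Suc n" "-1" \<phi>'] log[of "-1"]
      by (simp del: of_nat_Suc)
  qed
  show ?thesis using y
    by (induction rule: UQ0_induct) (simp_all add: h UQ0_homD[OF \<phi>] UQ0_homD[OF \<phi>'])
qed

text \<open>The equation E' = f' E is solved for the next coefficient of f: since E has constant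
  term 1, only sums, products and division by an integer occur, all of which stay in L.\<close>

lemma UQ0_hom_range:
  assumes \<phi>: "UQ0_hom \<phi>" and L: "subfield L (ring_of_type_algebra :: Kbar ring)" "range to_ac \<subseteq> L"
    and Lam: "\<And>r. \<phi> (Lam r) \<in> L" and y: "y \<in> UQ0"
  shows "\<phi> y \<in> L"
proof -
  note closed = subring_type_algebraD[OF subfieldE(1)[OF L(1)]]
  have inv: "x \<in> L \<Longrightarrow> inverse x \<in> L" for x using L(1) subfield_type_algebra_iff by blast
  have to_ac: "to_ac c \<in> L" for c using L(2) by blast
  have nat: "of_nat n \<in> L" for n using to_ac[of "of_nat n"] by simp
  have sum: "sum f I \<in> L" if "\<And>i. i \<in> I \<Longrightarrow> f i \<in> L" for f and I :: "nat set"
    using that by (induction I rule: infinite_finite_induct) (auto intro: closed)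
  have log: "fps_nth (log_Lam \<phi> \<epsilon>) n \<in> L" if \<epsilon>: "\<epsilon> \<in> {1, -1}" for \<epsilon> n
  proof (induction n rule: less_induct)
    case (less n)
    let ?f = "log_Lam \<phi> \<epsilon>" and ?E = "alg_exp to_ac (log_Lam \<phi> \<epsilon>)"
    have E: "fps_nth ?E k \<in> L" for k
      using Lam by (simp add: Lam_series_nth[OF \<epsilon>] flip: UQ0_hom_Lam_series[OF \<phi>])
    show ?case
    proof (cases n)
      case 0
      thus ?thesis by (simp add: closed)
    next
      case (Suc k)
      have "of_nat (Suc k) * fps_nth ?E (Suc k) = fps_nth (fps_deriv ?f * ?E) k"
        using arg_cong[OF Kbar.alg_exp_deriv[of ?f], of "\<lambda>F. fps_nth F k"] by simp
      also have "\<dots> = (\<Sum>i=0..k. of_nat (Suc i) * fps_nth ?f (Suc i) * fps_nth ?E (k - i))"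
        by (simp add: fps_mult_nth)
      also have "{0..k} = insert k {..<k}" by auto
      finally have "of_nat (Suc k) * fps_nth ?f (Suc k) = of_nat (Suc k) * fps_nth ?E (Suc k)
         + - (\<Sum>i<k. of_nat (Suc i) * fps_nth ?f (Suc i) * fps_nth ?E (k - i))"
        by (simp add: Kbar.alg_exp_nth_0)
      also have "\<dots> \<in> L"
        using less Suc by (intro closed sum nat E) auto
      finally have "of_nat (Suc k) * fps_nth ?f (Suc k) \<in> L" .
      hence "inverse (of_nat (Suc k)) * (of_nat (Suc k) * fps_nth ?f (Suc k)) \<in> L"
        by (rule closed(4)[OF inv[OF nat]])
      moreover have "inverse (of_nat (Suc k)) * (of_nat (Suc k) * fps_nth ?f (Suc k))
          = fps_nth ?f (Suc k)"
        by (subst mult.assoc[symmetric], subst left_inverse) (simp_all only: of_nat_eq_0_iff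
          nat.distinct
            not_False_eq_True mult_1_left)
      ultimately show ?thesis unfolding Suc by argo
    qed
  qed
  have h': "\<phi> (h (\<epsilon> * int n)) \<in> L" if "n > 0" "\<epsilon> \<in> {1, -1}" for n \<epsilon>
    unfolding h_from_log_Lam[OF that] by (intro closed to_ac log that(2))
  have h: "\<phi> (h r) \<in> L" for r
  proof (cases r)
    case (nonneg n)
    thus ?thesis using h'[of n 1] UQ0_homD(4)[OF \<phi>] closed(1) by (cases "n = 0") auto
  next
    case (neg n)
    thus ?thesis using h'[of "Suc n" "-1"] by (simp del: of_nat_Suc)
  qed
  show ?thesis using y
    by (induction rule: UQ0_induct) (simp_all add: h to_ac UQ0_homD[OF \<phi>] closed)
qed

lemma parameters_roots:
  assumes "\<pi> \<in> parameters m"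
  obtains a where "\<And>i. i < m \<Longrightarrow> a i \<noteq> 0"
    "\<And>i. i \<in> {1..m} \<Longrightarrow> coeff (linear_product a {..<m}) i = \<pi> ! (i - 1)"
proof -
  have len: "length \<pi> = m" and last: "m > 0 \<Longrightarrow> \<pi> ! (m - 1) \<noteq> 0"
    using assms by (auto simp: parameters_def)
  define p where "p = Poly (1 # \<pi>)"
  have coeff_p: "coeff p n = (if n = 0 then 1 else if n \<le> m then \<pi> ! (n - 1) else 0)" for n
    using len by (cases n) (auto simp: p_def nth_default_def)
  have p0: "coeff p 0 = 1" by (simp add: coeff_p)
  hence "p \<noteq> 0" by force
  have deg: "degree p = m"
  proof (rule order_antisym)
    show "degree p \<le> m" by (rule degree_le) (simp add: coeff_p)
    show "m \<le> degree p" by (rule le_degree) (use last in \<open>auto simp: coeff_p\<close>)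
  qed
  have lead: "lead_coeff (reflect_poly p) = 1" by (simp add: p0 coeff_reflect_poly)
  obtain A where A: "size A = degree (reflect_poly p)"
    "reflect_poly p = smult (lead_coeff (reflect_poly p)) (\<Prod>x\<in>#A. [:- x, 1:])"
    using alg_closed_imp_factorization[of "reflect_poly p"] \<open>p \<noteq> 0\<close> by auto
  have "size A = m" using A(1) deg p0 by simp
  obtain xs where xs: "mset xs = A" using ex_mset by blast
  have lenxs: "length xs = m" using xs \<open>size A = m\<close> by auto
  have "reflect_poly p = (\<Prod>i<m. [:- (xs ! i), 1:])"
  proof -
    have "reflect_poly p = prod_list (map (\<lambda>x. [:- x, 1:]) xs)"
      using A(2) lead by (simp add: xs[symmetric] prod_mset_prod_list flip: mset_map)
    also have "\<dots> = (\<Prod>i<m. [:- (xs ! i), 1:])"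
      by (simp add: prod.list_conv_set_nth lenxs lessThan_atLeast0)
    finally show ?thesis .
  qed
  moreover have "reflect_poly (reflect_poly p) = p" using p0 by simp
  ultimately have p: "p = (\<Prod>i<m. reflect_poly [:- (xs ! i), 1:])"
    by (metis reflect_poly_prod)
  have nz: "xs ! i \<noteq> 0" if i: "i < m" for i
  proof
    assume "xs ! i = 0"
    hence "coeff (reflect_poly p) 0 = 0"
      using i \<open>reflect_poly p = (\<Prod>i<m. [:- (xs ! i), 1:])\<close>
      by (auto simp: poly_prod simp flip: poly_0_coeff_0)
    thus False using \<open>p \<noteq> 0\<close> by simp
  qed
  have "p = linear_product (\<lambda>i. xs ! i) {..<m}"
    unfolding p linear_product_def by (rule prod.cong) (use nz in \<open>auto simp: reflect_poly_def\<close>)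
  thus ?thesis using that[of "\<lambda>i. xs ! i"] nz coeff_p by auto
qed

lemma coeff_linear_product_insert:
  assumes "finite M" "k \<notin> M"
  shows "coeff (linear_product c (insert k M)) n
    = coeff (linear_product c M) n - (if n
        = 0 then 0 else c k * coeff (linear_product c M) (n - 1))"
  using assms by (cases n) (simp_all add: linear_product_def)

text \<open>The coefficients have no pole, and setting the variable to 0 may be done before or after
  taking them.\<close>

lemma fps_to_fls_linear_product:
  assumes "finite M"
  shows "\<exists>g. coeff (linear_product (\<lambda>i. fps_to_fls (f i)) M) n = fps_to_fls g \<and>
    fps_nth g 0 = coeff (linear_product (\<lambda>i. fps_nth (f i) 0) M) n"
  using assms
proof (induction M arbitrary: n rule: finite_induct)
  case empty
  show ?case by (rule exI[of _ "if n = 0 then 1 else 0"]) (simp add: linear_product_def)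
next
  case (insert k M)
  obtain g where g: "coeff (linear_product (\<lambda>i. fps_to_fls (f i)) M) n = fps_to_fls g"
    "fps_nth g 0 = coeff (linear_product (\<lambda>i. fps_nth (f i) 0) M) n" using insert.IH by blast
  obtain g' where g': "coeff (linear_product (\<lambda>i. fps_to_fls (f i)) M) (n - 1) = fps_to_fls g'"
    "fps_nth g' 0 = coeff (linear_product (\<lambda>i. fps_nth (f i) 0) M) (n - 1)" using insert.IH by blast
  show ?case
    using insert.hyps g g'
    by (intro exI[of _ "g - (if n = 0 then 0 else f k * g')"])
      (simp add: coeff_linear_product_insert fls_times_fps_to_fls)
qed

text \<open>The roots may coincide, which the explicit module does not allow. We therefore work over the
  Laurent series in \<open>t\<close>, with \<open>z i = a i + (i + 1) t\<close>, and set \<open>t = 0\<close> in the top coefficient.\<close>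

lemma top_functional:
  assumes "\<pi> \<in> parameters m"
  obtains T where "UQ0_hom T" "\<And>x y. T (x + y) = T x + T y" "\<And>x y. y \<in> UQ0 \<Longrightarrow> T (x * y) = T x * T y"
    "\<And>x. x \<in> Iq m \<Longrightarrow> T x = 0" "\<And>p. p \<in> xm_span \<Longrightarrow> T p = 0"
    "\<And>i. i \<in> {1..m} \<Longrightarrow> T (Lam (int i)) = \<pi> ! (i - 1)"
proof -
  obtain a where a: "\<And>i. i < m \<Longrightarrow> a i \<noteq> 0"
    "\<And>i. i \<in> {1..m} \<Longrightarrow> coeff (linear_product a {..<m}) i = \<pi> ! (i - 1)"
    using parameters_roots[OF assms] by blast
  define f where "f i = fps_const (a i) + of_nat (Suc i) * fps_X" for i
  define z where "z i = fps_to_fls (f i)" for i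
  have f0: "fps_nth (f i) 0 = a i" and f1: "fps_nth (f i) 1 = of_nat (Suc i)" for i
    by (simp_all add: f_def del: of_nat_Suc)
  interpret subset_module "\<lambda>c. fls_const (to_ac c)" "{..<m}" z
  proof
    show "inj_on z {..<m}"
    proof (rule inj_onI)
      fix i j assume "z i = z j"
      hence "fps_nth (f i) 1 = fps_nth (f j) 1" by (simp add: z_def)
      thus "i = j" unfolding f1 of_nat_eq_iff by simp
    qed
    show "z i \<noteq> 0" if "i \<in> {..<m}" for i
      using a(1)[of i] that f0[of i] by (auto simp: z_def)
  qed (simp_all add: fls_const_mult_const flip: fls_plus_const)
  \<comment> \<open>Laurent series without polar part; only on these is the coefficient of degree 0
    multiplicative.\<close>
  let ?Reg = "range (fps_to_fls :: Kbar fps \<Rightarrow> Kbar fls)"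
  have reg_add: "x + y \<in> ?Reg" if "x \<in> ?Reg" "y \<in> ?Reg" for x y
    using that by (auto simp flip: fps_to_fls_plus)
  have reg_mult: "x * y \<in> ?Reg" "fls_nth (x * y) 0 = fls_nth x 0 * fls_nth y 0"
    if "x \<in> ?Reg" "y \<in> ?Reg" for x y
    using that by (auto simp flip: fls_times_fps_to_fls)
  have reg_const: "fls_const c \<in> ?Reg" for c
    by (metis fps_const_to_fls rangeI)
  have reg_pow: "x ^ n \<in> ?Reg" if "x \<in> ?Reg" for x n
    using that by (auto simp flip: fps_to_fls_power)
  have reg_z: "z i powi r \<in> ?Reg" if "i < m" for i r
  proof -
    have "z i \<in> ?Reg" by (simp add: z_def)
    moreover have "subdegree (f i) = 0" using a(1)[OF that] f0[of i] by simp
    hence "inverse (z i) \<in> ?Reg" unfolding z_def by (subst fls_inverse_fps_to_fls) simp_all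
    ultimately show ?thesis using reg_pow by (simp add: power_int_def)
  qed
  have reg_sum: "sum g I \<in> ?Reg" if "\<And>i. i \<in> I \<Longrightarrow> g i \<in> ?Reg" for g and I :: "nat set"
    using that reg_const[of 0] by (induction I rule: infinite_finite_induct) (auto intro!: reg_add)
  have reg_h: "tau (h r) \<in> ?Reg" for r
  proof -
    have "fls_const (to_ac (qint r)) / of_int r * (fls_const (to_ac q)) powi (- r)
       = fls_const (to_ac (qint r / of_int r * q powi (- r)))"
      using s_mult[of "qint r / of_int r" "q powi (- r)"] s_divide[of "qint r" "of_int r"]
        s_of_int[of r] s_powi[of q "- r"] by simp
    thus ?thesis unfolding tau_h by (simp only:) (intro reg_mult reg_const reg_sum reg_z, simp)
  qed
  have reg_UQ0: "tau y \<in> ?Reg" if "y \<in> UQ0" for y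
    using that
  proof (induction rule: UQ0_induct)
    case (uminus x)
    thus ?case by (auto simp: tau_uminus simp flip: fps_to_fls_uminus)
  qed (simp_all add: reg_h reg_const tau_add tau_mult reg_add reg_mult)
  \<comment> \<open>Although the coefficients of the operators have poles where roots collide,
    \<open>tau\<close> does not: each x has the same value as its component in \<open>UQ0\<close>,
    where only the eigenvalues of the \<open>h r\<close> enter.\<close>
  have reg: "tau x \<in> ?Reg" for x
  proof -
    obtain y p where y: "y \<in> UQ0" "p \<in> xm_span" "x - y - p \<in> hw_ideal (int m)"
      using top_component by blast
    have "tau (x - y - p) = 0" using hw_ideal_vac y(3) by (simp add: tau_def)
    hence "tau x = tau y" using tau_xm_span[OF y(2)] by (simp add: tau_diff)
    thus ?thesis using reg_UQ0[OF y(1)] by simp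
  qed
  define T where "T x = fls_nth (tau x) 0" for x
  show thesis
  proof
    show "T (x + y) = T x + T y" for x y by (simp add: T_def tau_add)
    show mult: "T (x * y) = T x * T y" if "y \<in> UQ0" for x y
      using that by (simp add: T_def tau_mult reg reg_mult)
    show "UQ0_hom T"
      unfolding UQ0_hom_def using mult by (simp add: T_def tau_add)
    show "T x = 0" if "x \<in> Iq m" for x
      using Iq_vac[of x "{}"] that by (simp add: T_def tau_def)
    show "T p = 0" if "p \<in> xm_span" for p
      using tau_xm_span[OF that] by (simp add: T_def)
    show "T (Lam (int i)) = \<pi> ! (i - 1)" if "i \<in> {1..m}" for i
    proof -
      obtain g where "coeff (linear_product z {..<m}) i = fps_to_fls g"
        "fps_nth g 0 = coeff (linear_product (\<lambda>i. fps_nth (f i) 0) {..<m}) i"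
        using fps_to_fls_linear_product[of "{..<m}" f i] unfolding z_def by blast
      thus ?thesis using a(2)[OF that] by (simp add: T_def tau_Lam_pos f0)
    qed
  qed
qed

section \<open>The Weyl ideal and the evaluation homomorphism\<close>

lemma hw_ideal_subset_Iq: "hw_ideal (int m) \<subseteq> Iq m"
proof
  have Iq: "0 \<in> Iq m" "\<And>x y. x \<in> Iq m \<Longrightarrow> y \<in> Iq m \<Longrightarrow> x + y \<in> Iq m" "\<And>a x. x \<in> Iq m \<Longrightarrow> a * x \<in> Iq m"
    using iffD1[OF submodule_left_regular_iff submodule_Iq[of m]] by auto
  fix x assume "x \<in> hw_ideal (int m)"
  thus "x \<in> Iq m"
  proof (induction rule: hw_ideal.induct)
    case (xp u k)
    thus ?case using Iq(3) Iq_gens_subset Iq_gens.xp by blast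
  next
    case (KK u)
    have "KK - scal (q powi int m) \<in> Iq m" using Iq_gens_subset Iq_gens.KK by auto
    thus ?case using Iq(3) by blast
  qed (use Iq in auto)
qed

text \<open>The last two families of generators carry a factor from \<open>UQ0\<close> for this
  purpose; the remaining ones are handled by commutativity and by \<open>hw_ideal_mult_UQ0\<close>.
  This yields the right action on \<open>Wq\<close>.\<close>

lemma Iq_mult_UQ0:
  assumes "x \<in> Iq m" "y \<in> UQ0"
  shows "x * y \<in> Iq m"
proof -
  note Iq = iffD1[OF submodule_left_regular_iff submodule_Iq[of m]]
  have left: "u * x \<in> Iq m" if "x \<in> Iq m" for u x using Iq that by blast
  have gens: "x * y \<in> Iq m" if "x \<in> Iq_gens m" for x
    using that
  proof cases
    case (xp k)
    thus ?thesis using hw_ideal_mult_UQ0[OF assms(2) hw_ideal.xp[of 1 k "int m"]]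
        hw_ideal_subset_Iq by auto
  next
    case KK
    thus ?thesis using hw_ideal_mult_UQ0[OF assms(2) hw_ideal.KK[of 1 "int m"]] hw_ideal_subset_Iq
        by auto
  next
    case (Lam r)
    have "y * Lam r \<in> Iq m" using Lam Iq_gens_subset Iq_gens.Lam by (intro left) blast
    thus ?thesis using Lam UQ0_commute[OF assms(2), of "Lam r"] by simp
  next
    case (Lam_Lam r)
    have "x \<in> UQ0" using Lam_Lam by (simp add: UQ0_diff UQ0_mult)
    moreover have "y * x \<in> Iq m" using that Iq_gens_subset by (intro left) blast
    ultimately show ?thesis using UQ0_commute[OF assms(2)] by simp
  next
    case (Xtilde y' r)
    hence "Xtilde_Lam m r * (y' * y) \<in> Iq_gens m" using assms(2) by (intro Iq_gens.Xtilde) auto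
    thus ?thesis using Xtilde Iq_gens_subset by (auto simp: mult.assoc)
  next
    case (X0_pow r s y')
    hence "fps_nth (X0 ^ r * Lam_series 1) s * (y' * y) \<in> Iq_gens m"
      using assms(2) by (intro Iq_gens.X0_pow) auto
    thus ?thesis using X0_pow Iq_gens_subset by (auto simp: mult.assoc)
  qed
  have "submodule {x. x * y \<in> Iq m} UQ (left_regular UQ)"
    unfolding submodule_left_regular_iff using Iq by (auto simp: distrib_right mult.assoc)
  hence "Iq m \<subseteq> {x. x * y \<in> Iq m}" using gens by (intro Iq_minimal) auto
  thus ?thesis using assms(1) by blast
qed

text \<open>The relations of \<open>Iq0\<close> leave no freedom: negative indices are obtained by
  division by the value of \<open>Lam m\<close>. The index -m is singled out because there the
  numerator is \<open>Lam 0 = 1\<close>, which is not an entry of \<pi>.\<close>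

lemma Lam_values:
  assumes \<phi>: "UQ0_hom \<phi>" and \<pi>: "\<pi> \<in> parameters m"
    and pos: "\<And>i. i \<in> {1..m} \<Longrightarrow> \<phi> (Lam (int i)) = \<pi> ! (i - 1)"
    and large: "\<And>r. \<bar>r\<bar> > int m \<Longrightarrow> \<phi> (Lam r) = 0"
    and refl: "\<And>r. 1 \<le> r \<Longrightarrow> r \<le> m \<Longrightarrow>
      \<phi> (Lam (int m)) * \<phi> (Lam (- int r)) = \<phi> (Lam (int m - int r))"
  shows "\<phi> (Lam r) = (if \<bar>r\<bar> > int m then 0 else if r = 0 then 1
    else if r > 0 then \<pi> ! (nat r - 1)
    else (if r = - int m then 1 else \<pi> ! (nat (int m + r) - 1)) / \<pi> ! (m - 1))"
proof -
  consider "\<bar>r\<bar> > int m" | "r = 0" | "r > 0" "r \<le> int m" | "r < 0" "- r \<le> int m" by linarith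
  thus ?thesis
  proof cases
    case 3
    hence "int (nat r) = r" "nat r \<in> {1..m}" by auto
    thus ?thesis using pos[of "nat r"] 3 by simp
  next
    case 4
    let ?k = "nat (- r)"
    have k: "1 \<le> ?k" "?k \<le> m" "r = - int ?k" "m > 0" using 4 by auto
    have "\<phi> (Lam (int m)) = \<pi> ! (m - 1)" using pos[of m] k by simp
    moreover have "\<pi> ! (m - 1) \<noteq> 0" using \<pi> k by (simp add: parameters_def)
    moreover have "\<phi> (Lam (int m - int ?k)) = (if r
        = - int m then 1 else \<pi> ! (nat (int m + r) - 1))"
    proof (cases "r = - int m")
      case True
      hence "int m - int ?k = 0" by simp
      hence "Lam (int m - int ?k) = 1" by (simp only: Lam_0)
      thus ?thesis using True UQ0_homD(5)[OF \<phi>] by simp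
    next
      case False
      hence "int m - int ?k = int (nat (int m + r))" "nat (int m + r) \<in> {1..m}" using 4 by auto
      thus ?thesis using pos[of "nat (int m + r)"] False by simp
    qed
    ultimately have "\<phi> (Lam r) = (if r
        = - int m then 1 else \<pi> ! (nat (int m + r) - 1)) / \<pi> ! (m - 1)"
      using refl[OF k(1,2)] k(3) by (simp add: field_simps)
    thus ?thesis using 4 by auto
  qed (use large UQ0_homD(5)[OF \<phi>] in auto)
qed

lemma subring_UQ0: "subring UQ0 UQ"
  by (rule subring_type_algebraI) auto

lemma ring_UQ0: "ring (UQ\<lparr>carrier := UQ0\<rparr>)"
  by (rule ring.subring_is_ring[OF ring_type_algebra subring_UQ0])

lemma Iq0_gens_in_Iq0:
  shows "\<bar>r\<bar> > int m \<Longrightarrow> Lam r \<in> Iq0 m"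
    and "1 \<le> k \<Longrightarrow> k \<le> m \<Longrightarrow> Lam (int m) * Lam (- int k) - Lam (int m - int k) \<in> Iq0 m"
  unfolding Iq0_def genideal_def by blast+

lemma Iq0_vanish:
  assumes \<phi>: "UQ0_hom \<phi>" and large: "\<And>r. \<bar>r\<bar> > int m \<Longrightarrow> \<phi> (Lam r) = 0"
    and refl: "\<And>r. 1 \<le> r \<Longrightarrow> r \<le> m \<Longrightarrow>
      \<phi> (Lam (int m)) * \<phi> (Lam (- int r)) = \<phi> (Lam (int m - int r))"
    and y: "y \<in> Iq0 m"
  shows "y \<in> UQ0 \<and> \<phi> y = 0"
proof -
  let ?R = "UQ\<lparr>carrier := UQ0\<rparr>"
  interpret R: ring ?R by (rule ring_UQ0)
  have "ideal {y \<in> UQ0. \<phi> y = 0} ?R"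
  proof (rule idealI[OF ring_UQ0])
    show "subgroup {y \<in> UQ0. \<phi> y = 0} (add_monoid ?R)"
    proof (rule group.subgroupI)
      show "group (add_monoid ?R)" by (rule R.a_group)
    next
      fix a assume a: "a \<in> {y \<in> UQ0. \<phi> y = 0}"
      have "\<ominus>\<^bsub>?R\<^esub> a = - a"
        using a by (intro R.minus_equality) (auto simp: ring_of_type_algebra_def)
      with a show "inv\<^bsub>add_monoid ?R\<^esub> a \<in> {y \<in> UQ0. \<phi> y = 0}"
        using UQ0_homD(6)[OF \<phi>] by (auto simp: a_inv_def)
    qed (use UQ0_homD[OF \<phi>] in \<open>auto simp: ring_of_type_algebra_def intro!: exI[of _ 0]\<close>)
  qed (use UQ0_homD[OF \<phi>] in \<open>auto simp: ring_of_type_algebra_def\<close>)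
  moreover have "{Lam r | r. \<bar>r\<bar> > int m} \<union>
      {Lam (int m) * Lam (- int r) - Lam (int m - int r) | r. 1 \<le> r \<and> r \<le> m}
      \<subseteq> {y \<in> UQ0. \<phi> y = 0}"
    using large refl by (auto simp: UQ0_homD[OF \<phi>] UQ0_diff UQ0_mult)
  ultimately show ?thesis using y unfolding Iq0_def genideal_def by blast
qed

text \<open>Any two candidates agree on all \<open>Lam r\<close> by \<open>Lam_values\<close>, hence
  on \<open>UQ0\<close>. This identifies the description by \<open>THE\<close> with the restriction
  of a homomorphism that is at hand.\<close>

lemma eval_hom_eq:
  assumes \<phi>: "UQ0_hom \<phi>" and \<pi>: "\<pi> \<in> parameters m"
    and pos: "\<And>i. i \<in> {1..m} \<Longrightarrow> \<phi> (Lam (int i)) = \<pi> ! (i - 1)"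
    and large: "\<And>r. \<bar>r\<bar> > int m \<Longrightarrow> \<phi> (Lam r) = 0"
    and refl: "\<And>r. 1 \<le> r \<Longrightarrow> r \<le> m \<Longrightarrow>
      \<phi> (Lam (int m)) * \<phi> (Lam (- int r)) = \<phi> (Lam (int m - int r))"
  shows "eval_hom m \<pi> = restrict \<phi> UQ0" and "y \<in> UQ0 \<Longrightarrow> \<phi> y \<in> Fpi \<pi>"
proof -
  have Lam: "\<phi> (Lam r) \<in> Fpi \<pi>" for r
  proof -
    have \<pi>_in: "\<pi> ! i \<in> Fpi \<pi>" if "i < m" for i
      using \<pi> that Fpi_contains(2)[of \<pi>] by (auto simp: parameters_def)
    have div: "x / y \<in> Fpi \<pi>" if "x \<in> Fpi \<pi>" "y \<in> Fpi \<pi>" for x y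
      using that by (simp add: divide_inverse Fpi_closed Fpi_inverse)
    have "\<phi> (Lam r) = (if \<bar>r\<bar> > int m then 0 else if r = 0 then 1
      else if r > 0 then \<pi> ! (nat r - 1)
      else (if r = - int m then 1 else \<pi> ! (nat (int m + r) - 1)) / \<pi> ! (m - 1))"
      by (rule Lam_values[OF \<phi> \<pi> pos large refl])
    thus ?thesis by (auto simp: Fpi_closed intro!: div \<pi>_in)
  qed
  show range: "\<phi> y \<in> Fpi \<pi>" if "y \<in> UQ0" for y
    using UQ0_hom_range[OF \<phi> subfield_Fpi _ Lam that] Fpi_contains(1) by blast
  have "is_eval_hom m \<pi> (restrict \<phi> UQ0)"
    unfolding is_eval_hom_def
  proof (intro conjI allI ballI)
    show "restrict \<phi> UQ0 \<in> ring_hom (UQ\<lparr>carrier := UQ0\<rparr>) (ring_of_type_algebra\<lparr>carrier := Fpi \<pi>\<rparr>)"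
      by (rule ring_hom_memI) (use range UQ0_homD[OF \<phi>] in \<open>auto simp: ring_of_type_algebra_def\<close>)
    fix y assume "y \<in> Iq0 m"
    thus "restrict \<phi> UQ0 y = 0"
      using Iq0_vanish[OF \<phi> large refl] by simp
  qed (use pos UQ0_homD[OF \<phi>] in auto)
  moreover have "\<phi>' = restrict \<phi> UQ0" if \<phi>': "is_eval_hom m \<pi> \<phi>'" for \<phi>'
  proof -
    have hom': "UQ0_hom \<phi>'"
    proof -
      have hom: "\<phi>' \<in> ring_hom (UQ\<lparr>carrier := UQ0\<rparr>) (ring_of_type_algebra\<lparr>carrier := Fpi \<pi>\<rparr>)"
        and "\<And>c. \<phi>' (scal c) = to_ac c"
        using \<phi>' by (auto simp: is_eval_hom_def)
      thus ?thesis
        unfolding UQ0_hom_def using ring_hom_add[OF hom] ring_hom_mult[OF hom]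
        by (simp add: ring_of_type_algebra_def)
    qed
    have pos': "\<phi>' (Lam (int i)) = \<pi> ! (i - 1)" if "i \<in> {1..m}" for i
      using \<phi>' that by (auto simp: is_eval_hom_def)
    have large': "\<phi>' (Lam r) = 0" if "\<bar>r\<bar> > int m" for r
      using \<phi>' Iq0_gens_in_Iq0(1)[OF that] by (auto simp: is_eval_hom_def)
    have refl': "\<phi>' (Lam (int m)) * \<phi>' (Lam (- int r)) = \<phi>' (Lam (int m - int r))"
      if "1 \<le> r" "r \<le> m" for r
    proof -
      have "\<phi>' (Lam (int m) * Lam (- int r) - Lam (int m - int r)) = 0"
        using \<phi>' Iq0_gens_in_Iq0(2)[OF that] unfolding is_eval_hom_def by blast
      thus ?thesis by (simp add: UQ0_homD[OF hom'] UQ0_mult)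
    qed
    have "\<phi>' y = \<phi> y" if "y \<in> UQ0" for y
      by (rule UQ0_hom_eqI[OF hom' \<phi> _ that])
        (simp only: Lam_values[OF hom' \<pi> pos' large' refl'] Lam_values[OF assms])
    moreover have "\<phi>' \<in> extensional UQ0" using \<phi>' by (simp add: is_eval_hom_def)
    ultimately show ?thesis by (intro extensionalityI[of _ UQ0]) auto
  qed
  ultimately show "eval_hom m \<pi> = restrict \<phi> UQ0"
    unfolding eval_hom_def by (intro the_equality)
qed

lemma UQ0_hom_image_subfield:
  assumes \<phi>: "UQ0_hom \<phi>"
  shows "subfield (\<phi> ` UQ0) (ring_of_type_algebra :: Kbar ring)"
proof -
  have sub: "subring (\<phi> ` UQ0) (ring_of_type_algebra :: Kbar ring)"
  proof (rule subring_type_algebraI)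
    show "0 \<in> \<phi> ` UQ0" "1 \<in> \<phi> ` UQ0"
      using UQ0_homD(4,5)[OF \<phi>] by (auto intro: image_eqI[of _ _ 0] image_eqI[of _ _ 1])
    show "x + y \<in> \<phi> ` UQ0" "x * y \<in> \<phi> ` UQ0" if "x \<in> \<phi> ` UQ0" "y \<in> \<phi> ` UQ0" for x y
      using that by (auto simp flip: UQ0_homD(2,3)[OF \<phi>])
    show "- x \<in> \<phi> ` UQ0" if "x \<in> \<phi> ` UQ0" for x
      using that by (auto simp flip: UQ0_homD(6)[OF \<phi>])
  qed
  moreover have "range to_ac \<subseteq> \<phi> ` UQ0"
    using UQ0_homD(1)[OF \<phi>] by (auto intro!: image_eqI[of _ _ "scal _"])
  ultimately show ?thesis
    unfolding subfield_type_algebra_iff using algebraic_subring_inverse by blast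
qed

lemma UQ0_hom_onto_Fpi:
  assumes \<phi>: "UQ0_hom \<phi>" and \<pi>: "\<pi> \<in> parameters m"
    and pos: "\<And>i. i \<in> {1..m} \<Longrightarrow> \<phi> (Lam (int i)) = \<pi> ! (i - 1)"
  shows "Fpi \<pi> \<subseteq> \<phi> ` UQ0"
proof (rule Fpi_minimal[OF UQ0_hom_image_subfield[OF \<phi>]])
  show "range to_ac \<subseteq> \<phi> ` UQ0"
    using UQ0_homD(1)[OF \<phi>] by (auto intro!: image_eqI[of _ _ "scal _"])
  show "set \<pi> \<subseteq> \<phi> ` UQ0"
  proof
    fix x assume "x \<in> set \<pi>"
    then obtain i where "i < m" "x = \<pi> ! i" using \<pi> by (auto simp: in_set_conv_nth parameters_def)
    thus "x \<in> \<phi> ` UQ0" using pos[of "Suc i"] by (auto intro!: image_eqI[of _ _ "Lam (int (Suc i))"])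
  qed
qed

section \<open>The top space of the Weyl modules\<close>

lemma operator_quotient_Iq: "operator_quotient (left_regular UQ) (Iq m)"
proof -
  interpret UQ_module "left_regular UQ" by (simp add: UQ_module_iff left_module_left_regular)
  show ?thesis by (rule operator_quotient[OF submodule_Iq])
qed

lemmas Iq_abelian_group = operator_quotient.abelian_group[OF operator_quotient_Iq]
  and Iq_coset_eq_iff = operator_quotient.coset_eq_iff[OF operator_quotient_Iq]
  and Iq_coset_self = operator_quotient.coset_self[OF operator_quotient_Iq]
  and Iq_carrier_Q = operator_quotient.carrier_Q[OF operator_quotient_Iq]
  and Iq_add_Q = operator_quotient.add_Q[OF operator_quotient_Iq]
  and Iq_smult_Q = operator_quotient.smult_Q[OF operator_quotient_Iq]
  and Iq_left_module_Q = operator_quotient.left_module_Q[OF operator_quotient_Iq]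

abbreviation coset_Iq :: "nat \<Rightarrow> uq \<Rightarrow> uq set" where
  "coset_Iq m x \<equiv> Iq m +>\<^bsub>left_regular UQ\<^esub> x"

lemma left_regular_simps [simp]: "carrier (left_regular UQ) = UNIV" "x \<oplus>\<^bsub>left_regular UQ\<^esub> y = x + y"
  "\<zero>\<^bsub>left_regular UQ\<^esub> = 0" "a \<odot>\<^bsub>left_regular UQ\<^esub> x = a * x"
  by (simp_all add: left_regular_def)

lemma left_regular_minus [simp]: "x \<ominus>\<^bsub>left_regular UQ\<^esub> y = x - y"
proof -
  interpret abelian_group "left_regular UQ" by (rule Iq_abelian_group)
  have "\<ominus>\<^bsub>left_regular UQ\<^esub> y = - y"
    using minus_equality[of "- y" y] by simp
  thus ?thesis by (simp add: minus_eq)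
qed

lemma UQ_module_Wq: "UQ_module (Wq m)"
  unfolding Wq_def by (simp add: UQ_module_iff Iq_left_module_Q)

lemma carrier_Wq: "carrier (Wq m) = range (coset_Iq m)"
  by (simp add: Wq_def Iq_carrier_Q)

lemma coset_Iq_in_Wq [simp]: "coset_Iq m x \<in> carrier (Wq m)"
  by (simp add: carrier_Wq)

lemma add_Wq [simp]: "coset_Iq m x \<oplus>\<^bsub>Wq m\<^esub> coset_Iq m y = coset_Iq m (x + y)"
  using Iq_add_Q[of x y m] by (simp add: Wq_def)

lemma smult_Wq [simp]: "a \<odot>\<^bsub>Wq m\<^esub> coset_Iq m x = coset_Iq m (a * x)"
  using Iq_smult_Q[where v = x and a = a and m = m] by (simp add: Wq_def)

lemma coset_Iq_eq_iff: "coset_Iq m x = coset_Iq m y \<longleftrightarrow> x - y \<in> Iq m"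
  using Iq_coset_eq_iff[of x y m] by simp

lemma mem_coset_Iq: "x \<in> coset_Iq m y \<longleftrightarrow> x - y \<in> Iq m"
  by (auto simp: a_r_coset_def' image_iff algebra_simps intro: bexI[of _ "x - y"])

lemma Wq_ract_coset:
  assumes "y \<in> UQ0"
  shows "Wq_ract m (coset_Iq m x) y = coset_Iq m (x * y)"
proof -
  have eq: "Iq m +>\<^bsub>UQ\<^esub> u = coset_Iq m u" for u
    by (simp add: a_r_coset_def')
  have "coset_Iq m (x' * y) = coset_Iq m (x * y)" if "x' \<in> coset_Iq m x" for x'
    using that Iq_mult_UQ0[OF _ assms, of "x' - x" m]
    by (simp add: coset_Iq_eq_iff mem_coset_Iq left_diff_distrib)
  moreover have "x \<in> coset_Iq m x" using Iq_coset_self[of x m] by simp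
  ultimately show ?thesis unfolding Wq_ract_def eq by blast
qed

text \<open>T is the functional of \<open>top_functional\<close>. It is multiplicative only for
  right factors from \<open>UQ0\<close>, which is exactly the compatibility with the balancing
  relations.\<close>

locale eval_parameters =
  fixes m :: nat and \<pi> :: "Kbar list" and T :: "uq \<Rightarrow> Kbar"
  assumes \<pi>: "\<pi> \<in> parameters m" and T_hom: "UQ0_hom T"
    and T_add: "T (x + y) = T x + T y"
    and T_mult: "y \<in> UQ0 \<Longrightarrow> T (x * y) = T x * T y"
    and T_Iq: "x \<in> Iq m \<Longrightarrow> T x = 0"
    and T_xm_span: "p \<in> xm_span \<Longrightarrow> T p = 0"
    and T_Lam: "i \<in> {1..m} \<Longrightarrow> T (Lam (int i)) = \<pi> ! (i - 1)"
begin

interpretation Wq: UQ_module "Wq m"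
  by (rule UQ_module_Wq)

lemma T_minus: "T (- x) = - T x"
  using T_add[of "- x" x] UQ0_homD(4)[OF T_hom] by (simp add: eq_neg_iff_add_eq_0)

lemma T_diff: "T (x - y) = T x - T y"
  using T_add[of x "- y"] T_minus[of y] by simp

lemma T_large: "\<bar>r\<bar> > int m \<Longrightarrow> T (Lam r) = 0"
  using T_Iq Iq_gens_subset Iq_gens.Lam by blast

lemma T_refl:
  assumes "1 \<le> r" "r \<le> m"
  shows "T (Lam (int m)) * T (Lam (- int r)) = T (Lam (int m - int r))"
proof -
  have "T (Lam (int m) * Lam (- int r) - Lam (int m - int r)) = 0"
    using assms T_Iq Iq_gens_subset Iq_gens.Lam_Lam by blast
  thus ?thesis by (simp add: T_diff T_mult)
qed

lemma eval_hom_T: "y \<in> UQ0 \<Longrightarrow> eval_hom m \<pi> y = T y"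
  using eval_hom_eq(1)[OF T_hom \<pi> T_Lam T_large T_refl] by simp

lemma T_in_Fpi: "y \<in> UQ0 \<Longrightarrow> T y \<in> Fpi \<pi>"
  by (rule eval_hom_eq(2)[OF T_hom \<pi> T_Lam T_large T_refl])

lemma Fpi_T: "f \<in> Fpi \<pi> \<Longrightarrow> \<exists>y\<in>UQ0. f = T y"
  using UQ0_hom_onto_Fpi[OF T_hom \<pi> T_Lam] by blast

section \<open>The tensor product with the field of the parameters\<close>

abbreviation F where "F \<equiv> Fpi_module m \<pi>"
definition TF where "TF = tensor_free (Wq m) F"
abbreviation S0 where "S0 \<equiv> UQ\<lparr>carrier := UQ0\<rparr>"
abbreviation rels where "rels \<equiv> tensor_relators (Wq m) (Wq_ract m) S0 F"

lemma F_simps [simp]: "carrier F = Fpi \<pi>" "f \<oplus>\<^bsub>F\<^esub> g = f + g"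
  "y \<in> UQ0 \<Longrightarrow> y \<odot>\<^bsub>F\<^esub> f = T y * f"
  by (simp_all add: Fpi_module_def eval_hom_T)

lemma TF_simps [simp]: "carrier TF = {c. Poly_Mapping.keys c \<subseteq> carrier (Wq m) \<times> Fpi \<pi>}"
  "c \<oplus>\<^bsub>TF\<^esub> d = c + d" "\<zero>\<^bsub>TF\<^esub> = 0"
  "a \<odot>\<^bsub>TF\<^esub> c = frag_extend (\<lambda>(w, f). frag_of (a \<odot>\<^bsub>Wq m\<^esub> w, f)) c"
  by (auto simp: TF_def tensor_free_def)

lemma abelian_group_TF: "abelian_group TF"
proof (rule abelian_groupI)
  fix c assume c: "c \<in> carrier TF"
  thus "\<exists>d\<in>carrier TF. d \<oplus>\<^bsub>TF\<^esub> c = \<zero>\<^bsub>TF\<^esub>"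
    by (intro bexI[of _ "- c"]) auto
  fix d assume "d \<in> carrier TF"
  thus "c \<oplus>\<^bsub>TF\<^esub> d \<in> carrier TF"
    using c keys_add[of c d] by auto
qed (auto simp: algebra_simps)

interpretation TF: abelian_group TF
  by (rule abelian_group_TF)

lemma TF_minus: "c \<in> carrier TF \<Longrightarrow> d \<in> carrier TF \<Longrightarrow> c \<ominus>\<^bsub>TF\<^esub> d = c - d"
proof -
  assume "c \<in> carrier TF" "d \<in> carrier TF"
  moreover hence "\<ominus>\<^bsub>TF\<^esub> d = - d" by (intro TF.minus_equality) auto
  ultimately show ?thesis by (simp add: TF.minus_eq)
qed

definition G where "G = generate (add_monoid TF) rels"

lemma rels_subset: "rels \<subseteq> carrier TF"
proof
  fix c assume "c \<in> rels"
  thus "c \<in> carrier TF"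
  proof cases
    case (add_left w w' f)
    thus ?thesis
      using keys_diff[of "frag_of (w \<oplus>\<^bsub>Wq m\<^esub> w', f)" "frag_of (w, f)"]
        keys_diff[of "frag_of (w \<oplus>\<^bsub>Wq m\<^esub> w', f) - frag_of (w, f)" "frag_of (w', f)"]
      by auto
  next
    case (add_right w f f')
    thus ?thesis
      using keys_diff[of "frag_of (w, f + f')" "frag_of (w, f)"] Fpi_closed(3)[of f \<pi> f']
        keys_diff[of "frag_of (w, f + f') - frag_of (w, f)" "frag_of (w, f')"]
      by auto
  next
    case (balanced w s f)
    obtain x where "w = coset_Iq m x" using balanced by (auto simp: carrier_Wq)
    hence "Wq_ract m w s \<in> carrier (Wq m)" using balanced by (simp add: Wq_ract_coset)
    moreover have "T s * f \<in> Fpi \<pi>" using balanced T_in_Fpi Fpi_closed(4) by simp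
    ultimately show ?thesis
      using balanced keys_diff[of "frag_of (Wq_ract m w s, f)" "frag_of (w, T s * f)"] by auto
  qed
qed

lemma subgroup_G: "subgroup G (add_monoid TF)"
  unfolding G_def using rels_subset by (intro group.generate_is_subgroup[OF TF.a_group]) simp

lemma G_closed: "0 \<in> G" "c \<in> G \<Longrightarrow> d \<in> G \<Longrightarrow> c + d \<in> G" "c \<in> G \<Longrightarrow> - c \<in> G" "c \<in> rels \<Longrightarrow> c \<in> G"
    "c \<in> G \<Longrightarrow> c \<in> carrier TF" "c \<in> G \<Longrightarrow> d \<in> G \<Longrightarrow> c - d \<in> G"
proof -
  show zero: "0 \<in> G" using subgroup.one_closed[OF subgroup_G] by simp
  show add: "c + d \<in> G" if "c \<in> G" "d \<in> G" for c d
    using subgroup.m_closed[OF subgroup_G that] by simp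
  show sub: "c \<in> carrier TF" if "c \<in> G" for c
    using subgroup.subset[OF subgroup_G] that by auto
  show neg: "- c \<in> G" if "c \<in> G" for c
  proof -
    have "\<ominus>\<^bsub>TF\<^esub> c = - c" using sub[OF that] by (intro TF.minus_equality) auto
    thus ?thesis using subgroup.m_inv_closed[OF subgroup_G that] by (simp add: a_inv_def)
  qed
  show "c \<in> rels \<Longrightarrow> c \<in> G" unfolding G_def by (rule generate.incl)
  show "c \<in> G \<Longrightarrow> d \<in> G \<Longrightarrow> c - d \<in> G" using add[of c "- d"] neg by simp
qed

lemma G_induct [consumes 1, case_names zero rel diff]:
  assumes "c \<in> G" "P 0" "\<And>c. c \<in> rels \<Longrightarrow> P c" "\<And>c d. P c \<Longrightarrow> P d \<Longrightarrow> P (c - d)"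
  shows "P c"
  using assms(1) unfolding G_def
proof (induction rule: generate.induct)
  case (inv c)
  hence "\<ominus>\<^bsub>TF\<^esub> c = - c" using rels_subset by (intro TF.minus_equality) auto
  thus ?case using assms(4)[OF assms(2) assms(3)[OF inv]] by (simp add: a_inv_def)
next
  case (eng c d)
  thus ?case using assms(4)[OF eng.IH(1) assms(4)[OF assms(2) eng.IH(2)]] by simp
qed (use assms in auto)

text \<open>The left action is additive and commutes with the right action of \<open>UQ0\<close>, so
  each kind of relator is preserved.\<close>

lemma smult_rels: "c \<in> rels \<Longrightarrow> a \<odot>\<^bsub>TF\<^esub> c \<in> rels"
proof (induction rule: tensor_relators.induct)
  case (add_left w w' f)
  thus ?case
    using tensor_relators.add_left[of "a \<odot>\<^bsub>Wq m\<^esub> w" "Wq m" "a \<odot>\<^bsub>Wq m\<^esub> w'" f F "Wq_ract m" S0]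
    by (simp add: frag_extend_diff Wq.smult_r_distr')
next
  case (add_right w f f')
  thus ?case
    using tensor_relators.add_right[of "a \<odot>\<^bsub>Wq m\<^esub> w" "Wq m" f F f' "Wq_ract m" S0]
    by (simp add: frag_extend_diff)
next
  case (balanced w s f)
  obtain x where x: "w = coset_Iq m x" using balanced by (auto simp: carrier_Wq)
  have s: "s \<in> UQ0" using balanced by simp
  have "a \<odot>\<^bsub>Wq m\<^esub> Wq_ract m w s = Wq_ract m (a \<odot>\<^bsub>Wq m\<^esub> w) s"
    by (simp add: x Wq_ract_coset[OF s] mult.assoc)
  thus ?case
    using balanced tensor_relators.balanced[of "a \<odot>\<^bsub>Wq m\<^esub> w" "Wq m" s S0 f F "Wq_ract m"]
    by (simp add: frag_extend_diff)
qed

lemma smult_diff_TF: "a \<odot>\<^bsub>TF\<^esub> (c - d) = a \<odot>\<^bsub>TF\<^esub> c - a \<odot>\<^bsub>TF\<^esub> d"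
  by (simp add: frag_extend_diff)

lemma smult_closed_TF: "c \<in> carrier TF \<Longrightarrow> a \<odot>\<^bsub>TF\<^esub> c \<in> carrier TF"
  using keys_frag_extend[of "\<lambda>(w, f). frag_of (a \<odot>\<^bsub>Wq m\<^esub> w, f)" c] by fastforce

lemma TF_induct [consumes 1, case_names zero diff frag]:
  assumes "c \<in> carrier TF" "P 0"
    "\<And>c d. c \<in> carrier TF \<Longrightarrow> d \<in> carrier TF \<Longrightarrow> P c \<Longrightarrow> P d \<Longrightarrow> P (c - d)"
    "\<And>w f. w \<in> carrier (Wq m) \<Longrightarrow> f \<in> Fpi \<pi> \<Longrightarrow> P (frag_of (w, f))"
  shows "P c"
  by (rule free_Abelian_group_induct[of c "carrier (Wq m) \<times> Fpi \<pi>"]) (use assms in auto)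

text \<open>On the free group products and 1 act correctly, but the sum of two scalars only up to
  relators of the first kind, since (a + b) w with f is a single generator.\<close>

lemma operator_quotient_TF: "operator_quotient TF G"
proof (rule operator_quotient.intro)
  interpret N: abelian_subgroup G TF
    using abelian_group_TF subgroup_G by (intro abelian_subgroupI3 additive_subgroupI)
  have coset_eq: "G +>\<^bsub>TF\<^esub> c = G +>\<^bsub>TF\<^esub> d" if "c - d \<in> G" "c \<in> carrier TF" "d \<in> carrier TF" for c d
  proof -
    have "c = (c - d) \<oplus>\<^bsub>TF\<^esub> d" by simp
    hence "c \<in> G +>\<^bsub>TF\<^esub> d" using that(1) by (force simp: a_r_coset_def')
    thus ?thesis using TF.a_repr_independence[OF _ that(3) subgroup_G] by simp
  qed
  show "abelian_group TF" "subgroup G (add_monoid TF)" by (rule abelian_group_TF subgroup_G)+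
  show "a \<odot>\<^bsub>TF\<^esub> c \<in> carrier TF" if "c \<in> carrier TF" for a c
    by (rule smult_closed_TF[OF that])
  show "a \<odot>\<^bsub>TF\<^esub> (c \<oplus>\<^bsub>TF\<^esub> d) = a \<odot>\<^bsub>TF\<^esub> c \<oplus>\<^bsub>TF\<^esub> a \<odot>\<^bsub>TF\<^esub> d" for a c d
    by (simp add: frag_extend_add)
  show "a \<odot>\<^bsub>TF\<^esub> c \<in> G" if "c \<in> G" for a c
    using that
  proof (induction rule: G_induct)
    case (rel c)
    show ?case by (rule G_closed(4)[OF smult_rels[OF rel]])
  next
    case (diff c d)
    thus ?case unfolding smult_diff_TF by (rule G_closed(6))
  qed (simp add: G_closed)
  fix a b c assume c: "c \<in> carrier TF"
  have "(a + b) \<odot>\<^bsub>TF\<^esub> c - (a \<odot>\<^bsub>TF\<^esub> c + b \<odot>\<^bsub>TF\<^esub> c) \<in> G"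
    using c
  proof (induction rule: TF_induct)
    case (diff c d)
    have "(a + b) \<odot>\<^bsub>TF\<^esub> (c - d) - (a \<odot>\<^bsub>TF\<^esub> (c - d) + b \<odot>\<^bsub>TF\<^esub> (c - d))
      = ((a + b) \<odot>\<^bsub>TF\<^esub> c - (a \<odot>\<^bsub>TF\<^esub> c + b \<odot>\<^bsub>TF\<^esub> c)) - ((a + b) \<odot>\<^bsub>TF\<^esub> d - (a \<odot>\<^bsub>TF\<^esub> d + b \<odot>\<^bsub>TF\<^esub> d))"
      unfolding smult_diff_TF by simp
    thus ?case using G_closed(6)[OF diff(3,4)] by (simp only:)
  next
    case (frag w f)
    have "frag_of (a \<odot>\<^bsub>Wq m\<^esub> w \<oplus>\<^bsub>Wq m\<^esub> b \<odot>\<^bsub>Wq m\<^esub> w, f) - frag_of (a \<odot>\<^bsub>Wq m\<^esub> w, f)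
      - frag_of (b \<odot>\<^bsub>Wq m\<^esub> w, f) \<in> rels"
      by (rule tensor_relators.add_left) (use frag in auto)
    thus ?case using frag by (intro G_closed(4)) (simp add: Wq.smult_l_distr' diff_diff_eq)
  qed (simp add: G_closed)
  thus "G +>\<^bsub>TF\<^esub> ((a + b) \<odot>\<^bsub>TF\<^esub> c) = G +>\<^bsub>TF\<^esub> (a \<odot>\<^bsub>TF\<^esub> c \<oplus>\<^bsub>TF\<^esub> b \<odot>\<^bsub>TF\<^esub> c)"
    using smult_closed_TF[OF c] TF.a_closed by (intro coset_eq) (simp_all only: TF_simps(2))
  have "(a * b) \<odot>\<^bsub>TF\<^esub> c = a \<odot>\<^bsub>TF\<^esub> (b \<odot>\<^bsub>TF\<^esub> c)"
    using c by (induction rule: TF_induct) (auto simp: frag_extend_diff Wq.smult_assoc')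
  thus "G +>\<^bsub>TF\<^esub> ((a * b) \<odot>\<^bsub>TF\<^esub> c) = G +>\<^bsub>TF\<^esub> (a \<odot>\<^bsub>TF\<^esub> (b \<odot>\<^bsub>TF\<^esub> c))" by (simp only:)
  have "1 \<odot>\<^bsub>TF\<^esub> c = c"
    using c by (induction rule: TF_induct) (auto simp: frag_extend_diff)
  thus "G +>\<^bsub>TF\<^esub> (1 \<odot>\<^bsub>TF\<^esub> c) = G +>\<^bsub>TF\<^esub> c" by (simp only:)
qed

interpretation OQ: operator_quotient TF G
  by (rule operator_quotient_TF)

lemma Wq_pi_eq: "Wq_pi m \<pi> = OQ.Q"
  by (simp add: Wq_pi_def tensor_module_def TF_def G_def)

interpretation W: UQ_module "Wq_pi m \<pi>"
  unfolding Wq_pi_eq by (simp add: UQ_module_iff OQ.left_module_Q)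

definition tens :: "uq \<Rightarrow> Kbar \<Rightarrow> wpi" where
  "tens x f = G +>\<^bsub>TF\<^esub> frag_of (coset_Iq m x, f)"

lemma tens_carrier: "f \<in> Fpi \<pi> \<Longrightarrow> tens x f \<in> carrier (Wq_pi m \<pi>)"
  by (auto simp: tens_def Wq_pi_eq OQ.carrier_Q)

lemma tens_smult: "f \<in> Fpi \<pi> \<Longrightarrow> a \<odot>\<^bsub>Wq_pi m \<pi>\<^esub> tens x f = tens (a * x) f"
  using OQ.smult_Q[of "frag_of (coset_Iq m x, f)" a] by (simp add: tens_def Wq_pi_eq)

lemma tens_balanced:
  assumes "y \<in> UQ0" "f \<in> Fpi \<pi>"
  shows "tens (x * y) f = tens x (T y * f)"
proof -
  have "frag_of (Wq_ract m (coset_Iq m x) y, f) - frag_of (coset_Iq m x, y \<odot>\<^bsub>F\<^esub> f) \<in> rels"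
    by (rule tensor_relators.balanced) (use assms in auto)
  hence "frag_of (coset_Iq m (x * y), f) - frag_of (coset_Iq m x, T y * f) \<in> G"
    using assms by (intro G_closed(4)) (simp add: Wq_ract_coset)
  moreover have "T y * f \<in> Fpi \<pi>" using assms T_in_Fpi Fpi_closed(4) by blast
  ultimately show ?thesis
    using assms OQ.coset_eq_iff[of "frag_of (coset_Iq m (x * y), f)"
      "frag_of (coset_Iq m x, T y * f)"]
    by (simp add: tens_def TF_minus)
qed

lemma tens_zero:
  assumes "f \<in> Fpi \<pi>"
  shows "x \<in> Iq m \<Longrightarrow> tens x f = \<zero>\<^bsub>Wq_pi m \<pi>\<^esub>" and "tens x 0 = \<zero>\<^bsub>Wq_pi m \<pi>\<^esub>"
proof -
  have "frag_of (coset_Iq m 0 \<oplus>\<^bsub>Wq m\<^esub> coset_Iq m 0, f) - frag_of (coset_Iq m 0, f)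
     - frag_of (coset_Iq m 0, f) \<in> rels"
    by (rule tensor_relators.add_left) (use assms in auto)
  hence "- frag_of (coset_Iq m 0, f) \<in> G" by (intro G_closed(4)) simp
  hence "frag_of (coset_Iq m 0, f) \<in> G" using G_closed(3) by fastforce
  moreover assume "x \<in> Iq m"
  hence "coset_Iq m x = coset_Iq m 0" by (simp add: coset_Iq_eq_iff)
  ultimately show "tens x f = \<zero>\<^bsub>Wq_pi m \<pi>\<^esub>"
    using assms by (simp add: tens_def Wq_pi_eq OQ.coset_eq_zero_iff)
next
  have zero: "0 \<in> Fpi \<pi>" by (rule Fpi_closed)
  have "frag_of (coset_Iq m x, 0 \<oplus>\<^bsub>F\<^esub> 0) - frag_of (coset_Iq m x, 0) - frag_of (coset_Iq m x, 0)
      \<in> rels"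
    by (rule tensor_relators.add_right) (use zero in auto)
  hence "- frag_of (coset_Iq m x, 0) \<in> G" by (intro G_closed(4)) simp
  hence "frag_of (coset_Iq m x, 0) \<in> G" using G_closed(3) by fastforce
  thus "tens x 0 = \<zero>\<^bsub>Wq_pi m \<pi>\<^esub>"
    using zero by (simp add: tens_def Wq_pi_eq OQ.coset_eq_zero_iff)
qed

definition v0 :: wpi where "v0 = tens 1 1"

lemma one_Fpi [simp]: "1 \<in> Fpi \<pi>"
  by (rule Fpi_closed)

lemma smult_v0: "x \<odot>\<^bsub>Wq_pi m \<pi>\<^esub> v0 = tens x 1"
  by (simp add: v0_def tens_smult)

lemma smult_v0_UQ0: "y \<in> UQ0 \<Longrightarrow> (x * y) \<odot>\<^bsub>Wq_pi m \<pi>\<^esub> v0 = tens x (T y)"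
  using tens_balanced[of y 1 x] by (simp add: smult_v0)

lemma v0_closed: "v0 \<in> carrier (Wq_pi m \<pi>)"
  by (simp add: v0_def tens_carrier)

text \<open>Every element of the field is T y for some y in \<open>UQ0\<close>, and then the tensor
  of x with T y is x y applied to \<open>v0\<close>.\<close>

lemma v0_generates:
  assumes "w \<in> carrier (Wq_pi m \<pi>)"
  shows "\<exists>x. w = x \<odot>\<^bsub>Wq_pi m \<pi>\<^esub> v0"
proof -
  have "\<exists>x. G +>\<^bsub>TF\<^esub> c = x \<odot>\<^bsub>Wq_pi m \<pi>\<^esub> v0" if "c \<in> carrier TF" for c
    using that
  proof (induction rule: TF_induct)
    case zero
    have "G +>\<^bsub>TF\<^esub> 0 = \<zero>\<^bsub>Wq_pi m \<pi>\<^esub>" using OQ.coset_zero OQ.zero_Q by (simp add: Wq_pi_eq)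
    thus ?case using v0_closed by (intro exI[of _ 0]) simp
  next
    case (diff c d)
    then obtain x y where xy: "G +>\<^bsub>TF\<^esub> c = x \<odot>\<^bsub>Wq_pi m \<pi>\<^esub> v0" "G +>\<^bsub>TF\<^esub> d = y \<odot>\<^bsub>Wq_pi m \<pi>\<^esub> v0"
      by blast
    have cd: "c - d \<in> carrier TF" using TF_minus[OF diff(1,2)] TF.minus_closed[OF diff(1,2)] by simp
    have "x \<odot>\<^bsub>Wq_pi m \<pi>\<^esub> v0 = (G +>\<^bsub>TF\<^esub> (c - d)) \<oplus>\<^bsub>Wq_pi m \<pi>\<^esub> y \<odot>\<^bsub>Wq_pi m \<pi>\<^esub> v0"
      unfolding xy[symmetric] unfolding Wq_pi_eq using OQ.add_Q[OF cd diff(2)] by simp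
    moreover have "G +>\<^bsub>TF\<^esub> (c - d) \<in> carrier (Wq_pi m \<pi>)"
      using cd by (simp add: Wq_pi_eq OQ.carrier_Q)
    ultimately have "G +>\<^bsub>TF\<^esub> (c - d) = (x - y) \<odot>\<^bsub>Wq_pi m \<pi>\<^esub> v0"
      using v0_closed by (simp add: W.smult_diff W.M.minus_eq W.M.a_assoc W.M.r_neg)
    thus ?case by blast
  next
    case (frag w f)
    obtain x where "w = coset_Iq m x" using frag by (auto simp: carrier_Wq)
    moreover obtain y where "y \<in> UQ0" "f = T y" using Fpi_T frag by blast
    ultimately show ?case using smult_v0_UQ0[of y x] by (auto simp: tens_def)
  qed
  thus ?thesis using assms by (auto simp: Wq_pi_eq OQ.carrier_Q)
qed

definition coset_val :: "uq set \<Rightarrow> Kbar" where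
  "coset_val C = T (SOME x. x \<in> C)"

lemma coset_val_coset: "coset_val (coset_Iq m x) = T x"
proof -
  have "x \<in> coset_Iq m x" using Iq_coset_self[of x m] by simp
  hence "(SOME y. y \<in> coset_Iq m x) \<in> coset_Iq m x" by (rule someI)
  hence "T ((SOME y. y \<in> coset_Iq m x) - x) = 0" using T_Iq by (simp add: mem_coset_Iq)
  thus ?thesis by (simp add: coset_val_def T_diff)
qed

text \<open>The functional that sends the tensor of w and f to T(w) f. It vanishes on the relators
  and thus shows that the tensor product does not collapse.\<close>

definition frag_val :: "(uq set \<times> Kbar \<Rightarrow>\<^sub>0 int) \<Rightarrow> Kbar" where
  "frag_val c = (\<Sum>k\<in>Poly_Mapping.keys c. of_int (Poly_Mapping.lookup c k) * (coset_val (fst k)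
      * snd k))"

lemma frag_val_superset:
  "finite A \<Longrightarrow> Poly_Mapping.keys c \<subseteq> A \<Longrightarrow>
    frag_val c = (\<Sum>k\<in>A. of_int (Poly_Mapping.lookup c k) * (coset_val (fst k) * snd k))"
  unfolding frag_val_def by (rule sum.mono_neutral_left) (auto simp: in_keys_iff)

lemma frag_val_diff: "frag_val (c - d) = frag_val c - frag_val d"
proof -
  let ?A = "Poly_Mapping.keys c \<union> Poly_Mapping.keys d"
  have "frag_val (c - d)
    = (\<Sum>k\<in>?A. of_int (Poly_Mapping.lookup (c - d) k) * (coset_val (fst k) * snd k))"
    by (rule frag_val_superset) (simp_all add: keys_diff)
  also have "\<dots> = frag_val c - frag_val d"
    by (simp add: frag_val_superset[of ?A c] frag_val_superset[of ?A d] lookup_minus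
        left_diff_distrib sum_subtractf)
  finally show ?thesis .
qed

lemma frag_val_frag: "frag_val (frag_of (w, f)) = coset_val w * f"
  by (simp add: frag_val_superset[of "{(w, f)}"])

lemma frag_val_G: "c \<in> G \<Longrightarrow> frag_val c = 0"
proof (induction rule: G_induct)
  case (rel c)
  thus ?case
  proof cases
    case (add_left w w' f)
    then obtain x y where "w = coset_Iq m x" "w' = coset_Iq m y" by (auto simp: carrier_Wq)
    thus ?thesis unfolding add_left(1)
      by (simp add: frag_val_diff frag_val_frag coset_val_coset T_add distrib_right)
  next
    case (add_right w f f')
    thus ?thesis by (simp add: frag_val_diff frag_val_frag distrib_left)
  next
    case (balanced w s f)
    then obtain x where "w = coset_Iq m x" by (auto simp: carrier_Wq)
    thus ?thesis using balanced
      by (simp add: frag_val_diff frag_val_frag Wq_ract_coset coset_val_coset T_mult)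
  qed
qed (simp_all add: frag_val_def[of 0] frag_val_diff)

lemma T_of_zero: "x \<odot>\<^bsub>Wq_pi m \<pi>\<^esub> v0 = \<zero>\<^bsub>Wq_pi m \<pi>\<^esub> \<Longrightarrow> T x = 0"
proof -
  assume "x \<odot>\<^bsub>Wq_pi m \<pi>\<^esub> v0 = \<zero>\<^bsub>Wq_pi m \<pi>\<^esub>"
  hence "tens x 1 = \<zero>\<^bsub>Wq_pi m \<pi>\<^esub>" by (simp only: smult_v0)
  hence "frag_of (coset_Iq m x, 1) \<in> G"
    by (simp add: tens_def Wq_pi_eq OQ.coset_eq_zero_iff)
  from frag_val_G[OF this] show "T x = 0" by (simp add: frag_val_frag coset_val_coset)
qed

lemma zero_of_T: "y \<in> UQ0 \<Longrightarrow> T y = 0 \<Longrightarrow> y \<odot>\<^bsub>Wq_pi m \<pi>\<^esub> v0 = \<zero>\<^bsub>Wq_pi m \<pi>\<^esub>"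
  using smult_v0_UQ0[of y 1] tens_zero(2)[OF one_Fpi] by simp

text \<open>Through T the top space becomes the field of the parameters: inverses there give
  \<open>top_field\<close>, and T vanishing on \<open>xm_span\<close> while T 1 = 1 gives
  \<open>top_proper\<close>.\<close>

lemma hw_cyclic_v0: "hw_cyclic (Wq_pi m \<pi>) v0 (int m)"
proof
  show "v0 \<in> carrier (Wq_pi m \<pi>)" by (rule v0_closed)
  show "j \<odot>\<^bsub>Wq_pi m \<pi>\<^esub> v0 = \<zero>\<^bsub>Wq_pi m \<pi>\<^esub>" if "j \<in> hw_ideal (int m)" for j
    using that hw_ideal_subset_Iq by (simp add: smult_v0) (rule tens_zero(1), auto)
  show "\<exists>x. w = x \<odot>\<^bsub>Wq_pi m \<pi>\<^esub> v0" if "w \<in> carrier (Wq_pi m \<pi>)" for w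
    by (rule v0_generates[OF that])
  show "p \<odot>\<^bsub>Wq_pi m \<pi>\<^esub> v0 \<noteq> v0" if "p \<in> xm_span" for p
  proof
    assume "p \<odot>\<^bsub>Wq_pi m \<pi>\<^esub> v0 = v0"
    hence "(p - 1) \<odot>\<^bsub>Wq_pi m \<pi>\<^esub> v0 = \<zero>\<^bsub>Wq_pi m \<pi>\<^esub>"
      using v0_closed by (simp add: W.smult_diff W.M.minus_eq W.M.r_neg)
    from T_of_zero[OF this] show False
      using T_xm_span[OF that] UQ0_homD(5)[OF T_hom] by (simp add: T_diff)
  qed
  show "\<exists>y'\<in>UQ0. (y' * y) \<odot>\<^bsub>Wq_pi m \<pi>\<^esub> v0 = v0"
    if y: "y \<in> UQ0" and nz: "y \<odot>\<^bsub>Wq_pi m \<pi>\<^esub> v0 \<noteq> \<zero>\<^bsub>Wq_pi m \<pi>\<^esub>" for y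
  proof -
    have "T y \<noteq> 0" using zero_of_T[OF y] nz by blast
    obtain y' where y': "y' \<in> UQ0" "inverse (T y) = T y'"
      using Fpi_T[OF Fpi_inverse[OF T_in_Fpi[OF y]]] by blast
    have "T (y' * y - 1) = 0"
      using \<open>T y \<noteq> 0\<close> y UQ0_homD(5)[OF T_hom] by (simp add: T_diff T_mult flip: y'(2))
    hence "(y' * y - 1) \<odot>\<^bsub>Wq_pi m \<pi>\<^esub> v0 = \<zero>\<^bsub>Wq_pi m \<pi>\<^esub>"
      using y y'(1) by (intro zero_of_T) auto
    hence "(y' * y) \<odot>\<^bsub>Wq_pi m \<pi>\<^esub> v0 = 1 \<odot>\<^bsub>Wq_pi m \<pi>\<^esub> v0"
      using W.smult_eq_iff[OF v0_closed] by blast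
    thus ?thesis using y'(1) v0_closed by auto
  qed
qed

end

lemma Wq_pi_hw_cyclic:
  assumes "\<pi> \<in> parameters m"
  obtains v where "hw_cyclic (Wq_pi m \<pi>) v (int m)"
    "\<And>y. y \<in> UQ0 \<Longrightarrow> y \<odot>\<^bsub>Wq_pi m \<pi>\<^esub> v = \<zero>\<^bsub>Wq_pi m \<pi>\<^esub> \<longleftrightarrow> eval_hom m \<pi> y = 0"
proof -
  obtain T where "UQ0_hom T" "\<And>x y. T (x + y) = T x + T y" "\<And>x y. y \<in> UQ0 \<Longrightarrow> T (x * y) = T x * T y"
    "\<And>x. x \<in> Iq m \<Longrightarrow> T x = 0" "\<And>p. p \<in> xm_span \<Longrightarrow> T p = 0"
    "\<And>i. i \<in> {1..m} \<Longrightarrow> T (Lam (int i)) = \<pi> ! (i - 1)"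
    by (rule top_functional[OF assms]) blast
  then interpret eval_parameters m \<pi> T
    using assms by unfold_locales auto
  show ?thesis
    using that[OF hw_cyclic_v0] T_of_zero zero_of_T eval_hom_T by metis
qed

lemma unique_irreducible_quotient_Wq_pi:
  assumes "\<pi> \<in> parameters m"
  shows "\<exists>!N. submodule N UQ (Wq_pi m \<pi>) \<and> irreducible_module UQ (quotient_module (Wq_pi m \<pi>) N)"
proof -
  obtain v where "hw_cyclic (Wq_pi m \<pi>) v (int m)" by (rule Wq_pi_hw_cyclic[OF assms]) blast
  then interpret hw_cyclic "Wq_pi m \<pi>" v "int m" .
  show ?thesis unfolding unique_irreducible_quotient by simp
qed

lemma Vq_pi_hw_vector:
  assumes "\<pi> \<in> parameters m"
  obtains v where "hw_vector (Vq_pi m \<pi>) v (int m)" "irreducible_module UQ (Vq_pi m \<pi>)"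
    "v \<noteq> \<zero>\<^bsub>Vq_pi m \<pi>\<^esub>"
    "\<And>y. y \<in> UQ0 \<Longrightarrow> y \<odot>\<^bsub>Vq_pi m \<pi>\<^esub> v = \<zero>\<^bsub>Vq_pi m \<pi>\<^esub> \<longleftrightarrow> eval_hom m \<pi> y = 0"
proof -
  obtain v where v: "hw_cyclic (Wq_pi m \<pi>) v (int m)"
    "\<And>y. y \<in> UQ0 \<Longrightarrow> y \<odot>\<^bsub>Wq_pi m \<pi>\<^esub> v = \<zero>\<^bsub>Wq_pi m \<pi>\<^esub> \<longleftrightarrow> eval_hom m \<pi> y = 0"
    by (rule Wq_pi_hw_cyclic[OF assms]) blast
  interpret W: hw_cyclic "Wq_pi m \<pi>" v "int m" by (rule v(1))
  have V: "Vq_pi m \<pi> = quotient_module (Wq_pi m \<pi>) W.max_submodule"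
    unfolding Vq_pi_def W.unique_irreducible_quotient by simp
  interpret Q: operator_quotient "Wq_pi m \<pi>" W.max_submodule
    by (rule W.operator_quotient[OF W.submodule_max])
  let ?v = "W.max_submodule +>\<^bsub>Wq_pi m \<pi>\<^esub> v"
  have smult: "x \<odot>\<^bsub>Vq_pi m \<pi>\<^esub> ?v = W.max_submodule +>\<^bsub>Wq_pi m \<pi>\<^esub> (x \<odot>\<^bsub>Wq_pi m \<pi>\<^esub> v)" for x
    unfolding V by (rule Q.smult_Q) simp
  have zero: "W.max_submodule +>\<^bsub>Wq_pi m \<pi>\<^esub> w = \<zero>\<^bsub>Vq_pi m \<pi>\<^esub> \<longleftrightarrow> w \<in> W.max_submodule"
    if "w \<in> carrier (Wq_pi m \<pi>)" for w
    unfolding V by (rule Q.coset_eq_zero_iff[OF that])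
  show ?thesis
  proof
    show irr: "irreducible_module UQ (Vq_pi m \<pi>)"
      unfolding V using W.unique_irreducible_quotient by blast
    show "hw_vector (Vq_pi m \<pi>) ?v (int m)"
    proof (intro hw_vector.intro hw_vector_axioms.intro)
      show "UQ_module (Vq_pi m \<pi>)" unfolding V by (simp add: UQ_module_iff Q.left_module_Q)
      show "?v \<in> carrier (Vq_pi m \<pi>)" unfolding V Q.carrier_Q by simp
      show "j \<odot>\<^bsub>Vq_pi m \<pi>\<^esub> ?v = \<zero>\<^bsub>Vq_pi m \<pi>\<^esub>" if "j \<in> hw_ideal (int m)" for j
        unfolding smult using W.hw[OF that] zero W.submoduleD(3)[OF W.submodule_max] by simp
    qed
    show "?v \<noteq> \<zero>\<^bsub>Vq_pi m \<pi>\<^esub>" using zero W.v_notin_max by simp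
    show "y \<odot>\<^bsub>Vq_pi m \<pi>\<^esub> ?v = \<zero>\<^bsub>Vq_pi m \<pi>\<^esub> \<longleftrightarrow> eval_hom m \<pi> y = 0" if "y \<in> UQ0" for y
      unfolding smult using zero W.UQ0_max[OF that] v(2)[OF that] by simp
  qed
qed

section \<open>Residue fields of the Cartan part\<close>

definition peval :: "Kq poly \<Rightarrow> uq \<Rightarrow> uq" where
  "peval p y = fold_coeffs (\<lambda>a z. scal a + y * z) p 0"

lemma peval_0 [simp]: "peval 0 y = 0"
  by (simp add: peval_def)

lemma peval_pCons: "peval (pCons a p) y = scal a + y * peval p y"
  by (cases "p = 0 \<and> a = 0") (auto simp: peval_def)

lemma peval_UQ0: "y \<in> UQ0 \<Longrightarrow> peval p y \<in> UQ0"
  by (induction p) (auto simp: peval_pCons)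

text \<open>A maximal ideal whose residue field is algebraic over \<open>Kq\<close>. The quotient is
  never formed; all arguments are carried out modulo \<open>I\<close>.\<close>

locale UQ0_maximal_ideal =
  fixes I :: "uq set"
  assumes sub: "I \<subseteq> UQ0" and zero: "0 \<in> I" and one: "1 \<notin> I"
    and add: "x \<in> I \<Longrightarrow> y \<in> I \<Longrightarrow> x + y \<in> I"
    and mult: "x \<in> UQ0 \<Longrightarrow> y \<in> I \<Longrightarrow> x * y \<in> I"
    and invertible: "y \<in> UQ0 \<Longrightarrow> y \<notin> I \<Longrightarrow> \<exists>y'\<in>UQ0. y' * y - 1 \<in> I"
    and algebraic: "y \<in> UQ0 \<Longrightarrow> \<exists>p. p \<noteq> 0 \<and> peval p y \<in> I"
begin

lemma uminus: "x \<in> I \<Longrightarrow> - x \<in> I"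
  using mult[of "- 1" x] UQ0_uminus[of 1] by simp

lemma diff: "x \<in> I \<Longrightarrow> y \<in> I \<Longrightarrow> x - y \<in> I"
  using add[of x "- y"] uminus by simp

lemma mult': "x \<in> UQ0 \<Longrightarrow> y \<in> I \<Longrightarrow> y * x \<in> I"
  using mult[of x y] UQ0_commute[of x y] sub by auto

lemma prime: "x \<in> UQ0 \<Longrightarrow> y \<in> UQ0 \<Longrightarrow> x * y \<in> I \<Longrightarrow> x \<notin> I \<Longrightarrow> y \<in> I"
proof -
  assume x: "x \<in> UQ0" "x \<notin> I" and y: "y \<in> UQ0" "x * y \<in> I"
  then obtain x' where x': "x' \<in> UQ0" "x' * x - 1 \<in> I" using invertible by blast
  have "x' * (x * y) - (x' * x - 1) * y \<in> I"
    by (rule diff[OF mult[OF x'(1) y(2)] mult'[OF y(1) x'(2)]])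
  thus "y \<in> I" by (simp add: algebra_simps)
qed

text \<open>Partial embeddings of \<open>UQ0 / I\<close> into \<open>Kbar\<close>, represented by their graphs.\<close>

definition partial_embedding :: "(uq \<times> Kbar) set \<Rightarrow> bool" where
  "partial_embedding G \<longleftrightarrow> fst ` G \<subseteq> UQ0 \<and> (\<forall>c. (scal c, to_ac c) \<in> G) \<and>
     (\<forall>x a y b. (x, a) \<in> G \<longrightarrow> (y, b) \<in> G \<longrightarrow> (x + y, a + b) \<in> G \<and> (x * y, a * b) \<in> G) \<and>
     (\<forall>x a. (x, a) \<in> G \<longrightarrow> x \<in> I \<longrightarrow> a = 0)"

lemma partial_embeddingD:
  assumes "partial_embedding G"
  shows "(x, a) \<in> G \<Longrightarrow> x \<in> UQ0" "(scal c, to_ac c) \<in> G" "(0, 0) \<in> G" "(1, 1) \<in> G"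
    "(x, a) \<in> G \<Longrightarrow> (y, b) \<in> G \<Longrightarrow> (x + y, a + b) \<in> G"
    "(x, a) \<in> G \<Longrightarrow> (y, b) \<in> G \<Longrightarrow> (x * y, a * b) \<in> G"
    "(x, a) \<in> G \<Longrightarrow> (- x, - a) \<in> G"
    "(x, a) \<in> G \<Longrightarrow> x \<in> I \<Longrightarrow> a = 0"
proof -
  show scal: "(scal c, to_ac c) \<in> G" for c using assms by (simp add: partial_embedding_def)
  show "(0, 0) \<in> G" "(1, 1) \<in> G" using scal[of 0] scal[of 1] by simp_all
  show mult: "(x, a) \<in> G \<Longrightarrow> (y, b) \<in> G \<Longrightarrow> (x * y, a * b) \<in> G" for x y a b
    using assms unfolding partial_embedding_def by blast
  show "(x, a) \<in> G \<Longrightarrow> (- x, - a) \<in> G"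
    using mult[OF scal[of "-1"]] by (simp add: scal_minus)
  show "(x, a) \<in> G \<Longrightarrow> x \<in> UQ0" "(x, a) \<in> G \<Longrightarrow> (y, b) \<in> G \<Longrightarrow> (x + y, a + b) \<in> G"
    "(x, a) \<in> G \<Longrightarrow> x \<in> I \<Longrightarrow> a = 0"
    using assms unfolding partial_embedding_def by (auto simp: image_subset_iff)
qed

lemma partial_embedding_base: "partial_embedding (range (\<lambda>c. (scal c, to_ac c)))"
proof -
  have kernel: "c = 0" if "scal c \<in> I" for c
  proof (rule ccontr)
    assume "c \<noteq> 0"
    have "scal (inverse c) * scal c \<in> I" using that by (intro mult) auto
    hence "1 \<in> I" using scal_inverse[OF \<open>c \<noteq> 0\<close>, of 1] by simp
    thus False using one by simp
  qed
  have closed: "(scal a + scal b, to_ac a + to_ac b) \<in> range (\<lambda>c. (scal c, to_ac c))"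
    "(scal a * scal b, to_ac a * to_ac b) \<in> range (\<lambda>c. (scal c, to_ac c))" for a b
    by (rule range_eqI[of _ _ "a + b"], simp add: scal_add,
        rule range_eqI[of _ _ "a * b"], simp add: scal_mult)
  show ?thesis
    unfolding partial_embedding_def
  proof (intro conjI allI impI)
    show "fst ` range (\<lambda>c. (scal c, to_ac c)) \<subseteq> UQ0" by auto
    show "(scal c, to_ac c) \<in> range (\<lambda>c. (scal c, to_ac c))" for c by (rule rangeI)
    fix x a assume "(x, a) \<in> range (\<lambda>c. (scal c, to_ac c))"
    then obtain c where c: "x = scal c" "a = to_ac c" by (erule_tac rangeE) (simp only: prod.inject)
    { fix y b assume "(y, b) \<in> range (\<lambda>c. (scal c, to_ac c))"
      then obtain d where d: "y = scal d" "b = to_ac d"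
          by (erule_tac rangeE) (simp only: prod.inject)
      show "(x + y, a + b) \<in> range (\<lambda>c. (scal c, to_ac c))"
        "(x * y, a * b) \<in> range (\<lambda>c. (scal c, to_ac c))"
        unfolding c d by (fact closed)+ }
    assume "x \<in> I"
    thus "a = 0" using c kernel by simp
  qed
qed

lemma partial_embedding_peval:
  assumes "partial_embedding G" "(y, c) \<in> G"
  shows "(peval p y, poly (map_poly to_ac p) c) \<in> G"
proof (induction p)
  case (pCons a p)
  have "(scal a + y * peval p y, to_ac a + c * poly (map_poly to_ac p) c) \<in> G"
    using pCons.IH assms by (intro partial_embeddingD[OF assms(1)])
  thus ?case by (simp add: peval_pCons map_poly_pCons)
qed (simp add: partial_embeddingD[OF assms(1)])

text \<open>An algebraic relation of y modulo \<open>I\<close> can be divided by y as long as its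
  constant coefficient is zero, \<open>I\<close> being prime. Once the constant is nonzero, applying
  the embedding with y sent to 0 makes it vanish.\<close>

lemma partial_embedding_kernel:
  assumes G: "partial_embedding G" and y: "(y, 0) \<in> G"
  shows "y \<in> I"
proof (rule ccontr)
  assume "y \<notin> I"
  have y0: "y \<in> UQ0" by (rule partial_embeddingD(1)[OF G y])
  obtain p where "p \<noteq> 0" "peval p y \<in> I" using algebraic[OF y0] by blast
  thus False
  proof (induction p)
    case (pCons a p)
    have eq: "scal a + y * peval p y \<in> I" using pCons.prems by (simp add: peval_pCons)
    show False
    proof (cases "a = 0")
      case True
      hence "peval p y \<in> I" using eq \<open>y \<notin> I\<close> y0
          by (intro prime[of y "peval p y", OF y0 peval_UQ0[OF y0]]) auto
      moreover have "p \<noteq> 0" using pCons.hyps True by auto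
      ultimately show False using pCons.IH by blast
    next
      case False
      have "(scal a + y * peval p y, to_ac a + 0 * poly (map_poly to_ac p) 0) \<in> G"
        using partial_embedding_peval[OF G y] y by (intro partial_embeddingD[OF G])
      hence "to_ac a = 0" by (intro partial_embeddingD(8)[OF G _ eq]) simp
      thus False using False by simp
    qed
  qed simp
qed

section \<open>Extension of partial embeddings\<close>

lemma maximal_partial_embedding:
  "\<exists>G. partial_embedding G \<and> (\<forall>G'. partial_embedding G' \<longrightarrow> G \<subseteq> G' \<longrightarrow> G' = G)"
proof -
  have "\<exists>G\<in>Collect partial_embedding. \<forall>G'\<in>Collect partial_embedding. G \<subseteq> G' \<longrightarrow> G' = G"
  proof (rule subset_Zorn_nonempty)
    show "Collect partial_embedding \<noteq> {}" using partial_embedding_base by blast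
    fix C assume C: "C \<noteq> {}" "subset.chain (Collect partial_embedding) C"
    have pe: "partial_embedding G" if "G \<in> C" for G
      using C(2) that by (auto simp: subset_chain_def)
    have common: "\<exists>G\<in>C. p \<in> G \<and> p' \<in> G" if "p \<in> \<Union>C" "p' \<in> \<Union>C" for p p'
    proof -
      obtain A B where AB: "A \<in> C" "B \<in> C" "p \<in> A" "p' \<in> B" using \<open>p \<in> \<Union>C\<close> \<open>p' \<in> \<Union>C\<close> by blast
      have "A \<subseteq> B \<or> B \<subseteq> A" using C(2) AB(1,2) by (simp add: subset_chain_def)
      thus ?thesis using AB by blast
    qed
    have "partial_embedding (\<Union>C)"
      unfolding partial_embedding_def
    proof (intro conjI allI impI)
      show "fst ` \<Union>C \<subseteq> UQ0" using partial_embeddingD(1)[OF pe] by auto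
      show "(scal c, to_ac c) \<in> \<Union>C" for c using C(1) partial_embeddingD(2)[OF pe] by blast
      fix x a y b
      assume "(x, a) \<in> \<Union>C" "(y, b) \<in> \<Union>C"
      then obtain G where "G \<in> C" "(x, a) \<in> G" "(y, b) \<in> G" using common by blast
      thus "(x + y, a + b) \<in> \<Union>C" "(x * y, a * b) \<in> \<Union>C"
        using partial_embeddingD(5,6)[OF pe] by blast+
    next
      fix x a assume "(x, a) \<in> \<Union>C" "x \<in> I"
      thus "a = 0" using partial_embeddingD(8)[OF pe] by blast
    qed
    thus "\<Union>C \<in> Collect partial_embedding" by simp
  qed
  thus ?thesis by auto
qed

text \<open>The pairs \<open>(p(g), p)\<close>, where \<open>p\<close> runs over the polynomials with coefficients in \<open>G\<close>; the
  second component retains the images in \<open>Kbar\<close> of the coefficients.\<close>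

inductive_set adjoin :: "(uq \<times> Kbar) set \<Rightarrow> uq \<Rightarrow> (uq \<times> Kbar poly) set" for G g where
  const: "(a, c) \<in> G \<Longrightarrow> (a, [:c:]) \<in> adjoin G g"
| horner: "(y, p) \<in> adjoin G g \<Longrightarrow> (a, c) \<in> G \<Longrightarrow> (a + y * g, pCons c p) \<in> adjoin G g"

context
  fixes G g assumes G: "partial_embedding G" and g: "g \<in> UQ0"
begin

lemma adjoin_UQ0: "(y, p) \<in> adjoin G g \<Longrightarrow> y \<in> UQ0"
  by (induction rule: adjoin.induct) (use g partial_embeddingD(1)[OF G] in auto)

lemma adjoin_add_const: "(y, p) \<in> adjoin G g \<Longrightarrow> (a, c) \<in> G \<Longrightarrow> (a + y, [:c:] + p) \<in> adjoin G g"
proof (induction rule: adjoin.induct)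
  case (const a' c')
  thus ?case using adjoin.const[OF partial_embeddingD(5)[OF G const(2,1)]] by simp
next
  case (horner y p a' c')
  thus ?case using adjoin.horner[OF horner(1) partial_embeddingD(5)[OF G horner(4,2)]]
    by (simp add: add.assoc)
qed

lemma adjoin_add:
  "(y, p) \<in> adjoin G g \<Longrightarrow> (y', p') \<in> adjoin G g \<Longrightarrow> (y + y', p + p') \<in> adjoin G g"
proof (induction arbitrary: y' p' rule: adjoin.induct)
  case (const a c)
  thus ?case using adjoin_add_const by blast
next
  case (horner y p a c)
  from horner(4) show ?case
  proof cases
    case (const c')
    thus ?thesis using adjoin_add_const[OF adjoin.horner[OF horner(1,2)] const(2)]
      by (simp add: add.commute)
  next
    case (horner y'' p'' a' c')
    have "(a + a' + (y + y'') * g, pCons (c + c') (p + p'')) \<in> adjoin G g"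
      using \<open>\<And>y' p'. (y', p') \<in> adjoin G g \<Longrightarrow> (y + y', p + p') \<in> adjoin G g\<close>[OF horner(3)]
        partial_embeddingD(5)[OF G \<open>(a, c) \<in> G\<close> horner(4)] by (rule adjoin.horner)
    thus ?thesis using horner(1,2) by (simp add: algebra_simps)
  qed
qed

lemma adjoin_scale: "(y, p) \<in> adjoin G g \<Longrightarrow> (a, c) \<in> G \<Longrightarrow> (a * y, smult c p) \<in> adjoin G g"
proof (induction rule: adjoin.induct)
  case (const a' c')
  thus ?case using adjoin.const[OF partial_embeddingD(6)[OF G const(2,1)]] by simp
next
  case (horner y p a' c')
  thus ?case using adjoin.horner[OF horner(3)[OF horner(4)] partial_embeddingD(6)[OF G horner(4,2)]]
    by (simp add: distrib_left mult.assoc)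
qed

lemma adjoin_shift: "(y, p) \<in> adjoin G g \<Longrightarrow> (y * g, pCons 0 p) \<in> adjoin G g"
  using adjoin.horner[OF _ partial_embeddingD(3)[OF G]] by fastforce

lemma adjoin_mult:
  "(y, p) \<in> adjoin G g \<Longrightarrow> (y', p') \<in> adjoin G g \<Longrightarrow> (y * y', p * p') \<in> adjoin G g"
proof (induction rule: adjoin.induct)
  case (const a c)
  thus ?case using adjoin_scale by simp
next
  case (horner y p a c)
  have "(a * y' + y * y' * g, smult c p' + pCons 0 (p * p')) \<in> adjoin G g"
    using adjoin_scale[OF horner(4,2)] adjoin_shift[OF horner(3)[OF horner(4)]] by (rule adjoin_add)
  moreover have "y * y' * g = y * g * y'"
    using UQ0_commute[OF adjoin_UQ0[OF horner(4)] g] by (simp add: mult.assoc)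
  ultimately show ?case by (simp add: distrib_right)
qed

lemma adjoin_shifts:
  "(y, p) \<in> adjoin G g \<Longrightarrow> (y * g ^ k, monom 1 k * p) \<in> adjoin G g"
proof (induction k)
  case (Suc k)
  have "y * g ^ Suc k = y * g ^ k * g" by (simp add: mult.assoc power_commutes)
  moreover have "monom 1 (Suc k) * p = pCons 0 (monom 1 k * p)" by (simp add: monom_Suc)
  ultimately show ?case using adjoin_shift[OF Suc.IH[OF Suc.prems]] by simp
qed simp

lemma adjoin_coeff: "(y, p) \<in> adjoin G g \<Longrightarrow> coeff p i \<in> snd ` G"
proof (induction arbitrary: i rule: adjoin.induct)
  case (const a c)
  thus ?case using partial_embeddingD(3)[OF G]
      by (cases i) (auto simp: image_iff intro: bexI[of _ "(0, 0)"] bexI[of _ "(a, c)"])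
next
  case (horner y p a c)
  thus ?case by (cases i) (auto simp: image_iff intro: bexI[of _ "(a, c)"])
qed

lemma adjoin_zero: "(y, p) \<in> adjoin G g \<Longrightarrow> p = 0 \<Longrightarrow> y \<in> I"
proof (induction rule: adjoin.induct)
  case (const a c)
  thus ?case using partial_embedding_kernel[OF G] by simp
next
  case (horner y p a c)
  thus ?case using partial_embedding_kernel[OF G] g by (auto intro!: add mult')
qed

text \<open>A constant polynomial may also arise from a longer Horner scheme whose higher part has
  image 0; by \<open>adjoin_zero\<close> that part lies in \<open>I\<close> and can be
  removed.\<close>

lemma adjoin_constant: "(y, [:c:]) \<in> adjoin G g \<Longrightarrow> y \<in> I \<Longrightarrow> c = 0"
proof -
  assume "(y, [:c:]) \<in> adjoin G g" and y: "y \<in> I"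
  thus "c = 0"
  proof cases
    case (const c')
    thus ?thesis using partial_embeddingD(8)[OF G _ y] by auto
  next
    case (horner y' p a c')
    hence "y' \<in> I" using adjoin_zero by auto
    hence "y - y' * g \<in> I" using y g by (intro diff mult')
    hence "a \<in> I" using horner by simp
    thus ?thesis using partial_embeddingD(8)[OF G] horner by auto
  qed
qed

lemma common_root: "\<exists>\<alpha>. \<forall>y p. (y, p) \<in> adjoin G g \<longrightarrow> y \<in> I \<longrightarrow> poly p \<alpha> = 0"
proof (cases "\<exists>y p. (y, p) \<in> adjoin G g \<and> y \<in> I \<and> p \<noteq> 0")
  case True
  define P where "P p \<longleftrightarrow> (\<exists>y\<in>I. (y, p) \<in> adjoin G g) \<and> p \<noteq> 0" for p
  obtain p0 where "P p0" using True by (auto simp: P_def)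
  hence "\<exists>d. P d \<and> (\<forall>p. P p \<longrightarrow> degree d \<le> degree p)"
    by (rule ex_has_least_nat)
  then obtain d yd where d: "(yd, d) \<in> adjoin G g" "yd \<in> I" "d \<noteq> 0"
    and min: "\<And>y p. (y, p) \<in> adjoin G g \<Longrightarrow> y \<in> I \<Longrightarrow> p \<noteq> 0 \<Longrightarrow> degree d \<le> degree p"
    unfolding P_def by blast
  have "degree d > 0"
  proof (rule ccontr)
    assume "\<not> degree d > 0"
    then obtain c where "d = [:c:]" by (auto elim: degree_eq_zeroE)
    thus False using adjoin_constant d by auto
  qed
  then obtain \<alpha> where \<alpha>: "poly d \<alpha> = 0" using alg_closed_imp_poly_has_root by blast
  have "poly p \<alpha> = 0" if "(y, p) \<in> adjoin G g" "y \<in> I" for y p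
    using that
  proof (induction "degree p" arbitrary: y p rule: less_induct)
    case less
    show ?case
    proof (cases "p = 0")
      case False
      define k where "k = degree p - degree d"
      have deg: "degree p = degree d + k" using min[OF less.prems False] by (simp add: k_def)
      have sub: "subring (snd ` G) (ring_of_type_algebra :: Kbar ring)"
      proof (rule subring_type_algebraI)
        show "0 \<in> snd ` G" "1 \<in> snd ` G"
          using partial_embeddingD(3,4)[OF G] by (auto simp: image_iff
            intro: bexI[of _ "(0, 0)"] bexI[of _ "(1, 1)"])
        show "a + b \<in> snd ` G" "a * b \<in> snd ` G" if "a \<in> snd ` G" "b \<in> snd ` G" for a b
          using that partial_embeddingD(5,6)[OF G] by (force simp: image_iff)+
        show "- a \<in> snd ` G" if "a \<in> snd ` G" for a
          using that partial_embeddingD(7)[OF G] by (force simp: image_iff)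
      qed
      have "range to_ac \<subseteq> snd ` G" using partial_embeddingD(2)[OF G] by (force simp: image_iff)
      hence "inverse (lead_coeff d) \<in> snd ` G"
        using adjoin_coeff[OF d(1)] by (intro algebraic_subring_inverse[OF sub])
      hence "- (lead_coeff p * inverse (lead_coeff d)) \<in> snd ` G"
        using adjoin_coeff[OF less.prems(1)] subring_type_algebraD(4,5)[OF sub] by blast
      then obtain b where b: "(b, - (lead_coeff p * inverse (lead_coeff d))) \<in> G" by auto
      \<comment> \<open>One step of the division by d: the leading terms cancel. The multiplier is
        lifted to b, so that the new polynomial again comes from an element of
        \<open>I\<close>.\<close>
      define p' where "p' = p + smult (- (lead_coeff p * inverse (lead_coeff d))) (monom 1 k * d)"
      have p'_ext: "(y + b * (yd * g ^ k), p') \<in> adjoin G g"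
        unfolding p'_def using less.prems(1) adjoin_scale[OF adjoin_shifts[OF d(1)] b]
            by (rule adjoin_add)
      have "g ^ k \<in> UQ0" for k using g by (induction k) auto
      hence p'_I: "y + b * (yd * g ^ k) \<in> I"
        using less.prems(2) d(2) partial_embeddingD(1)[OF G b] by (intro add mult mult')
      have "degree p' \<le> degree p"
        unfolding p'_def using deg degree_mult_le[of "monom 1 k" d] degree_monom_le[of "1::Kbar" k]
        by (intro degree_add_le order.trans[OF degree_smult_le]) auto
      moreover have "coeff p' (degree p) = 0"
        unfolding p'_def deg using d(3) by (simp add: coeff_monom_mult)
      ultimately have "p' = 0 \<or> degree p' < degree p" by (rule eq_zero_or_degree_less)
      hence "poly p' \<alpha> = 0" using less.hyps[OF _ p'_ext p'_I] by auto
      thus ?thesis using \<alpha> by (simp add: p'_def)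
    qed simp
  qed
  thus ?thesis by blast
next
  case False
  hence "poly p 0 = 0" if "(y, p) \<in> adjoin G g" "y \<in> I" for y p using that by force
  thus ?thesis by blast
qed

text \<open>Send g to the common root \<alpha>. Elements of \<open>I\<close> then go to 0, whichever
  polynomial represents them.\<close>

lemma extend_partial_embedding: "\<exists>G' \<alpha>. partial_embedding G' \<and> G \<subseteq> G' \<and> (g, \<alpha>) \<in> G'"
proof -
  obtain \<alpha> where \<alpha>: "\<And>y p. (y, p) \<in> adjoin G g \<Longrightarrow> y \<in> I \<Longrightarrow> poly p \<alpha> = 0"
    using common_root by blast
  define G' where "G' = (\<lambda>(y, p). (y, poly p \<alpha>)) ` adjoin G g"
  have mem: "(y, poly p \<alpha>) \<in> G'" if "(y, p) \<in> adjoin G g" for y p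
    using that by (force simp: G'_def)
  have memE: "\<exists>p. (y, p) \<in> adjoin G g \<and> a = poly p \<alpha>" if "(y, a) \<in> G'" for y a
    using that by (auto simp: G'_def)
  have sub_G: "G \<subseteq> G'" using mem adjoin.const[of _ _ G g] by fastforce
  have "partial_embedding G'"
    unfolding partial_embedding_def
  proof (intro conjI allI impI)
    show "fst ` G' \<subseteq> UQ0" using adjoin_UQ0 by (auto simp: G'_def)
    show "(scal c, to_ac c) \<in> G'" for c using partial_embeddingD(2)[OF G] sub_G by blast
    fix x a y b
    assume "(x, a) \<in> G'" "(y, b) \<in> G'"
    then obtain p p' where "(x, p) \<in> adjoin G g" "a = poly p \<alpha>" "(y, p') \<in> adjoin G g"
        "b = poly p' \<alpha>"
      using memE by blast
    thus "(x + y, a + b) \<in> G'" "(x * y, a * b) \<in> G'"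
      using mem[OF adjoin_add] mem[OF adjoin_mult] by (metis poly_add, metis poly_mult)
  next
    fix x a assume "(x, a) \<in> G'" "x \<in> I"
    thus "a = 0" using memE \<alpha> by blast
  qed
  moreover have "(g, \<alpha>) \<in> G'"
    using mem[OF adjoin_shift[OF adjoin.const[OF partial_embeddingD(4)[OF G]]]] by simp
  ultimately show ?thesis using sub_G by blast
qed

end

text \<open>A maximal partial embedding is defined on all of \<open>UQ0\<close>. It is single-valued
  because a difference of two images of y is an image of 0, and its kernel is
  \<open>I\<close>.\<close>

theorem residue_embedding: "\<exists>\<phi>. UQ0_hom \<phi> \<and> (\<forall>y\<in>UQ0. \<phi> y = 0 \<longleftrightarrow> y \<in> I)"
proof -
  obtain G where G: "partial_embedding G"
    and max: "\<And>G'. partial_embedding G' \<Longrightarrow> G \<subseteq> G' \<Longrightarrow> G' = G"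
    using maximal_partial_embedding by blast
  have total: "\<exists>c. (y, c) \<in> G" if "y \<in> UQ0" for y
    using extend_partial_embedding[OF G that] max by blast
  have unique: "c = c'" if "(y, c) \<in> G" "(y, c') \<in> G" for y c c'
  proof -
    have "(y + - y, c + - c') \<in> G" using that by (intro partial_embeddingD[OF G])
    thus ?thesis using partial_embeddingD(8)[OF G, of 0 "c - c'"] zero by simp
  qed
  define \<phi> where "\<phi> y = (THE c. (y, c) \<in> G)" for y
  have \<phi>: "\<phi> y = c" if "(y, c) \<in> G" for y c
    unfolding \<phi>_def using that unique by blast
  have mem: "(y, \<phi> y) \<in> G" if "y \<in> UQ0" for y using total[OF that] \<phi> by blast
  have "UQ0_hom \<phi>"
    unfolding UQ0_hom_def
    using \<phi>[OF partial_embeddingD(2)[OF G]] \<phi>[OF partial_embeddingD(5)[OF G mem mem]]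
      \<phi>[OF partial_embeddingD(6)[OF G mem mem]] by blast
  moreover have "\<phi> y = 0 \<longleftrightarrow> y \<in> I" if "y \<in> UQ0" for y
    using mem[OF that] partial_embedding_kernel[OF G] partial_embeddingD(8)[OF G] by metis
  ultimately show ?thesis by blast
qed

end

section \<open>Commutation relations between powers\<close>

lemma (in Kq_scalars) alg_exp_dilate:
  assumes "fps_nth f 0 = 0"
  shows "fps_nth (alg_exp s (Abs_fps (\<lambda>n. c ^ n * fps_nth f n))) n
      = c ^ n * fps_nth (alg_exp s f) n"
proof -
  let ?Y = "Abs_fps (\<lambda>n. c ^ n * fps_nth (alg_exp s f) n)"
  have "alg_exp s (Abs_fps (\<lambda>n. c ^ n * fps_nth f n)) = ?Y"
  proof (rule alg_exp_unique)
    show "fps_deriv ?Y = fps_deriv (Abs_fps (\<lambda>n. c ^ n * fps_nth f n)) * ?Y"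
    proof (rule fps_ext)
      fix n
      have "of_nat (Suc n) * fps_nth (alg_exp s f) (Suc n) = fps_nth (fps_deriv f * alg_exp s f) n"
        using arg_cong[OF alg_exp_deriv[OF assms], of "\<lambda>F. fps_nth F n"] by simp
      moreover have "fps_nth (fps_deriv ?Y) n
          = c ^ Suc n * (of_nat (Suc n) * fps_nth (alg_exp s f) (Suc n))"
        by (simp add: ac_simps del: of_nat_Suc)
      ultimately have "fps_nth (fps_deriv ?Y) n = c ^ Suc n * fps_nth (fps_deriv f * alg_exp s f) n"
        by simp
      also have "\<dots> = (\<Sum>i=0..n. c ^ Suc n * (of_nat (Suc i) * fps_nth f (Suc i)
          * fps_nth (alg_exp s f) (n - i)))"
        by (simp add: fps_mult_nth sum_distrib_left del: of_nat_Suc)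
      also have "\<dots> = (\<Sum>i=0..n. of_nat (Suc i) * (c ^ Suc i * fps_nth f (Suc i))
          * (c ^ (n - i) * fps_nth (alg_exp s f) (n - i)))"
      proof (rule sum.cong[OF refl])
        fix i assume "i \<in> {0..n}"
        hence "c ^ Suc n = c ^ Suc i * c ^ (n - i)" by (simp only: power_add[symmetric]) simp
        thus "c ^ Suc n * (of_nat (Suc i) * fps_nth f (Suc i) * fps_nth (alg_exp s f) (n - i))
          = of_nat (Suc i) * (c ^ Suc i * fps_nth f (Suc i)) * (c ^ (n - i)
              * fps_nth (alg_exp s f) (n - i))"
          by (simp only: ac_simps)
      qed
      also have "\<dots> = fps_nth (fps_deriv (Abs_fps (\<lambda>n. c ^ n * fps_nth f n)) * ?Y) n"
        by (simp add: fps_mult_nth del: of_nat_Suc power_Suc)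
      finally show "fps_nth (fps_deriv ?Y) n
        = fps_nth (fps_deriv (Abs_fps (\<lambda>n. c ^ n * fps_nth f n)) * ?Y) n" .
    qed
  qed (simp_all add: assms alg_exp_nth_0)
  thus ?thesis by simp
qed

text \<open>The relation \<open>\<psi>\<^sup>\<epsilon>(u) \<Lambda>\<^sup>\<epsilon>(u) = K\<^sup>\<epsilon> \<Lambda>\<^sup>\<epsilon>(q\<^sup>-\<^sup>2\<^sup>\<epsilon> u)\<close>, without the factor \<open>K\<^sup>\<epsilon>\<close>.\<close>

lemma psi_Lam:
  assumes \<phi>: "UQ0_hom \<phi>" and \<epsilon>: "\<epsilon> \<in> {1, -1}"
  shows "(\<Sum>j\<le>n. \<phi> (psi0 \<epsilon> (n - j)) * \<phi> (Lam (\<epsilon> * int j)))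
    = to_ac (q powi (- 2 * \<epsilon> * int n)) * \<phi> (Lam (\<epsilon> * int n))"
proof -
  define c where "c = to_ac (q powi (- 2 * \<epsilon>))"
  let ?L = "log_Lam \<phi> \<epsilon>"
  let ?F = "Abs_fps (\<lambda>s. if s = 0 then 0 else scal (of_int \<epsilon> * (q - inverse q)) * h (\<epsilon> * int s))"
  let ?f = "Abs_fps (\<lambda>n. \<phi> (fps_nth ?F n))"
  have "fps_nth ?F n \<in> UQ0" for n by (simp add: UQ0_mult)
  hence psi: "\<phi> (psi0 \<epsilon> n) = fps_nth (alg_exp to_ac ?f) n" for n
    unfolding psi0_def by (rule UQ0_hom_alg_exp[OF \<phi>])
  have Lam: "\<phi> (Lam (\<epsilon> * int n)) = fps_nth (alg_exp to_ac ?L) n" for n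
    using UQ0_hom_Lam_series[OF \<phi>, of \<epsilon> n] Lam_series_nth[OF \<epsilon>] by simp
  \<comment> \<open>On the level of logarithms: log Lam(c u) = log psi(u) + log Lam(u), which is a
    statement about single coefficients.\<close>
  have "Abs_fps (\<lambda>n. c ^ n * fps_nth ?L n) = ?f + ?L"
  proof (rule fps_ext)
    fix n
    show "fps_nth (Abs_fps (\<lambda>n. c ^ n * fps_nth ?L n)) n = fps_nth (?f + ?L) n"
    proof (cases "n = 0")
      case False
      have cn: "c ^ n = to_ac (q powi (- 2 * \<epsilon> * int n))"
        unfolding c_def power_int_mult[of q "- 2 * \<epsilon>" "int n"] by simp
      have "(q - inverse q) * qint (int n) = q powi (int n) - q powi (- int n)"
        by (simp add: qint_def del: right_minus_eq)
      hence num: "of_int \<epsilon> * (q - inverse q) * qint (int n)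
          = q powi (\<epsilon> * int n) - q powi (- (\<epsilon> * int n))"
        using \<epsilon> by (auto simp: algebra_simps)
      have prod: "q powi (- 2 * \<epsilon> * int n) * q powi (\<epsilon> * int n) = q powi (- (\<epsilon> * int n))"
        by (simp add: algebra_simps flip: power_int_add)
      have scalar: "q powi (- 2 * \<epsilon> * int n) * (q powi (\<epsilon> * int n) / qint (int n))
         = q powi (\<epsilon> * int n) / qint (int n) - of_int \<epsilon> * (q - inverse q)"
        using False num prod by (simp add: field_simps)
      have "fps_nth (Abs_fps (\<lambda>n. c ^ n * fps_nth ?L n)) n
        = - (to_ac (q powi (- 2 * \<epsilon> * int n) * (q powi (\<epsilon> * int n) / qint (int n))) * \<phi> (h (\<epsilon>
            * int n)))"
        using False by (simp add: log_Lam_def cn mult.assoc del: to_ac_divide times_divide_eq_right)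
      also have "\<dots> = to_ac (of_int \<epsilon> * (q - inverse q)) * \<phi> (h (\<epsilon> * int n)) + fps_nth ?L n"
        unfolding scalar using False by (simp
            add: log_Lam_def left_diff_distrib del: to_ac_divide to_ac_mult)
      also have "to_ac (of_int \<epsilon> * (q - inverse q)) * \<phi> (h (\<epsilon> * int n)) = fps_nth ?f n"
        using False by (simp add: UQ0_homD[OF \<phi>] del: to_ac_mult)
      finally show ?thesis by simp
    qed (simp add: UQ0_homD[OF \<phi>])
  qed
  moreover have "fps_nth ?f 0 = 0" by (simp add: UQ0_homD[OF \<phi>])
  ultimately have "alg_exp to_ac (Abs_fps (\<lambda>n. c ^ n * fps_nth ?L n))
      = alg_exp to_ac ?f * alg_exp to_ac ?L"
    using Kbar.alg_exp_add[of ?f ?L] by simp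
  hence "c ^ n * fps_nth (alg_exp to_ac ?L) n = fps_nth (alg_exp to_ac ?L * alg_exp to_ac ?f) n"
    using Kbar.alg_exp_dilate[of ?L c n] by (simp add: mult.commute)
  also have "\<dots> = (\<Sum>j\<le>n. \<phi> (psi0 \<epsilon> (n - j)) * \<phi> (Lam (\<epsilon> * int j)))"
    unfolding fps_mult_nth psi Lam by (simp only: atLeast0AtMost mult.commute)
  finally show ?thesis unfolding Lam c_def power_int_mult[of q "- 2 * \<epsilon>" "int n"] by simp
qed

section \<open>Commutators with powers of a generator\<close>

lemma scal_scal: "scal c * (scal d * x) = scal (c * d) * x"
  by (simp add: scal_mult mult.assoc)

lemma psi0_0 [simp]: "psi0 \<epsilon> 0 = 1"
  by (simp add: psi0_def alg_exp_def)

lemma psi0_1: "psi0 1 1 = scal (q - inverse q) * h 1"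
  by (simp add: psi0_def alg_exp_def)

lemma xp_xm_opposite: "xp a * xm (- a) = xm (- a) * xp a + scal (1 / (q - inverse q)) * (KK - Kinv)"
  using xp_xm[of a "- a"] by (simp add: psi_def Kpow_def)

lemma xp_xm_pos:
  assumes "0 < a + b"
  shows "xp a * xm b = xm b * xp a + scal (1 / (q - inverse q)) * (KK * psi0 1 (nat (a + b)))"
  using xp_xm[of a b] assms by (simp add: psi_def Kpow_def)

lemma xp_0_xm_1: "xp 0 * xm 1 = xm 1 * xp 0 + KK * h 1"
proof -
  have "scal (1 / (q - inverse q)) * (KK * (scal (q - inverse q) * h 1)) = KK * h 1"
    by (simp add: scal_left_commute[of KK] scal_scal del: right_minus_eq)
  thus ?thesis using xp_xm_pos[of 0 1] psi0_1 by simp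
qed

lemma double_cancel: "x + x = (y + y :: uq) \<Longrightarrow> x = y"
proof -
  assume "x + x = y + y"
  hence "scal (1/2) * ((x - y) + (x - y)) = 0" by (simp add: algebra_simps)
  moreover have "scal (1/2) * (w + w) = w" for w
    by (simp add: distrib_left flip: distrib_right scal_add)
  ultimately show "x = y" by simp
qed

text \<open>For equal indices the two sides of \<open>xp_xp\<close> are negatives of each other, so
  both vanish.\<close>

lemma xp_succ: "xp (k + 1) * xp k = scal (q powi 2) * (xp k * xp (k + 1))"
  by (rule double_cancel) (use xp_xp[of k k] in \<open>simp add: algebra_simps\<close>)

lemma xm_succ: "xm (k + 1) * xm k = scal (q powi (- 2)) * (xm k * xm (k + 1))"
  by (rule double_cancel) (use xm_xm[of k k] in \<open>simp add: algebra_simps\<close>)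

text \<open>The elements \<open>H E\<^sup>k\<close> and \<open>E\<^sup>k H\<close> span all \<open>E\<^sup>i H E\<^sup>j\<close> with \<open>i + j = k\<close>, since
  \<open>H E - t E H\<close> commutes with \<open>E\<close> up to the scalar \<open>t\<^sup>2\<close>.\<close>

locale serre_triple =
  fixes E F H Z :: uq and t :: Kq
  assumes EF: "E * F = F * E + H"
    and HE: "H * E = scal t * (E * H) + Z"
    and ZE: "Z * E = scal (t\<^sup>2) * (E * Z)"
    and t_nonzero: "t \<noteq> 0" and t_power: "n > 0 \<Longrightarrow> t ^ n \<noteq> 1"
begin

text \<open>The coefficient t^k (1 + t + \<dots> + t^k) collected when H passes k + 1 factors E and
  leaves one Z behind.\<close>

definition S :: "nat \<Rightarrow> Kq" where
  "S k = t ^ k * (t ^ Suc k - 1) / (t - 1)"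

lemma t_minus_1: "t - 1 \<noteq> 0" "t\<^sup>2 - 1 \<noteq> 0"
  using t_power[of 1] t_power[of 2] by auto

lemma S_Suc: "S (Suc k) = t ^ Suc k + t\<^sup>2 * S k"
  using t_minus_1 by (simp add: S_def field_simps power2_eq_square)

lemma H_E_power: "H * E ^ Suc k = scal (t ^ Suc k) * (E ^ Suc k * H) + scal (S k) * (E ^ k * Z)"
proof (induction k)
  case 0
  show ?case using t_minus_1 by (simp add: HE S_def)
next
  case (Suc k)
  have "H * E ^ Suc (Suc k) = (H * E ^ Suc k) * E" by (simp add: mult.assoc power_commutes)
  also have "\<dots> = scal (t ^ Suc k) * (E ^ Suc k * (H * E)) + scal (S k) * (E ^ k * (Z * E))"
    unfolding Suc.IH by (simp add: distrib_right mult.assoc)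
  also have "\<dots> = scal (t ^ Suc k) * (scal t * (E ^ Suc k * (E * H)) + E ^ Suc k * Z)
     + scal (S k) * (scal (t\<^sup>2) * (E ^ k * (E * Z)))"
    unfolding HE ZE distrib_left scal_left_commute[of "E ^ _"] ..
  also have "E ^ Suc k * (E * H) = E ^ Suc (Suc k) * H" by (simp only: power_Suc2 mult.assoc)
  also have "E ^ k * (E * Z) = E ^ Suc k * Z" by (simp only: power_Suc2 mult.assoc)
  also have "scal (t ^ Suc k) * (scal t * (E ^ Suc (Suc k) * H) + E ^ Suc k * Z)
      + scal (S k) * (scal (t\<^sup>2) * (E ^ Suc k * Z))
    = scal (t ^ Suc k * t) * (E ^ Suc (Suc k) * H) + scal (t ^ Suc k + t\<^sup>2 * S k) * (E ^ Suc k * Z)"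
    unfolding distrib_left scal_scal scal_add distrib_right
        by (simp only: add.assoc mult.commute[of "S k"])
  finally show ?case by (simp add: S_Suc mult.commute)
qed

text \<open>The commutator of \<open>E ^ Suc k\<close> and F is the sum of all E^i H E^j with i + j
  = k; \<open>a k\<close> and \<open>b k\<close> are the coefficients of this sum at
  \<open>H * E ^ k\<close> and \<open>E ^ k * H\<close>.\<close>

definition a :: "nat \<Rightarrow> Kq" where
  "a k = t * (t ^ Suc k - 1) / ((t\<^sup>2 - 1) * t ^ k)"

definition b :: "nat \<Rightarrow> Kq" where
  "b k = (t ^ Suc k - 1) / (t\<^sup>2 - 1)"

lemma E_power_F: "E ^ Suc k * F = F * E ^ Suc k + scal (a k) * (H * E ^ k) + scal (b k) * (E ^ k
    * H)"
proof (induction k)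
  case 0
  have "a 0 + b 0 = (t * (t - 1) + (t - 1)) / (t\<^sup>2 - 1)"
    by (simp add: a_def b_def add_divide_distrib)
  also have "t * (t - 1) + (t - 1) = t\<^sup>2 - 1" by (simp add: algebra_simps power2_eq_square)
  finally have "a 0 + b 0 = 1" using t_minus_1 by simp
  thus ?case by (simp add: EF add.assoc flip: distrib_right scal_add)
next
  case (Suc k)
  let ?u = "E ^ Suc k * H" and ?w = "E ^ k * Z"
  \<comment> \<open>The coefficient of Z when H passes k factors; for k = 0 there is none, and the
    predecessor must not be taken.\<close>
  define r where "r = (if k = 0 then 0 else S (k - 1))"
  have EHE: "E * (H * E ^ k) = scal (t ^ k) * ?u + scal r * ?w"
  proof (cases k)
    case (Suc k')
    have "E * (H * E ^ k) = scal (t ^ k) * (E * (E ^ k * H)) + scal (S k') * (E * (E ^ k' * Z))"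
      unfolding Suc H_E_power distrib_left scal_left_commute[of E] ..
    thus ?thesis using Suc by (simp add: r_def mult.assoc)
  qed (simp add: r_def)
  have c1: "t ^ Suc k + a k * t ^ k + b k = a (Suc k) * t ^ Suc k + b (Suc k)"
  proof -
    have ak: "a k * t ^ k = t * b k" for k using t_minus_1 t_nonzero by (simp add: a_def b_def)
    have "(t + 1) * (b (Suc k) - b k) = (t + 1) * (t ^ Suc (Suc k) - t ^ Suc k) / (t\<^sup>2 - 1)"
      by (simp add: b_def flip: diff_divide_distrib)
    also have "(t + 1) * (t ^ Suc (Suc k) - t ^ Suc k) = t ^ Suc k * (t\<^sup>2 - 1)"
      by (simp add: algebra_simps power2_eq_square)
    finally have "(t + 1) * (b (Suc k) - b k) = t ^ Suc k" using t_minus_1 by simp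
    thus ?thesis unfolding ak by (simp add: algebra_simps)
  qed
  have c2: "S k + a k * r = a (Suc k) * S k"
  proof (cases k)
    case 0
    thus ?thesis using t_minus_1 t_nonzero by (simp add: r_def a_def field_simps power2_eq_square)
  next
    case (Suc k')
    define u where "u = t ^ k'"
    define e where "e = (t\<^sup>2 * u - 1) / ((t\<^sup>2 - 1) * (t - 1))"
    have u: "u \<noteq> 0" using t_nonzero by (simp add: u_def)
    have k: "t ^ k = t * u" "t ^ Suc k = t\<^sup>2 * u" "t ^ Suc (Suc k) = t * (t\<^sup>2 * u)"
      using Suc by (simp_all add: u_def power2_eq_square)
    have S_eq: "S k = t * u * (t\<^sup>2 - 1) * e"
      using t_minus_1 by (simp add: S_def k(1,2) e_def del: power_Suc)
    have a_eq: "a k * r = (t * u - 1) * e"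
      using Suc u t_nonzero by (simp add: r_def S_def a_def k(1,2) e_def u_def del: power_Suc)
        (simp add: u_def power2_eq_square)
    have "a (Suc k) * S k = (t * (t\<^sup>2 * u) - 1) * e"
      using u t_nonzero by (simp add: S_def a_def k e_def del: power_Suc) (simp
        add: power2_eq_square)
    thus ?thesis unfolding S_eq a_eq by (simp add: algebra_simps)
  qed
  have "E ^ Suc (Suc k) * F = E * (E ^ Suc k * F)" by (simp add: mult.assoc)
  also have "\<dots> = (F * E + H) * E ^ Suc k + scal (a k) * (E * (H * E ^ k)) + scal (b k) * (E
      * (E ^ k * H))"
    unfolding Suc.IH distrib_left scal_left_commute[of E] by (simp add: EF flip: mult.assoc)
  also have "\<dots> = F * E ^ Suc (Suc k) + (scal (t ^ Suc k) * ?u + scal (S k) * ?w)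
     + scal (a k) * (scal (t ^ k) * ?u + scal r * ?w) + scal (b k) * ?u"
    unfolding EHE H_E_power[symmetric] by (simp add: distrib_right mult.assoc)
  also have "\<dots> = F * E ^ Suc (Suc k) + scal (t ^ Suc k + a k * t ^ k + b k) * ?u + scal (S k + a k
      * r) * ?w"
    by (simp add: scal_add scal_scal distrib_left distrib_right add_ac)
  also have "\<dots> = F * E ^ Suc (Suc k) + scal (a (Suc k)) * (scal (t ^ Suc k) * ?u + scal (S k) * ?w)
     + scal (b (Suc k)) * ?u"
    unfolding c1 c2 by (simp add: scal_add scal_scal distrib_left distrib_right add_ac)
  finally show ?case unfolding H_E_power[symmetric] .
qed

end

text \<open>The scalar q^2 comes from moving \<open>KK\<close> across \<open>xp 0\<close>, and Z
  from the commutator of \<open>h 1\<close> with \<open>xp 0\<close>, which is [2]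
  \<open>xp 1\<close>.\<close>

lemma serre_triple_xp: "serre_triple (xp 0) (xm 1) (KK * h 1) (scal (qint 2) * (KK * xp 1)) (q\<^sup>2)"
proof
  show "xp 0 * xm 1 = xm 1 * xp 0 + KK * h 1" by (rule xp_0_xm_1)
  have K: "KK * (xp 0 * x) = scal (q\<^sup>2) * (xp 0 * (KK * x))" for x
    using K_xp[of 0] by (metis mult.assoc power_int_numeral)
  show "KK * h 1 * xp 0 = scal (q\<^sup>2) * (xp 0 * (KK * h 1)) + scal (qint 2) * (KK * xp 1)"
    using h_xp[of 1 0] by (simp add: mult.assoc distrib_left K scal_left_commute[of KK] scal_scal)
  show "scal (qint 2) * (KK * xp 1) * xp 0
      = scal ((q\<^sup>2)\<^sup>2) * (xp 0 * (scal (qint 2) * (KK * xp 1)))"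
    using xp_succ[of 0]
    by (simp add: mult.assoc K scal_left_commute[of KK] scal_left_commute[of "xp 0"] scal_scal
        power2_eq_square[of "q\<^sup>2"] ac_simps)
  show "(q\<^sup>2) ^ n \<noteq> 1" if "n > 0" for n
    using that q_power_eq_1_iff[of "2 * n"] by (simp add: power_mult)
qed simp

text \<open>The same commutator read with the roles of the two generators exchanged, hence the sign
  of H and the inverse scalar.\<close>

lemma serre_triple_xm:
  "serre_triple (xm 1) (xp 0) (- (KK * h 1)) (scal (qint 2) * (KK * xm 2)) (inverse (q\<^sup>2))"
proof
  show "xm 1 * xp 0 = xp 0 * xm 1 + - (KK * h 1)" using xp_0_xm_1 by simp
  have q2: "q powi (- 2) = inverse (q\<^sup>2)" by (simp add: power_int_minus)
  have K: "KK * (xm 1 * x) = scal (inverse (q\<^sup>2)) * (xm 1 * (KK * x))" for x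
    using K_xm[of 1] unfolding q2 by (metis mult.assoc)
  show "- (KK * h 1) * xm 1 = scal (inverse (q\<^sup>2)) * (xm 1 * - (KK * h 1)) + scal (qint 2) * (KK
      * xm 2)"
    using h_xm[of 1 1] by (simp add: mult.assoc right_diff_distrib K scal_left_commute[of KK])
  show "scal (qint 2) * (KK * xm 2) * xm 1
      = scal ((inverse (q\<^sup>2))\<^sup>2) * (xm 1 * (scal (qint 2) * (KK * xm 2)))"
    using xm_succ[of 1] unfolding q2
    by (simp add: mult.assoc K scal_left_commute[of KK] scal_left_commute[of "xm 1"] scal_scal
        power2_eq_square[of "inverse (q\<^sup>2)"] ac_simps)
  show "(inverse (q\<^sup>2)) ^ n \<noteq> 1" if "n > 0" for n
    using that q_power_eq_1_iff[of "2 * n"] by (simp add: power_mult power_inverse)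
qed simp

section \<open>The identity of Garland\<close>

locale left_ideal =
  fixes J :: "uq set"
  assumes zero: "0 \<in> J" and add: "x \<in> J \<Longrightarrow> y \<in> J \<Longrightarrow> x + y \<in> J"
    and mult: "x \<in> J \<Longrightarrow> a * x \<in> J"
begin

lemma uminus: "x \<in> J \<Longrightarrow> - x \<in> J"
  using mult[of x "- 1"] by simp

lemma diff: "x \<in> J \<Longrightarrow> y \<in> J \<Longrightarrow> x - y \<in> J"
  using add[of x "- y"] uminus by simp

lemma sum: "(\<And>i. i \<in> A \<Longrightarrow> f i \<in> J) \<Longrightarrow> sum f A \<in> J"
  by (induction A rule: infinite_finite_induct) (simp_all add: zero add)

lemma scal_cancel: "scal c * x \<in> J \<Longrightarrow> c \<noteq> 0 \<Longrightarrow> x \<in> J"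
  using mult[of "scal c * x" "scal (inverse c)"] by (simp add: scal_inverse)

definition congruent :: "uq \<Rightarrow> uq \<Rightarrow> bool" (infix "\<doteq>" 50) where
  "x \<doteq> y \<longleftrightarrow> x - y \<in> J"

lemma cong_refl [simp]: "x \<doteq> x"
  by (simp add: congruent_def zero)

lemma cong_sym: "x \<doteq> y \<Longrightarrow> y \<doteq> x"
  using uminus[of "x - y"] by (simp add: congruent_def)

lemma cong_trans [trans]: "x \<doteq> y \<Longrightarrow> y \<doteq> z \<Longrightarrow> x \<doteq> z"
  using add[of "x - y" "y - z"] by (simp add: congruent_def)

lemma cong_add: "x \<doteq> y \<Longrightarrow> x' \<doteq> y' \<Longrightarrow> x + x' \<doteq> y + y'"
  using add[of "x - y" "x' - y'"] by (simp add: congruent_def algebra_simps)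

lemma cong_mult: "x \<doteq> y \<Longrightarrow> a * x \<doteq> a * y"
  using mult[of "x - y" a] by (simp add: congruent_def right_diff_distrib)

lemma cong_diff: "x \<doteq> y \<Longrightarrow> x' \<doteq> y' \<Longrightarrow> x - x' \<doteq> y - y'"
  using diff[of "x - y" "x' - y'"] by (simp add: congruent_def algebra_simps)

lemma cong_sum: "(\<And>i. i \<in> A \<Longrightarrow> f i \<doteq> g i) \<Longrightarrow> sum f A \<doteq> sum g A"
  using sum[of A "\<lambda>i. f i - g i"] by (simp add: congruent_def sum_subtractf)

lemma cong_mem_iff: "x \<doteq> y \<Longrightarrow> x \<in> J \<longleftrightarrow> y \<in> J"
  using diff[of x "x - y"] add[of y "x - y"] by (auto simp: congruent_def)

text \<open>Applying \<open>KK\<close> minus the eigenvalue of one vector removes that vector from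
  the relation and multiplies the others by nonzero scalars.\<close>

lemma eigenvector_independence:
  assumes "finite A" "inj_on \<mu> A" "\<And>i. i \<in> A \<Longrightarrow> KK * x i \<doteq> scal (q powi \<mu> i) * x i"
    and "(\<Sum>i\<in>A. scal (d i) * x i) \<in> J" and "i \<in> A"
  shows "scal (d i) * x i \<in> J"
  using assms
proof (induction A arbitrary: d i rule: finite_induct)
  case (insert k A)
  have "(KK - scal (q powi \<mu> k)) * (\<Sum>i\<in>insert k A. scal (d i) * x i)
      \<doteq> (\<Sum>i\<in>insert k A. scal ((q powi \<mu> i - q powi \<mu> k) * d i) * x i)"
    unfolding sum_distrib_left
  proof (rule cong_sum)
    fix i assume "i \<in> insert k A"
    from cong_mult[OF insert.prems(2)[OF this], of "scal (d i)"]
    have "scal (d i) * (KK * x i) - scal (q powi \<mu> k) * (scal (d i) * x i)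
      \<doteq> scal (d i) * (scal (q powi \<mu> i) * x i) - scal (q powi \<mu> k) * (scal (d i) * x i)"
      by (intro cong_diff) simp_all
    thus "(KK - scal (q powi \<mu> k)) * (scal (d i) * x i)
      \<doteq> scal ((q powi \<mu> i - q powi \<mu> k) * d i) * x i"
      by (simp add: left_diff_distrib scal_diff scal_left_commute[of KK] scal_scal mult.commute[of
        "d i"])
  qed
  moreover have "(KK - scal (q powi \<mu> k)) * (\<Sum>i\<in>insert k A. scal (d i) * x i) \<in> J"
    by (rule mult[OF insert.prems(3)])
  ultimately have "(\<Sum>i\<in>insert k A. scal ((q powi \<mu> i - q powi \<mu> k) * d i) * x i) \<in> J"
    by (simp only: cong_mem_iff)
  hence "(\<Sum>i\<in>A. scal ((q powi \<mu> i - q powi \<mu> k) * d i) * x i) \<in> J"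
    using insert.hyps by simp
  hence "scal ((q powi \<mu> i - q powi \<mu> k) * d i) * x i \<in> J" if "i \<in> A" for i
    using insert.IH[of "\<lambda>i. (q powi \<mu> i - q powi \<mu> k) * d i"] insert.prems that
      by (simp add: inj_on_insert)
  moreover have "q powi \<mu> i - q powi \<mu> k \<noteq> 0" if "i \<in> A" for i
  proof -
    have "\<mu> i \<noteq> \<mu> k" using insert.hyps(2) insert.prems(1) that by (metis inj_onD insertI1 insertI2)
    thus ?thesis by (simp add: q_powi_eq_iff)
  qed
  ultimately have A: "scal (d i) * x i \<in> J" if "i \<in> A" for i
    using scal_cancel that by (metis scal_mult mult.assoc)
  have "(\<Sum>i\<in>insert k A. scal (d i) * x i) - (\<Sum>i\<in>A. scal (d i) * x i) \<in> J"
    by (intro diff sum A insert.prems(3))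
  hence "scal (d k) * x k \<in> J" using insert.hyps by simp
  thus ?case using A insert.prems(4) by auto
qed simp

end

text \<open>\<open>h k\<close> commutes with every \<open>Lam j\<close>, so it shifts all indices of
  the \<open>xm\<close> alike. This is how a relation for one s spreads to all s.\<close>

lemma h_Xtilde_Lam:
  "h k * Xtilde_Lam N s = Xtilde_Lam N s * h k - scal (qint (2 * k) / of_int k) * Xtilde_Lam N (s
      + k)"
proof -
  have "h k * (xm (s - 1 - int j) * Lam (int j)) = xm (s - 1 - int j) * Lam (int j) * h k
      - scal (qint (2 * k) / of_int k) * (xm (s + k - 1 - int j) * Lam (int j))" for j
  proof -
    have "h k * (xm (s - 1 - int j) * Lam (int j)) = (h k * xm (s - 1 - int j)) * Lam (int j)"
      by (simp only: mult.assoc)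
    also have "\<dots> = xm (s - 1 - int j) * (h k * Lam (int j))
      - scal (qint (2 * k) / of_int k) * (xm (k + (s - 1 - int j)) * Lam (int j))"
      unfolding h_xm by (simp only: left_diff_distrib mult.assoc)
    also have "h k * Lam (int j) = Lam (int j) * h k" by (rule UQ0_h_commute) simp
    also have "k + (s - 1 - int j) = s + k - 1 - int j" by simp
    finally show ?thesis by (simp only: mult.assoc)
  qed
  thus ?thesis
    by (simp add: Xtilde_Lam_def sum_distrib_left sum_distrib_right sum_subtractf)
qed

section \<open>Congruences modulo the annihilator of a highest weight vector\<close>

definition psi_pos :: "int \<Rightarrow> uq" where
  "psi_pos k = (if k \<ge> 0 then psi0 1 (nat k) else 0)"

definition psi_neg :: "int \<Rightarrow> uq" where
  "psi_neg k = (if k \<le> 0 then psi0 (- 1) (nat (- k)) else 0)"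

lemma psi_pos_UQ0 [simp]: "psi_pos k \<in> UQ0" and psi_neg_UQ0 [simp]: "psi_neg k \<in> UQ0"
  by (simp_all add: psi_pos_def psi_neg_def)

lemma to_ac_powi_neq_1: "k \<noteq> 0 \<Longrightarrow> to_ac (q powi k) \<noteq> 1"
  using q_powi_eq_1_iff[of k] by (metis to_ac_1 to_ac_eq_iff)

lemma UQ0_hom_sum:
  assumes "UQ0_hom \<phi>" "\<And>i. i \<in> A \<Longrightarrow> f i \<in> UQ0"
  shows "\<phi> (sum f A) = (\<Sum>i\<in>A. \<phi> (f i))"
  using assms(2)
  by (induction A rule: infinite_finite_induct) (simp_all add: UQ0_homD[OF assms(1)] UQ0_sum)

text \<open>\<open>J\<close> plays the annihilator of a highest weight vector of weight n, and
  \<phi> the character by which \<open>UQ0\<close> acts on it, with values in \<open>Kbar\<close>.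
  Since only kernels are compared, the vector need not be an eigenvector over
  \<open>Kq\<close>.\<close>

locale hw_annihilator = left_ideal J for J +
  fixes n :: int and \<phi> :: "uq \<Rightarrow> Kbar"
  assumes hw: "hw_ideal n \<subseteq> J" and right: "x \<in> J \<Longrightarrow> y \<in> UQ0 \<Longrightarrow> x * y \<in> J"
    and \<phi>: "UQ0_hom \<phi>" and kernel: "y \<in> UQ0 \<Longrightarrow> y \<in> J \<longleftrightarrow> \<phi> y = 0"
begin

lemma cong_right: "x \<doteq> y \<Longrightarrow> z \<in> UQ0 \<Longrightarrow> x * z \<doteq> y * z"
  using right[of "x - y" z] by (simp add: congruent_def left_diff_distrib)

lemma cong_UQ0_iff: "x \<in> UQ0 \<Longrightarrow> y \<in> UQ0 \<Longrightarrow> x \<doteq> y \<longleftrightarrow> \<phi> x = \<phi> y"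
  using kernel[of "x - y"] by (simp add: congruent_def UQ0_diff UQ0_homD[OF \<phi>])

lemma K_cong: "s \<in> lowering r \<Longrightarrow> KK * s \<doteq> scal (q powi (n - 2 * int r)) * s"
  using lowering_K[of s r n] hw by (auto simp: congruent_def)

lemma Kinv_cong: "y \<in> UQ0 \<Longrightarrow> Kinv * y \<doteq> scal (q powi (- n)) * y"
  using lowering_Kinv[OF lowering_base, of y n] hw by (auto simp: congruent_def)

lemma psi_cong:
  "psi 1 k \<doteq> scal (q powi n) * psi_pos k" "psi (- 1) k \<doteq> scal (q powi (- n)) * psi_neg k"
  using K_cong[OF lowering_base, of "psi0 1 (nat k)"] Kinv_cong[of "psi0 (- 1) (nat (- k))"]
  by (auto simp: psi_def psi_pos_def psi_neg_def Kpow_def)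

lemma xp_cong: "y \<in> UQ0 \<Longrightarrow> xp k * y \<doteq> 0"
  using lowering_xp_0[OF lowering_base, of y k n] hw by (auto simp: congruent_def)

lemma xp_xm_cong:
  assumes "y \<in> UQ0"
  shows "xp 0 * (xm k * y) \<doteq> scal (1 / (q - inverse q)) *
    ((scal (q powi n) * psi_pos k - scal (q powi (- n)) * psi_neg k) * y)"
proof -
  have "xp 0 * (xm k * y) = xp 0 * xm k * y" by (simp only: mult.assoc)
  also have "\<dots> = xm k * (xp 0 * y) + scal (1 / (q - inverse q)) * ((psi 1 k - psi (- 1) k) * y)"
    using xp_xm[of 0 k] by (simp add: distrib_right mult.assoc)
  also have "\<dots> \<doteq> xm k * 0 + scal (1 / (q - inverse q)) *
      ((scal (q powi n) * psi_pos k - scal (q powi (- n)) * psi_neg k) * y)"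
    by (intro cong_add cong_mult xp_cong cong_right cong_diff psi_cong assms)
  finally show ?thesis by simp
qed

lemma xp_Xtilde_cong:
  "xp 0 * Xtilde_Lam N s \<doteq> scal (1 / (q - inverse q)) * (\<Sum>j\<le>N.
    (scal (q powi n) * psi_pos (s - 1 - int j) - scal (q powi (- n)) * psi_neg (s - 1 - int j))
        * Lam (int j))"
  unfolding Xtilde_Lam_def sum_distrib_left by (intro cong_sum xp_xm_cong) simp

text \<open>For this index only psi with positive index contributes. The sum is that of
  \<open>psi_Lam\<close> in degree r + 1 without its last term, which leaves q^(-2 (r + 1)) - 1
  times \<open>Lam (Suc r)\<close>.\<close>

lemma xp_Xtilde_Lam:
  "xp 0 * Xtilde_Lam r (int r + 2) \<doteq> scal (q powi n * (q powi (- 2 * int (Suc r)) - 1) / (q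
      - inverse q)) * Lam (int (Suc r))"
proof -
  let ?S = "\<Sum>j\<le>r. psi0 1 (Suc r - j) * Lam (int j)"
  have "(\<Sum>j\<le>r. \<phi> (psi0 1 (Suc r - j)) * \<phi> (Lam (int j)))
      = to_ac (q powi (- 2 * int (Suc r))) * \<phi> (Lam (int (Suc r))) - \<phi> (Lam (int (Suc r)))"
    using psi_Lam[OF \<phi>, of 1 "Suc r"] by (simp add: UQ0_homD[OF \<phi>] eq_diff_eq del: of_nat_Suc)
  moreover have "\<phi> ?S = (\<Sum>j\<le>r. \<phi> (psi0 1 (Suc r - j)) * \<phi> (Lam (int j)))"
    by (simp add: UQ0_hom_sum[OF \<phi>] UQ0_mult UQ0_homD[OF \<phi>])
  ultimately have "?S \<doteq> scal (q powi (- 2 * int (Suc r)) - 1) * Lam (int (Suc r))"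
    by (subst cong_UQ0_iff)
      (auto simp: UQ0_homD[OF \<phi>] left_diff_distrib simp del: of_nat_Suc intro!: UQ0_sum UQ0_mult)
  from cong_mult[OF this, of "scal (1 / (q - inverse q) * q powi n)"]
  have "scal (1 / (q - inverse q) * q powi n) * ?S
    \<doteq> scal (q powi n * (q powi (- 2 * int (Suc r)) - 1) / (q - inverse q)) * Lam (int (Suc r))"
    by (simp add: scal_scal del: of_nat_Suc right_minus_eq)
  moreover have "(\<Sum>j\<le>r. (scal (q powi n) * psi_pos (int r + 2 - 1 - int j)
      - scal (q powi (- n)) * psi_neg (int r + 2 - 1 - int j)) * Lam (int j))
          = scal (q powi n) * ?S"
    unfolding sum_distrib_left
  proof (rule sum.cong[OF refl])
    fix j assume "j \<in> {..r}"
    hence j: "j \<le> r" "nat (1 + int r - int j) = Suc r - j" by auto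
    thus "(scal (q powi n) * psi_pos (int r + 2 - 1 - int j) - scal (q powi (- n))
        * psi_neg (int r + 2 - 1 - int j)) * Lam (int j)
      = scal (q powi n) * (psi0 1 (Suc r - j) * Lam (int j))"
      by (simp add: psi_pos_def psi_neg_def mult.assoc)
  qed
  ultimately show ?thesis
    using cong_trans[OF xp_Xtilde_cong[of r "int r + 2"]] by (simp only: scal_scal)
qed

text \<open>In the induction step the two expansions of \<open>E\<^sup>r\<^sup>+\<^sup>1 F\<^sup>r\<^sup>+\<^sup>2\<close> given by \<open>E_power_F\<close>, for
  \<open>E\<^sup>r\<^sup>+\<^sup>1 F\<close> and for \<open>E F\<^sup>r\<^sup>+\<^sup>2\<close>, both contain \<open>E\<^sup>r H F\<^sup>r\<^sup>+\<^sup>1\<close>; eliminating it leaves a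
  commutator with \<open>h 1\<close>.\<close>

lemma garland:
  "\<exists>g. g \<noteq> 0 \<and> xp 0 ^ r * xm 1 ^ Suc r \<doteq> scal g * Xtilde_Lam r (int r + 2)"
proof (induction r)
  case 0
  show ?case by (intro exI[of _ 1]) (simp add: Xtilde_Lam_def)
next
  case (Suc r)
  then obtain g where g: "g \<noteq> 0" "xp 0 ^ r * xm 1 ^ Suc r \<doteq> scal g * Xtilde_Lam r (int r + 2)"
    by blast
  interpret P: serre_triple "xp 0" "xm 1" "KK * h 1" "scal (qint 2) * (KK * xp 1)" "q\<^sup>2"
    by (rule serre_triple_xp)
  interpret M: serre_triple "xm 1" "xp 0" "- (KK * h 1)" "scal (qint 2) * (KK * xm 2)"
      "inverse (q\<^sup>2)"
    by (rule serre_triple_xm)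
  let ?E = "xp 0" and ?F = "xm 1" and ?H = "KK * h 1" and ?S = "Xtilde_Lam r (int r + 2)"
  let ?G = "?E ^ r * ?F ^ Suc r" and ?G' = "?E ^ Suc r * ?F ^ Suc (Suc r)"
    and ?W = "?E ^ r * (?H * ?F ^ Suc r)" and ?L = "Lam (int (Suc r))"
  define a b a' b' where "a = P.a r" "b = P.b r" "a' = M.a (Suc r)" "b' = M.b (Suc r)"
  \<comment> \<open>This produces \<open>xm 1 * Lam (Suc r)\<close>, the term by which the sum for r
    + 1 exceeds the shifted sum for r.\<close>
  have FEG: "?F * (?E * ?G) \<doteq> scal (g * (q powi n * (q powi (- 2 * int (Suc r)) - 1) / (q
      - inverse q))) * (?F * ?L)"
  proof -
    have "?F * (?E * ?G) \<doteq> scal g * (?F * (?E * ?S))"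
      using cong_mult[OF cong_mult[OF g(2)], of ?F ?E]
      by (simp only: scal_left_commute[of ?E] scal_left_commute[of ?F])
    also have "scal g * (?F * (?E * ?S))
        \<doteq> scal g * (?F * (scal (q powi n * (q powi (- 2 * int (Suc r)) - 1) / (q - inverse q))
            * ?L))"
      by (intro cong_mult xp_Xtilde_Lam)
    finally show ?thesis by (simp only: scal_left_commute[of ?F] scal_scal)
  qed
  have S: "?S \<in> lowering 1"
  proof -
    have "(\<Sum>j\<in>A. xm (int r + 2 - 1 - int j) * Lam (int j)) \<in> lowering 1" for A
      by (induction A rule: infinite_finite_induct)
        (simp_all add: lowering_add lowering_step[OF lowering_base, simplified])
    thus ?thesis by (simp only: Xtilde_Lam_def)
  qed
  have HG: "?H * ?G \<doteq> scal (g * q powi (n - 2)) * (h 1 * ?S)"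
  proof -
    have "?H * ?G \<doteq> ?H * (scal g * ?S)" by (rule cong_mult[OF g(2)])
    also have "?H * (scal g * ?S) = scal g * (KK * (h 1 * ?S))"
      by (simp only: mult.assoc scal_left_commute[of KK] scal_left_commute[of "h 1"])
    also have "\<dots> \<doteq> scal g * (scal (q powi (n - 2)) * (h 1 * ?S))"
      using K_cong[OF lowering_h[OF S]] by (intro cong_mult) simp
    finally show ?thesis by (simp only: scal_scal)
  qed
  have GH: "?G * ?H \<doteq> scal (g * q powi n) * (?S * h 1)"
  proof -
    have "?G * ?H \<doteq> ?G * (scal (q powi n) * h 1)"
      using K_cong[OF lowering_base, of "h 1"] by (intro cong_mult) simp
    also have "?G * (scal (q powi n) * h 1) = scal (q powi n) * (?G * h 1)"
      by (rule scal_left_commute)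
    also have "\<dots> \<doteq> scal (q powi n) * (scal g * ?S * h 1)"
      by (intro cong_mult cong_right g(2)) simp
    finally show ?thesis by (simp only: mult.assoc scal_scal mult.commute[of g])
  qed
  have "?G' = (?E ^ Suc r * ?F) * ?F ^ Suc r" by (simp add: mult.assoc)
  also have "\<dots> = ?F * (?E * ?G) + scal a * (?H * ?G) + scal b * ?W"
    unfolding P.E_power_F a_b_a'_b'_def by (simp add: distrib_right mult.assoc)
  finally have G1: "?G' = ?F * (?E * ?G) + scal a * (?H * ?G) + scal b * ?W" .
  have "?G' = ?E ^ r * (?E * ?F ^ Suc (Suc r))" by (simp only: power_Suc2 mult.assoc)
  also have "?E * ?F ^ Suc (Suc r) = ?F ^ Suc (Suc r) * ?E + scal a' * (?H * ?F ^ Suc r) + scal b'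
      * (?F ^ Suc r * ?H)"
    unfolding M.E_power_F a_b_a'_b'_def by simp
  also have "?E ^ r * \<dots> = ?E ^ r * ?F ^ Suc (Suc r) * ?E + scal a' * ?W + scal b' * (?G * ?H)"
    by (simp only: distrib_left mult.assoc scal_left_commute[of "?E ^ r"])
  also have "\<dots> \<doteq> 0 + scal a' * ?W + scal b' * (?G * ?H)"
  proof (intro cong_add cong_refl)
    show "?E ^ r * ?F ^ Suc (Suc r) * ?E \<doteq> 0" using cong_mult[OF xp_cong[of 1 0]] by simp
  qed
  finally have G2: "?G' \<doteq> scal a' * ?W + scal b' * (?G * ?H)" by simp
  let ?e = "q powi n * (q powi (- 2 * int (Suc r)) - 1) / (q - inverse q)" and ?t = "q\<^sup>2"
  let ?X = "Xtilde_Lam r (int r + 2 + 1)"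
  \<comment> \<open>\<open>c1\<close> and \<open>c3\<close> show that \<open>h 1 * ?S\<close> and
    \<open>?S * h 1\<close> occur with this same coefficient and thus form a commutator. By
    \<open>c2\<close> the extra term carries -C [2], the coefficient that the commutator gives to
    the shifted sum.\<close>
  define C where "C = b * b' * g * q powi n"
  have t: "?t ^ Suc r \<noteq> 1" "?t ^ Suc (Suc r) \<noteq> 1" "?t\<^sup>2 \<noteq> 1" "?t \<noteq> 1" "?t \<noteq> 0"
    using P.t_power[of "Suc r"] P.t_power[of "Suc (Suc r)"] P.t_power[of 2] P.t_power[of 1] by
      simp_all
  have a: "a * ?t ^ r = ?t * b"
    unfolding a_b_a'_b'_def P.a_def P.b_def using t(5) by simp
  have b: "b * (?t\<^sup>2 - 1) = ?t ^ Suc r - 1"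
    unfolding a_b_a'_b'_def P.b_def using t(3) by simp
  have a': "a' = ?t ^ r * b'"

  proof -
    have "x * N / (D * y) = x / y * (N / D)" for x y N D :: Kq by simp
    hence "a' = inverse ?t / inverse ?t ^ Suc r * b'" unfolding a_b_a'_b'_def M.a_def M.b_def .
    also have "inverse ?t / inverse ?t ^ Suc r = ?t ^ r" using t(5) by (simp add: field_simps)
    finally show ?thesis .
  qed
  have b': "b' = ?t\<^sup>2 * (inverse ?t ^ Suc (Suc r) - 1) / (1 - ?t\<^sup>2)"
    unfolding a_b_a'_b'_def M.b_def using t(3,5) by (simp add: field_simps)
  have a'_eq: "a' * (?t\<^sup>2 - 1) = ?t ^ Suc (Suc r) - 1"
    unfolding a' b' using t(3,5) by (simp add: field_simps power2_eq_square)
  have "(a' - b) * (?t\<^sup>2 - 1) = ?t ^ Suc r * (?t - 1)"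
    unfolding left_diff_distrib[of a'] a'_eq b by (simp add: algebra_simps)
  \<comment> \<open>The factor by which the left-hand side is multiplied in the elimination; it has
    to be inverted at the end.\<close>
  hence nonzero: "a' - b \<noteq> 0" using t(4,5) by auto
  have "b \<noteq> 0" "a' \<noteq> 0" using a'_eq b t(1,2) by auto
  hence "b' \<noteq> 0" "C \<noteq> 0" using a' g(1) by (auto simp: C_def)
  have "a' * a * (g * q powi (n - 2)) = (a * ?t ^ r) * b' * g * (q powi n / ?t)"
    unfolding a' by (simp add: power_int_diff)
  hence c1: "a' * a * (g * q powi (n - 2)) = C"
    unfolding a C_def using t(5) by simp
  have qint_2: "qint 2 = (?t\<^sup>2 - 1) / ?t / (q - inverse q)"
  proof -
    have "q powi 2 - q powi (- 2) = (?t\<^sup>2 - 1) / ?t"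
      by (simp add: power_int_minus field_simps)
    thus ?thesis by (simp add: qint_def)
  qed
  have "q powi (- 2 * int (Suc r)) = inverse (?t ^ Suc r)"
    using power_int_mult[of q 2 "- int (Suc r)"]
      by (simp only: power_int_minus power_int_of_nat) simp
  hence "?t ^ r * (q powi (- 2 * int (Suc r)) - 1) = - (b * (?t\<^sup>2 - 1) / ?t)"
    unfolding b using t(5) by (simp add: field_simps)
  moreover have "a' * (g * ?e) = b' * g * q powi n * (?t ^ r * (q powi (- 2 * int (Suc r))
      - 1)) / (q - inverse q)"
    unfolding a' by (simp only: times_divide_eq_right ac_simps)
  ultimately have c2: "a' * (g * ?e) = - (C * qint 2)"
    unfolding qint_2 C_def by (simp add: ac_simps del: right_minus_eq)
  have c3: "b * b' * (g * q powi n) = C" by (simp add: C_def)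
  have X: "Xtilde_Lam (Suc r) (int (Suc r) + 2) = ?X + ?F * ?L"
    by (simp add: Xtilde_Lam_def algebra_simps)
  \<comment> \<open>Subtracting b times the second expansion from a' times the first removes
    \<open>?W\<close>.\<close>
  have "scal (a' - b) * ?G' = scal a' * ?G' - scal b * ?G'"
    by (simp only: scal_diff left_diff_distrib)
  also have "\<dots> \<doteq> scal a' * (?F * (?E * ?G) + scal a * (?H * ?G) + scal b * ?W)
      - scal b * (scal a' * ?W + scal b' * (?G * ?H))"
    using G2 by (intro cong_diff cong_mult) (simp_all only: G1[symmetric] cong_refl)
  also have "\<dots> = scal a' * (?F * (?E * ?G)) + scal (a' * a) * (?H * ?G) - scal (b * b') * (?G * ?H)"
    by (simp only: distrib_left scal_scal mult.commute[of b a']) (simp add: algebra_simps)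
  also have "\<dots> \<doteq> scal a' * (scal (g * ?e) * (?F * ?L)) + scal (a' * a) * (scal (g * q powi (n
      - 2)) * (h 1 * ?S))
      - scal (b * b') * (scal (g * q powi n) * (?S * h 1))"
    by (intro cong_diff cong_add cong_mult FEG HG GH)
  also have "\<dots> = scal (- (C * qint 2)) * (?F * ?L) + scal C * (h 1 * ?S - ?S * h 1)"
    unfolding scal_scal c1 c2 c3 by (simp only: right_diff_distrib add_diff_eq)
  also have "h 1 * ?S - ?S * h 1 = - (scal (qint 2) * ?X)"
    unfolding h_Xtilde_Lam[of 1] by simp
  also have "scal (- (C * qint 2)) * (?F * ?L) + scal C * - (scal (qint 2) * ?X)
    = scal (- (C * qint 2)) * Xtilde_Lam (Suc r) (int (Suc r) + 2)"
    unfolding X by (simp add: scal_minus scal_scal distrib_left)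
  finally have "scal (a' - b) * ?G' \<doteq> scal (- (C * qint 2)) * Xtilde_Lam (Suc r) (int (Suc r)
      + 2)" .
  from cong_mult[OF this, of "scal (inverse (a' - b))"]
  have "?G' \<doteq> scal (inverse (a' - b) * - (C * qint 2)) * Xtilde_Lam (Suc r) (int (Suc r) + 2)"
    by (simp only: scal_inverse[OF nonzero]) (simp only: scal_scal)
  moreover have "inverse (a' - b) * - (C * qint 2) \<noteq> 0"
    using nonzero \<open>C \<noteq> 0\<close> by simp
  ultimately show ?case by blast
qed

section \<open>Recursions for the values of the Lam r\<close>

context
  assumes n: "n \<ge> 0" and top: "xm 1 ^ Suc (nat n) \<in> J" and one: "1 \<notin> J"
begin

text \<open>\<open>garland\<close> gives the single index n + 2. Since \<open>J\<close> is stable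
  under multiplication by \<open>h k\<close> on both sides, the commutator moves the index by any
  nonzero k.\<close>

lemma Xtilde_Lam_vanishes: "Xtilde_Lam (nat n) s \<in> J"
proof -
  let ?T = "Xtilde_Lam (nat n)"
  obtain g where g: "g \<noteq> 0" "xp 0 ^ nat n * xm 1 ^ Suc (nat n) \<doteq> scal g * ?T (int (nat n) + 2)"
    using garland by blast
  have start: "?T (n + 2) \<in> J"
    using cong_mem_iff[OF g(2)] mult[OF top] scal_cancel[OF _ g(1)] n by simp
  have shift: "?T (s + k) \<in> J" if "?T s \<in> J" "k \<noteq> 0" for s k
  proof -
    have "?T s * h k - h k * ?T s \<in> J" by (intro diff mult right that) simp
    hence "scal (qint (2 * k) / of_int k) * ?T (s + k) \<in> J" by (simp add: h_Xtilde_Lam)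
    thus ?thesis by (rule scal_cancel) (use that in simp)
  qed
  show ?thesis
    using shift[OF start, of "s - (n + 2)"] start by (cases "s = n + 2") auto
qed

definition L :: "int \<Rightarrow> Kbar" where
  "L j = (if 0 \<le> j \<and> j \<le> n then \<phi> (Lam j) else 0)"

lemma psi_relation:
  "(\<Sum>j\<le>nat n. (to_ac (q powi n) * \<phi> (psi_pos (s - int j)) - to_ac (q powi (- n)) * \<phi> (psi_neg (s
      - int j)))
     * \<phi> (Lam (int j))) = 0"
proof -
  let ?f = "\<lambda>j. (scal (q powi n) * psi_pos (s - int j) - scal (q powi (- n)) * psi_neg (s
      - int j)) * Lam (int j)"
  have f: "?f j \<in> UQ0" for j by (intro UQ0_mult UQ0_diff) auto
  have "xp 0 * Xtilde_Lam (nat n) (s + 1) \<in> J" by (rule mult[OF Xtilde_Lam_vanishes])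
  hence "scal (1 / (q - inverse q)) * (\<Sum>j\<le>nat n. ?f j) \<in> J"
    using cong_mem_iff[OF xp_Xtilde_cong[of "nat n" "s + 1"]] by simp
  hence "(\<Sum>j\<le>nat n. ?f j) \<in> J" by (rule scal_cancel) (simp del: right_minus_eq)
  hence "\<phi> (\<Sum>j\<le>nat n. ?f j) = 0" by (rule iffD1[OF kernel[OF UQ0_sum], rotated]) (rule f)
  moreover have "\<phi> (?f j) = (to_ac (q powi n) * \<phi> (psi_pos (s - int j)) - to_ac (q powi (- n))
      * \<phi> (psi_neg (s - int j)))
     * \<phi> (Lam (int j))" for j
    by (simp add: UQ0_homD[OF \<phi>] UQ0_mult UQ0_diff)
  ultimately show ?thesis by (simp add: UQ0_hom_sum[OF \<phi> f])
qed

text \<open>For index r > n the relation \<open>psi_relation\<close> is the sum of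
  \<open>psi_Lam\<close> over j < r, the terms between n and r vanishing by induction. Hence
  \<open>Lam r\<close> and q^(-2r) \<open>Lam r\<close> have the same value.\<close>

lemma Lam_large: "r > nat n \<Longrightarrow> \<phi> (Lam (int r)) = 0"
proof (induction r rule: less_induct)
  case (less r)
  let ?f = "\<lambda>j. \<phi> (psi0 1 (r - j)) * \<phi> (Lam (int j))"
  have pos: "psi_pos (int r - int j) = psi0 1 (r - j)"
      "psi_neg (int r - int j) = 0" if "j \<le> nat n" for j
    using that less.prems by (auto simp: psi_pos_def psi_neg_def nat_diff_distrib)
  have "(\<Sum>j\<le>nat n. to_ac (q powi n) * ?f j) = 0"
    using psi_relation[of "int r"] by (simp add: pos UQ0_homD[OF \<phi>] mult.assoc)
  hence "(\<Sum>j\<le>nat n. ?f j) = 0" by (simp flip: sum_distrib_left)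
  moreover have "(\<Sum>j\<le>r. ?f j) = (\<Sum>j\<in>insert r {..nat n}. ?f j)"
    using less by (intro sum.mono_neutral_right) auto
  ultimately have "(\<Sum>j\<le>r. ?f j) = \<phi> (Lam (int r))"
    using less.prems by (simp add: UQ0_homD[OF \<phi>])
  hence "\<phi> (Lam (int r)) = to_ac (q powi (- 2 * int r)) * \<phi> (Lam (int r))"
    using psi_Lam[OF \<phi>, of 1 r] by simp
  moreover have "to_ac (q powi (- 2 * int r)) \<noteq> 1"
    using to_ac_powi_neq_1[of "- 2 * int r"] less.prems by simp
  ultimately show ?case by (metis mult_cancel_right1)
qed

text \<open>With \<open>L j = 0\<close> outside \<open>0 \<le> j \<le> n\<close>, the sequence \<open>L (n - r)\<close> satisfies the recursion that
  \<open>psi_Lam\<close> gives for \<open>\<phi> (Lam (- r))\<close>.\<close>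

lemma L_recursion:
  "(\<Sum>i\<le>r. \<phi> (psi0 (- 1) (r - i)) * L (n - int i)) = to_ac (q powi (2 * int r)) * L (n - int r)"
proof -
  let ?s = "n - int r" and ?N = "nat n"
  have A: "(\<Sum>j\<le>?N. \<phi> (psi_pos (?s - int j)) * \<phi> (Lam (int j))) = to_ac (q powi (- 2 * ?s)) * L ?s"
  proof (cases "?s \<ge> 0")
    case True
    have "(\<Sum>j\<le>?N. \<phi> (psi_pos (?s - int j)) * \<phi> (Lam (int j)))
      = (\<Sum>j\<le>nat ?s. \<phi> (psi_pos (?s - int j)) * \<phi> (Lam (int j)))"
      using n True by (intro sum.mono_neutral_right) (auto
        simp: psi_pos_def UQ0_homD[OF \<phi>] le_nat_iff)
    also have "\<dots> = (\<Sum>j\<le>nat ?s. \<phi> (psi0 1 (nat ?s - j)) * \<phi> (Lam (1 * int j)))"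
      using True by (intro sum.cong) (auto simp: psi_pos_def nat_diff_distrib le_nat_iff)
    also have "\<dots> = to_ac (q powi (- 2 * ?s)) * \<phi> (Lam ?s)"
      using psi_Lam[OF \<phi>, of 1 "nat ?s"] True by simp
    finally show ?thesis using True by (simp add: L_def)
  qed (simp add: L_def psi_pos_def UQ0_homD[OF \<phi>])
  let ?F = "\<lambda>i. \<phi> (psi_neg (int i - int r)) * L (n - int i)"
  \<comment> \<open>Substitution i = n - j. Both L and \<open>psi_neg\<close> vanish outside their
    ranges, so the upper limit n may be exchanged for r, whichever is larger.\<close>
  have "(\<Sum>j\<le>?N. \<phi> (psi_neg (?s - int j)) * \<phi> (Lam (int j))) = (\<Sum>i\<le>?N. ?F i)"
    using n by (intro sum.reindex_bij_witness[of _ "\<lambda>i. ?N - i" "\<lambda>i. ?N - i"])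
      (auto simp: L_def algebra_simps)
  also have "\<dots> = (\<Sum>i\<le>max ?N r. ?F i)"
    using n by (intro sum.mono_neutral_left) (auto simp: L_def)
  also have "\<dots> = (\<Sum>i\<le>r. ?F i)"
    by (intro sum.mono_neutral_right) (auto simp: psi_neg_def UQ0_homD[OF \<phi>])
  also have "\<dots> = (\<Sum>i\<le>r. \<phi> (psi0 (- 1) (r - i)) * L (n - int i))"
    by (intro sum.cong) (auto simp: psi_neg_def nat_diff_distrib)
  finally have B: "(\<Sum>j\<le>?N. \<phi> (psi_neg (?s - int j)) * \<phi> (Lam (int j)))
    = (\<Sum>i\<le>r. \<phi> (psi0 (- 1) (r - i)) * L (n - int i))" .
  have "to_ac (q powi n) * (\<Sum>j\<le>?N. \<phi> (psi_pos (?s - int j)) * \<phi> (Lam (int j)))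
    = to_ac (q powi (- n)) * (\<Sum>j\<le>?N. \<phi> (psi_neg (?s - int j)) * \<phi> (Lam (int j)))"
    using psi_relation[of ?s]
    by (simp add: left_diff_distrib sum_subtractf mult.assoc flip: sum_distrib_left)
  hence "to_ac (q powi n) * (to_ac (q powi n) * (to_ac (q powi (- 2 * ?s)) * L ?s))
    = to_ac (q powi n) * (to_ac (q powi (- n)) * (\<Sum>i\<le>r. \<phi> (psi0 (- 1) (r - i)) * L (n - int i)))"
    unfolding A B by (rule arg_cong)
  moreover have "to_ac (q powi n) * (to_ac (q powi k) * x)
      = to_ac (q powi (n + k)) * x" for k and x :: Kbar
    by (simp add: power_int_add mult.assoc)
  moreover have "n + (n + - 2 * ?s) = 2 * int r" by simp
  ultimately show ?thesis
    by (simp only: add.right_inverse power_int_0_right to_ac_1 mult_1)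
qed

text \<open>Both sides obey the same recursion, which determines the value at r because q^(2r) - 1
  is nonzero; they agree at r = 0.\<close>

lemma L_reflect: "L (n - int r) = L n * \<phi> (Lam (- int r))"
proof (induction r rule: less_induct)
  case (less r)
  show ?case
  proof (cases "r = 0")
    case False
    let ?c = "to_ac (q powi (2 * int r))"
    have split: "(\<Sum>i\<le>r. f i) = (\<Sum>i<r. f i) + f r" for f :: "nat \<Rightarrow> Kbar"
      by (simp flip: lessThan_Suc_atMost)
    have "(\<Sum>i<r. \<phi> (psi0 (- 1) (r - i)) * \<phi> (Lam (- int i))) = (?c - 1) * \<phi> (Lam (- int r))"
      using psi_Lam[OF \<phi>, of "- 1" r]
        by (simp add: split UQ0_homD[OF \<phi>] left_diff_distrib eq_diff_eq)
    moreover have "(\<Sum>i<r. \<phi> (psi0 (- 1) (r - i)) * L (n - int i)) = (?c - 1) * L (n - int r)"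
      using L_recursion[of r] by (simp add: split UQ0_homD[OF \<phi>] left_diff_distrib eq_diff_eq)
    moreover have "(\<Sum>i<r. \<phi> (psi0 (- 1) (r - i)) * L (n - int i))
      = L n * (\<Sum>i<r. \<phi> (psi0 (- 1) (r - i)) * \<phi> (Lam (- int i)))"
      by (simp add: less.IH sum_distrib_left ac_simps)
    ultimately have "(?c - 1) * L (n - int r) = (?c - 1) * (L n * \<phi> (Lam (- int r)))"
      by (simp only: mult.left_commute[of "?c - 1" "L n"])
    moreover have "?c - 1 \<noteq> 0" using to_ac_powi_neq_1[of "2 * int r"] False by simp
    ultimately show ?thesis by (rule iffD1[OF mult_left_cancel, rotated])
  qed (simp add: UQ0_homD[OF \<phi>])
qed

lemma L_0: "L 0 = 1"
  using n by (simp add: L_def UQ0_homD[OF \<phi>])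

text \<open>The reflection law at r = n exhibits \<open>L n\<close> as a factor of
  \<open>L 0 = 1\<close>. This is the condition that the last parameter be nonzero.\<close>

lemma L_n: "L n \<noteq> 0"
  using L_reflect[of "nat n"] L_0 n by auto

lemma Lam_reflect:
  "r \<le> nat n \<Longrightarrow> \<phi> (Lam n) * \<phi> (Lam (- int r)) = \<phi> (Lam (n - int r))"
proof -
  assume "r \<le> nat n"
  hence "int r \<le> n" using n by linarith
  thus ?thesis using L_reflect[of r] n by (simp add: L_def)
qed

lemma Lam_vanishes: "\<bar>r\<bar> > n \<Longrightarrow> \<phi> (Lam r) = 0"
proof (cases "r \<ge> 0")
  case False
  assume "\<bar>r\<bar> > n"
  thus ?thesis using L_reflect[of "nat (- r)"] L_n False by (simp add: L_def)
qed (use Lam_large[of "nat r"] n in auto)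

lemma eval_hom_parameters:
  "\<exists>\<pi>\<in>parameters (nat n). \<forall>y\<in>UQ0. eval_hom (nat n) \<pi> y = \<phi> y"
proof -
  define \<pi> where "\<pi> = map (\<lambda>i. \<phi> (Lam (int (Suc i)))) [0..<nat n]"
  have "\<pi> \<in> parameters (nat n)"
    using L_n n by (auto simp: \<pi>_def parameters_def L_def simp del: of_nat_Suc)
  moreover have "eval_hom (nat n) \<pi> = restrict \<phi> UQ0"
  proof (rule eval_hom_eq(1)[OF \<phi> \<open>\<pi> \<in> parameters (nat n)\<close>])
    show "\<phi> (Lam (int i)) = \<pi> ! (i - 1)" if "i \<in> {1..nat n}" for i
      using that by (cases i) (simp_all add: \<pi>_def del: of_nat_Suc upt_Suc)
    show "\<phi> (Lam r) = 0" if "\<bar>r\<bar> > int (nat n)" for r using that n Lam_vanishes by simp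
    show "\<phi> (Lam (int (nat n))) * \<phi> (Lam (- int r)) = \<phi> (Lam (int (nat n) - int r))"
      if "1 \<le> r" "r \<le> nat n" for r
      using that n Lam_reflect by simp
  qed
  ultimately show ?thesis by (metis restrict_apply')
qed

end

end

section \<open>Finite-dimensional irreducible modules\<close>

lemma xm_power_lowering: "xm k ^ i \<in> lowering i"
  by (induction i) (auto intro: lowering_base lowering_step)

text \<open>The induction step in the formula for a raising operator applied to a power of the
  lowering operator; with x = q^j and y = q^k it is an identity of rational functions.\<close>

lemma qint_recursion: "qint j * qint k + qint (k - j - 1) = qint (j + 1) * qint (k - 1)"
proof -
  define x y where "x = q powi j" and "y = q powi k"
  have nz: "x \<noteq> 0" "y \<noteq> 0" by (simp_all add: x_def y_def)
  let ?D = "q - inverse q"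
  have e: "qint j * ?D = x - inverse x" "qint k * ?D = y - inverse y"
    "qint (k - j - 1) * ?D = y / (x * q) - x * q / y"
    "qint (j + 1) * ?D = x * q - inverse (x * q)" "qint (k - 1) * ?D = y / q - q / y"
    by (simp_all add: qint_def x_def y_def power_int_diff power_int_minus power_int_add
      divide_inverse
        mult.assoc del: right_minus_eq)
  have "(qint j * qint k + qint (k - j - 1)) * (?D * ?D)
      = (qint j * ?D) * (qint k * ?D) + (qint (k - j - 1) * ?D) * ?D"
    by (simp only: distrib_right mult.assoc mult.left_commute[of "qint k" ?D])
  also have "\<dots> = (qint (j + 1) * ?D) * (qint (k - 1) * ?D)"
    unfolding e using nz by (simp add: field_simps)
  also have "\<dots> = (qint (j + 1) * qint (k - 1)) * (?D * ?D)" by (simp only: ac_simps)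
  finally show ?thesis by (simp del: right_minus_eq)
qed

section \<open>Weights in finite-dimensional modules\<close>

context UQ_module
begin

definition ann :: "'v \<Rightarrow> uq set" where
  "ann v = {x. x \<odot> v = \<zero>}"

lemma left_ideal_ann: "v \<in> carrier M \<Longrightarrow> left_ideal (ann v)"
  by unfold_locales (simp_all add: ann_def smult_l_distr' smult_assoc')

lemma cong_ann: "v \<in> carrier M \<Longrightarrow> left_ideal.congruent (ann v) x y \<longleftrightarrow> x \<odot> v = y \<odot> v"
  using smult_eq_iff[of v x y] left_ideal_ann[of v] by (simp add: left_ideal.congruent_def ann_def)

lemma smult_finsum:
  "finite B \<Longrightarrow> g \<in> B \<rightarrow> carrier M \<Longrightarrow> a \<odot> (\<Oplus>b\<in>B. g b) = (\<Oplus>b\<in>B. a \<odot> g b)"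
proof (induction B rule: finite_induct)
  case (insert b B)
  thus ?case by (simp add: smult_r_distr' Pi_iff)
qed simp

text \<open>The bound N, one more than the size of a spanning set, is the same for all vectors v and
  all families x. Dependence is expressed through \<open>ann v\<close> so that it can be combined
  with congruences.\<close>

lemma finite_dimensional_dependence:
  assumes "finite_dimensional M"
  obtains N :: nat where "\<And>v x. v \<in> carrier M
      \<Longrightarrow> \<exists>d. (\<exists>i<N. d i \<noteq> 0) \<and> (\<Sum>i<N. scal (d i) * x i) \<in> ann v"
proof -
  obtain B where B: "finite B" "B \<subseteq> carrier M"
    "\<And>v. v \<in> carrier M \<Longrightarrow> \<exists>c. v = (\<Oplus>b\<in>B. scal (c b) \<odot> b)"
    using assms by (auto simp: finite_dimensional_def)
  have "\<exists>d. (\<exists>i<Suc (card B). d i \<noteq> 0) \<and> (\<Sum>i<Suc (card B). scal (d i) * x i) \<in> ann v"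
    if v: "v \<in> carrier M" for v and x :: "nat \<Rightarrow> uq"
  proof -
    have "\<forall>i. \<exists>c. x i \<odot> v = (\<Oplus>b\<in>B. scal (c b) \<odot> b)" using B(3) v by blast
    then obtain c where c: "\<And>i. x i \<odot> v = (\<Oplus>b\<in>B. scal (c i b) \<odot> b)" by metis
    obtain d where d: "\<exists>i<Suc (card B). d i \<noteq> 0" "\<And>b. b \<in> B \<Longrightarrow> (\<Sum>i<Suc (card B). d i * c i b) = 0"
      using linear_dependence[OF B(1), of "Suc (card B)" c] by auto
    have b: "b \<in> carrier M" if "b \<in> B" for b using B(2) that by blast
    have "(\<Sum>i<k. scal (d i) * x i) \<odot> v = (\<Oplus>b\<in>B. scal (\<Sum>i<k. d i * c i b) \<odot> b)" for k
    proof (induction k)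
      case 0
      have "(\<Oplus>b\<in>B. scal 0 \<odot> b) = (\<Oplus>b\<in>B. \<zero>)" by (rule M.finsum_cong') (use b in auto)
      thus ?case using v by simp
    next
      case (Suc k)
      have "(\<Sum>i<Suc k. scal (d i) * x i) \<odot> v
        = (\<Oplus>b\<in>B. scal (\<Sum>i<k. d i * c i b) \<odot> b) \<oplus> (\<Oplus>b\<in>B. scal (d k) \<odot> (scal (c k b) \<odot> b))"
        using Suc v b B(1) by (simp add: smult_l_distr' smult_assoc' c smult_finsum Pi_iff)
      also have "\<dots> = (\<Oplus>b\<in>B. scal (\<Sum>i<k. d i * c i b) \<odot> b \<oplus> scal (d k) \<odot> (scal (c k b) \<odot> b))"
        by (rule M.finsum_addf[symmetric]) (use b in auto)
      also have "\<dots> = (\<Oplus>b\<in>B. scal (\<Sum>i<Suc k. d i * c i b) \<odot> b)"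
        by (rule M.finsum_cong') (use b in \<open>auto
          simp: scal_add scal_mult smult_l_distr' smult_assoc'\<close>)
      finally show ?case .
    qed
    moreover have "(\<Oplus>b\<in>B. scal (\<Sum>i<Suc (card B). d i * c i b) \<odot> b) = (\<Oplus>b\<in>B. \<zero>)"
      by (rule M.finsum_cong') (use b d(2) in \<open>auto simp del: sum.lessThan_Suc\<close>)
    ultimately have "(\<Sum>i<Suc (card B). scal (d i) * x i) \<in> ann v"
        by (simp add: ann_def del: sum.lessThan_Suc)
    thus ?thesis using d(1) by blast
  qed
  thus thesis by (rule that)
qed

lemma eigenvectors_dependent:
  assumes fin: "finite_dimensional M" and v: "v \<in> carrier M" and inj: "inj \<mu>"
    and eigen: "\<And>i::nat. x i \<odot> v \<in> weight_space M (\<mu> i)"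
  shows "\<exists>i. x i \<odot> v = \<zero>"
proof -
  interpret left_ideal "ann v" by (rule left_ideal_ann[OF v])
  obtain N where "\<exists>d. (\<exists>i<N. d i \<noteq> 0) \<and> (\<Sum>i<N. scal (d i) * x i) \<in> ann v"
    using finite_dimensional_dependence[OF fin] v by metis
  then obtain d k where d: "k < N" "d k \<noteq> 0" "(\<Sum>i<N. scal (d i) * x i) \<in> ann v" by blast
  have "scal (d k) * x k \<in> ann v"
  proof (rule eigenvector_independence[OF _ _ _ d(3)])
    show "inj_on \<mu> {..<N}" using inj by (rule inj_on_subset) simp
    show "congruent (KK * x i) (scal (q powi \<mu> i) * x i)" for i
      using eigen[of i] v by (simp add: cong_ann weight_space_def smult_assoc')
  qed (use d in auto)
  hence "x k \<in> ann v" using d(2) by (rule scal_cancel)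
  thus ?thesis by (auto simp: ann_def)
qed

lemma weight_space_xp:
  assumes "w \<in> weight_space M n"
  shows "xp k \<odot> w \<in> weight_space M (n + 2)"
proof -
  have w: "w \<in> carrier M" "KK \<odot> w = scal (q powi n) \<odot> w" using assms
      by (auto simp: weight_space_def)
  have "KK \<odot> (xp k \<odot> w) = scal (q powi 2) \<odot> (xp k \<odot> (KK \<odot> w))"
    using w(1) by (simp add: K_xp flip: smult_assoc')
  also have "\<dots> = (scal (q powi 2) * (xp k * scal (q powi n))) \<odot> w"
    unfolding w(2) using w(1) by (simp add: smult_assoc')
  also have "scal (q powi 2) * (xp k * scal (q powi n)) = scal (q powi (n + 2)) * xp k"
    unfolding scal_commute[of "xp k"] scal_scal by (simp add: power_int_add mult.commute)
  finally show ?thesis using w(1) by (simp add: weight_space_def smult_assoc')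
qed

text \<open>Otherwise every nonzero weight vector could be raised by some \<open>xp k\<close> to a
  nonzero vector of weight two higher, and the resulting infinite chain of distinct weights
  contradicts finite dimension. The chain is written as x i v to apply
  \<open>eigenvectors_dependent\<close>.\<close>

lemma highest_weight_vector:
  assumes irr: "irreducible_module UQ M" and fin: "finite_dimensional M" and "type_1 M"
  obtains n w where "w \<in> weight_space M n" "w \<noteq> \<zero>" "\<And>k. xp k \<odot> w = \<zero>"
proof -
  obtain v where v: "v \<in> carrier M" "v \<noteq> \<zero>" using irr by (auto simp: irreducible_module_def)
  then obtain f where f: "\<And>n. f n \<in> weight_space M n" "v = (\<Oplus>n\<in>{n. f n \<noteq> \<zero>}. f n)"
    using \<open>type_1 M\<close> unfolding type_1_def by blast
  have "{n. f n \<noteq> \<zero>} \<noteq> {}"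
  proof
    assume "{n. f n \<noteq> \<zero>} = {}"
    hence "v = \<zero>" using f(2) by (simp only: M.finsum_empty)
    thus False using v by simp
  qed
  then obtain \<mu> where \<mu>: "f \<mu> \<in> weight_space M \<mu>" "f \<mu> \<noteq> \<zero>" using f(1) by blast
  show thesis
  proof (rule ccontr)
    assume "\<not> thesis"
    hence step: "\<exists>k. xp k \<odot> w \<noteq> \<zero>" if "w \<in> weight_space M n" "w \<noteq> \<zero>" for w n
      using that \<open>\<And>w n. \<lbrakk>w \<in> weight_space M n; w \<noteq> \<zero>; \<And>k. xp k \<odot> w = \<zero>\<rbrakk> \<Longrightarrow> thesis\<close> by blast
    have "\<exists>x. x \<odot> v \<in> weight_space M (\<mu> + 2 * int i) \<and> x \<odot> v \<noteq> \<zero>" for i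
    proof (induction i)
      case 0
      have "f \<mu> \<in> carrier M" using \<mu> by (simp add: weight_space_def)
      then obtain x where "f \<mu> = x \<odot> v" using irreducible_generated[OF irr v] by blast
      thus ?case using \<mu> by (intro exI[of _ x]) simp
    next
      case (Suc i)
      then obtain x where x: "x \<odot> v \<in> weight_space M (\<mu> + 2 * int i)" "x \<odot> v \<noteq> \<zero>" by blast
      then obtain k where "xp k \<odot> (x \<odot> v) \<noteq> \<zero>" using step by blast
      thus ?case using weight_space_xp[OF x(1), of k] v(1)
        by (intro exI[of _ "xp k * x"]) (simp add: smult_assoc' algebra_simps)
    qed
    then obtain x where x: "\<And>i. x i \<odot> v \<in> weight_space M (\<mu> + 2 * int i)" "\<And>i. x i \<odot> v \<noteq> \<zero>"
      by metis
    have "inj (\<lambda>i. \<mu> + 2 * int i)" by (rule injI) simp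
    from eigenvectors_dependent[OF fin v(1) this x(1)] x(2) show False by blast
  qed
qed

end

section \<open>The highest weight vector of an irreducible module\<close>

locale irreducible_hw = hw_vector +
  assumes irreducible: "irreducible_module UQ M" and fin: "finite_dimensional M"
      and v_nonzero: "v \<noteq> \<zero>"
begin

sublocale left_ideal "ann v"
  by (rule left_ideal_ann[OF v_closed])

notation congruent (infix "\<doteq>" 50)

lemma hw_ann: "hw_ideal m \<subseteq> ann v"
  using hw by (auto simp: ann_def)

lemma one_ann: "1 \<notin> ann v"
  using v_nonzero by (simp add: ann_def)

lemma ann_top: "x \<notin> ann v \<Longrightarrow> \<exists>z. z * x - 1 \<in> ann v"
proof -
  assume "x \<notin> ann v"
  hence "x \<odot> v \<noteq> \<zero>" by (simp add: ann_def)
  then obtain z where "v = z \<odot> (x \<odot> v)"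
    using irreducible_generated[OF irreducible _ _ v_closed] by blast
  hence "(z * x - 1) \<odot> v = \<zero>" using smult_eq_iff[OF v_closed, of "z * x" 1]
      by (simp add: smult_assoc')
  thus ?thesis by (auto simp: ann_def)
qed

lemma cong_hw: "x - y \<in> hw_ideal m \<Longrightarrow> x \<doteq> y"
  using hw_ann by (auto simp: congruent_def)

text \<open>If x y v were nonzero, some z would give z x y v = v. The top component y0 of z x kills
  v, since x does. But then v = \<kappa> z x y v = y0 y v = y y0 v = 0.\<close>

lemma ann_right: "x \<in> ann v \<Longrightarrow> y \<in> UQ0 \<Longrightarrow> x * y \<in> ann v"
proof (rule ccontr)
  assume x: "x \<in> ann v" and y: "y \<in> UQ0" "x * y \<notin> ann v"
  obtain z where z: "z * (x * y) \<doteq> 1" using ann_top[OF y(2)] by (auto simp: congruent_def)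
  obtain \<kappa> y0 where \<kappa>: "y0 \<in> UQ0" "\<kappa> * (z * x) - y0 \<in> hw_ideal m" "\<kappa> - 1 \<in> hw_ideal m"
    using top_component by blast
  have "y0 \<in> ann v"
    using cong_mem_iff[OF cong_hw[OF \<kappa>(2)]] mult[OF mult[OF x]] by blast
  have "1 \<doteq> \<kappa>" by (rule cong_sym[OF cong_hw[OF \<kappa>(3)]])
  also have "\<kappa> \<doteq> \<kappa> * (z * (x * y))" using cong_sym[OF cong_mult[OF z, of \<kappa>]] by simp
  also have "\<kappa> * (z * (x * y)) \<doteq> y0 * y"
    using hw_ideal_mult_UQ0[OF y(1) \<kappa>(2)]
      by (intro cong_hw) (simp add: left_diff_distrib mult.assoc)
  also have "y0 * y = y * y0" by (rule UQ0_commute[OF \<kappa>(1) y(1)])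
  finally have "1 \<in> ann v" using cong_mem_iff mult[OF \<open>y0 \<in> ann v\<close>] by blast
  thus False using one_ann by simp
qed

text \<open>Irreducibility gives an inverse z in the whole algebra; its top component is an inverse
  within \<open>UQ0\<close>.\<close>

lemma UQ0_inverse: "y \<in> UQ0 \<Longrightarrow> y \<notin> ann v \<Longrightarrow> \<exists>y'\<in>UQ0. y' * y - 1 \<in> ann v"
proof -
  assume y: "y \<in> UQ0" "y \<notin> ann v"
  obtain z where z: "z * y \<doteq> 1" using ann_top[OF y(2)] by (auto simp: congruent_def)
  obtain \<kappa> y' where \<kappa>: "y' \<in> UQ0" "\<kappa> * z - y' \<in> hw_ideal m" "\<kappa> - 1 \<in> hw_ideal m"
    using top_component by blast
  have "y' * y \<doteq> \<kappa> * z * y"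
    using hw_ideal_mult_UQ0[OF y(1) \<kappa>(2)]
      by (intro cong_sym[OF cong_hw]) (simp add: left_diff_distrib)
  also have "\<kappa> * z * y \<doteq> \<kappa>" using cong_mult[OF z, of \<kappa>] by (simp add: mult.assoc)
  also have "\<kappa> \<doteq> 1" by (rule cong_hw[OF \<kappa>(3)])
  finally show ?thesis using \<kappa>(1) by (auto simp: congruent_def)
qed

text \<open>The vectors y^i v for i < N are linearly dependent, and the dependence is a polynomial
  relation for y.\<close>

lemma UQ0_algebraic: "\<exists>p. p \<noteq> 0 \<and> peval p y \<in> ann v"
proof -
  have poly: "\<exists>p. (\<forall>i. poly.coeff p i = (if i < N then d i else 0)) \<and> peval p y
      = (\<Sum>i<N. scal (d i) * y ^ i)" for N d
  proof (induction N arbitrary: d)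
    case (Suc N)
    from Suc[of "\<lambda>i. d (Suc i)"] obtain p where p: "\<And>i. poly.coeff p i
        = (if i < N then d (Suc i) else 0)"
      "peval p y = (\<Sum>i<N. scal (d (Suc i)) * y ^ i)" by blast
    have "peval (pCons (d 0) p) y = (\<Sum>i<Suc N. scal (d i) * y ^ i)"
      unfolding sum.lessThan_Suc_shift peval_pCons p(2)
      by (simp add: sum_distrib_left scal_left_commute[of y])
    thus ?case by (intro exI[of _ "pCons (d 0) p"]) (auto simp: p(1) coeff_pCons split: nat.split)
  qed (auto intro: exI[of _ 0])
  obtain N where "\<exists>d. (\<exists>i<N. d i \<noteq> 0) \<and> (\<Sum>i<N. scal (d i) * y ^ i) \<in> ann v"
    using finite_dimensional_dependence[OF fin] v_closed by metis
  then obtain d i where d: "i < N" "d i \<noteq> 0" "(\<Sum>i<N. scal (d i) * y ^ i) \<in> ann v" by blast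
  obtain p where p: "\<And>i. poly.coeff p i = (if i < N then d i else 0)"
      "peval p y = (\<Sum>i<N. scal (d i) * y ^ i)"
    using poly by blast
  have "poly.coeff p i \<noteq> 0" using p(1) d by simp
  hence "p \<noteq> 0" by auto
  thus ?thesis using d(3) p(2) by auto
qed

lemma top_homomorphism: "\<exists>\<phi>. UQ0_hom \<phi> \<and> (\<forall>y\<in>UQ0. \<phi> y = 0 \<longleftrightarrow> y \<in> ann v)"
proof -
  interpret I: UQ0_maximal_ideal "ann v \<inter> UQ0"
  proof
    show "\<exists>p. p \<noteq> 0 \<and> peval p y \<in> ann v \<inter> UQ0" if "y \<in> UQ0" for y
      using UQ0_algebraic[of y] peval_UQ0[OF that] by blast
    show "\<exists>y'\<in>UQ0. y' * y - 1 \<in> ann v \<inter> UQ0" if "y \<in> UQ0" "y \<notin> ann v \<inter> UQ0" for y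
      using UQ0_inverse[OF that(1)] that by (blast intro: UQ0_diff UQ0_mult UQ0_one)
  qed (use zero one_ann add mult in auto)
  show ?thesis using I.residue_embedding by blast
qed

lemma xp_xm_opposite_cong:
  assumes "s \<in> lowering r"
  shows "xp (- 1) * (xm 1 * s) \<doteq> xm 1 * (xp (- 1) * s) + scal (qint (m - 2 * int r)) * s"
proof -
  have "xp (- 1) * (xm 1 * s) = xm 1 * (xp (- 1) * s) + scal (1 / (q - inverse q)) * (KK * s
      - Kinv * s)"
    using xp_xm_opposite[of "- 1"] by (simp
      add: mult.assoc[symmetric] distrib_right left_diff_distrib del: right_minus_eq)
      (simp add: mult.assoc left_diff_distrib del: right_minus_eq)
  also have "\<dots> \<doteq> xm 1 * (xp (- 1) * s) + scal (1 / (q - inverse q)) *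
      (scal (q powi (m - 2 * int r)) * s - scal (q powi (2 * int r - m)) * s)"
    by (intro cong_add cong_mult cong_diff cong_refl cong_hw lowering_K lowering_Kinv assms)
  finally show ?thesis
    by (simp add: qint_def scal_scal diff_divide_distrib scal_diff right_diff_distrib
      left_diff_distrib del: right_minus_eq)
qed

text \<open>The subalgebra generated by \<open>xp (- 1)\<close>
    and \<open>xm 1\<close> is a copy of the quantized enveloping algebra
  of \<open>sl\<^sub>2\<close>, as \<open>xp (- 1) * xm 1 - xm 1 * xp (- 1)\<close> involves only \<open>KK\<close> and \<open>Kinv\<close>.\<close>

lemma xp_xm_power:
  "xp (- 1) * xm 1 ^ Suc j \<doteq> scal (qint (int j + 1) * qint (m - int j)) * xm 1 ^ j"
proof (induction j)
  case 0
  have "xm 1 * (xp (- 1) * 1) + scal (qint m) * 1 \<doteq> xm 1 * 0 + scal (qint m) * 1"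
    using hw_ideal.xp[of 1 "- 1" m] by (intro cong_add cong_mult cong_refl cong_hw) simp
  with xp_xm_opposite_cong[OF lowering_base[OF UQ0_one]]
  have "xp (- 1) * (xm 1 * 1) \<doteq> xm 1 * 0 + scal (qint m) * 1"
    by (auto intro: cong_trans)
  moreover have "qint 1 = 1" using q_diff_nonzero
      by (simp add: qint_def power_int_minus del: right_minus_eq)
  ultimately show ?case by simp
next
  case (Suc j)
  let ?c = "qint (int j + 1) * qint (m - int j)" and ?F = "xm 1 ^ Suc j"
  have "xp (- 1) * (xm 1 * ?F) \<doteq> xm 1 * (xp (- 1) * ?F) + scal (qint (m - 2 * int (Suc j))) * ?F"
    by (rule xp_xm_opposite_cong[OF xm_power_lowering])
  also have "\<dots> \<doteq> xm 1 * (scal ?c * xm 1 ^ j) + scal (qint (m - 2 * int (Suc j))) * ?F"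
    by (intro cong_add cong_mult cong_refl Suc)
  also have "\<dots> = scal (?c + qint (m - 2 * int (Suc j))) * ?F"
    by (simp only: scal_left_commute[of "xm 1"] scal_add distrib_right power_Suc)
  also have "?c + qint (m - 2 * int (Suc j)) = qint (int (Suc j) + 1) * qint (m - int (Suc j))"
    using qint_recursion[of "int j + 1" "m - int j"] by (simp add: algebra_simps)
  finally show ?case by (simp only: power_Suc)
qed

text \<open>Distinct weights force some power of \<open>xm 1\<close> to kill v. If j + 1 is the
  least exponent, applying \<open>xp (- 1)\<close> shows [j + 1] [m - j] = 0, hence m = j.\<close>

lemma integrable: "m \<ge> 0 \<and> xm 1 ^ Suc (nat m) \<in> ann v"
proof -
  have "\<exists>i. xm 1 ^ i \<odot> v = \<zero>"
  proof (rule eigenvectors_dependent[OF fin v_closed])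
    show "inj (\<lambda>i. m - 2 * int i)" by (rule injI) simp
    fix i
    show "xm 1 ^ i \<odot> v \<in> weight_space M (m - 2 * int i)"
      using hw_eq[OF lowering_K[OF xm_power_lowering[of 1 i], of m]]
        by (simp add: weight_space_def smult_assoc')
  qed
  hence ex: "\<exists>i. xm 1 ^ i \<in> ann v" by (simp add: ann_def)
  define i where "i = (LEAST i. xm 1 ^ i \<in> ann v)"
  have i: "xm 1 ^ i \<in> ann v" unfolding i_def by (rule LeastI_ex[OF ex])
  have "i \<noteq> 0" using i one_ann by (cases i) auto
  then obtain j where j: "i = Suc j" by (cases i) auto
  have "xm 1 ^ j \<notin> ann v" using not_less_Least[of j "\<lambda>i. xm 1 ^ i \<in> ann v"] j by (simp add: i_def)
  moreover have "scal (qint (int j + 1) * qint (m - int j)) * xm 1 ^ j \<in> ann v"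
    using cong_mem_iff[OF xp_xm_power[of j]] mult[OF i] j by simp
  ultimately have "qint (int j + 1) * qint (m - int j) = 0" using scal_cancel by blast
  hence "m = int j" by simp
  thus ?thesis using i j by simp
qed

text \<open>The parameters are chosen so that \<open>eval_hom\<close> is the character on the
  highest weight vector. Both modules are then irreducible with the same weight and the same
  annihilator in \<open>UQ0\<close>.\<close>

lemma isomorphic_Vq_pi: "\<exists>k. \<exists>\<pi>\<in>parameters k. isomorphic_modules UQ M (Vq_pi k \<pi>)"
proof -
  obtain \<phi> where \<phi>: "UQ0_hom \<phi>" "\<And>y. y \<in> UQ0 \<Longrightarrow> \<phi> y = 0 \<longleftrightarrow> y \<in> ann v"
    using top_homomorphism by blast
  interpret A: hw_annihilator "ann v" m \<phi>
    by unfold_locales (use hw_ann ann_right \<phi> in auto)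
  have m: "m \<ge> 0" "xm 1 ^ Suc (nat m) \<in> ann v" using integrable by auto
  obtain \<pi> where \<pi>: "\<pi> \<in> parameters (nat m)" "\<And>y. y \<in> UQ0 \<Longrightarrow> eval_hom (nat m) \<pi> y = \<phi> y"
    using A.eval_hom_parameters[OF m one_ann] by blast
  obtain w where w: "hw_vector (Vq_pi (nat m) \<pi>) w (int (nat m))"
      "irreducible_module UQ (Vq_pi (nat m) \<pi>)"
    "w \<noteq> \<zero>\<^bsub>Vq_pi (nat m) \<pi>\<^esub>"
    "\<And>y. y \<in> UQ0 \<Longrightarrow> y \<odot>\<^bsub>Vq_pi (nat m) \<pi>\<^esub> w = \<zero>\<^bsub>Vq_pi (nat m) \<pi>\<^esub> \<longleftrightarrow> eval_hom (nat m) \<pi> y = 0"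
    by (rule Vq_pi_hw_vector[OF \<pi>(1)]) blast
  have "isomorphic_modules UQ M (Vq_pi (nat m) \<pi>)"
  proof (rule irreducible_hw_isomorphic)
    show "hw_vector M v m" by (rule hw_vector_axioms)
    show "hw_vector (Vq_pi (nat m) \<pi>) w m" using w(1) m(1) by simp
    show "y \<odot> v = \<zero> \<longleftrightarrow> y \<odot>\<^bsub>Vq_pi (nat m) \<pi>\<^esub> w = \<zero>\<^bsub>Vq_pi (nat m) \<pi>\<^esub>" if "y \<in> UQ0" for y
      using w(4)[OF that] \<pi>(2)[OF that] \<phi>(2)[OF that] by (simp add: ann_def)
  qed (fact irreducible v_nonzero w(2) w(3))+
  thus ?thesis using \<pi>(1) by blast
qed

end

theorem theorem3:
  shows "(\<forall>m. \<forall>\<pi> \<in> parameters m.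
            \<exists>!N. submodule N UQ (Wq_pi m \<pi>) \<and>
                 irreducible_module UQ (quotient_module (Wq_pi m \<pi>) N))
       \<and> (\<forall>V :: (uq, 'v) module.
            irreducible_module UQ V \<and> finite_dimensional V \<and> type_1 V \<longrightarrow>
            (\<exists>m. \<exists>\<pi> \<in> parameters m. isomorphic_modules UQ V (Vq_pi m \<pi>)))"
proof (intro conjI allI ballI impI)
  fix m \<pi> assume "\<pi> \<in> parameters m"
  thus "\<exists>!N. submodule N UQ (Wq_pi m \<pi>) \<and> irreducible_module UQ (quotient_module (Wq_pi m \<pi>) N)"
    by (rule unique_irreducible_quotient_Wq_pi)
next
  fix V :: "(uq, 'v) module"
  assume V: "irreducible_module UQ V \<and> finite_dimensional V \<and> type_1 V"
  interpret V: UQ_module V using V by (simp add: UQ_module_iff irreducible_module_def)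
  obtain n w where w: "w \<in> weight_space V n" "w \<noteq> \<zero>\<^bsub>V\<^esub>" "\<And>k. xp k \<odot>\<^bsub>V\<^esub> w = \<zero>\<^bsub>V\<^esub>"
    using V.highest_weight_vector V by blast
  have wc: "w \<in> carrier V" and K: "(KK - scal (q powi n)) \<odot>\<^bsub>V\<^esub> w = \<zero>\<^bsub>V\<^esub>"
    using w(1) V.smult_eq_iff[of w KK "scal (q powi n)"] by (auto simp: weight_space_def)
  have "irreducible_hw V w n"
  proof unfold_locales
    show "j \<odot>\<^bsub>V\<^esub> w = \<zero>\<^bsub>V\<^esub>" if "j \<in> hw_ideal n" for j
      using that by (induction rule: hw_ideal.induct) (simp_all
        add: wc K w(3) V.smult_assoc' V.smult_l_distr')
  qed (use V w wc in auto)
  thus "\<exists>m. \<exists>\<pi>\<in>parameters m. isomorphic_modules UQ V (Vq_pi m \<pi>)"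
    by (rule irreducible_hw.isomorphic_Vq_pi)
qed

end
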